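(* Let $T_0$ be an ergodic interval exchange transformation of $[0,1]$. Let $\beta_1,\dots,\beta_k$ be distinct real numbers with $\beta_i>1$ and $\log\beta_i\ne\frac{\pi^2}{6\log2}$ for all $i$. Then for all $f_0,f_1,\dots,f_{k+1}\in L^\infty(\lambda)$ and every probability measure $\nu$ equivalent to Lebesgue measure $\lambda$, $\lim_{N-M\to\infty}\frac{1}{N-M}\sum_{n=M}^{N-1}T_0^nf_0\cdot T_{\beta_1}^nf_1\cdots T_{\beta_k}^nf_k\cdot T_G^nf_{k+1}=\int f_0\,d\lambda\cdot\prod_{i=1}^k\int f_i\,d\mu_{\beta_i}\cdot\int f_{k+1}\,d\mu_G$ in $L^2(\nu)$.
   Context: $T^nf:=f\circ T^n$; $\lim_{N-M\to\infty}$ is uniform over all pairs $0\le M<N$ with $N-M\to\infty$. For $\beta>1$, $T_\beta x=\beta x\bmod 1$ on $[0,1]$ and $\mu_\beta$ is the unique $T_\beta$-invariant ergodic probability measure equivalent to $\lambda$ (equal to $\lambda$ when $\beta$ is an integer). The Gauss map is $T_G(x)=\frac1x\bmod1$ for $x\ne0$, $T_G(0)=0$, and $\mu_G(A)=\frac{1}{\log2}\int_A\frac{dx}{1+x}$. An interval exchange transformation: for a probability vector $\mathbf a=(a_1,\dots,a_n)$ with $a_i>0$ and a permutation $\pi$ of $\{1,\dots,n\}$, with $I_i=[a_1+\dots+a_{i-1},a_1+\dots+a_i)$, $T_{\mathbf a,\pi}(x)=x-\sum_{j<i}a_j+\sum_{\pi(j)<\pi(i)}a_j$ for $x\in I_i$;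 it preserves $\lambda$. *)

theory Defs
  imports "HOL-Probability.Probability" "HOL-Combinatorics.Permutations"
begin

definition lam01 :: "real measure" where
  "lam01 = restrict_space lborel {0..1}"

definition equiv_measure :: "'a measure \<Rightarrow> 'a measure \<Rightarrow> bool" where
  "equiv_measure M N \<longleftrightarrow> sets M = sets N \<and>
     (\<forall>A\<in>sets M. emeasure M A = 0 \<longleftrightarrow> emeasure N A = 0)"

definition invariant_measure :: "'a measure \<Rightarrow> ('a \<Rightarrow> 'a) \<Rightarrow> bool" where
  "invariant_measure M T \<longleftrightarrow> T \<in> measurable M M \<and> distr M M T = M"

definition ergodic_wrt :: "'a measure \<Rightarrow> ('a \<Rightarrow> 'a) \<Rightarrow> bool" where
  "ergodic_wrt M T \<longleftrightarrow> T \<in> measurable M M \<and>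
     (\<forall>A\<in>sets M. T -` A \<inter> space M = A \<longrightarrow> measure M A = 0 \<or> measure M A = 1)"

definition beta_map :: "real \<Rightarrow> real \<Rightarrow> real" where
  "beta_map \<beta> x = frac (\<beta> * x)"

definition gauss_map :: "real \<Rightarrow> real" where
  "gauss_map x = (if x = 0 then 0 else frac (1 / x))"

definition beta_measure :: "real \<Rightarrow> real measure" where
  "beta_measure \<beta> = (THE \<mu>. prob_space \<mu> \<and> equiv_measure \<mu> lam01 \<and>
      invariant_measure \<mu> (beta_map \<beta>) \<and> ergodic_wrt \<mu> (beta_map \<beta>))"

definition gauss_measure :: "real measure" where
  "gauss_measure = density lam01 (\<lambda>x. ennreal (1 / (ln 2 * (1 + x))))"

text \<open>Interval exchange transformation for lengths a 1, ..., a n and permutation pi of {1..n};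
  the intervals I_i = [a_1+...+a_(i-1), a_1+...+a_i). Points outside [0,1) are fixed.\<close>
definition iet_interval :: "(nat \<Rightarrow> real) \<Rightarrow> nat \<Rightarrow> real set" where
  "iet_interval a i = {(\<Sum>j\<in>{1..<i}. a j) ..< (\<Sum>j\<in>{1..i}. a j)}"

definition iet :: "nat \<Rightarrow> (nat \<Rightarrow> real) \<Rightarrow> (nat \<Rightarrow> nat) \<Rightarrow> real \<Rightarrow> real" where
  "iet n a \<pi> x =
     (if \<exists>i\<in>{1..n}. x \<in> iet_interval a i then
        (let i = (THE i. i \<in> {1..n} \<and> x \<in> iet_interval a i) in
           x - (\<Sum>j\<in>{1..<i}. a j) + (\<Sum>j\<in>{j\<in>{1..n}. \<pi> j < \<pi> i}. a j))
      else x)"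

definition Linfty :: "(real \<Rightarrow> real) set" where
  "Linfty = {f. f \<in> borel_measurable lam01 \<and> (\<exists>C. AE x in lam01. \<bar>f x\<bar> \<le> C)}"

end

theory Submission
  imports Defs "HOL-Real_Asymp.Real_Asymp"
begin

text \<open>Say that a map has speed \<open>h\<close> if its \<open>n\<close>-th iterate, composed with a step function, is close in
  mean to a step function with about \<open>exp (n h)\<close> jumps (\<open>slow\<close>), and if it averages out, uniformly, every
  step function with at most \<open>exp (n h')\<close> jumps, \<open>h' < h\<close> (\<open>equidist\<close>). An interval exchange has speed \<open>0\<close>
  (only the first property), the \<open>\<beta>\<close>-map speed \<open>ln \<beta>\<close>, and the Gauss map speed \<open>pi\<^sup>2 / (6 ln 2)\<close>, its
  Lyapunov exponent \<open>h\<close>: outside a small set, the cylinders of rank \<open>n\<close> have length about \<open>exp (- n h)\<close>. Since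
  the speeds are distinct, the factors of a product \<open>f\<^sub>0 \<circ> T\<^sub>0\<^sup>n \<cdots> f\<^sub>k \<circ> T\<^sub>k\<^sup>n\<close> can be split off one after the other, the fastest first, so its
  integral converges to the product of the integrals. Applied to the functions \<open>f\<^sub>i \<circ> T\<^sub>i\<^sup>d \<cdot> f\<^sub>i \<circ> T\<^sub>i\<^sup>e\<close> this gives
  the correlations of the sequence of products, and a van der Corput argument, using the mean ergodic theorem for \<open>T\<^sub>0\<close>
  and mixing of the other maps, yields the limit in mean square.\<close>

text \<open>The maps need not commute or share an invariant measure. Lebesgue measure serves as
  common reference, and each invariant measure enters only through a bounded density. At time
  \<open>n\<close> a map of speed h has structure on the scale exp (- n h): a product of slower
  factors is still nearly constant on most pieces on which the fastest factor already averages out.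
  The strict gap between the speeds pays for all subexponential errors, which is why equal speeds,
  in particular ln \<beta> = pi^2 / (6 ln 2), are excluded. Both equidistribution proofs cut the
  time into p + q: p steps turn a step function into (nearly) a combination of monotone weights, and
  q steps mix such weights at a uniform rate. The interval exchange may fail to be mixing; it can
  only be the slowest factor, and its correlations are controlled only after double averaging. Since
  \<open>beta_measure\<close> is a definite description, the explicit Parry measure has to be shown
  to be the only candidate; mixing supplies this uniqueness.\<close>

abbreviation borel_fun :: "('a :: topological_space \<Rightarrow> 'b :: topological_space) \<Rightarrow> bool" where
  "borel_fun f \<equiv> f \<in> borel_measurable borel"

abbreviation fun01 :: "(real \<Rightarrow> 'b :: topological_space) \<Rightarrow> bool" where
  "fun01 f \<equiv> f \<in> borel_measurable lam01"

abbreviation unit_bounded :: "(real \<Rightarrow> real) \<Rightarrow> bool" where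
  "unit_bounded f \<equiv> \<forall>x. \<bar>f x\<bar> \<le> 1"

abbreviation muG :: "real measure" where
  "muG \<equiv> gauss_measure"

abbreviation mean01 :: "(real \<Rightarrow> real) \<Rightarrow> real" (binder "E01 " 10) where
  "mean01 f \<equiv> integral\<^sup>L lam01 f"

section \<open>Lebesgue measure on the unit interval\<close>

lemma space_lam01 [simp]: "space lam01 = {0..1}"
  by (simp add: lam01_def space_restrict_space)

lemma sets_lam01: "sets lam01 = sets (restrict_space borel {0..1})"
  unfolding lam01_def by (intro sets_restrict_space_cong) simp

lemma sets_lam01_iff: "A \<in> sets lam01 \<longleftrightarrow> A \<in> sets borel \<and> A \<subseteq> {0..1}"
  unfolding sets_lam01 by (subst sets_restrict_space_iff) auto

lemma measurable_lam01_cong: "measurable lam01 N = measurable (restrict_space borel {0..1}) N"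
  by (intro measurable_cong_sets sets_lam01) simp

lemma measurable_lam01I: "f \<in> borel_measurable borel ==> fun01 f"
  unfolding measurable_lam01_cong by (rule measurable_restrict_space1)

interpretation lam01: prob_space lam01
  by standard (simp add: lam01_def emeasure_restrict_space space_restrict_space)

lemma measurable_lam01_extend:
  fixes f :: "real => real"
  assumes "fun01 f"
  shows "borel_fun (\<lambda>x. indicator {0..1} x * f x)"
  using assms unfolding measurable_lam01_cong
  by (subst (asm) borel_measurable_restrict_space_iff) (auto simp: mult.commute)

lemma measurable_lam01_lam01I:
  assumes "fun01 T" "\<And>x. x \<in> {0..1} ==> T x \<in> {0..1}"
  shows "T \<in> measurable lam01 lam01"
proof -
  have "T \<in> measurable lam01 (restrict_space borel {0..1})"
    using assms by (intro measurable_restrict_space2) auto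
  then show ?thesis
    by (simp cong: measurable_cong_sets add: sets_lam01)
qed

lemma measurable_funpow:
  assumes "T \<in> measurable M M" shows "(T ^^ n) \<in> measurable M M"
  by (induction n) (use assms in \<open>auto intro: measurable_comp\<close>)

lemma integrable_lam01_bounded:
  fixes f :: "real => real"
  assumes "fun01 f" "\<And>x. x \<in> {0..1} ==> \<bar>f x\<bar> <= B"
  shows "integrable lam01 f"
  by (rule lam01.integrable_const_bound[where B = B]) (use assms in auto)

lemma integral_lam01:
  fixes f :: "real => real"
  shows "(E01 x. f x) = (\<integral>x. indicator {0..1} x * f x \<partial>lborel)"
  unfolding lam01_def by (subst integral_restrict_space) auto

lemma AE_lborel_neq: "AE x in lborel. x \<noteq> (a::real)"
  by (rule AE_I[of _ _ "{a}"]) auto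

lemma AE_lam01_neq: "AE x in lam01. x \<noteq> (a::real)"
  unfolding lam01_def by (subst AE_restrict_space_iff) (auto intro: eventually_mono[OF AE_lborel_neq[of a]])

lemma integral_lam01_Ico:
  fixes f :: "real => real"
  assumes f: "borel_fun (\<lambda>x. indicator {0..<1} x * f x)"
  shows "(E01 x. f x) = (\<integral>x. indicator {0..<1} x * f x \<partial>lborel)"
proof -
  have eq: "(\<lambda>x. indicator {0..1} x * f x) = (\<lambda>x. indicator {0..<1} x * f x + indicator {1} x * f 1)"
    by (auto simp: indicator_def fun_eq_iff)
  have [measurable]: "borel_fun (\<lambda>x. indicator {0..1} x * f x)"
    unfolding eq using f by (intro borel_measurable_add) auto
  show ?thesis
    unfolding integral_lam01
  proof (rule integral_cong_AE)
    show "AE x in lborel. indicator {0..1} x * f x = indicator {0..<1} x * f x"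
      using AE_lborel_neq[of 1] by eventually_elim (auto simp: indicator_def)
  qed (use f in simp_all)
qed

section \<open>Step functions and their density in L1\<close>

lemma clip_diff:
  fixes a b c :: real
  assumes "0 <= c" "\<bar>a\<bar> <= c"
  shows "\<bar>a - max (-c) (min c b)\<bar> <= \<bar>a - b\<bar>"
  using assms by (auto simp: max_def min_def abs_if)

text \<open>\<open>S\<close> collects the places where \<open>g\<close> may jump. Testing closed
  intervals against \<open>S\<close> avoids listing pieces in order and leaves the value at a point
  of \<open>S\<close> free. Only \<open>[0, 1)\<close> is looked at, since the endpoint 1 is null.
  The size of \<open>S\<close> is the only complexity that is counted later.\<close>

definition step :: "real set => (real => real) => bool" where
  "step S g \<longleftrightarrow> (\<forall>x y. 0 <= x --> x <= y --> y < 1 --> {x..y} \<inter> S = {} --> g x = g y)"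

lemma stepD: "step S g ==> 0 <= x ==> x <= y ==> y < 1 ==> {x..y} \<inter> S = {} ==> g x = g y"
  unfolding step_def by blast

lemma step_combine: "step S f ==> step S' g ==> step (S \<union> S') (\<lambda>x. F (f x) (g x))"
  unfolding step_def by (metis Un_empty Int_Un_distrib)

lemma step_compose: "step S f ==> step S (\<lambda>x. F (f x))"
  unfolding step_def by metis

lemma step_const: "step S (\<lambda>x. c)"
  unfolding step_def by auto

definition step_approx :: "(real => real) => bool" where
  "step_approx f \<longleftrightarrow> integrable lam01 f \<and> (\<forall>e>0. \<exists>s S. finite S \<and> step S s \<and> borel_fun s \<and>
     (\<exists>B. \<forall>x. \<bar>s x\<bar> <= B) \<and> (E01 x. \<bar>f x - s x\<bar>) < e)"

lemma step_approxE:
  assumes "step_approx f" "e > 0"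
  obtains S s B where "finite S" "step S s" "borel_fun s" "\<forall>x. \<bar>s x\<bar> <= B"
    "(E01 x. \<bar>f x - s x\<bar>) < e" "integrable lam01 s"
proof -
  obtain s S B where *: "finite S" "step S s" "borel_fun s" "\<forall>x. \<bar>s x\<bar> <= B"
    "(E01 x. \<bar>f x - s x\<bar>) < e"
    using assms unfolding step_approx_def by blast
  then have "integrable lam01 s"
    by (intro integrable_lam01_bounded[of _ B] measurable_lam01I) auto
  with * that show thesis by blast
qed

lemma integral_abs_triangle:
  fixes f g h :: "real => real"
  assumes "integrable M f" "integrable M g" "integrable M h"
  shows "(\<integral>x. \<bar>f x - h x\<bar> \<partial>M) <= (\<integral>x. \<bar>f x - g x\<bar> \<partial>M) + (\<integral>x. \<bar>g x - h x\<bar> \<partial>M)"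
proof -
  have "(\<integral>x. \<bar>f x - h x\<bar> \<partial>M) <= (\<integral>x. \<bar>f x - g x\<bar> + \<bar>g x - h x\<bar> \<partial>M)"
    using assms by (intro integral_mono) auto
  also have "... = (\<integral>x. \<bar>f x - g x\<bar> \<partial>M) + (\<integral>x. \<bar>g x - h x\<bar> \<partial>M)"
    using assms by (intro Bochner_Integration.integral_add) auto
  finally show ?thesis .
qed

lemma step_approx_add:
  assumes "step_approx f" "step_approx g"
  shows "step_approx (\<lambda>x. f x + g x)"
  unfolding step_approx_def
proof (intro conjI allI impI)
  show int: "integrable lam01 (\<lambda>x. f x + g x)"
    using assms by (auto simp: step_approx_def)
  fix e :: real assume "e > 0"
  obtain s S B where s: "finite S" "step S s" "borel_fun s" "\<forall>x. \<bar>s x\<bar> <= B"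
    "(E01 x. \<bar>f x - s x\<bar>) < e / 2" "integrable lam01 s"
    using step_approxE[OF assms(1) half_gt_zero[OF \<open>e > 0\<close>]] by blast
  obtain t T C where t: "finite T" "step T t" "borel_fun t" "\<forall>x. \<bar>t x\<bar> <= C"
    "(E01 x. \<bar>g x - t x\<bar>) < e / 2" "integrable lam01 t"
    using step_approxE[OF assms(2) half_gt_zero[OF \<open>e > 0\<close>]] by blast
  have intfg: "integrable lam01 f" "integrable lam01 g"
    using assms by (auto simp: step_approx_def)
  have "(E01 x. \<bar>f x + g x - (s x + t x)\<bar>) <= (E01 x. \<bar>f x - s x\<bar> + \<bar>g x - t x\<bar>)"
    using intfg s t by (intro integral_mono) auto
  also have "... < e"
    using intfg s t by (subst Bochner_Integration.integral_add) auto
  finally have 1: "(E01 x. \<bar>f x + g x - (s x + t x)\<bar>) < e" .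
  show "\<exists>s S. finite S \<and> step S s \<and> borel_fun s \<and>
     (\<exists>B. \<forall>x. \<bar>s x\<bar> <= B) \<and> (E01 x. \<bar>f x + g x - s x\<bar>) < e"
    using s t 1 step_combine[OF s(2) t(2), of "(+)"] 
    by (intro exI[of _ "\<lambda>x. s x + t x"] exI[of _ "S \<union> T"] conjI exI[of _ "B + C"])
       (auto intro: order_trans[OF abs_triangle_ineq] add_mono)
qed

lemma step_approx_cmult:
  assumes "step_approx f"
  shows "step_approx (\<lambda>x. c * f x)"
  unfolding step_approx_def
proof (intro conjI allI impI)
  show int: "integrable lam01 (\<lambda>x. c * f x)"
    using assms by (auto simp: step_approx_def)
  fix e :: real assume "e > 0"
  have e': "e / (\<bar>c\<bar> + 1) > 0" using \<open>e > 0\<close> by (intro divide_pos_pos) auto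
  obtain s S B where s: "finite S" "step S s" "borel_fun s" "\<forall>x. \<bar>s x\<bar> <= B"
    "(E01 x. \<bar>f x - s x\<bar>) < e / (\<bar>c\<bar> + 1)" "integrable lam01 s"
    using step_approxE[OF assms e'] by blast
  have "(E01 x. \<bar>c * f x - c * s x\<bar>) = \<bar>c\<bar> * (E01 x. \<bar>f x - s x\<bar>)"
    by (subst integral_mult_right_zero[symmetric]) (simp add: abs_mult[symmetric] right_diff_distrib)
  also have "... <= \<bar>c\<bar> * (e / (\<bar>c\<bar> + 1))"
    using s(5) by (intro mult_left_mono) auto
  also have "... < e"
    using \<open>e > 0\<close> by (simp add: field_simps)
  finally have 1: "(E01 x. \<bar>c * f x - c * s x\<bar>) < e" .
  show "\<exists>s S. finite S \<and> step S s \<and> borel_fun s \<and>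
     (\<exists>B. \<forall>x. \<bar>s x\<bar> <= B) \<and> (E01 x. \<bar>c * f x - s x\<bar>) < e"
    using s 1 step_compose[OF s(2), of "(*) c"] 
    by (intro exI[of _ "\<lambda>x. c * s x"] exI[of _ "S"] conjI exI[of _ "\<bar>c\<bar> * B"])
       (auto simp: abs_mult intro: mult_left_mono)
qed

text \<open>Dominated convergence puts some \<open>s i\<close> close to \<open>f\<close> in L1, and
  \<open>s i\<close> is itself approximable. This closure property serves both the countable unions
  in the indicator case and the limit case for integrable functions.\<close>

lemma step_approx_lim:
  assumes "integrable lam01 f" "\<And>i::nat. step_approx (s i)"
    and lim: "\<And>x. x \<in> {0..1} ==> (\<lambda>i. s i x) \<longlonglongrightarrow> f x"
    and dom: "\<And>i x. x \<in> {0..1} ==> \<bar>s i x\<bar> <= w x" and w: "integrable lam01 w"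
  shows "step_approx f"
  unfolding step_approx_def
proof (intro conjI allI impI)
  show int: "integrable lam01 f" by fact
  fix e :: real assume "e > 0"
  have ints: "integrable lam01 (s i)" for i
    using assms(2)[of i] by (auto simp: step_approx_def)
  have "(\<lambda>i. E01 x. \<bar>f x - s i x\<bar>) \<longlonglongrightarrow> (E01 x. 0)"
  proof (rule integral_dominated_convergence[where w = "\<lambda>x. \<bar>f x\<bar> + w x"])
    show "AE x in lam01. (\<lambda>i. \<bar>f x - s i x\<bar>) \<longlonglongrightarrow> 0"
    proof (rule AE_I2)
      fix x assume "x \<in> space lam01"
      then have "(\<lambda>i. \<bar>f x - s i x\<bar>) \<longlonglongrightarrow> \<bar>f x - f x\<bar>"
        using lim by (intro tendsto_intros) auto
      then show "(\<lambda>i. \<bar>f x - s i x\<bar>) \<longlonglongrightarrow> 0" by simp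
    qed
    show "AE x in lam01. norm \<bar>f x - s i x\<bar> <= \<bar>f x\<bar> + w x" for i
      using dom[of _ i] by (intro AE_I2) (auto intro: order_trans[OF abs_triangle_ineq4])
  qed (use int ints w in auto)
  then have "\<forall>\<^sub>F i in sequentially. (E01 x. \<bar>f x - s i x\<bar>) < e / 2"
    using \<open>e > 0\<close> by (intro order_tendstoD) auto
  then obtain i where i: "(E01 x. \<bar>f x - s i x\<bar>) < e / 2"
    by (auto simp: eventually_sequentially)
  obtain t T C where t: "finite T" "step T t" "borel_fun t" "\<forall>x. \<bar>t x\<bar> <= C"
    "(E01 x. \<bar>s i x - t x\<bar>) < e / 2" "integrable lam01 t"
    using step_approxE[OF assms(2)[of i] half_gt_zero[OF \<open>e > 0\<close>]] by blast
  have "(E01 x. \<bar>f x - t x\<bar>) < e"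
    using integral_abs_triangle[OF int ints[of i] t(6)] i t(5) by linarith
  then show "\<exists>s S. finite S \<and> step S s \<and> borel_fun s \<and>
     (\<exists>B. \<forall>x. \<bar>s x\<bar> <= B) \<and> (E01 x. \<bar>f x - s x\<bar>) < e"
    using t by blast
qed

lemma step_approx_step:
  assumes "finite S" "step S s" "borel_fun s" "\<And>x. \<bar>s x\<bar> <= B"
  shows "step_approx s"
  unfolding step_approx_def
proof (intro conjI allI impI)
  show "integrable lam01 s"
    using assms by (intro integrable_lam01_bounded[of _ B] measurable_lam01I) auto
  fix e :: real assume "e > 0"
  show "\<exists>t S. finite S \<and> step S t \<and> borel_fun t \<and>
     (\<exists>B. \<forall>x. \<bar>t x\<bar> <= B) \<and> (E01 x. \<bar>s x - t x\<bar>) < e"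
    by (rule exI[of _ s], rule exI[of _ S]) (use assms \<open>e > 0\<close> in auto)
qed

text \<open>The half-lines \<open>{..a}\<close> form an intersection-stable generator of the Borel
  sets, and approximability of the indicator passes to complements and, by dominated convergence, to
  countable disjoint unions; so the pi-lambda theorem applies.\<close>

lemma step_approx_indicator:
  assumes "A \<in> sets borel"
  shows "step_approx (indicator A)"
proof -
  have 1: "Int_stable (range (\<lambda>a::real. {..a}))"
    by (auto simp: Int_stable_def)
  have 2: "range (\<lambda>a::real. {..a}) \<subseteq> Pow UNIV" by simp
  have 3: "A \<in> sigma_sets UNIV (range (\<lambda>a::real. {..a}))"
    using assms by (subst (asm) borel_eq_atMost) auto
  from 1 2 3 show ?thesis
  proof (induction rule: sigma_sets_induct_disjoint)
    case (basic A)
    then obtain a where A: "A = {..a}" by auto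
    show ?case
      by (rule step_approx_step[of "{a}" _ 1]) (auto simp: A step_def indicator_def)
  next
    case empty
    show ?case
      by (rule step_approx_step[of "{}" _ 1]) (auto simp: step_def)
  next
    case (compl A)
    have eq: "indicator (UNIV - A) = (\<lambda>x. 1 + (-1) * indicator A x :: real)"
      by (auto simp: indicator_def fun_eq_iff)
    show ?case unfolding eq
      by (intro step_approx_add step_approx_cmult compl(2) step_approx_step[of "{}" _ 1]) (auto simp: step_def)
  next
    case (union A)
    have meas: "A i \<in> sets borel" for i
      using union by (subst borel_eq_atMost) auto
    have fin: "step_approx (indicator (\<Union>i<n. A i))" for n
    proof (induction n)
      case 0
      show ?case
        by (rule step_approx_step[of "{}" _ 1]) (auto simp: step_def)
    next
      case (Suc n)
      have "(\<Union>i<n. A i) \<inter> A n = {}"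
        using union(1) by (auto simp: disjoint_family_on_def) (metis disjoint_iff less_irrefl)
      then have eq: "indicator (\<Union>i<Suc n. A i) = (\<lambda>x. indicator (\<Union>i<n. A i) x + indicator (A n) x :: real)"
        by (auto simp: lessThan_Suc indicator_def fun_eq_iff)
      show ?case unfolding eq
        by (intro step_approx_add Suc.IH union(3))
    qed
    show ?case
    proof (rule step_approx_lim[OF _ fin, where w = "\<lambda>_. 1"])
      show "integrable lam01 (indicator (\<Union>i. A i) :: real => real)"
        by (rule integrable_lam01_bounded[of _ 1]) (use meas in \<open>auto intro!: measurable_lam01I\<close>)
      show "(\<lambda>n. indicator (\<Union>i<n. A i) x :: real) \<longlonglongrightarrow> indicator (\<Union>i. A i) x" for x
        by (rule LIMSEQ_indicator_UN)
    qed auto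
  qed
qed

lemma step_approx_integrable:
  assumes "integrable lam01 f"
  shows "step_approx f"
  using assms
proof (induction rule: integrable_induct)
  case (base A c)
  have "step_approx (indicator A)"
    using base(1) by (intro step_approx_indicator) (auto simp: sets_lam01_iff)
  from step_approx_cmult[OF this, of c] show ?case
    by (simp add: mult.commute)
next
  case (add f g)
  then show ?case by (intro step_approx_add) auto
next
  case (lim f s)
  show ?case
    by (rule step_approx_lim[where s = s and w = "\<lambda>x. 2 * \<bar>f x\<bar>"]) (use lim in auto)
qed

text \<open>Clipping the approximant to \<open>[-1, 1]\<close> does not increase its distance to
  \<open>f\<close>, by \<open>clip_diff\<close>, and creates no new jumps.\<close>

lemma step_approx_bounded:
  fixes f :: "real => real"
  assumes "fun01 f" "\<And>x. \<bar>f x\<bar> <= 1" "e > 0"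
  obtains S s where "finite S" "step S s" "borel_fun s" "unit_bounded s"
    "(E01 x. \<bar>f x - s x\<bar>) < e"
proof -
  have int: "integrable lam01 f"
    by (rule integrable_lam01_bounded[OF assms(1,2)])
  obtain s S B where s: "finite S" "step S s" "borel_fun s" "\<forall>x. \<bar>s x\<bar> <= B"
    "(E01 x. \<bar>f x - s x\<bar>) < e" "integrable lam01 s"
    using step_approxE[OF step_approx_integrable[OF int] \<open>e > 0\<close>] by blast
  define t where "t = (\<lambda>x. max (-1) (min 1 (s x)))"
  have m: "borel_fun t"
    unfolding t_def using s(3) by measurable
  have bd: "\<bar>t x\<bar> <= 1" for x
    by (auto simp: t_def)
  have "(E01 x. \<bar>f x - t x\<bar>) <= (E01 x. \<bar>f x - s x\<bar>)"
  proof (rule integral_mono)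
    show "integrable lam01 (\<lambda>x. \<bar>f x - t x\<bar>)"
      by (intro integrable_abs Bochner_Integration.integrable_diff int
          integrable_lam01_bounded[of t 1] measurable_lam01I m bd)
    show "\<bar>f x - t x\<bar> <= \<bar>f x - s x\<bar>" for x
      unfolding t_def using assms(2)[of x] by (intro clip_diff) auto
  qed (use int s in auto)
  then show thesis
    using that[OF s(1) _ m] s(5) step_compose[OF s(2), of "\<lambda>z. max (-1) (min 1 z)"]
    bd \<open>(E01 x. \<bar>f x - t x\<bar>) <= _\<close>
    unfolding t_def by fastforce
qed

section \<open>Speed of a map\<close>

text \<open>\<open>\<phi>\<close> may differ from the composition itself: for the Gauss map the
  composition has in general infinitely many jumps already for \<open>n = 1\<close>, and a small set
  has to be given up.\<close>

definition slow :: "real => (real => real) => bool" where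
  "slow h T \<longleftrightarrow> (\<forall>g S d e. finite S --> step S g --> borel_fun g --> unit_bounded g --> 0 < d --> 0 < e -->
     (\<forall>\<^sub>F n in sequentially. \<exists>\<phi> S'. finite S' \<and> step S' \<phi> \<and> borel_fun \<phi> \<and> unit_bounded \<phi> \<and>
        real (card S') <= exp (real n * (h + d)) \<and> (E01 x. \<bar>\<phi> x - g ((T ^^ n) x)\<bar>) <= e))"

text \<open>\<open>\<phi>\<close>, \<open>S\<close> and \<open>g\<close> are quantified after
  \<open>n\<close>: in the application \<open>\<phi>\<close> stands for a product of slower factors
  and changes with \<open>n\<close>, so a limit for each fixed \<open>\<phi>\<close> would not
  do.\<close>

definition equidist :: "real => (real => real) => real measure => bool" where
  "equidist h T \<mu> \<longleftrightarrow> (\<forall>h' e. h' < h --> 0 < e -->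
     (\<forall>\<^sub>F n in sequentially. \<forall>\<phi> S g. finite S --> step S \<phi> --> borel_fun \<phi> --> unit_bounded \<phi> -->
        real (card S) <= exp (real n * h') --> borel_fun g --> unit_bounded g -->
        \<bar>(E01 x. \<phi> x * g ((T ^^ n) x)) - (E01 x. \<phi> x) * (\<integral>x. g x \<partial>\<mu>)\<bar> <= e))"

text \<open>The last clause says that pulling back along an iterate enlarges Lebesgue L1 norms by at
  most the factor \<open>C\<close>, uniformly in \<open>n\<close>; an L1 approximation made once
  thus survives all iterates. The range up to 2 covers absolute differences of functions bounded by
  1.\<close>

definition nice :: "(real => real) => real measure => bool" where
  "nice T \<mu> \<longleftrightarrow> T \<in> measurable lam01 lam01 \<and> prob_space \<mu> \<and> invariant_measure \<mu> T \<and>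
     (\<exists>\<rho> C. borel_fun \<rho> \<and> (\<forall>x. 0 <= \<rho> x \<and> \<rho> x <= C) \<and> \<mu> = density lam01 (\<lambda>x. ennreal (\<rho> x)) \<and>
       (\<forall>n u. fun01 u --> (\<forall>x. 0 <= u x \<and> u x <= 2) -->
          (E01 x. u ((T ^^ n) x)) <= C * (E01 x. u x)))"

text \<open>The time is split as \<open>p + q\<close>. The first \<open>p\<close> steps leave an
  error proportional to the number of jumps times \<open>exp (- p * h')\<close>, the last
  \<open>q\<close> steps a mixing error \<open>\<rho> q\<close>, and \<open>\<sigma> p\<close>
  stands for exceptional points. Taking \<open>p\<close> as a fixed fraction of \<open>n\<close>
  makes all three small.\<close>

lemma equidistI:
  assumes h: "0 < h" and bound: "\<And>h'. 0 <= h' ==> h' < h ==> \<exists>\<rho> \<sigma> K. \<rho> \<longlonglongrightarrow> 0 \<and> \<sigma> \<longlonglongrightarrow> 0 \<and>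
      (\<forall>p q \<phi> S g. finite S --> step S \<phi> --> borel_fun \<phi> --> unit_bounded \<phi> -->
        borel_fun g --> unit_bounded g -->
        \<bar>(E01 x. \<phi> x * g ((T ^^ (p + q)) x)) - (E01 x. \<phi> x) * (\<integral>x. g x \<partial>\<mu>)\<bar>
          <= \<rho> q + \<sigma> p + K * real (card S) * exp (- real p * h'))"
  shows "equidist h T \<mu>"
  unfolding equidist_def
proof (intro allI impI)
  fix h0 e :: real assume h0: "h0 < h" and e: "0 < e"
  \<comment> \<open>The bound is used at the rate \<open>h2\<close>, strictly between
    \<open>h1\<close> and \<open>h\<close>. The fraction \<open>th\<close> lies midway between
    \<open>h1 / h2\<close> and 1: then \<open>th * h2 > h1\<close>, so \<open>th * n\<close> steps
    beat \<open>exp (n * h1)\<close> jumps, while a positive share of the time is left for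
    mixing.\<close>
  define h1 where "h1 = max h0 0"
  define h2 where "h2 = (h1 + h) / 2"
  define th where "th = (h1 / h2 + 1) / 2"
  have h12: "0 <= h1" "h0 <= h1" "h1 < h2" "h2 < h" "0 < h2" using h h0 by (auto simp: h1_def h2_def)
  have th: "0 < th" "th < 1" "th * h2 - h1 > 0"
    using h12 by (auto simp: th_def field_simps add_pos_nonneg)
  have "0 <= h2" using h12 by simp
  from bound[OF this h12(4)] obtain \<rho> \<sigma> K where rs: "\<rho> \<longlonglongrightarrow> 0" "\<sigma> \<longlonglongrightarrow> 0" and
    K: "\<forall>p q \<phi> S (g :: real => real). finite S --> step S \<phi> --> borel_fun \<phi> --> unit_bounded \<phi> -->
        borel_fun g --> unit_bounded g -->
        \<bar>(E01 x. \<phi> x * g ((T ^^ (p + q)) x)) - (E01 x. \<phi> x) * (\<integral>x. g x \<partial>\<mu>)\<bar>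
          <= \<rho> q + \<sigma> p + K * real (card S) * exp (- real p * h2)"
    by blast
  define p where "p = (\<lambda>n. nat \<lfloor>th * real n\<rfloor>)"
  define q where "q = (\<lambda>n. n - p n)"
  have p_le: "real (p n) <= th * real n" and p_ge: "th * real n - 1 <= real (p n)" for n
  proof -
    have "0 <= th * real n" using th by simp
    then show "real (p n) <= th * real n" "th * real n - 1 <= real (p n)"
      unfolding p_def by linarith+
  qed
  have pn: "p n <= n" for n
  proof -
    have "th * real n <= real n" using th by (simp add: mult_left_le_one_le)
    then have "real (p n) <= real n" using p_le[of n] by linarith
    then show ?thesis by simp
  qed
  then have pq: "p n + q n = n" for n by (simp add: q_def)
  have limp: "filterlim p sequentially sequentially"
    unfolding filterlim_at_top eventually_sequentially
  proof (intro allI)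
    fix Z
    show "\<exists>N. \<forall>n\<ge>N. Z <= p n"
    proof (intro exI allI impI)
      fix n assume "nat \<lceil>(real Z + 1) / th\<rceil> <= n"
      then have "(real Z + 1) / th <= real n" by linarith
      then have "real Z + 1 <= th * real n" using th by (simp add: field_simps)
      then show "Z <= p n" using p_ge[of n] by linarith
    qed
  qed
  have limq: "filterlim q sequentially sequentially"
    unfolding filterlim_at_top eventually_sequentially
  proof (intro allI)
    fix Z
    show "\<exists>N. \<forall>n\<ge>N. Z <= q n"
    proof (intro exI allI impI)
      fix n assume "nat \<lceil>real Z / (1 - th)\<rceil> <= n"
      then have "real Z / (1 - th) <= real n" by linarith
      then have "real Z <= real n - th * real n" using th by (simp add: field_simps)
      also have "... <= real (q n)" using p_le[of n] pn[of n] by (simp add: q_def)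
      finally show "Z <= q n" by simp
    qed
  qed
  have lim3: "(\<lambda>n. \<bar>K\<bar> * (exp h2 * exp (- (th * h2 - h1)) ^ n)) \<longlonglongrightarrow> \<bar>K\<bar> * (exp h2 * 0)"
    using th by (intro tendsto_intros LIMSEQ_power_zero) auto
  have "\<forall>\<^sub>F n in sequentially. \<rho> (q n) < e / 3"
    using e by (intro order_tendstoD(2)[OF filterlim_compose[OF rs(1) limq]]) auto
  moreover have "\<forall>\<^sub>F n in sequentially. \<sigma> (p n) < e / 3"
    using e by (intro order_tendstoD(2)[OF filterlim_compose[OF rs(2) limp]]) auto
  moreover have "\<forall>\<^sub>F n in sequentially. \<bar>K\<bar> * (exp h2 * exp (- (th * h2 - h1)) ^ n) < e / 3"
    using e by (intro order_tendstoD(2)[OF lim3]) auto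
  ultimately show "\<forall>\<^sub>F n in sequentially. \<forall>\<phi> S (g :: real => real). finite S --> step S \<phi> --> borel_fun \<phi> --> unit_bounded \<phi> -->
        real (card S) <= exp (real n * h0) --> borel_fun g --> unit_bounded g -->
        \<bar>(E01 x. \<phi> x * g ((T ^^ n) x)) - (E01 x. \<phi> x) * (\<integral>x. g x \<partial>\<mu>)\<bar> <= e"
  proof eventually_elim
    case (elim n)
    show ?case
    proof (intro allI impI)
      fix \<phi> S and g :: "real => real" assume *: "finite S" "step S \<phi>" "borel_fun \<phi>" "unit_bounded \<phi>"
        "real (card S) <= exp (real n * h0)" "borel_fun g" "unit_bounded g"
      have "K * real (card S) * exp (- real (p n) * h2) <= \<bar>K\<bar> * (real (card S) * exp (- real (p n) * h2))"
        unfolding mult.assoc by (intro mult_right_mono) auto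
      also have "... <= \<bar>K\<bar> * (exp (real n * h1) * exp (h2 - th * real n * h2))"
      proof (intro mult_left_mono mult_mono)
        have "real n * h0 <= real n * h1" using h12 by (intro mult_left_mono) auto
        then show "real (card S) <= exp (real n * h1)" using *(5) by (meson exp_le_cancel_iff order_trans)
        have "(th * real n - 1) * h2 <= real (p n) * h2" using p_ge[of n] h12 by (intro mult_right_mono) auto
        then show "exp (- real (p n) * h2) <= exp (h2 - th * real n * h2)" by (simp add: algebra_simps)
      qed auto
      also have "exp (real n * h1) * exp (h2 - th * real n * h2) = exp h2 * exp (- (th * h2 - h1)) ^ n"
        by (simp add: exp_add[symmetric] exp_of_nat_mult[symmetric] algebra_simps)
      finally have "K * real (card S) * exp (- real (p n) * h2) < e / 3" using elim(3) by linarith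
      then show "\<bar>(E01 x. \<phi> x * g ((T ^^ n) x)) - (E01 x. \<phi> x) * (\<integral>x. g x \<partial>\<mu>)\<bar> <= e"
        using K[rule_format, OF *(1,2,3) *(4)[rule_format] *(6) *(7)[rule_format], of "p n" "q n"] elim(1,2) unfolding pq by linarith
    qed
  qed
qed

section \<open>Consequences of equidistribution: mixing, uniqueness, ergodicity\<close>

lemma niceD:
  assumes "nice T \<mu>"
  shows "T \<in> measurable lam01 lam01" "(T ^^ n) \<in> measurable lam01 lam01" "prob_space \<mu>" "invariant_measure \<mu> T"
    "sets \<mu> = sets lam01" "space \<mu> = {0..1}"
  using assms by (auto simp: nice_def intro: measurable_funpow dest: sets_eq_imp_space_eq)

lemma integral_pow_invariant:
  fixes f :: "real => real"
  assumes "invariant_measure \<mu> T" "f \<in> borel_measurable \<mu>"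
  shows "(\<integral>x. f ((T ^^ n) x) \<partial>\<mu>) = (\<integral>x. f x \<partial>\<mu>)"
  using assms(2)
proof (induction n arbitrary: f)
  case (Suc n)
  have T: "T \<in> measurable \<mu> \<mu>" "distr \<mu> \<mu> T = \<mu>" using assms by (auto simp: invariant_measure_def)
  have "(\<integral>x. f ((T ^^ Suc n) x) \<partial>\<mu>) = (\<integral>x. f (T ((T ^^ n) x)) \<partial>\<mu>)" by simp
  also have "... = (\<integral>x. f (T x) \<partial>\<mu>)"
    by (rule Suc.IH[OF measurable_compose[OF T(1) Suc.prems]])
  also have "... = (\<integral>x. f x \<partial>distr \<mu> \<mu> T)"
    using Suc.prems T by (subst integral_distr) auto
  finally show ?case by (simp add: T)
qed simp

lemma abs_integral_le_1:
  fixes g :: "real => real"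
  assumes "prob_space \<mu>" "unit_bounded g" "g \<in> borel_measurable \<mu>"
  shows "\<bar>\<integral>x. g x \<partial>\<mu>\<bar> <= 1"
proof -
  interpret prob_space \<mu> by fact
  have int: "integrable \<mu> g" by (rule integrable_const_bound[where B = 1]) (use assms in auto)
  have "\<bar>\<integral>x. g x \<partial>\<mu>\<bar> <= (\<integral>x. \<bar>g x\<bar> \<partial>\<mu>)" by (rule integral_abs_bound)
  also have "... <= (\<integral>x. 1 \<partial>\<mu>)" using assms int by (intro integral_mono) auto
  finally show ?thesis by (simp add: prob_space)
qed

lemma measurable_lam01_borel: "T \<in> measurable lam01 lam01 ==> fun01 T"
  using measurable_compose[of T lam01 lam01 "\<lambda>x. x" borel] by (simp add: measurable_lam01I)

text \<open>A fixed step function eventually has fewer than \<open>exp (n * h / 2)\<close> jumps, so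
  positive speed gives the limit for it; an integrable weight \<open>w\<close> follows by L1
  approximation, because \<open>g\<close> is bounded by 1.\<close>

lemma equidist_mixing:
  fixes w g :: "real => real"
  assumes eq: "equidist h T \<mu>" and h: "0 < h" and nice: "nice T \<mu>" and w: "integrable lam01 w"
    and g: "borel_fun g" "unit_bounded g"
  shows "(\<lambda>n. E01 x. w x * g ((T ^^ n) x)) \<longlonglongrightarrow> (E01 x. w x) * (\<integral>x. g x \<partial>\<mu>)"
proof (rule tendstoI)
  fix e :: real assume e: "0 < e"
  have e4: "0 < e / 4" using e by simp
  obtain S s B where s: "finite S" "step S s" "borel_fun s" "\<forall>x. \<bar>s x\<bar> <= B"
    "(E01 x. \<bar>w x - s x\<bar>) < e / 4" "integrable lam01 s"
    using step_approxE[OF step_approx_integrable[OF w] e4] by blast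
  \<comment> \<open>\<open>equidist\<close> accepts only step functions bounded by 1, so
    \<open>s\<close> is divided by \<open>c\<close> and the tolerance by \<open>c\<close> as
    well.\<close>
  define c where "c = \<bar>B\<bar> + 1"
  have c: "c > 0" by (simp add: c_def)
  have sc: "step S (\<lambda>x. s x / c)" "borel_fun (\<lambda>x. s x / c)" "\<forall>x. \<bar>s x / c\<bar> <= 1"
  proof -
    show "\<forall>x. \<bar>s x / c\<bar> <= 1"
    proof
      fix x
      have "\<bar>s x\<bar> <= c" using s(4) by (auto simp: c_def intro: order_trans)
      then show "\<bar>s x / c\<bar> <= 1" using c by simp
    qed
  qed (use s(3) step_compose[OF s(2), of "\<lambda>z. z / c"] in auto)
  have Tn [measurable]: "fun01 (T ^^ n)" for n
    by (rule measurable_lam01_borel[OF niceD(2)[OF nice]])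
  have gT: "fun01 (\<lambda>x. g ((T ^^ n) x))" for n
    using g(1) by measurable
  have bd: "integrable lam01 (\<lambda>x. f x * g ((T ^^ n) x))" if "integrable lam01 f" for f n
    by (rule Bochner_Integration.integrable_bound[OF that])
       (use that gT[of n] g(2) in \<open>auto simp: abs_mult intro!: AE_I2 mult_left_le\<close>)
  interpret mu: prob_space \<mu> using niceD(3)[OF nice] .
  have g1: "\<bar>\<integral>x. g x \<partial>\<mu>\<bar> <= 1"
    by (rule abs_integral_le_1) (use niceD[OF nice] g measurable_lam01I[OF g(1)] in \<open>auto cong: measurable_cong_sets\<close>)
  have "e / (4 * c) > 0" using e c by simp
  moreover have "h / 2 < h" using h by simp
  ultimately have "\<forall>\<^sub>F n in sequentially. \<forall>\<phi> S g. finite S --> step S \<phi> --> borel_fun \<phi> --> unit_bounded \<phi> -->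
        real (card S) <= exp (real n * (h / 2)) --> borel_fun g --> unit_bounded g -->
        \<bar>(E01 x. \<phi> x * g ((T ^^ n) x)) - (E01 x. \<phi> x) * (\<integral>x. g x \<partial>\<mu>)\<bar> <= e / (4 * c)"
    using eq unfolding equidist_def by blast
  then have ev: "\<forall>\<^sub>F n in sequentially. real (card S) <= exp (real n * (h / 2)) -->
     \<bar>(E01 x. s x / c * g ((T ^^ n) x)) - (E01 x. s x / c) * (\<integral>x. g x \<partial>\<mu>)\<bar> <= e / (4 * c)"
  proof (rule eventually_mono, intro impI)
    fix n
    assume *: "\<forall>\<phi> S g. finite S --> step S \<phi> --> borel_fun \<phi> --> unit_bounded \<phi> -->
        real (card S) <= exp (real n * (h / 2)) --> borel_fun g --> unit_bounded g -->
        \<bar>(E01 x. \<phi> x * g ((T ^^ n) x)) - (E01 x. \<phi> x) * (\<integral>x. g x \<partial>\<mu>)\<bar> <= e / (4 * c)"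
    assume "real (card S) <= exp (real n * (h / 2))"
    then show "\<bar>(E01 x. s x / c * g ((T ^^ n) x)) - (E01 x. s x / c) * (\<integral>x. g x \<partial>\<mu>)\<bar> <= e / (4 * c)"
      using *[THEN spec, THEN spec, THEN spec, of S "\<lambda>x. s x / c" g] s(1) sc g by blast
  qed
  have "filterlim (\<lambda>n. exp (real n * (h / 2))) at_top sequentially"
    using h by (intro filterlim_compose[OF exp_at_top] filterlim_at_top_mult_tendsto_pos[OF tendsto_const] filterlim_real_sequentially) auto
  then have "\<forall>\<^sub>F n in sequentially. real (card S) <= exp (real n * (h / 2))"
    by (simp add: filterlim_at_top)
  with ev show "\<forall>\<^sub>F n in sequentially. dist (E01 x. w x * g ((T ^^ n) x)) ((E01 x. w x) * (\<integral>x. g x \<partial>\<mu>)) < e"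
  proof eventually_elim
    case (elim n)
    define G where "G = (\<lambda>x. g ((T ^^ n) x))"
    have "\<bar>(E01 x. w x * G x) - (E01 x. s x * G x)\<bar> = \<bar>\<integral>x. (w x - s x) * G x \<partial>lam01\<bar>"
      using bd[OF w, of n] bd[OF s(6), of n] by (simp add: G_def left_diff_distrib)
    also have "... <= (E01 x. \<bar>(w x - s x) * G x\<bar>)" by (rule integral_abs_bound)
    also have "... <= (E01 x. \<bar>w x - s x\<bar>)"
    proof (rule integral_mono)
      show "integrable lam01 (\<lambda>x. \<bar>(w x - s x) * G x\<bar>)"
        using bd[of "\<lambda>x. w x - s x" n] w s(6) unfolding G_def by (intro integrable_abs) auto
      show "\<bar>(w x - s x) * G x\<bar> <= \<bar>w x - s x\<bar>" for x
        using g(2) by (auto simp: G_def abs_mult intro: mult_left_le)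
    qed (use w s(6) in auto)
    finally have 1: "\<bar>(E01 x. w x * G x) - (E01 x. s x * G x)\<bar> < e / 4" using s(5) by linarith
    have "\<bar>(E01 x. s x * G x) / c - (E01 x. s x) / c * (\<integral>x. g x \<partial>\<mu>)\<bar> <= e / (4 * c)"
      using elim by (simp add: G_def)
    also have "(E01 x. s x * G x) / c - (E01 x. s x) / c * (\<integral>x. g x \<partial>\<mu>) =
       ((E01 x. s x * G x) - (E01 x. s x) * (\<integral>x. g x \<partial>\<mu>)) / c" by (simp add: diff_divide_distrib)
    finally have 2: "\<bar>(E01 x. s x * G x) - (E01 x. s x) * (\<integral>x. g x \<partial>\<mu>)\<bar> <= e / 4"
      using c by (simp add: abs_divide field_simps)
    have "\<bar>(E01 x. s x) - (E01 x. w x)\<bar> <= (E01 x. \<bar>w x - s x\<bar>)"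
      using integral_abs_bound[of lam01 "\<lambda>x. w x - s x"] w s(6) by simp
    then have "\<bar>((E01 x. s x) - (E01 x. w x)) * (\<integral>x. g x \<partial>\<mu>)\<bar> <= (E01 x. \<bar>w x - s x\<bar>) * 1"
      unfolding abs_mult using g1 by (intro mult_mono) auto
    then have 3: "\<bar>(E01 x. s x) * (\<integral>x. g x \<partial>\<mu>) - (E01 x. w x) * (\<integral>x. g x \<partial>\<mu>)\<bar> < e / 4"
      using s(5) by (simp add: left_diff_distrib)
    show ?case
      using 1 2 3 e unfolding dist_real_def G_def by linarith
  qed
qed

lemma indicator_pow_measurable:
  assumes "T \<in> measurable lam01 lam01" "A \<in> sets lam01"
  shows "fun01 (\<lambda>x. indicator A ((T ^^ n) x) :: real)"
  using measurable_compose[OF measurable_funpow[OF assms(1), of n] borel_measurable_indicator[OF assms(2)]] .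

text \<open>Mixing with the density \<open>D\<close> of \<open>N\<close> as weight shows that the
  \<open>N\<close>-measure of the \<open>n\<close>-th preimage of \<open>A\<close> tends to the
  \<open>\<mu>\<close>-measure of \<open>A\<close>; by invariance of \<open>N\<close> that sequence
  is constantly the \<open>N\<close>-measure of \<open>A\<close>.\<close>

lemma equidist_unique:
  assumes eq: "equidist h T \<mu>" and h: "0 < h" and nice: "nice T \<mu>"
    and N: "prob_space N" "sets N = sets lam01" "absolutely_continuous lam01 N" "invariant_measure N T"
  shows "N = \<mu>"
proof (rule measure_eqI)
  show "sets N = sets \<mu>" using N niceD(5)[OF nice] by simp
  fix A assume "A \<in> sets N"
  then have A: "A \<in> sets lam01" "A \<in> sets borel" using N by (auto simp: sets_lam01_iff)
  interpret N: prob_space N by fact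
  interpret mu: prob_space \<mu> using niceD(3)[OF nice] .
  obtain D where D: "fun01 D" "AE x in lam01. RN_deriv lam01 N x = ennreal (D x)" "\<And>x. 0 <= D x"
    using lam01.real_RN_deriv[OF N.finite_measure_axioms N(3,2)] by metis
  have ND: "N = density lam01 (\<lambda>x. ennreal (D x))"
    using lam01.density_RN_deriv[OF N(3,2)] D(1,2) by (subst (asm) density_cong[of _ _ "\<lambda>x. ennreal (D x)"]) auto
  have "(\<integral>\<^sup>+ x. ennreal (D x) \<partial>lam01) = 1"
  proof -
    have "1 = emeasure (density lam01 (\<lambda>x. ennreal (D x))) (space lam01)"
      using N.emeasure_space_1 unfolding ND by simp
    also have "... = (\<integral>\<^sup>+ x. ennreal (D x) * indicator (space lam01) x \<partial>lam01)"
      using D(1) by (intro emeasure_density sets.top) auto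
    also have "... = (\<integral>\<^sup>+ x. ennreal (D x) \<partial>lam01)"
      by (intro nn_integral_cong) (simp add: indicator_def)
    finally show ?thesis by simp
  qed
  then have int: "integrable lam01 D"
    using D by (intro integrableI_nonneg) auto
  have i1: "(\<integral>x. f x \<partial>N) = (E01 x. D x * f x)" if "fun01 f" for f :: "real => real"
    unfolding ND using that D by (subst integral_density) auto
  have "(\<lambda>n. E01 x. D x * indicator A ((T ^^ n) x)) \<longlonglongrightarrow> (E01 x. D x) * (\<integral>x. indicator A x \<partial>\<mu>)"
    by (rule equidist_mixing[OF eq h nice int]) (use A in auto)
  moreover have "(E01 x. D x * indicator A ((T ^^ n) x)) = measure N A" for n
  proof -
    have "(E01 x. D x * indicator A ((T ^^ n) x)) = (\<integral>x. indicator A ((T ^^ n) x) \<partial>N)"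
      by (rule i1[symmetric]) (rule indicator_pow_measurable[OF niceD(1)[OF nice] A(1)])
    also have "... = (\<integral>x. indicator A x \<partial>N)"
      by (rule integral_pow_invariant[OF N(4)]) (use A N in auto)
    finally show ?thesis using A N by simp
  qed
  moreover have "(E01 x. D x) = 1"
    using i1[of "\<lambda>_. 1"] N.prob_space by simp
  moreover have "(\<integral>x. indicator A x \<partial>\<mu>) = measure \<mu> A"
    using A niceD(5)[OF nice] by simp
  ultimately have "measure N A = measure \<mu> A"
    by (simp add: LIMSEQ_const_iff)
  then show "emeasure N A = emeasure \<mu> A"
    by (simp add: N.emeasure_eq_measure mu.emeasure_eq_measure)
qed

text \<open>For an invariant \<open>A\<close>, mixing with the weight \<open>\<rho>\<close> times
  the indicator of \<open>A\<close> gives a constant sequence with value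
  \<open>measure \<mu> A\<close> and limit its square.\<close>

lemma equidist_ergodic:
  assumes eq: "equidist h T \<mu>" and h: "0 < h" and nice: "nice T \<mu>"
  shows "ergodic_wrt \<mu> T"
  unfolding ergodic_wrt_def
proof (intro conjI ballI impI)
  show "T \<in> measurable \<mu> \<mu>" using niceD(4)[OF nice] by (simp add: invariant_measure_def)
  fix A assume "A \<in> sets \<mu>" and inv: "T -` A \<inter> space \<mu> = A"
  then have A: "A \<in> sets lam01" "A \<in> sets borel" using niceD(5)[OF nice] by (auto simp: sets_lam01_iff)
  obtain \<rho> C where \<rho>: "borel_fun \<rho>" "\<And>x. 0 <= \<rho> x" "\<And>x. \<rho> x <= C"
    "\<mu> = density lam01 (\<lambda>x. ennreal (\<rho> x))" using nice unfolding nice_def by blast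
  have i1: "(\<integral>x. f x \<partial>\<mu>) = (E01 x. \<rho> x * f x)" if "fun01 f" for f :: "real => real"
    unfolding \<rho>(4) using that \<rho> measurable_lam01I[OF \<rho>(1)] by (subst integral_density) auto
  have mA: "measure \<mu> A = (E01 x. \<rho> x * indicator A x)"
    using i1[of "indicator A"] A \<open>A \<in> sets \<mu>\<close> by simp
  have pow: "indicator A ((T ^^ n) x) = (indicator A x :: real)" if "x \<in> {0..1}" for x n
  proof -
    have "(T ^^ n) x \<in> A \<longleftrightarrow> x \<in> A"
    proof (induction n)
      case (Suc n)
      have "(T ^^ n) x \<in> space lam01"
        using that niceD(2)[OF nice, of n] by (auto simp: measurable_def)
      then show ?case using Suc inv niceD(6)[OF nice] by auto
    qed simp
    then show ?thesis by (simp add: indicator_def)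
  qed
  have int: "integrable lam01 (\<lambda>x. \<rho> x * indicator A x)"
    by (rule integrable_lam01_bounded[of _ C])
       (use \<rho> A measurable_lam01I[OF \<rho>(1)] order_trans[OF \<rho>(2,3)] in \<open>auto simp: indicator_def\<close>)
  have "(\<lambda>n. E01 x. \<rho> x * indicator A x * indicator A ((T ^^ n) x))
      \<longlonglongrightarrow> (E01 x. \<rho> x * indicator A x) * (\<integral>x. indicator A x \<partial>\<mu>)"
    by (rule equidist_mixing[OF eq h nice int]) (use A in auto)
  moreover have "(E01 x. \<rho> x * indicator A x * indicator A ((T ^^ n) x)) = measure \<mu> A" for n
    unfolding mA by (intro Bochner_Integration.integral_cong) (auto simp: pow, auto simp: indicator_def)
  ultimately have "measure \<mu> A = measure \<mu> A * measure \<mu> A"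
    using \<open>A \<in> sets \<mu>\<close> by (simp add: LIMSEQ_const_iff mA[symmetric])
  then show "measure \<mu> A = 0 \<or> measure \<mu> A = 1" by auto
qed

text \<open>The definite description has a value only once existence and uniqueness are both known;
  ergodicity contributes to existence, while uniqueness follows from invariance and absolute
  continuity.\<close>

lemma beta_measure_eq:
  assumes eq: "equidist h (beta_map b) \<mu>" and h: "0 < h" and nice: "nice (beta_map b) \<mu>"
    and equiv: "equiv_measure \<mu> lam01"
  shows "beta_measure b = \<mu>"
  unfolding beta_measure_def
proof (rule the_equality)
  show "prob_space \<mu> \<and> equiv_measure \<mu> lam01 \<and> invariant_measure \<mu> (beta_map b) \<and> ergodic_wrt \<mu> (beta_map b)"
    using niceD[OF nice] equiv equidist_ergodic[OF eq h nice] by blast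
  show "N = \<mu>" if "prob_space N \<and> equiv_measure N lam01 \<and> invariant_measure N (beta_map b) \<and> ergodic_wrt N (beta_map b)" for N
    using that by (intro equidist_unique[OF eq h nice]) (auto simp: equiv_measure_def absolutely_continuous_def null_sets_def)
qed

section \<open>Beta transformations\<close>

text \<open>Vanishing outside \<open>[0, 1)\<close> lets all integrals run over the whole line,
  where affine substitution is available, and makes branches that leave the interval contribute
  0.\<close>

definition unit_bdd :: "(real => real) => bool" where
  "unit_bdd f \<longleftrightarrow> f \<in> borel_measurable borel \<and> (\<forall>x. x \<notin> {0..<1} --> f x = 0) \<and> (\<exists>B. \<forall>x. \<bar>f x\<bar> <= B)"

lemma unit_bdd_mult:
  assumes "unit_bdd f" "borel_fun g" "\<And>x. \<bar>g x\<bar> <= C"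
  shows "unit_bdd (\<lambda>x. f x * g x)"
proof -
  obtain B where B: "\<And>x. \<bar>f x\<bar> <= B" using assms(1) by (auto simp: unit_bdd_def)
  have "\<bar>f x * g x\<bar> <= B * C" for x
    unfolding abs_mult using B[of x] assms(3)[of x] by (intro mult_mono) auto
  then show ?thesis using assms by (auto simp: unit_bdd_def)
qed

lemma unit_bdd_integrable:
  assumes "unit_bdd f" shows "integrable lborel f"
proof -
  obtain B where B: "\<And>x. \<bar>f x\<bar> <= B" using assms by (auto simp: unit_bdd_def)
  have "integrable lborel (\<lambda>x. B * indicator {0..1::real} x :: real)"
    by (intro integrable_mult_right integrable_real_indicator) auto
  then show ?thesis
  proof (rule Bochner_Integration.integrable_bound)
    show "f \<in> borel_measurable lborel" using assms by (simp add: unit_bdd_def)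
    show "AE x in lborel. norm (f x) <= norm (B * indicator {0..1} x)"
      using assms B by (intro AE_I2) (auto simp: unit_bdd_def indicator_def intro: order_trans[OF B abs_ge_self])
  qed
qed

lemma unit_bdd_cmult: "unit_bdd f ==> unit_bdd (\<lambda>x. c * f x)"
  unfolding unit_bdd_def
proof (elim conjE exE, intro conjI)
  fix B assume "\<forall>x. \<bar>f x\<bar> <= B"
  then show "\<exists>B. \<forall>x. \<bar>c * f x\<bar> <= B"
    by (intro exI[of _ "\<bar>c\<bar> * B"]) (auto simp: abs_mult intro: mult_left_mono)
qed auto

lemma unit_bdd_indicator: "unit_bdd (indicator {0..<1})"
  unfolding unit_bdd_def by (auto intro!: exI[of _ 1])

lemma unit_bdd_restrict:
  "f \<in> borel_measurable borel ==> (\<And>x. \<bar>f x\<bar> <= B) ==> unit_bdd (\<lambda>x. indicator {0..<1} x * f x)"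
  using unit_bdd_mult[OF unit_bdd_indicator] by blast

text \<open>Being 0 from 1 onwards, such a function decreases on all of
  \<open>[0, \<infinity>)\<close>. This is why the class is stable under the transfer operator even
  if the last branch of the \<beta>-map is incomplete: points beyond 1 only bring in zeros.\<close>

definition decf :: "(real => real) => bool" where
  "decf f \<longleftrightarrow> (\<forall>x. x \<notin> {0..<1} --> f x = 0) \<and> (\<forall>x. 0 <= f x) \<and> (\<forall>x y. 0 <= x --> x <= y --> f y <= f x)"

lemma decfI:
  assumes "\<And>x. x \<notin> {0..<1} ==> f x = 0" "\<And>x. x \<in> {0..<1} ==> 0 <= f x"
    "\<And>x y. 0 <= x ==> x <= y ==> y < 1 ==> f y <= f x"
  shows "decf f"
  unfolding decf_def
proof (intro conjI allI impI)
  show nn: "0 <= f x" for x using assms(1,2)[of x] by (cases "x \<in> {0..<1}") auto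
  show "f y <= f x" if "0 <= x" "x <= y" for x y
    using that assms(1)[of y] assms(3)[of x y] nn[of x] by (cases "y < 1") auto
qed (use assms in auto)

lemma decfD: "decf f ==> 0 <= x ==> x <= y ==> f y <= f x"
  by (simp add: decf_def)

lemma decf_le0: "decf f ==> f x <= f 0"
  unfolding decf_def by (metis atLeastLessThan_iff linear order_refl)

lemma decf_unit_bdd:
  assumes "decf f" shows "unit_bdd f"
proof -
  have "mono (\<lambda>x. - f (max 0 x))"
    using assms by (auto simp: mono_def decf_def)
  from borel_measurable_mono[OF this] have "borel_fun (\<lambda>x. - (- f (max 0 x)))"
    by (rule borel_measurable_uminus)
  then have "borel_fun (\<lambda>x. indicator {0..<1} x * f (max 0 x))"
    by simp
  also have "(\<lambda>x. indicator {0..<1} x * f (max 0 x)) = f"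
    using assms by (auto simp: fun_eq_iff decf_def indicator_def max_def)
  finally show ?thesis
    using assms decf_le0[OF assms] by (auto simp: unit_bdd_def decf_def intro!: exI[of _ "f 0"])
qed

lemma decf_indicator: "decf (indicator {0..<1})"
  by (rule decfI) auto

lemma decf_lincomb: "decf f ==> decf g ==> 0 <= c ==> 0 <= d ==> decf (\<lambda>x. c * f x + d * g x)"
  unfolding decf_def by (auto intro!: add_mono mult_left_mono)

lemma beta_map_measurable [measurable]: "beta_map b \<in> borel_measurable borel"
  unfolding beta_map_def[abs_def] frac_def by measurable

lemma beta_map_pow_measurable [measurable]: "borel_fun (beta_map b ^^ n)"
  by (rule measurable_funpow) (rule beta_map_measurable)

lemma beta_map_unit: "beta_map b x \<in> {0..<1}"
  by (simp add: beta_map_def frac_lt_1)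

lemma beta_map_pow_unit: "x \<in> {0..<1} ==> (beta_map b ^^ n) x \<in> {0..<1}"
  by (cases n) (auto simp: beta_map_unit[simplified])

lemma beta_map_0 [simp]: "beta_map b 0 = 0"
  by (simp add: beta_map_def)

definition dens :: "real => (real => real) => bool" where
  "dens K f \<longleftrightarrow> decf f \<and> (\<integral>x. f x \<partial>lborel) = 1 \<and> f 0 <= K"

context
  fixes b :: real
  assumes b1: "1 < b"
begin

text \<open>The transfer operator of the \<beta>-map with respect to Lebesgue measure, with
  \<open>nat \<lceil>b\<rceil>\<close> inverse branches. It is applied to functions that vanish
  beyond 1, so that the missing part of the last branch needs no case distinction.\<close>

definition btr :: "(real => real) => real => real" where
  "btr f x = indicator {0..<1} x * ((\<Sum>j<nat \<lceil>b\<rceil>. f ((x + real j) / b)) / b)"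

lemma btr_outside: "x \<notin> {0..<1} ==> btr f x = 0"
  by (simp add: btr_def)

lemma btr_inside: "0 <= x ==> x < 1 ==> btr f x = (\<Sum>j<nat \<lceil>b\<rceil>. f ((x + real j) / b)) / b"
  by (simp add: btr_def)

lemma btr_lincomb: "btr (\<lambda>x. c * f x + d * g x) x = c * btr f x + d * btr g x"
  by (simp add: btr_def sum.distrib sum_distrib_left[symmetric] algebra_simps add_divide_distrib)

lemma btr_pow_lincomb: "(btr ^^ n) (\<lambda>x. c * f x + d * g x) = (\<lambda>x. c * (btr ^^ n) f x + d * (btr ^^ n) g x)"
  by (induction n) (auto simp: btr_lincomb)

lemma btr_pow_sum:
  assumes "finite I" shows "(btr ^^ n) (\<lambda>x. c * (\<Sum>i\<in>I. f i x)) = (\<lambda>x. c * (\<Sum>i\<in>I. (btr ^^ n) (f i) x))"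
  using assms
proof (induction I rule: finite_induct)
  case empty
  show ?case using btr_pow_lincomb[of n 0 "\<lambda>_. 0" 0 "\<lambda>_. 0"] by simp
next
  case (insert i I)
  have "(btr ^^ n) (\<lambda>x. c * (\<Sum>i\<in>insert i I. f i x)) = (btr ^^ n) (\<lambda>x. c * f i x + 1 * (c * (\<Sum>i\<in>I. f i x)))"
    using insert by (simp add: distrib_left)
  also have "... = (\<lambda>x. c * (btr ^^ n) (f i) x + 1 * (btr ^^ n) (\<lambda>x. c * (\<Sum>i\<in>I. f i x)) x)"
    by (rule btr_pow_lincomb)
  finally show ?case
    using insert by (simp add: distrib_left)
qed

lemma btr_mono:
  assumes "\<And>x. f x <= g x" shows "btr f x <= btr g x"
  unfolding btr_def using b1 by (intro mult_left_mono divide_right_mono sum_mono assms) auto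

lemma btr_pow_mono:
  assumes "\<And>x. f x <= g x" shows "(btr ^^ n) f x <= (btr ^^ n) g x"
  by (induction n arbitrary: x) (auto intro: btr_mono assms)

lemma btr_unit_bdd:
  assumes "unit_bdd f" shows "unit_bdd (btr f)"
proof -
  obtain B where B: "\<And>x. \<bar>f x\<bar> <= B" using assms by (auto simp: unit_bdd_def)
  have [measurable]: "borel_fun f" using assms by (simp add: unit_bdd_def)
  have "borel_fun (\<lambda>x. (\<Sum>j<nat \<lceil>b\<rceil>. f ((x + real j) / b)) / b)"
    by measurable
  moreover have "\<bar>(\<Sum>j<nat \<lceil>b\<rceil>. f ((x + real j) / b)) / b\<bar> <= (\<Sum>j<nat \<lceil>b\<rceil>. B) / b" for x
    unfolding abs_divide using b1
    by (intro divide_mono order_trans[OF sum_abs] sum_mono B) auto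
  ultimately show ?thesis
    unfolding btr_def[abs_def] by (rule unit_bdd_restrict)
qed

lemma btr_pow_unit_bdd: "unit_bdd f ==> unit_bdd ((btr ^^ n) f)"
  by (induction n) (auto intro: btr_unit_bdd)

text \<open>\<open>F j\<close> is the part of the integral over the interval where the integer part
  of \<open>b * x\<close> is \<open>j\<close>. The last of these intervals may reach beyond 1, where
  \<open>f\<close> is 0. Each part is carried to \<open>[0, 1)\<close> by an affine
  substitution.\<close>

lemma btr_duality:
  assumes f: "unit_bdd f" and g: "borel_fun g" "\<And>x. \<bar>g x\<bar> <= C"
  shows "(\<integral>x. btr f x * g x \<partial>lborel) = (\<integral>x. f x * g (beta_map b x) \<partial>lborel)"
proof -
  define J where "J = nat \<lceil>b\<rceil>"
  note [measurable] = g(1)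
  have fm [measurable]: "borel_fun f" using f by (simp add: unit_bdd_def)
  define F where "F = (\<lambda>j x. indicator {real j / b ..< (real j + 1) / b} x * (f x * g (b * x - real j)))"
  have eq: "f x * g (beta_map b x) = (\<Sum>j<J. F j x)" for x
  proof (cases "x \<in> {0..<1}")
    case True
    define j0 where "j0 = nat \<lfloor>b * x\<rfloor>"
    have nn: "0 <= b * x" using True b1 by auto
    then have j0: "real j0 = of_int \<lfloor>b * x\<rfloor>" by (simp add: j0_def)
    have "b * x < b" using True b1 by auto
    then have "\<lfloor>b * x\<rfloor> < \<lceil>b\<rceil>" by (simp add: floor_less_iff less_ceiling_iff) linarith
    then have "j0 < J" using nn b1 by (simp add: j0_def J_def)
    have "F j x = (if j = j0 then f x * g (beta_map b x) else 0)" for j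
    proof -
      have "x \<in> {real j / b ..< (real j + 1) / b} \<longleftrightarrow> real j <= b * x \<and> b * x < real j + 1"
        using b1 by (simp add: field_simps)
      also have "... \<longleftrightarrow> j = j0"
        using j0 by linarith
      finally show ?thesis
        using j0 by (simp add: F_def beta_map_def frac_def indicator_def)
    qed
    then show ?thesis using \<open>j0 < J\<close> by simp
  next
    case False
    then show ?thesis using f by (simp add: F_def unit_bdd_def)
  qed
  have "unit_bdd (F j)" for j
    unfolding F_def
    using unit_bdd_mult[OF unit_bdd_mult[OF f, of "\<lambda>x. g (b * x - real j)" C], of "indicator {real j / b ..< (real j + 1) / b}" 1] g(2)
    by (simp add: mult.commute)
  then have int: "integrable lborel (F j)" for j
    by (rule unit_bdd_integrable)
  have aff: "(\<integral>x. F j x \<partial>lborel) = (\<integral>x. indicator {0..<1} x * (f ((x + real j) / b) * g x / b) \<partial>lborel)" for j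
  proof -
    have "(\<integral>x. F j x \<partial>lborel) = \<bar>1 / b\<bar> *\<^sub>R (\<integral>x. F j (real j / b + (1 / b) * x) \<partial>lborel)"
      using b1 by (intro lborel_integral_real_affine) auto
    also have "(\<lambda>x. F j (real j / b + (1 / b) * x)) = (\<lambda>x. indicator {0..<1} x * (f ((x + real j) / b) * g x))"
    proof
      fix x
      have *: "real j / b + (1 / b) * x = (x + real j) / b" using b1 by (simp add: field_simps)
      have "(x + real j) / b \<in> {real j / b ..< (real j + 1) / b} \<longleftrightarrow> x \<in> {0..<1}"
        using b1 by (auto simp: divide_le_cancel divide_less_cancel)
      then show "F j (real j / b + (1 / b) * x) = indicator {0..<1} x * (f ((x + real j) / b) * g x)"
        unfolding * F_def using b1 by (simp add: indicator_def)
    qed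
    also have "\<bar>1 / b\<bar> *\<^sub>R (\<integral>x. indicator {0..<1} x * (f ((x + real j) / b) * g x) \<partial>lborel)
        = (\<integral>x. indicator {0..<1} x * (f ((x + real j) / b) * g x / b) \<partial>lborel)"
      using b1 by (subst integral_scaleR_right[symmetric]) (auto simp: field_simps)
    finally show ?thesis .
  qed
  obtain B where B: "\<And>x. \<bar>f x\<bar> <= B" using f by (auto simp: unit_bdd_def)
  have int2: "integrable lborel (\<lambda>x. indicator {0..<1} x * (f ((x + real j) / b) * g x / b))" for j
  proof (rule unit_bdd_integrable[OF unit_bdd_restrict[where B = "B * C / b"]])
    show "\<bar>f ((x + real j) / b) * g x / b\<bar> <= B * C / b" for x
      unfolding abs_divide abs_mult using b1 B[of "(x + real j) / b"] g(2)[of x]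
      by (auto intro!: divide_right_mono mult_mono)
  qed measurable
  have "(\<integral>x. f x * g (beta_map b x) \<partial>lborel) = (\<Sum>j<J. \<integral>x. F j x \<partial>lborel)"
    unfolding eq using int by (intro Bochner_Integration.integral_sum) auto
  also have "... = (\<integral>x. (\<Sum>j<J. indicator {0..<1} x * (f ((x + real j) / b) * g x / b)) \<partial>lborel)"
    unfolding aff using int2 by (intro Bochner_Integration.integral_sum[symmetric]) auto
  also have "... = (\<integral>x. btr f x * g x \<partial>lborel)"
    by (intro Bochner_Integration.integral_cong)
       (auto simp: btr_def J_def sum_distrib_left sum_distrib_right sum_divide_distrib mult_ac)
  finally show ?thesis ..
qed

lemma btr_pow_duality:
  assumes f: "unit_bdd f" and g: "borel_fun g" "\<And>x. \<bar>g x\<bar> <= C"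
  shows "(\<integral>x. (btr ^^ n) f x * g x \<partial>lborel) = (\<integral>x. f x * g ((beta_map b ^^ n) x) \<partial>lborel)"
  using g
proof (induction n arbitrary: g)
  case (Suc n)
  have "(\<integral>x. (btr ^^ Suc n) f x * g x \<partial>lborel) = (\<integral>x. (btr ^^ n) f x * g (beta_map b x) \<partial>lborel)"
    using btr_duality[OF btr_pow_unit_bdd[OF f] Suc.prems] by simp
  also have "... = (\<integral>x. f x * g (beta_map b ((beta_map b ^^ n) x)) \<partial>lborel)"
    using Suc.prems by (intro Suc.IH) (auto intro: measurable_compose[OF beta_map_measurable])
  finally show ?case by simp
qed simp

lemma btr_pow_integral:
  assumes "unit_bdd f" shows "(\<integral>x. (btr ^^ n) f x \<partial>lborel) = (\<integral>x. f x \<partial>lborel)"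
  using btr_pow_duality[OF assms, of "\<lambda>_. 1" 1 n] by simp

lemma btr_decf:
  assumes "decf f" shows "decf (btr f)"
proof (rule decfI)
  show "0 <= btr f x" for x
    unfolding btr_def using b1 assms by (auto simp: decf_def intro!: mult_nonneg_nonneg divide_nonneg_nonneg sum_nonneg)
  show "btr f y <= btr f x" if "0 <= x" "x <= y" "y < 1" for x y
    using that b1
    by (auto simp: btr_inside intro!: divide_right_mono sum_mono decfD[OF assms])
qed (rule btr_outside)

lemma btr_pow_decf: "decf f ==> decf ((btr ^^ n) f)"
  by (induction n) (auto intro: btr_decf)

text \<open>For decreasing \<open>f\<close> all terms of \<open>btr f 0\<close> except the one for \<open>j = 0\<close> are dominated by
  the corresponding terms of \<open>btr f t\<close>, \<open>0 <= t < 1\<close>, shifted by one.\<close>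
lemma btr_sup:
  assumes "decf f" shows "btr f 0 <= f 0 / b + (\<integral>x. f x \<partial>lborel)"
proof -
  define J where "J = nat \<lceil>b\<rceil>"
  define c where "c = btr f 0 - f 0 / b"
  have le: "c * indicator {0..<1} t <= btr f t" for t
  proof (cases "t \<in> {0..<1}")
    case True
    have "btr f 0 * b = (\<Sum>j<J. f (real j / b))"
      using b1 by (simp add: btr_inside J_def)
    also have "... <= (\<Sum>j<Suc J. f (real j / b))"
      using assms by (simp add: decf_def)
    also have "... = f 0 + (\<Sum>j<J. f ((1 + real j) / b))"
      by (subst sum.lessThan_Suc_shift) (simp add: add.commute)
    also have "(\<Sum>j<J. f ((1 + real j) / b)) <= (\<Sum>j<J. f ((t + real j) / b))"
      using True b1 by (intro sum_mono decfD[OF assms] divide_right_mono) auto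
    also have "... = btr f t * b"
      using True b1 by (simp add: btr_inside J_def)
    finally show ?thesis
      using True b1 by (simp add: c_def field_simps)
  next
    case False
    then show ?thesis by (simp add: btr_outside)
  qed
  have "(\<integral>t. c * indicator {0..<1::real} t \<partial>lborel) <= (\<integral>t. btr f t \<partial>lborel)"
  proof (rule integral_mono)
    show "integrable lborel (\<lambda>t. c * indicator {0..<1::real} t)"
      by (rule unit_bdd_integrable[OF unit_bdd_cmult[OF unit_bdd_indicator]])
    show "integrable lborel (btr f)"
      by (rule unit_bdd_integrable[OF btr_unit_bdd[OF decf_unit_bdd[OF assms]]])
  qed (rule le)
  also have "... = (\<integral>t. f t \<partial>lborel)"
    using btr_pow_integral[OF decf_unit_bdd[OF assms], of 1] by simp
  finally show ?thesis by (simp add: c_def)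
qed

text \<open>Iteration of \<open>btr_sup\<close>: the integral is preserved, the old peak is divided
  by \<open>b\<close> at each step, and the added masses sum to at most
  \<open>1 + 1 / b + 1 / b^2 + ... = b / (b - 1)\<close>.\<close>

lemma btr_pow_sup:
  assumes "decf f" shows "(btr ^^ n) f 0 <= f 0 / b ^ n + b / (b - 1) * (\<integral>x. f x \<partial>lborel)"
proof (induction n)
  case 0
  have "0 <= (\<integral>x. f x \<partial>lborel)" using assms by (intro integral_nonneg_AE) (auto simp: decf_def)
  then show ?case using b1 by simp
next
  case (Suc n)
  define I where "I = (\<integral>x. f x \<partial>lborel)"
  have "(btr ^^ Suc n) f 0 <= (btr ^^ n) f 0 / b + I"
    using btr_sup[OF btr_pow_decf[OF assms, of n]] btr_pow_integral[OF decf_unit_bdd[OF assms], of n]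
    by (simp add: I_def)
  also have "... <= (f 0 / b ^ n + b / (b - 1) * I) / b + I"
    using Suc b1 by (intro add_right_mono divide_right_mono) (auto simp: I_def)
  also have "... = f 0 / b ^ Suc n + b / (b - 1) * I"
    using b1 by (simp add: field_simps)
  finally show ?case by (simp add: I_def)
qed

text \<open>Only the inverse branch that fixes 0 is kept in each of the \<open>n\<close> steps. It
  is always complete, and a decreasing density is largest near 0.\<close>

lemma btr_pow_first_branch:
  assumes "\<And>x. 0 <= f x" "0 <= x" "x < 1"
  shows "f (x / b ^ n) / b ^ n <= (btr ^^ n) f x"
  using assms(2,3)
proof (induction n arbitrary: x)
  case (Suc n)
  have nn: "0 <= (btr ^^ n) f y" for y
    by (induction n arbitrary: y)
       (use b1 assms(1) in \<open>auto simp: btr_def intro!: mult_nonneg_nonneg divide_nonneg_nonneg sum_nonneg\<close>)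
  have x: "0 <= x / b" "x / b < 1" using Suc.prems b1 by (auto simp: field_simps)
  have "f (x / b ^ Suc n) / b ^ Suc n = (f (x / b / b ^ n) / b ^ n) / b"
    by (simp add: field_simps)
  also have "... <= (btr ^^ n) f (x / b) / b"
    using Suc.IH[OF x] b1 by (intro divide_right_mono) auto
  also have "(btr ^^ n) f (x / b) <= (\<Sum>j<nat \<lceil>b\<rceil>. (btr ^^ n) f ((x + real j) / b))"
    using member_le_sum[of 0 "{..<nat \<lceil>b\<rceil>}" "\<lambda>j. (btr ^^ n) f ((x + real j) / b)"] nn b1 by simp
  finally show ?case
    using Suc.prems b1 by (simp add: btr_inside divide_right_mono)
qed simp

text \<open>If the density were below 1/2 at \<open>y\<close>, it would stay below 1/2 from there
  on, and its mass would be less than \<open>K * y + 1/2 < 1\<close>.\<close>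

lemma dens_half:
  assumes f: "dens K f" and y: "0 <= y" "2 * K * y < 1" and K: "1 <= K"
  shows "1 / 2 <= f y"
proof (rule ccontr)
  assume "\<not> 1 / 2 <= f y"
  then have fy: "f y < 1 / 2" by simp
  have y1: "y < 1"
  proof -
    have "1 * y <= 2 * K * y" using y K by (intro mult_right_mono) auto
    then show ?thesis using y by linarith
  qed
  have dec: "decf f" using f by (simp add: dens_def)
  have le: "f x <= K * indicator {0..<y} x + 1/2 * indicator {y..<1} x" for x
  proof -
    consider "x < 0 \<or> 1 <= x" | "0 <= x" "x < y" | "y <= x" "x < 1" by linarith
    then show ?thesis
    proof cases
      case 1
      then show ?thesis using dec y y1 by (auto simp: decf_def indicator_def)
    next
      case 2
      then show ?thesis using decf_le0[OF dec, of x] f by (auto simp: dens_def indicator_def)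
    next
      case 3
      then have "f x <= f y" using dec y by (auto simp: decf_def)
      then show ?thesis using 3 y fy by (auto simp: indicator_def)
    qed
  qed
  have "(\<integral>x. f x \<partial>lborel) <= (\<integral>x. K * indicator {0..<y} x + 1/2 * indicator {y..<1} x \<partial>lborel)"
    by (rule integral_mono[OF unit_bdd_integrable[OF decf_unit_bdd[OF dec]] _ le])
       (intro Bochner_Integration.integrable_add integrable_mult_right integrable_real_indicator; use y y1 in simp)
  also have "... = K * y + 1/2 * (1 - y)"
    using y y1 by (subst Bochner_Integration.integral_add) auto
  also have "... < 1"
  proof -
    have "K * y < 1 / 2" using y(2) by simp
    moreover have "K * y + 1 / 2 * (1 - y) <= K * y + 1 / 2" using y(1) by simp
    ultimately show ?thesis by linarith
  qed
  finally show False using f by (simp add: dens_def)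
qed

text \<open>A Doeblin decomposition: after \<open>r\<close> steps every density of the class
  contains the same multiple \<open>c\<close> of the uniform one, and the renormalised rest is again
  in the class. The lower bound \<open>c\<close> comes from the first branch, with value at least
  1/2 at \<open>x / b ^ r\<close> and slope \<open>b ^ r\<close>.\<close>

lemma dens_step:
  assumes f: "dens K f" and K: "b / (b - 1) + 1 <= K" and r: "2 * K < b ^ r"
    and c: "c = 1 / (2 * b ^ r)"
  obtains f' where "dens K f'" "(btr ^^ r) f = (\<lambda>x. c * indicator {0..<1} x + (1 - c) * f' x)"
proof -
  have C0: "b / (b - 1) > 0" using b1 by simp
  have K1: "1 <= K" using K C0 by linarith
  have dec: "decf f" using f by (simp add: dens_def)
  have br: "b ^ r > 2" using r K1 by linarith
  have cpos: "0 < c" "c < 1 / 4" using br unfolding c by (auto simp: field_simps)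
  have low: "c <= (btr ^^ r) f x" if "0 <= x" "x < 1" for x
  proof -
    have "2 * K * (x / b ^ r) < 1"
    proof -
      have "2 * K * x <= 2 * K * 1" using that K1 by (intro mult_left_mono) auto
      then show ?thesis using r br by (simp add: field_simps)
    qed
    then have "1 / 2 <= f (x / b ^ r)"
      using that br K1 by (intro dens_half[OF f]) auto
    then have "c <= f (x / b ^ r) / b ^ r"
      unfolding c using br divide_right_mono[of "1/2" "f (x / b ^ r)" "b ^ r"] by simp
    also have "... <= (btr ^^ r) f x"
      using dec that by (intro btr_pow_first_branch) (auto simp: decf_def)
    finally show ?thesis .
  qed
  define f' where "f' = (\<lambda>x. ((btr ^^ r) f x - c * indicator {0..<1} x) / (1 - c))"
  have decr: "decf ((btr ^^ r) f)" by (rule btr_pow_decf[OF dec])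
  have "decf f'"
  proof (rule decfI)
    show "f' y <= f' x" if "0 <= x" "x <= y" "y < 1" for x y
      using decr that cpos unfolding f'_def decf_def by (intro divide_right_mono) auto
  qed (use low decr cpos in \<open>auto simp: f'_def decf_def\<close>)
  moreover have "(\<integral>x. f' x \<partial>lborel) = 1"
  proof -
    have "(\<integral>x. f' x \<partial>lborel) = (\<integral>x. (btr ^^ r) f x - c * indicator {0..<1} x \<partial>lborel) / (1 - c)"
      unfolding f'_def by simp
    also have "(\<integral>x. (btr ^^ r) f x - c * indicator {0..<1} x \<partial>lborel) = 1 - c"
      using btr_pow_integral[OF decf_unit_bdd[OF dec], of r] f unit_bdd_integrable[OF decf_unit_bdd[OF decr]]
      by (subst Bochner_Integration.integral_diff) (auto simp: dens_def)
    finally show ?thesis using cpos by simp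
  qed
  \<comment> \<open>After \<open>r\<close> steps the initial peak has decayed to at most 1/2, so the
    new supremum is at most \<open>1/2 + b / (b - 1)\<close>. Since \<open>K\<close> exceeds
    \<open>b / (b - 1)\<close> by 1, room remains for the division by \<open>1 - c\<close>.\<close>
  moreover have "f' 0 <= K"
  proof -
    have f0: "f 0 <= K" using f by (simp add: dens_def)
    have "f 0 / b ^ r <= K / b ^ r" using f0 br by (intro divide_right_mono) auto
    also have "... <= 1 / 2" using r br by (simp add: field_simps)
    finally have 1: "(btr ^^ r) f 0 <= 1 / 2 + b / (b - 1)"
      using btr_pow_sup[OF dec, of r] f by (auto simp only: dens_def mult_1_right)
    have "K * c <= 1 / 4" unfolding c using r br by (simp add: field_simps)
    then have "1 / 2 + b / (b - 1) <= K * (1 - c)" using K by (simp add: right_diff_distrib)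
    then have "(btr ^^ r) f 0 - c <= K * (1 - c)" using 1 cpos by linarith
    then show ?thesis using cpos by (simp add: f'_def field_simps)
  qed
  ultimately have "dens K f'" by (simp add: dens_def)
  moreover have "(btr ^^ r) f = (\<lambda>x. c * indicator {0..<1} x + (1 - c) * f' x)"
    using cpos by (auto simp: f'_def fun_eq_iff)
  ultimately show thesis by (rule that)
qed

text \<open>In each block of \<open>r\<close> steps the common part \<open>c\<close> of the two
  densities cancels in the difference, and the rests are densities of the same class weighted by
  \<open>1 - c\<close>.\<close>

lemma dens_contract:
  assumes K: "b / (b - 1) + 1 <= K" and r: "2 * K < b ^ r" and c: "c = 1 / (2 * b ^ r)"
    and f: "dens K f1" "dens K f2" and g: "borel_fun g" "\<And>x. \<bar>g x\<bar> <= 1"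
  shows "\<bar>(\<integral>x. f1 x * g ((beta_map b ^^ (m * r)) x) \<partial>lborel) - (\<integral>x. f2 x * g ((beta_map b ^^ (m * r)) x) \<partial>lborel)\<bar>
     <= 2 * (1 - c) ^ m"
  using f
proof (induction m arbitrary: f1 f2)
  case 0
  have "\<bar>\<integral>x. f x * g x \<partial>lborel\<bar> <= 1" if "dens K f" for f
  proof -
    have u: "unit_bdd f" using that decf_unit_bdd by (auto simp: dens_def)
    have "\<bar>\<integral>x. f x * g x \<partial>lborel\<bar> <= (\<integral>x. \<bar>f x * g x\<bar> \<partial>lborel)"
      by (rule integral_abs_bound)
    also have "... <= (\<integral>x. f x \<partial>lborel)"
    proof (rule integral_mono)
      show "\<bar>f x * g x\<bar> <= f x" for x
        unfolding abs_mult using g(2)[of x] that by (auto simp: dens_def decf_def intro: mult_left_le)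
    qed (use unit_bdd_integrable[OF u] unit_bdd_integrable[OF unit_bdd_mult[OF u g]] in auto)
    finally show ?thesis using that by (simp add: dens_def)
  qed
  from this[OF 0(1)] this[OF 0(2)] show ?case by simp
next
  case (Suc m)
  define G where "G = (\<lambda>x. g ((beta_map b ^^ (m * r)) x))"
  have G: "borel_fun G" "\<And>x. \<bar>G x\<bar> <= 1"
    using g unfolding G_def by auto
  have br: "0 < c" "c < 1"
  proof -
    have "b / (b - 1) > 0" using b1 by simp
    then have "b ^ r > 2" using K r by linarith
    then show "0 < c" "c < 1" by (auto simp: c field_simps)
  qed
  have key: "\<exists>f'. dens K f' \<and> (\<integral>x. f x * g ((beta_map b ^^ (Suc m * r)) x) \<partial>lborel) =
     c * (\<integral>x. indicator {0..<1} x * G x \<partial>lborel) + (1 - c) * (\<integral>x. f' x * G x \<partial>lborel)" if f: "dens K f" for f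
  proof -
    obtain f' where f': "dens K f'" "(btr ^^ r) f = (\<lambda>x. c * indicator {0..<1} x + (1 - c) * f' x)"
      using dens_step[OF f K r c] .
    have u: "unit_bdd f" "unit_bdd f'" using f f'(1) decf_unit_bdd by (auto simp: dens_def)
    have "(\<integral>x. f x * g ((beta_map b ^^ (Suc m * r)) x) \<partial>lborel) = (\<integral>x. f x * G ((beta_map b ^^ r) x) \<partial>lborel)"
      by (simp add: G_def funpow_add[symmetric] add.commute flip: o_apply[of "_ ^^ _"])
    also have "... = (\<integral>x. (btr ^^ r) f x * G x \<partial>lborel)"
      by (rule btr_pow_duality[symmetric, OF u(1) G])
    also have "... = (\<integral>x. c * (indicator {0..<1} x * G x) + (1 - c) * (f' x * G x) \<partial>lborel)"
      unfolding f'(2) by (simp add: algebra_simps)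
    also have "... = c * (\<integral>x. indicator {0..<1} x * G x \<partial>lborel) + (1 - c) * (\<integral>x. f' x * G x \<partial>lborel)"
      using unit_bdd_integrable[OF unit_bdd_mult[OF unit_bdd_indicator G]] unit_bdd_integrable[OF unit_bdd_mult[OF u(2) G]]
      by (subst Bochner_Integration.integral_add) auto
    finally show ?thesis using f'(1) by blast
  qed
  obtain f1' f2' where f': "dens K f1'" "dens K f2'" and
    1: "(\<integral>x. f1 x * g ((beta_map b ^^ (Suc m * r)) x) \<partial>lborel) =
     c * (\<integral>x. indicator {0..<1} x * G x \<partial>lborel) + (1 - c) * (\<integral>x. f1' x * G x \<partial>lborel)" and
    2: "(\<integral>x. f2 x * g ((beta_map b ^^ (Suc m * r)) x) \<partial>lborel) =
     c * (\<integral>x. indicator {0..<1} x * G x \<partial>lborel) + (1 - c) * (\<integral>x. f2' x * G x \<partial>lborel)"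
    using key[OF Suc.prems(1)] key[OF Suc.prems(2)] by blast
  have "\<bar>(\<integral>x. f1' x * G x \<partial>lborel) - (\<integral>x. f2' x * G x \<partial>lborel)\<bar> <= 2 * (1 - c) ^ m"
    using Suc.IH[OF f'] by (simp add: G_def)
  then have "(1 - c) * \<bar>(\<integral>x. f1' x * G x \<partial>lborel) - (\<integral>x. f2' x * G x \<partial>lborel)\<bar> <= (1 - c) * (2 * (1 - c) ^ m)"
    using br by (intro mult_left_mono) auto
  then show ?case
    unfolding 1 2 using br by (simp add: abs_mult[symmetric] right_diff_distrib[symmetric] abs_mult)
qed

text \<open>One rate \<open>\<rho>\<close> serves all pairs of densities of the class and all test
  functions; this uniformity is what \<open>equidist\<close> requires.\<close>

lemma dens_mixing:
  assumes K: "b / (b - 1) + 1 <= K"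
  obtains \<rho> where "\<rho> \<longlonglongrightarrow> 0" "\<And>n. 0 <= \<rho> n"
    "\<And>f1 f2 g n. dens K f1 ==> dens K f2 ==> g \<in> borel_measurable borel ==> \<forall>x. \<bar>g x\<bar> <= 1 ==>
      \<bar>(\<integral>x. f1 x * g ((beta_map b ^^ n) x) \<partial>lborel) - (\<integral>x. f2 x * g ((beta_map b ^^ n) x) \<partial>lborel)\<bar> <= \<rho> n"
proof -
  have C0: "b / (b - 1) > 0" using b1 by simp
  obtain r where r: "2 * K < b ^ r" using real_arch_pow[OF b1] by blast
  have br: "b ^ r > 2" using r K C0 by linarith
  then have "r > 0" by (cases r) auto
  define c where "c = 1 / (2 * b ^ r)"
  have c: "0 < c" "c < 1" using br by (auto simp: c_def field_simps)
  define \<rho> where "\<rho> = (\<lambda>n. 2 * (1 - c) ^ (n div r))"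
  show thesis
  proof (rule that[of \<rho>])
    have "(\<lambda>m. 2 * (1 - c) ^ m) \<longlonglongrightarrow> 2 * 0"
      using c by (intro tendsto_intros LIMSEQ_power_zero) auto
    moreover have "filterlim (\<lambda>n. n div r) sequentially sequentially"
      unfolding filterlim_at_top eventually_sequentially
    proof (intro allI exI impI)
      fix Z n assume "Z * r <= n"
      then show "Z <= n div r" using \<open>r > 0\<close> by (simp add: less_eq_div_iff_mult_less_eq)
    qed
    ultimately show "\<rho> \<longlonglongrightarrow> 0"
      unfolding \<rho>_def by (auto dest: filterlim_compose)
    show "0 <= \<rho> n" for n using c by (simp add: \<rho>_def)
    fix f1 f2 :: "real => real" and g :: "real => real" and n
    assume f: "dens K f1" "dens K f2" and g: "borel_fun g" "unit_bounded g"
    \<comment> \<open>The incomplete block of \<open>n mod r\<close> steps is absorbed into the test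
      function, which stays bounded by 1.\<close>
    have "n = n div r * r + n mod r" by simp
    then have "(beta_map b ^^ n) x = (beta_map b ^^ (n mod r)) ((beta_map b ^^ (n div r * r)) x)" for x
      by (metis add.commute comp_apply funpow_add)
    then show "\<bar>(\<integral>x. f1 x * g ((beta_map b ^^ n) x) \<partial>lborel) - (\<integral>x. f2 x * g ((beta_map b ^^ n) x) \<partial>lborel)\<bar> <= \<rho> n"
      unfolding \<rho>_def using g
      by (simp only:, intro dens_contract[OF K r c_def f, of "\<lambda>x. g ((beta_map b ^^ (n mod r)) x)"])
         (auto intro: measurable_compose[OF beta_map_pow_measurable])
  qed
qed

section \<open>The Parry density and the number of branches\<close>

lemma beta_orbit_1_le: "(beta_map b ^^ n) 1 <= 1"
  by (cases n) (auto simp: beta_map_def frac_lt_1 less_imp_le)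

lemma beta_orbit_1_ge: "0 <= (beta_map b ^^ n) 1"
  by (cases n) (auto simp: beta_map_def)

text \<open>Parry's formula for the invariant density, without normalisation:
  \<open>b ^ (- n)\<close> is added on the part of \<open>[0, 1)\<close> below the
  \<open>n\<close>-th point of the orbit of 1. For an integer \<open>b\<close> that orbit is 0 from
  the first step on and the sum is constant on \<open>[0, 1)\<close>.\<close>

definition parry :: "real => real" where
  "parry x = indicator {0..<1} x * (\<Sum>n. (1 / b) ^ n * of_bool (x < (beta_map b ^^ n) 1))"

lemma summable_parry: "summable (\<lambda>n. (1 / b) ^ n * of_bool (x < (beta_map b ^^ n) 1))"
  by (rule summable_comparison_test[OF _ summable_geometric[of "1 / b"]])
     (use b1 in \<open>auto intro!: exI[of _ 0]\<close>)

lemma parry_ge_0: "0 <= x ==> parry x = (\<Sum>n. (1 / b) ^ n * of_bool (x < (beta_map b ^^ n) 1))"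
proof -
  assume "0 <= x"
  have "of_bool (x < (beta_map b ^^ n) 1) = (0::real)" if "1 <= x" for n
    using that beta_orbit_1_le[of n] by auto
  then show ?thesis using \<open>0 <= x\<close> by (auto simp: parry_def indicator_def)
qed

lemma decf_parry: "decf parry"
proof (rule decfI)
  show "0 <= parry x" for x
    using b1 by (auto simp: parry_def intro!: mult_nonneg_nonneg suminf_nonneg summable_parry)
  show "parry y <= parry x" if "0 <= x" "x <= y" "y < 1" for x y
    using that b1 by (auto simp: parry_ge_0 intro!: suminf_le summable_parry)
qed (simp add: parry_def)

lemma parry_ge_1: "0 <= x ==> x < 1 ==> 1 <= parry x"
  using sum_le_suminf[OF summable_parry, of "{0}" x] b1 by (simp add: parry_ge_0)

lemma parry_le: "parry x <= b / (b - 1)"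
proof (cases "x \<in> {0..<1}")
  case True
  have "parry x <= (\<Sum>n. (1 / b) ^ n)"
    using True b1 by (auto simp: parry_ge_0 intro!: suminf_le summable_parry summable_geometric)
  also have "... = b / (b - 1)" using b1 by (subst suminf_geometric) (auto simp: field_simps)
  finally show ?thesis .
next
  case False
  then show ?thesis using b1 by (auto simp: parry_def)
qed

text \<open>With \<open>b * t = m + f\<close>, where \<open>m\<close> is an integer and
  \<open>0 <= f < 1\<close>, the inequality says \<open>x + j < m + f\<close>; this holds for
  \<open>j < m\<close>, and for \<open>j = m\<close> exactly if \<open>x < f\<close>. Up to the
  factor \<open>1 / b\<close> this is the image under \<open>btr\<close> of the indicator of
  \<open>[0, t)\<close>.\<close>

lemma card_branches_less:
  assumes "0 <= x" "x < 1" "0 <= t" "t <= 1"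
  shows "(\<Sum>j<nat \<lceil>b\<rceil>. of_bool ((x + real j) / b < t)) = b * t - beta_map b t + of_bool (x < beta_map b t)"
proof -
  define m where "m = nat \<lfloor>b * t\<rfloor>"
  define f where "f = beta_map b t"
  have nn: "0 <= b * t" using assms b1 by simp
  have bt: "b * t = real m + f" using nn by (simp add: m_def f_def beta_map_def frac_def)
  have f: "0 <= f" "f < 1" using beta_map_unit[of b t] by (auto simp: f_def)
  have "b * t <= b" using assms b1 by (simp add: mult_left_le)
  also have "b <= real (nat \<lceil>b\<rceil>)" using b1 by linarith
  finally have mJ: "real m + f <= real (nat \<lceil>b\<rceil>)" using bt by simp
  have "(x + real j) / b < t \<longleftrightarrow> j < m \<or> (j = m \<and> x < f)" for j
  proof -
    have "(x + real j) / b < t \<longleftrightarrow> x + real j < real m + f"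
      using b1 by (simp add: bt[symmetric] pos_divide_less_eq mult.commute)
    also have "... \<longleftrightarrow> j < m \<or> (j = m \<and> x < f)"
    proof (cases j m rule: linorder_cases)
      case less
      then have "real j + 1 <= real m" by simp
      then show ?thesis using less assms f by linarith
    next
      case equal
      then show ?thesis by simp
    next
      case greater
      then have "real m + 1 <= real j" by simp
      then show ?thesis using greater assms f by linarith
    qed
    finally show ?thesis .
  qed
  note iff = this
  have "x < f ==> m < nat \<lceil>b\<rceil>"
  proof -
    assume "x < f"
    then have "real m < real (nat \<lceil>b\<rceil>)" using mJ assms(1) by linarith
    then show ?thesis by (simp only: of_nat_less_iff)
  qed
  moreover have "m <= nat \<lceil>b\<rceil>"
  proof -
    have "real m <= real (nat \<lceil>b\<rceil>)" using mJ f by linarith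
    then show ?thesis by (simp only: of_nat_le_iff)
  qed
  ultimately have "{..<nat \<lceil>b\<rceil>} \<inter> {j. (x + real j) / b < t} = (if x < f then {..m} else {..<m})"
    unfolding iff by (simp only: split: if_split) auto
  then have "(\<Sum>j<nat \<lceil>b\<rceil>. of_bool ((x + real j) / b < t)) = real (card (if x < f then {..m} else {..<m}))"
    by (simp only: sum_of_bool_eq finite_lessThan)
  then show ?thesis
    unfolding f_def[symmetric] using bt by (simp only: split: if_split) simp
qed

text \<open>By \<open>card_branches_less\<close>, the \<open>n\<close>-th summand is sent to the
  next summand plus the difference of \<open>b ^ (- n) * t n\<close> and its successor. These
  differences telescope to \<open>t 0 = 1\<close>, which replaces the summand for
  \<open>n = 0\<close> lost in the shift.\<close>

lemma btr_parry: "btr parry = parry"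
proof
  fix x
  show "btr parry x = parry x"
  proof (cases "x \<in> {0..<1}")
    case True
    define t where "t = (\<lambda>n. (beta_map b ^^ n) 1)"
    have t: "0 <= t n" "t n <= 1" "t (Suc n) = beta_map b (t n)" for n
      using beta_orbit_1_le beta_orbit_1_ge by (auto simp: t_def)
    have tel: "(\<lambda>n. (1 / b) ^ n * t n - (1 / b) ^ Suc n * t (Suc n)) sums ((1 / b) ^ 0 * t 0 - 0)"
    proof (rule telescope_sums')
      show "(\<lambda>n. (1 / b) ^ n * t n) \<longlonglongrightarrow> 0"
      proof (rule tendsto_sandwich[of "\<lambda>_. 0"])
        show "(\<lambda>n. (1 / b) ^ n) \<longlonglongrightarrow> 0" using b1 by (intro LIMSEQ_power_zero) auto
      qed (use t b1 in \<open>auto intro!: always_eventually mult_left_le\<close>)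
    qed
    have "(\<lambda>n. (1 / b) ^ Suc n * of_bool (x < t (Suc n))) sums (parry x - (1 / b) ^ 0 * of_bool (x < t 0))"
      using summable_sums[OF summable_parry, of x] True unfolding t_def
      by (subst sums_Suc_iff) (simp add: parry_ge_0)
    from sums_add[OF tel this]
    have 1: "(\<lambda>n. (1 / b) ^ n * t n - (1 / b) ^ Suc n * t (Suc n) + (1 / b) ^ Suc n * of_bool (x < t (Suc n))) sums parry x"
      using True by (simp add: t_def)
    have "btr parry x = (\<Sum>j<nat \<lceil>b\<rceil>. \<Sum>n. (1 / b) ^ n * of_bool ((x + real j) / b < t n)) / b"
      using True b1 by (simp add: btr_inside parry_ge_0 t_def)
    also have "... = (\<Sum>n. \<Sum>j<nat \<lceil>b\<rceil>. (1 / b) ^ n * of_bool ((x + real j) / b < t n)) / b"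
      unfolding t_def by (subst suminf_sum) (auto intro: summable_parry)
    also have "... = (\<Sum>n. (\<Sum>j<nat \<lceil>b\<rceil>. (1 / b) ^ n * of_bool ((x + real j) / b < t n)) / b)"
      unfolding t_def by (intro suminf_divide[symmetric] summable_sum summable_parry)
    also have "(\<lambda>n. (\<Sum>j<nat \<lceil>b\<rceil>. (1 / b) ^ n * of_bool ((x + real j) / b < t n)) / b) =
      (\<lambda>n. (1 / b) ^ n * t n - (1 / b) ^ Suc n * t (Suc n) + (1 / b) ^ Suc n * of_bool (x < t (Suc n)))"
    proof
      fix n
      define q where "q = (1 / b) ^ n"
      show "(\<Sum>j<nat \<lceil>b\<rceil>. (1 / b) ^ n * of_bool ((x + real j) / b < t n)) / b =
        (1 / b) ^ n * t n - (1 / b) ^ Suc n * t (Suc n) + (1 / b) ^ Suc n * of_bool (x < t (Suc n))"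
        unfolding sum_distrib_left[symmetric] power_Suc q_def[symmetric] t(3)
        using True b1 t(1,2)[of n] by (subst card_branches_less) (auto simp: field_simps)
    qed
    finally show ?thesis using 1 by (simp add: sums_iff)
  qed (simp add: btr_outside parry_def)
qed

lemma btr_pow_parry: "(btr ^^ n) parry = parry"
  by (induction n) (auto simp: btr_parry)

text \<open>Summing over preimages under one step is \<open>b\<close> times \<open>btr\<close>, and
  \<open>parry\<close> is fixed by \<open>btr\<close>. As \<open>parry\<close> is at least 1 on
  \<open>[0, 1)\<close>, it dominates the count for \<open>n = 0\<close>, and the domination
  propagates. This gives growth \<open>b ^ n\<close> instead of the trivial power of
  \<open>\<lceil>b\<rceil>\<close>.\<close>

lemma card_preimage:
  fixes n :: nat
  assumes "s \<in> {0..<1}"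
  shows "finite {y \<in> {0..<1}. (beta_map b ^^ n) y = s} \<and>
    real (card {y \<in> {0..<1}. (beta_map b ^^ n) y = s}) <= b ^ n * parry s"
  using assms
proof (induction n arbitrary: s)
  case 0
  have "{y \<in> {0..<1}. (beta_map b ^^ 0) y = s} = {s}" using 0 by auto
  then show ?case using parry_ge_1[of s] 0 by auto
next
  case (Suc n)
  define A where "A = (\<lambda>z. {y \<in> {0..<1}. (beta_map b ^^ n) y = z})"
  have IH: "finite (A z)" "real (card (A z)) <= b ^ n * parry z" if "0 <= z" for z
  proof -
    have "finite (A z) \<and> real (card (A z)) <= b ^ n * parry z"
    proof (cases "z < 1")
      case True
      then show ?thesis using Suc.IH[of z] that by (simp add: A_def)
    next
      case False
      then have "A z = {}" using beta_map_pow_unit[where b = b and n = n] by (auto simp: A_def)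
      then show ?thesis using decf_parry b1 by (auto simp: decf_def)
    qed
    then show "finite (A z)" "real (card (A z)) <= b ^ n * parry z" by auto
  qed
  have sub: "{y \<in> {0..<1}. (beta_map b ^^ Suc n) y = s} \<subseteq> (\<Union>j<nat \<lceil>b\<rceil>. A ((s + real j) / b))"
  proof
    fix y assume y: "y \<in> {y \<in> {0..<1}. (beta_map b ^^ Suc n) y = s}"
    define z where "z = (beta_map b ^^ n) y"
    have z: "z \<in> {0..<1}" using y beta_map_pow_unit[of y n b] by (simp add: z_def)
    define j where "j = nat \<lfloor>b * z\<rfloor>"
    have "s = b * z - real j" using y z b1 by (auto simp: z_def beta_map_def frac_def j_def)
    moreover have "b * z < b" using z b1 by auto
    then have "\<lfloor>b * z\<rfloor> < \<lceil>b\<rceil>" by (simp add: floor_less_iff less_ceiling_iff) linarith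
    then have "j < nat \<lceil>b\<rceil>" using b1 by (simp add: j_def)
    ultimately show "y \<in> (\<Union>j<nat \<lceil>b\<rceil>. A ((s + real j) / b))"
      using y b1 by (auto simp: A_def z_def intro!: bexI[of _ j])
  qed
  have nn: "0 <= (s + real j) / b" for j using Suc.prems b1 by simp
  have fin: "finite (\<Union>j<nat \<lceil>b\<rceil>. A ((s + real j) / b))" using IH(1)[OF nn] by blast
  have "real (card {y \<in> {0..<1}. (beta_map b ^^ Suc n) y = s}) <= real (card (\<Union>j<nat \<lceil>b\<rceil>. A ((s + real j) / b)))"
    using card_mono[OF fin sub] by simp
  also have "... <= real (\<Sum>j<nat \<lceil>b\<rceil>. card (A ((s + real j) / b)))"
    by (intro of_nat_mono card_UN_le) simp
  also have "... <= (\<Sum>j<nat \<lceil>b\<rceil>. b ^ n * parry ((s + real j) / b))"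
    unfolding of_nat_sum using IH(2)[OF nn] by (intro sum_mono) auto
  also have "... = b ^ Suc n * btr parry s"
    using Suc.prems b1 by (simp add: btr_inside sum_distrib_left[symmetric])
  finally show ?case
    using finite_subset[OF sub fin] by (simp add: btr_parry)
qed

text \<open>The map jumps exactly where it takes the value 0 (apart from the harmless start).
  Requiring 0 in \<open>S\<close> therefore puts all discontinuities into the preimage of
  \<open>S\<close>, so that no separate set of branch points has to be carried along.\<close>

lemma step_beta_map:
  assumes S: "step S g" "0 \<in> S"
  shows "step {y \<in> {0..<1}. beta_map b y \<in> S} (\<lambda>x. g (beta_map b x))"
  unfolding step_def
proof (intro allI impI)
  fix x y :: real assume xy: "0 <= x" "x <= y" "y < 1" "{x..y} \<inter> {y \<in> {0..<1}. beta_map b y \<in> S} = {}"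
  have no: "beta_map b z \<notin> S" if "x <= z" "z <= y" for z
    using that xy by auto
  have fl: "\<lfloor>b * x\<rfloor> = \<lfloor>b * y\<rfloor>"
  proof (rule ccontr)
    assume ne: "\<lfloor>b * x\<rfloor> \<noteq> \<lfloor>b * y\<rfloor>"
    \<comment> \<open>If the integer part changes between \<open>x\<close> and \<open>y\<close>,
      then \<open>z\<close> is the last discontinuity up to \<open>y\<close>; it is mapped to 0,
      which belongs to \<open>S\<close>.\<close>
    define z where "z = of_int \<lfloor>b * y\<rfloor> / b"
    have "b * x <= b * y" using xy b1 by simp
    then have "\<lfloor>b * x\<rfloor> < \<lfloor>b * y\<rfloor>" using ne floor_mono[of "b * x" "b * y"] by linarith
    then have "b * x < of_int \<lfloor>b * y\<rfloor>" by (simp add: floor_less_iff)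
    then have "x <= z" using b1 by (simp add: z_def field_simps)
    moreover have "z <= y" using b1 of_int_floor_le[of "b * y"] by (simp add: z_def field_simps)
    moreover have "beta_map b z = 0" using b1 by (simp add: z_def beta_map_def)
    ultimately show False using no S(2) by metis
  qed
  show "g (beta_map b x) = g (beta_map b y)"
  proof (rule stepD[OF S(1)])
    show "beta_map b x <= beta_map b y" using fl xy b1 by (simp add: beta_map_def frac_def)
    show "{beta_map b x..beta_map b y} \<inter> S = {}"
    proof (rule ccontr)
      assume "{beta_map b x..beta_map b y} \<inter> S \<noteq> {}"
      then obtain s where s: "beta_map b x <= s" "s <= beta_map b y" "s \<in> S" by auto
      define z where "z = (s + of_int \<lfloor>b * x\<rfloor>) / b"
      have "s < 1" "0 <= s" using s beta_map_unit[of b x] beta_map_unit[of b y] by auto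
      then have "beta_map b z = s" using b1 by (simp add: z_def beta_map_def frac_unique_iff)
      moreover have "x <= z" using s(1) b1 by (simp add: z_def beta_map_def frac_def field_simps)
      moreover have "z <= y" using s(2) b1 fl by (simp add: z_def beta_map_def frac_def field_simps)
      ultimately show False using no s(3) by metis
    qed
  qed (use beta_map_unit[of b x] beta_map_unit[of b y] in auto)
qed

lemma step_beta_map_pow:
  assumes S: "step S g" "0 \<in> S"
  shows "step {y \<in> {0..<1}. (beta_map b ^^ n) y \<in> S} (\<lambda>x. g ((beta_map b ^^ n) x))"
proof (induction n)
  case 0
  have "step {y \<in> {0..<1}. y \<in> S} g"
    using S(1) unfolding step_def by (auto simp: disjoint_iff)
  then show ?case by simp
next
  case (Suc n)
  have "(beta_map b ^^ n) 0 = 0" by (induction n) auto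
  then have 0: "0 \<in> {y \<in> {0..<1}. (beta_map b ^^ n) y \<in> S}" using S(2) by simp
  have eq: "{y \<in> {0..<1}. beta_map b y \<in> {y \<in> {0..<1}. (beta_map b ^^ n) y \<in> S}} = {y \<in> {0..<1}. (beta_map b ^^ Suc n) y \<in> S}"
    using beta_map_unit[of b] by (auto simp: funpow_Suc_right simp del: funpow.simps)
  show ?case
    using step_beta_map[OF Suc 0] unfolding eq by (simp add: funpow_swap1)
qed

lemma beta_step_count:
  fixes n :: nat
  assumes S: "finite S" "step S g"
  obtains S' where "finite S'" "step S' (\<lambda>x. g ((beta_map b ^^ n) x))"
    "real (card S') <= b ^ n * (b / (b - 1) * real (card S + 1))"
proof -
  define S0 where "S0 = insert 0 S"
  have S0: "step S0 g" "0 \<in> S0" "finite S0" using S by (auto simp: S0_def step_def)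
  define S' where "S' = {y \<in> {0..<1}. (beta_map b ^^ n) y \<in> S0}"
  define A where "A = (\<lambda>z. {y \<in> {0..<1}. (beta_map b ^^ n) y = z})"
  have A: "finite (A z) \<and> real (card (A z)) <= b ^ n * (b / (b - 1))" for z
  proof (cases "z \<in> {0..<1}")
    case True
    have "b ^ n * parry z <= b ^ n * (b / (b - 1))" using parry_le[of z] b1 by (intro mult_left_mono) auto
    then show ?thesis using card_preimage[OF True, of n] by (auto simp: A_def)
  next
    case False
    then have "A z = {}" using beta_map_pow_unit[where b = b and n = n] by (auto simp: A_def)
    then show ?thesis using b1 by simp
  qed
  have eq: "S' = (\<Union>z\<in>S0. A z)" by (auto simp: S'_def A_def)
  have "real (card S') <= real (\<Sum>z\<in>S0. card (A z))"
    unfolding eq using S0 by (intro of_nat_mono card_UN_le) auto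
  also have "... <= (\<Sum>z\<in>S0. b ^ n * (b / (b - 1)))"
    unfolding of_nat_sum using A by (intro sum_mono) auto
  also have "... = b ^ n * (b / (b - 1) * real (card S0))" by simp
  also have "... <= b ^ n * (b / (b - 1) * real (card S + 1))"
    using b1 S by (intro mult_left_mono) (auto simp: S0_def card_insert_if)
  finally have "real (card S') <= b ^ n * (b / (b - 1) * real (card S + 1))" .
  moreover have "finite S'" unfolding eq using S0 A by auto
  moreover have "step S' (\<lambda>x. g ((beta_map b ^^ n) x))"
    unfolding S'_def by (rule step_beta_map_pow[OF S0(1,2)])
  ultimately show thesis by (intro that)
qed

text \<open>A function that decreases away from finitely many points becomes almost decreasing under the
  iterates of the transfer operator, since only the branches hitting these points do harm.\<close>
lemma btr_almost_decreasing:
  assumes "finite S" "\<And>x. 0 <= f x" "\<And>x. f x <= 1" "\<And>x. x \<notin> {0..<1} ==> f x = 0"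
    "\<And>x y. 0 <= x ==> x <= y ==> y < 1 ==> {x..y} \<inter> S = {} ==> f y <= f x"
    "0 <= x" "x <= y" "y < 1"
  shows "(btr ^^ n) f y <= (btr ^^ n) f x + real (card S) / b ^ n"
  using assms
proof (induction n arbitrary: f S)
  case 0
  show ?case
  proof (cases "{x..y} \<inter> S = {}")
    case True
    then show ?thesis using 0(5)[OF 0(6-8)] by simp
  next
    case False
    then have "1 <= card S" using 0(1) by (metis One_nat_def Suc_leI card_gt_0_iff inf_bot_right)
    then show ?thesis using 0(2)[of x] 0(3)[of y] by simp
  qed
next
  case (Suc n)
  define J where "J = nat \<lceil>b\<rceil>"
  define F where "F = (\<lambda>j x. indicator {0..<1} x * f ((x + real j) / b))"
  define R where "R = (\<lambda>j. {t \<in> {0..<1}. (t + real j) / b \<in> S})"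
  have eq: "btr f = (\<lambda>x. (1 / b) * (\<Sum>j<J. F j x))"
    by (rule ext) (simp add: btr_def F_def J_def sum_distrib_left[symmetric])
  have finR: "finite (R j)" for j
  proof (rule finite_subset)
    show "R j \<subseteq> (\<lambda>s. b * s - real j) ` S" using b1 by (auto simp: R_def intro!: image_eqI[of _ _ "(_ + real j) / b"])
  qed (use Suc.prems(1) in auto)
  \<comment> \<open>The inverse branches have disjoint images, so each point of \<open>S\<close> is
    charged to at most one \<open>j\<close>. Therefore the defect is divided by the full factor
    \<open>b\<close> per step, although about \<open>\<lceil>b\<rceil>\<close> branches are
    summed.\<close>
  have cardR: "(\<Sum>j<J. card (R j)) <= card S"
  proof -
    have "(\<Sum>j<J. card (R j)) = card (SIGMA j:{..<J}. R j)"
      using finR by (subst card_SigmaI) auto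
    also have "... <= card S"
    proof (rule card_inj_on_le[where f = "\<lambda>(j, t). (t + real j) / b"])
      show "inj_on (\<lambda>(j, t). (t + real j) / b) (SIGMA j:{..<J}. R j)"
      proof (rule inj_onI, clarify)
        fix i s j t assume "s \<in> R i" "t \<in> R j" and e: "(s + real i) / b = (t + real j) / b"
        then have "0 <= s" "s < 1" "0 <= t" "t < 1" "s + real i = t + real j"
          using b1 by (auto simp: R_def)
        then show "i = j \<and> s = t" by (cases i j rule: linorder_cases) (auto simp: less_iff_Suc_add)
      qed
    qed (use Suc.prems(1) in \<open>auto simp: R_def\<close>)
    finally show ?thesis .
  qed
  then have cardR': "(\<Sum>j<J. real (card (R j))) <= real (card S)"
    by (metis of_nat_le_iff of_nat_sum)
  have step: "(btr ^^ n) (F j) y <= (btr ^^ n) (F j) x + real (card (R j)) / b ^ n" for j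
  proof (rule Suc.IH[OF finR _ _ _ _ Suc.prems(6-8)])
    fix u v :: real assume uv: "0 <= u" "u <= v" "v < 1" "{u..v} \<inter> R j = {}"
    show "F j v <= F j u"
    proof (cases "(v + real j) / b < 1")
      case True
      have "f ((v + real j) / b) <= f ((u + real j) / b)"
      proof (rule Suc.prems(5))
        show "{(u + real j) / b..(v + real j) / b} \<inter> S = {}"
        proof (rule ccontr)
          assume "{(u + real j) / b..(v + real j) / b} \<inter> S \<noteq> {}"
          then obtain s where s: "(u + real j) / b <= s" "s <= (v + real j) / b" "s \<in> S" by auto
          define t where "t = b * s - real j"
          have t: "(t + real j) / b = s" "u <= t" "t <= v" using s b1 by (auto simp: t_def field_simps)
          then show False using uv s(3) by (auto simp: R_def disjoint_iff)
        qed
      qed (use uv True b1 in \<open>auto intro!: divide_right_mono\<close>)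
      then show ?thesis using uv by (simp add: F_def)
    next
      case False
      then have "f ((v + real j) / b) = 0" by (intro Suc.prems(4)) auto
      then show ?thesis using Suc.prems(2) by (simp add: F_def)
    qed
  qed (use Suc.prems(2,3) in \<open>auto simp: F_def indicator_def\<close>)
  have "(btr ^^ Suc n) f y = (1 / b) * (\<Sum>j<J. (btr ^^ n) (F j) y)"
    using btr_pow_sum[of "{..<J}" n "1 / b" F] by (simp add: funpow_Suc_right eq del: funpow.simps)
  also have "... <= (1 / b) * (\<Sum>j<J. (btr ^^ n) (F j) x + real (card (R j)) / b ^ n)"
    using b1 by (intro mult_left_mono sum_mono step) auto
  also have "... = (btr ^^ Suc n) f x + real (\<Sum>j<J. card (R j)) / b ^ Suc n"
    using btr_pow_sum[of "{..<J}" n "1 / b" F]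
    by (simp add: funpow_Suc_right eq sum.distrib sum_divide_distrib[symmetric] add_divide_distrib mult.commute del: funpow.simps)
  also have "... <= (btr ^^ Suc n) f x + real (card S) / b ^ Suc n"
    using cardR' b1 by (intro add_left_mono divide_right_mono) auto
  finally show ?case .
qed

end

section \<open>The Parry measure and the speed of a beta map\<close>

lemma card_le_scaled:
  fixes b :: real
  assumes "1 < b" "0 < d" "0 <= c"
  shows "\<forall>\<^sub>F n in sequentially. b ^ n * c <= exp (real n * (ln b + d))"
proof -
  have "filterlim (\<lambda>n. exp (real n * d)) at_top sequentially"
    using assms by (intro filterlim_compose[OF exp_at_top] filterlim_at_top_mult_tendsto_pos[OF tendsto_const] filterlim_real_sequentially) auto
  then have "\<forall>\<^sub>F n in sequentially. c <= exp (real n * d)" by (simp add: filterlim_at_top)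
  then show ?thesis
  proof eventually_elim
    case (elim n)
    have "b ^ n = exp (real n * ln b)" using assms by (simp add: exp_of_nat_mult)
    then show ?case using elim assms by (simp add: distrib_left exp_add)
  qed
qed

definition parry_measure :: "real => real measure" where
  "parry_measure b = density lam01 (\<lambda>x. ennreal (parry b x / (\<integral>x. parry b x \<partial>lborel)))"

context
  fixes b :: real
  assumes b1: "1 < b"
begin

definition nparry :: "real => real" where
  "nparry x = parry b x / (\<integral>x. parry b x \<partial>lborel)"

lemma integral_parry_ge_1: "1 <= (\<integral>x. parry b x \<partial>lborel)"
proof -
  have "(\<integral>x. indicator {0..<1::real} x \<partial>lborel) <= (\<integral>x. parry b x \<partial>lborel)"
  proof (rule integral_mono)
    show "indicator {0..<1} x <= parry b x" for x
      using parry_ge_1[OF b1, of x] decf_parry[OF b1] by (auto simp: indicator_def decf_def)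
  qed (use unit_bdd_integrable unit_bdd_indicator decf_unit_bdd[OF decf_parry[OF b1]] in blast)+
  then show ?thesis by simp
qed

lemma dens_nparry: "dens (b / (b - 1)) nparry"
  unfolding dens_def
proof (intro conjI)
  have "decf (\<lambda>x. (1 / (\<integral>x. parry b x \<partial>lborel)) * parry b x + 0 * parry b x)"
    using integral_parry_ge_1 by (intro decf_lincomb decf_parry b1) auto
  then show "decf nparry" by (simp add: nparry_def[abs_def])
  show "(\<integral>x. nparry x \<partial>lborel) = 1"
    unfolding nparry_def using integral_parry_ge_1 by simp
  have "nparry 0 <= parry b 0 / 1"
    unfolding nparry_def using integral_parry_ge_1 decf_parry[OF b1] by (intro divide_left_mono) (auto simp: decf_def)
  then show "nparry 0 <= b / (b - 1)" using parry_le[OF b1, of 0] by simp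
qed

lemma unit_bdd_nparry: "unit_bdd nparry"
  using dens_nparry decf_unit_bdd by (auto simp: dens_def)

lemma nparry_pos: "0 <= x ==> x < 1 ==> 0 < nparry x"
  using parry_ge_1[OF b1, of x] integral_parry_ge_1 unfolding nparry_def by (intro divide_pos_pos) auto

lemma nparry_bounds: "0 <= nparry x" "nparry x <= b / (b - 1)"
  using dens_nparry decf_le0[of nparry x] by (auto simp: dens_def decf_def intro: order_trans)

lemma nparry_invariant:
  assumes "borel_fun g" "\<And>x. \<bar>g x\<bar> <= C"
  shows "(\<integral>x. nparry x * g ((beta_map b ^^ n) x) \<partial>lborel) = (\<integral>x. nparry x * g x \<partial>lborel)"
proof -
  have "(btr b ^^ n) (\<lambda>x. (1 / (\<integral>x. parry b x \<partial>lborel)) * parry b x + 0 * parry b x) = nparry"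
    unfolding btr_pow_lincomb[OF b1] btr_pow_parry[OF b1] by (simp add: nparry_def fun_eq_iff)
  then have "(btr b ^^ n) nparry = nparry" by (simp add: nparry_def[abs_def])
  then show ?thesis using btr_pow_duality[OF b1 unit_bdd_nparry assms, of n] by simp
qed

lemma integral_parry_measure:
  assumes [measurable]: "borel_fun g"
  shows "(\<integral>x. g x \<partial>parry_measure b) = (\<integral>x. nparry x * g x \<partial>lborel)"
proof -
  have np [measurable]: "borel_fun nparry" using unit_bdd_nparry by (simp add: unit_bdd_def)
  have "(\<integral>x. g x \<partial>parry_measure b) = (E01 x. nparry x * g x)"
    unfolding parry_measure_def nparry_def[symmetric]
    using nparry_bounds(1) by (subst integral_density) (auto intro!: measurable_lam01I)
  also have "... = (\<integral>x. indicator {0..<1} x * (nparry x * g x) \<partial>lborel)"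
    by (rule integral_lam01_Ico) measurable
  also have "... = (\<integral>x. nparry x * g x \<partial>lborel)"
    using unit_bdd_nparry by (intro Bochner_Integration.integral_cong) (auto simp: unit_bdd_def indicator_def)
  finally show ?thesis .
qed

lemma beta_map_lam01: "beta_map b \<in> measurable lam01 lam01"
  by (rule measurable_lam01_lam01I)
     (use beta_map_unit[of b] in \<open>auto intro: measurable_lam01I less_imp_le\<close>)

lemma beta_integral_lam01:
  fixes \<phi> g :: "real => real"
  assumes [measurable]: "borel_fun \<phi>" "borel_fun g"
  shows "(E01 x. \<phi> x * g ((beta_map b ^^ n) x)) = (\<integral>x. indicator {0..<1} x * \<phi> x * g ((beta_map b ^^ n) x) \<partial>lborel)"
proof -
  have "(E01 x. \<phi> x * g ((beta_map b ^^ n) x)) = (\<integral>x. indicator {0..<1} x * (\<phi> x * g ((beta_map b ^^ n) x)) \<partial>lborel)"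
    by (rule integral_lam01_Ico) measurable
  then show ?thesis by (simp add: mult.assoc)
qed

text \<open>By duality the \<open>n\<close>-th image of Lebesgue measure has the density
  \<open>(btr b ^^ n) (indicator {0..<1})\<close>, which \<open>btr_pow_sup\<close> bounds by
  \<open>b / (b - 1) + 1\<close> for all \<open>n\<close>.\<close>

lemma beta_quasi_invariant:
  assumes u: "fun01 u" "\<forall>x. 0 <= u x \<and> u x <= 2"
  shows "(E01 x. u ((beta_map b ^^ n) x)) <= (b / (b - 1) + 1) * (E01 x. u x)"
proof -
  define v where "v = (\<lambda>x. indicator {0..1} x * u x)"
  have v [measurable]: "borel_fun v" unfolding v_def by (rule measurable_lam01_extend[OF u(1)])
  have vb: "\<bar>v x\<bar> <= 2" "0 <= v x" for x using u(2) by (auto simp: v_def indicator_def)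
  have "(E01 x. u ((beta_map b ^^ n) x)) = (E01 x. 1 * v ((beta_map b ^^ n) x))"
  proof (intro Bochner_Integration.integral_cong)
    fix x assume "x \<in> space lam01"
    then have "(beta_map b ^^ n) x \<in> {0..1}"
      using measurable_space[OF measurable_funpow[OF beta_map_lam01]] by force
    then show "u ((beta_map b ^^ n) x) = 1 * v ((beta_map b ^^ n) x)" by (simp add: v_def)
  qed simp
  also have "... = (\<integral>x. indicator {0..<1} x * v ((beta_map b ^^ n) x) \<partial>lborel)"
    by (subst beta_integral_lam01) auto
  also have "... = (\<integral>x. (btr b ^^ n) (indicator {0..<1}) x * v x \<partial>lborel)"
    by (rule btr_pow_duality[OF b1 unit_bdd_indicator v vb(1), symmetric])
  also have "... <= (\<integral>x. (b / (b - 1) + 1) * (indicator {0..<1} x * v x) \<partial>lborel)"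
  proof (rule integral_mono)
    have d: "decf ((btr b ^^ n) (indicator {0..<1}))" by (rule btr_pow_decf[OF b1 decf_indicator])
    show "integrable lborel (\<lambda>x. (btr b ^^ n) (indicator {0..<1}) x * v x)"
      by (rule unit_bdd_integrable[OF unit_bdd_mult[OF decf_unit_bdd[OF d] v vb(1)]])
    show "integrable lborel (\<lambda>x. (b / (b - 1) + 1) * (indicator {0..<1} x * v x))"
      by (rule unit_bdd_integrable[OF unit_bdd_cmult[OF unit_bdd_mult[OF unit_bdd_indicator v vb(1)]]])
    show "(btr b ^^ n) (indicator {0..<1}) x * v x <= (b / (b - 1) + 1) * (indicator {0..<1} x * v x)" for x
    proof (cases "x \<in> {0..<1}")
      case True
      have "(btr b ^^ n) (indicator {0..<1}) x <= 1 / b ^ n + b / (b - 1)"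
        using decf_le0[OF d, of x] btr_pow_sup[OF b1 decf_indicator, of n] by simp
      also have "... <= b / (b - 1) + 1" using b1 by simp
      finally show ?thesis using True vb(2)[of x] by (simp add: mult_right_mono)
    next
      case False
      then show ?thesis using d by (simp add: decf_def)
    qed
  qed
  also have "... = (b / (b - 1) + 1) * (E01 x. v x)"
    by (subst integral_lam01_Ico) auto
  also have "(E01 x. v x) = (E01 x. u x)"
    by (intro Bochner_Integration.integral_cong) (auto simp: v_def)
  finally show ?thesis .
qed

lemma sets_parry_measure [simp]: "sets (parry_measure b) = sets lam01"
  by (simp add: parry_measure_def)

lemma space_parry_measure [simp]: "space (parry_measure b) = {0..1}"
  by (simp add: parry_measure_def)

lemma nparry_measurable: "borel_fun nparry"
  using unit_bdd_nparry by (simp add: unit_bdd_def)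

lemma prob_space_parry: "prob_space (parry_measure b)"
proof
  have "emeasure (parry_measure b) (space (parry_measure b)) = (\<integral>\<^sup>+x. ennreal (nparry x) * indicator {0..1} x \<partial>lam01)"
    unfolding parry_measure_def nparry_def[symmetric]
    using measurable_lam01I[OF nparry_measurable] sets.top[of lam01] by (subst emeasure_density) auto
  also have "... = (\<integral>\<^sup>+x. ennreal (nparry x) \<partial>lam01)"
    by (intro nn_integral_cong) (auto simp: indicator_def)
  also have "... = ennreal (E01 x. nparry x)"
    using nparry_bounds by (intro nn_integral_eq_integral integrable_lam01_bounded[where B = "b / (b - 1)"] measurable_lam01I nparry_measurable) auto
  also have "(E01 x. nparry x) = (\<integral>x. indicator {0..<1} x * nparry x \<partial>lborel)"
    using nparry_measurable by (intro integral_lam01_Ico) auto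
  also have "... = (\<integral>x. nparry x \<partial>lborel)"
    using unit_bdd_nparry by (intro Bochner_Integration.integral_cong) (auto simp: unit_bdd_def indicator_def)
  finally show "emeasure (parry_measure b) (space (parry_measure b)) = 1"
    using dens_nparry by (simp add: dens_def)
qed

lemma invariant_parry: "invariant_measure (parry_measure b) (beta_map b)"
  unfolding invariant_measure_def
proof
  interpret prob_space "parry_measure b" by (rule prob_space_parry)
  show T: "beta_map b \<in> parry_measure b \<rightarrow>\<^sub>M parry_measure b"
    using beta_map_lam01 by (simp cong: measurable_cong_sets)
  interpret D: prob_space "distr (parry_measure b) (parry_measure b) (beta_map b)"
    by (rule prob_space_distr[OF T])
  show "distr (parry_measure b) (parry_measure b) (beta_map b) = parry_measure b"
  proof (rule measure_eqI)
    fix A assume A': "A \<in> sets (distr (parry_measure b) (parry_measure b) (beta_map b))"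
    then have A: "A \<in> sets (parry_measure b)" "A \<in> sets borel" by (auto simp: sets_lam01_iff)
    have "measure (distr (parry_measure b) (parry_measure b) (beta_map b)) A = (\<integral>x. indicator A x \<partial>distr (parry_measure b) (parry_measure b) (beta_map b))"
      using A' by (simp add: sets_lam01_iff Int_absorb2)
    also have "... = (\<integral>x. indicator A (beta_map b x) \<partial>parry_measure b)"
      by (rule integral_distr[OF T borel_measurable_indicator[OF A(1)]])
    also have "... = (\<integral>x. nparry x * indicator A ((beta_map b ^^ 1) x) \<partial>lborel)"
      using A by (subst integral_parry_measure) (auto intro: measurable_compose[OF beta_map_measurable])
    also have "... = (\<integral>x. nparry x * indicator A x \<partial>lborel)"
      using A by (intro nparry_invariant[where C = 1]) (auto simp: indicator_def)
    also have "... = (\<integral>x. indicator A x \<partial>parry_measure b)"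
      using A by (subst integral_parry_measure) auto
    also have "... = measure (parry_measure b) A" using A by (simp add: sets_lam01_iff Int_absorb2)
    finally show "emeasure (distr (parry_measure b) (parry_measure b) (beta_map b)) A = emeasure (parry_measure b) A"
      by (simp add: emeasure_eq_measure D.emeasure_eq_measure)
  qed simp
qed

lemma nice_beta: "nice (beta_map b) (parry_measure b)"
  unfolding nice_def
proof (intro conjI exI[of _ nparry] exI[of _ "b / (b - 1) + 1"] allI impI)
  show "nparry x <= b / (b - 1) + 1" for x using nparry_bounds(2)[of x] by linarith
  show "parry_measure b = density lam01 (\<lambda>x. ennreal (nparry x))"
    by (simp add: parry_measure_def nparry_def)
qed (auto intro: beta_map_lam01 prob_space_parry invariant_parry nparry_measurable nparry_bounds beta_quasi_invariant)

lemma equiv_parry: "equiv_measure (parry_measure b) lam01"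
  unfolding equiv_measure_def
proof (intro conjI ballI)
  fix A assume "A \<in> sets (parry_measure b)"
  then have A: "A \<in> sets lam01" by simp
  have pos: "AE x in lam01. 0 < nparry x"
    using AE_lam01_neq[of 1] AE_space
    by eventually_elim (auto intro: nparry_pos)
  have m: "fun01 (\<lambda>x. ennreal (nparry x))"
    using measurable_lam01I[OF nparry_measurable] by measurable
  have "emeasure (parry_measure b) A = (\<integral>\<^sup>+x. ennreal (nparry x) * indicator A x \<partial>lam01)"
    unfolding parry_measure_def nparry_def[symmetric] by (rule emeasure_density[OF m A])
  also have "... = 0 \<longleftrightarrow> (AE x in lam01. ennreal (nparry x) * indicator A x = 0)"
    by (rule nn_integral_0_iff_AE[OF borel_measurable_times_ennreal[OF m borel_measurable_indicator[OF A]]])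
  also have "... \<longleftrightarrow> (AE x in lam01. x \<notin> A)"
  proof
    assume "AE x in lam01. ennreal (nparry x) * indicator A x = 0"
    with pos show "AE x in lam01. x \<notin> A"
      by eventually_elim (auto simp: indicator_def split: if_splits)
  next
    assume "AE x in lam01. x \<notin> A"
    then show "AE x in lam01. ennreal (nparry x) * indicator A x = 0"
      by eventually_elim auto
  qed
  also have "... \<longleftrightarrow> emeasure lam01 A = 0"
    using AE_iff_null_sets[OF A] A by (auto simp: null_sets_def)
  finally show "emeasure (parry_measure b) A = 0 \<longleftrightarrow> emeasure lam01 A = 0" .
qed simp

text \<open>Here the composition is itself a step function, so the error is 0; the constant factor
  in front of \<open>b ^ n\<close> is absorbed by \<open>exp (n * d)\<close>.\<close>

lemma slow_beta: "slow (ln b) (beta_map b)"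
  unfolding slow_def
proof (intro allI impI)
  fix g :: "real => real" and S and d e :: real
  assume g: "finite S" "step S g" "borel_fun g" "unit_bounded g" and de: "0 < d" "0 < e"
  have "\<forall>\<^sub>F n in sequentially. b ^ n * (b / (b - 1) * real (card S + 1)) <= exp (real n * (ln b + d))"
    using b1 de by (intro card_le_scaled mult_nonneg_nonneg) auto
  then show "\<forall>\<^sub>F n in sequentially. \<exists>\<phi> S'. finite S' \<and> step S' \<phi> \<and> borel_fun \<phi> \<and> unit_bounded \<phi> \<and>
        real (card S') <= exp (real n * (ln b + d)) \<and> (E01 x. \<bar>\<phi> x - g ((beta_map b ^^ n) x)\<bar>) <= e"
  proof eventually_elim
    case (elim n)
    obtain S' where S': "finite S'" "step S' (\<lambda>x. g ((beta_map b ^^ n) x))"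
      "real (card S') <= b ^ n * (b / (b - 1) * real (card S + 1))"
      using beta_step_count[OF b1 g(1,2)] by blast
    show ?case
      by (rule exI[of _ "\<lambda>x. g ((beta_map b ^^ n) x)"], rule exI[of _ S'])
         (use S' g elim de in \<open>auto intro: measurable_compose[OF beta_map_pow_measurable]\<close>)
  qed
qed

text \<open>Extends \<open>dens_mixing\<close> from probability densities to decreasing functions of
  arbitrary mass, with a rate that depends only on the bound at 0. The factor \<open>C + 3\<close>
  is \<open>C + 2\<close>, a bound for the renormalising factor \<open>a + 1\<close>, plus 1 for the
  uniform density that has to be subtracted again.\<close>

lemma beta_mixing_decreasing:
  "\<exists>\<rho>. \<rho> \<longlonglongrightarrow> 0 \<and> (\<forall>A g n. decf A --> A 0 <= b / (b - 1) + 1 --> borel_fun g --> unit_bounded g -->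
      \<bar>(\<integral>x. A x * g ((beta_map b ^^ n) x) \<partial>lborel) - (\<integral>x. A x \<partial>lborel) * (\<integral>x. g x \<partial>parry_measure b)\<bar> <= \<rho> n)"
proof -
  define C where "C = b / (b - 1)"
  have C: "0 < C" using b1 by (simp add: C_def)
  define K where "K = C + 2"
  have "b / (b - 1) + 1 <= K" by (simp add: K_def C_def)
  then have "\<exists>\<rho>. \<rho> \<longlonglongrightarrow> 0 \<and> (\<forall>n. 0 <= \<rho> n) \<and> (\<forall>f1 f2 g n. dens K f1 --> dens K f2 --> borel_fun g --> unit_bounded g -->
      \<bar>(\<integral>x. f1 x * g ((beta_map b ^^ n) x) \<partial>lborel) - (\<integral>x. f2 x * g ((beta_map b ^^ n) x) \<partial>lborel)\<bar> <= \<rho> n)"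
    by (rule dens_mixing[OF b1]) blast
  then obtain \<rho> where \<rho>1: "\<rho> \<longlonglongrightarrow> 0" "\<forall>n. 0 <= \<rho> n"
    "\<forall>f1 f2 g n. dens K f1 --> dens K f2 --> borel_fun g --> unit_bounded g -->
      \<bar>(\<integral>x. f1 x * g ((beta_map b ^^ n) x) \<partial>lborel) - (\<integral>x. f2 x * g ((beta_map b ^^ n) x) \<partial>lborel)\<bar> <= \<rho> n"
    by blast
  note \<rho> = \<rho>1(1) \<rho>1(2)[rule_format] \<rho>1(3)[THEN spec, THEN spec, THEN spec, THEN spec, THEN mp, THEN mp, THEN mp, THEN mp]
  have np: "dens K nparry" using dens_nparry by (simp add: dens_def K_def C_def)
  have ind: "dens K (indicator {0..<1})" using C by (simp add: dens_def decf_indicator K_def)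
  show ?thesis
  proof (intro exI[of _ "\<lambda>n. (C + 3) * \<rho> n"] conjI allI impI)
    show "(\<lambda>n. (C + 3) * \<rho> n) \<longlonglongrightarrow> 0" using tendsto_mult_right_zero[OF \<rho>(1)] .
    fix A g :: "real => real" and n
    assume A: "decf A" "A 0 <= b / (b - 1) + 1" and g: "borel_fun g" "unit_bounded g"
    define G where "G = (\<lambda>x. g ((beta_map b ^^ n) x))"
    have G: "borel_fun G" "\<And>x. \<bar>G x\<bar> <= 1"
      using g by (auto simp: G_def intro: measurable_compose[OF beta_map_pow_measurable])
    define m where "m = (\<integral>x. g x \<partial>parry_measure b)"
    have m: "(\<integral>x. nparry x * G x \<partial>lborel) = m"
      unfolding G_def m_def using nparry_invariant[of g 1 n] g integral_parry_measure[of g] by simp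
    define a where "a = (\<integral>x. A x \<partial>lborel)"
    have uA: "unit_bdd A" by (rule decf_unit_bdd[OF A(1)])
    have a0: "0 <= a" unfolding a_def using A(1) by (intro integral_nonneg_AE) (auto simp: decf_def)
    have "a <= (\<integral>x. (C + 1) * indicator {0..<1::real} x \<partial>lborel)" unfolding a_def
    proof (rule integral_mono)
      show "A x <= (C + 1) * indicator {0..<1} x" for x
        using decf_le0[OF A(1), of x] A by (auto simp: indicator_def C_def decf_def)
    qed (use unit_bdd_integrable uA unit_bdd_cmult[OF unit_bdd_indicator] in blast)+
    then have aC: "a <= C + 1" by simp
    \<comment> \<open>Dividing \<open>A\<close> by its own mass could violate the bound at 0 if the
      mass is small. Adding the uniform density first makes the denominator at least 1.\<close>
    define f where "f = (\<lambda>x. (1 / (a + 1)) * A x + (1 / (a + 1)) * indicator {0..<1} x)"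
    have iA: "integrable lborel A" "integrable lborel (\<lambda>x. A x * G x)" "integrable lborel (\<lambda>x. indicator {0..<1} x * G x)"
      using unit_bdd_integrable uA unit_bdd_mult[OF uA G] unit_bdd_mult[OF unit_bdd_indicator G] by blast+
    have "dens K f"
      unfolding dens_def
    proof (intro conjI)
      show "decf f" unfolding f_def using a0 by (intro decf_lincomb A decf_indicator) auto
      have "(\<integral>x. f x \<partial>lborel) = (1 / (a + 1)) * a + (1 / (a + 1)) * 1"
        unfolding f_def using iA unit_bdd_integrable[OF unit_bdd_indicator]
        by (subst Bochner_Integration.integral_add) (auto simp: a_def)
      then show "(\<integral>x. f x \<partial>lborel) = 1" using a0 by (simp add: field_simps)
      have "f 0 = (A 0 + 1) / (a + 1)" by (simp add: f_def add_divide_distrib)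
      also have "... <= (A 0 + 1) / 1" using a0 A(1) by (intro divide_left_mono) (auto simp: decf_def)
      also have "... <= K" using A(2) by (simp add: K_def C_def)
      finally show "f 0 <= K" .
    qed
    from \<rho>(3)[OF this np g, of n] have 1: "\<bar>(\<integral>x. f x * G x \<partial>lborel) - m\<bar> <= \<rho> n"
      using m by (simp add: G_def)
    have "(\<integral>x. f x * G x \<partial>lborel) = (\<integral>x. (1 / (a + 1)) * (A x * G x) + (1 / (a + 1)) * (indicator {0..<1} x * G x) \<partial>lborel)"
      by (simp add: f_def algebra_simps)
    also have "... = ((\<integral>x. A x * G x \<partial>lborel) + (\<integral>x. indicator {0..<1} x * G x \<partial>lborel)) / (a + 1)"
      using iA by (subst Bochner_Integration.integral_add) (auto simp: add_divide_distrib)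
    finally have fG: "(a + 1) * (\<integral>x. f x * G x \<partial>lborel) = (\<integral>x. A x * G x \<partial>lborel) + (\<integral>x. indicator {0..<1} x * G x \<partial>lborel)"
      using a0 by simp
    have "(a + 1) * \<bar>(\<integral>x. f x * G x \<partial>lborel) - m\<bar> <= (a + 1) * \<rho> n"
      using 1 a0 by (intro mult_left_mono) auto
    also have "... <= (C + 2) * \<rho> n" using aC \<rho>(2) by (intro mult_right_mono) auto
    finally have "\<bar>(a + 1) * (\<integral>x. f x * G x \<partial>lborel) - (a + 1) * m\<bar> <= (C + 2) * \<rho> n"
      using a0 by (simp add: abs_mult right_diff_distrib[symmetric])
    moreover have "\<bar>(\<integral>x. indicator {0..<1} x * G x \<partial>lborel) - m\<bar> <= \<rho> n"
      using \<rho>(3)[OF ind np g, of n] m by (simp add: G_def)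
    ultimately have "\<bar>(\<integral>x. A x * G x \<partial>lborel) - a * m\<bar> <= (C + 2) * \<rho> n + \<rho> n"
      unfolding fG by (simp add: distrib_right)
    then show "\<bar>(\<integral>x. A x * g ((beta_map b ^^ n) x) \<partial>lborel) - (\<integral>x. A x \<partial>lborel) * (\<integral>x. g x \<partial>parry_measure b)\<bar> <= (C + 3) * \<rho> n"
      by (simp add: G_def a_def m_def algebra_simps)
  qed
qed

text \<open>After \<open>p\<close> steps of the transfer operator the step function is decreasing up
  to \<open>card S / b ^ p\<close>. It is replaced by a truly decreasing function at that distance,
  which the remaining \<open>q\<close> steps mix at the uniform rate.\<close>

lemma equidist_beta_bound:
  "\<exists>\<rho>. \<rho> \<longlonglongrightarrow> 0 \<and> (\<forall>p q \<phi> S g. finite S --> step S \<phi> --> borel_fun \<phi> --> unit_bounded \<phi> -->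
        borel_fun g --> unit_bounded g -->
        \<bar>(E01 x. \<phi> x * g ((beta_map b ^^ (p + q)) x)) - (E01 x. \<phi> x) * (\<integral>x. g x \<partial>parry_measure b)\<bar>
          <= 3 * \<rho> q + 4 * (real (card S) / b ^ p))"
proof -
  from beta_mixing_decreasing obtain \<rho> where \<rho>1: "\<rho> \<longlonglongrightarrow> 0"
    "\<forall>A g n. decf A --> A 0 <= b / (b - 1) + 1 --> borel_fun g --> unit_bounded g -->
      \<bar>(\<integral>x. A x * g ((beta_map b ^^ n) x) \<partial>lborel) - (\<integral>x. A x \<partial>lborel) * (\<integral>x. g x \<partial>parry_measure b)\<bar> <= \<rho> n"
    by blast
  note \<rho> = \<rho>1(2)[THEN spec, THEN spec, THEN spec, THEN mp, THEN mp, THEN mp, THEN mp]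
  show ?thesis
  proof (intro exI[of _ \<rho>] conjI allI impI)
    show "\<rho> \<longlonglongrightarrow> 0" by (rule \<rho>1(1))
    fix p q \<phi> S and g :: "real => real"
    assume S: "finite S" "step S \<phi>" and \<phi>: "borel_fun \<phi>" "unit_bounded \<phi>"
      and g: "borel_fun g" "unit_bounded g"
    define m where "m = (\<integral>x. g x \<partial>parry_measure b)"
    have m1: "\<bar>m\<bar> <= 1"
      unfolding m_def using g by (intro abs_integral_le_1 prob_space_parry)
        (auto simp: parry_measure_def intro: measurable_lam01I)
    define G where "G = (\<lambda>x. g ((beta_map b ^^ q) x))"
    have G: "borel_fun G" "\<And>x. \<bar>G x\<bar> <= 1"
      using g by (auto simp: G_def intro: measurable_compose[OF beta_map_pow_measurable])
    \<comment> \<open>The transfer estimates need values in \<open>[0, 1]\<close>;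
      \<open>\<phi>\<close> is recovered as \<open>2 * f - 1\<close>, which is why the constant
      function is treated in \<open>one\<close>.\<close>
    define f where "f = (\<lambda>x. indicator {0..<1} x * ((\<phi> x + 1) / 2))"
    have f01: "0 <= f x" "f x <= 1" for x
      using \<phi>(2)[rule_format, of x] by (auto simp: f_def indicator_def abs_le_iff)
    have uf: "unit_bdd f"
      unfolding f_def
    proof (rule unit_bdd_restrict)
      show "\<bar>(\<phi> x + 1) / 2\<bar> <= 1" for x using \<phi>(2)[rule_format, of x] by (auto simp: abs_le_iff)
    qed (use \<phi>(1) in measurable)
    define F where "F = (btr b ^^ p) f"
    define \<eta> where "\<eta> = real (card S) / b ^ p"
    have \<eta>: "0 <= \<eta>" using b1 by (simp add: \<eta>_def)
    have uF: "unit_bdd F" unfolding F_def by (rule btr_pow_unit_bdd[OF b1 uf])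
    have dI: "decf ((btr b ^^ p) (indicator {0..<1}))" by (rule btr_pow_decf[OF b1 decf_indicator])
    have Fub: "F x <= b / (b - 1) + 1" for x
    proof -
      have "F x <= (btr b ^^ p) (indicator {0..<1}) x"
        unfolding F_def by (rule btr_pow_mono[OF b1]) (use f01(2) in \<open>simp add: f_def indicator_def abs_le_iff \<phi>(2)[rule_format, unfolded abs_le_iff]\<close>)
      also have "... <= 1 / b ^ p + b / (b - 1)"
        using decf_le0[OF dI, of x] btr_pow_sup[OF b1 decf_indicator, of p] by simp
      also have "... <= b / (b - 1) + 1" using b1 by simp
      finally show ?thesis .
    qed
    have Fnn: "0 <= F x" for x
    proof -
      have "(btr b ^^ p) (\<lambda>_. 0) x <= F x"
        unfolding F_def by (rule btr_pow_mono[OF b1]) (rule f01)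
      moreover have "(btr b ^^ p) (\<lambda>_. 0) x = 0"
        using btr_pow_lincomb[OF b1, of p 0 "\<lambda>_. 0" 0 "\<lambda>_. 0"] by (simp add: fun_eq_iff)
      ultimately show ?thesis by simp
    qed
    have Fdec: "F y <= F x + \<eta>" if "0 <= x" "x <= y" "y < 1" for x y
      unfolding F_def \<eta>_def
    proof (rule btr_almost_decreasing[OF b1 S(1) f01 _ _ that])
      show "f y <= f x" if "0 <= x" "x <= y" "y < 1" "{x..y} \<inter> S = {}" for x y
        using stepD[OF S(2) that] that by (simp add: f_def)
    qed (simp add: f_def)
    \<comment> \<open>The least decreasing majorant of \<open>F\<close> on \<open>[0, 1)\<close>.
      Since \<open>F\<close> never rises by more than \<open>\<eta>\<close>, the majorant exceeds it
      by at most \<open>\<eta>\<close>.\<close>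
    define A where "A = (\<lambda>x. if x \<in> {0..<1} then Sup (F ` {x..<1}) else 0)"
    have bdd: "bdd_above (F ` {x..<1})" for x using Fub by (auto intro!: bdd_aboveI)
    have AF: "F x <= A x" "A x <= F x + \<eta>" if "0 <= x" "x < 1" for x
    proof -
      show "F x <= A x" using that bdd by (auto simp: A_def intro!: cSUP_upper)
      show "A x <= F x + \<eta>" using that Fdec by (auto simp: A_def intro!: cSUP_least)
    qed
    have decA: "decf A"
    proof (rule decfI)
      show "0 <= A x" if "x \<in> {0..<1}" for x using AF(1)[of x] Fnn[of x] that by auto
      show "A y <= A x" if "0 <= x" "x <= y" "y < 1" for x y
        using that bdd by (auto simp: A_def intro!: cSUP_subset_mono)
    qed (auto simp: A_def)
    have A0: "A 0 <= b / (b - 1) + 1" using Fub by (auto simp: A_def intro!: cSUP_least)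
    have uA: "unit_bdd A" by (rule decf_unit_bdd[OF decA])
    have AFb: "\<bar>A x - F x\<bar> <= \<eta> * indicator {0..<1} x" for x
    proof (cases "x \<in> {0..<1}")
      case True
      then show ?thesis using AF[of x] by simp
    next
      case False
      then have "A x = 0" "F x = 0" using decA uF by (auto simp: decf_def unit_bdd_def)
      then show ?thesis using False by simp
    qed
    have iAF: "integrable lborel A" "integrable lborel F" "integrable lborel (\<lambda>x. A x * G x)" "integrable lborel (\<lambda>x. F x * G x)"
      using unit_bdd_integrable uA uF unit_bdd_mult[OF uA G] unit_bdd_mult[OF uF G] by blast+
    have diff: "\<bar>(\<integral>x. A x * H x \<partial>lborel) - (\<integral>x. F x * H x \<partial>lborel)\<bar> <= \<eta>"
      if H: "borel_fun H" "\<And>x. \<bar>H x\<bar> <= 1" for H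
    proof -
      have i: "integrable lborel (\<lambda>x. A x * H x)" "integrable lborel (\<lambda>x. F x * H x)"
        using unit_bdd_integrable unit_bdd_mult[OF uA H] unit_bdd_mult[OF uF H] by blast+
      have "\<bar>(\<integral>x. A x * H x \<partial>lborel) - (\<integral>x. F x * H x \<partial>lborel)\<bar> = \<bar>\<integral>x. A x * H x - F x * H x \<partial>lborel\<bar>"
        using i by simp
      also have "... <= (\<integral>x. \<bar>A x * H x - F x * H x\<bar> \<partial>lborel)" by (rule integral_abs_bound)
      also have "... <= (\<integral>x. \<eta> * indicator {0..<1::real} x \<partial>lborel)"
      proof (rule integral_mono)
        show "\<bar>A x * H x - F x * H x\<bar> <= \<eta> * indicator {0..<1} x" for x
        proof -
          have "\<bar>A x * H x - F x * H x\<bar> = \<bar>A x - F x\<bar> * \<bar>H x\<bar>" by (simp add: abs_mult[symmetric] left_diff_distrib)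
          also have "... <= \<bar>A x - F x\<bar>" using H(2)[of x] by (intro mult_left_le) auto
          finally show ?thesis using AFb[of x] by linarith
        qed
        show "integrable lborel (\<lambda>x. \<bar>A x * H x - F x * H x\<bar>)"
          using i by (intro integrable_abs Bochner_Integration.integrable_diff)
      qed (use unit_bdd_integrable unit_bdd_cmult[OF unit_bdd_indicator] in blast)
      finally show ?thesis by simp
    qed
    have d1: "\<bar>(\<integral>x. A x * G x \<partial>lborel) - (\<integral>x. F x * G x \<partial>lborel)\<bar> <= \<eta>" by (rule diff[OF G])
    have d2: "\<bar>(\<integral>x. A x \<partial>lborel) - (\<integral>x. F x \<partial>lborel)\<bar> <= \<eta>" using diff[of "\<lambda>_. 1"] by simp
    have d3: "\<bar>(\<integral>x. A x \<partial>lborel) * m - (\<integral>x. F x \<partial>lborel) * m\<bar> <= \<eta>"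
    proof -
      have "\<bar>((\<integral>x. A x \<partial>lborel) - (\<integral>x. F x \<partial>lborel)) * m\<bar> <= \<eta> * 1"
        unfolding abs_mult using d2 m1 \<eta> by (intro mult_mono) auto
      then show ?thesis by (simp add: left_diff_distrib)
    qed
    have d4: "\<bar>(\<integral>x. A x * G x \<partial>lborel) - (\<integral>x. A x \<partial>lborel) * m\<bar> <= \<rho> q"
      using \<rho>[OF decA A0 g, of q] by (simp add: G_def m_def)
    have Ff: "(\<integral>x. F x * G x \<partial>lborel) = (\<integral>x. f x * G ((beta_map b ^^ p) x) \<partial>lborel)"
      unfolding F_def by (rule btr_pow_duality[OF b1 uf G])
    have Gpq: "G ((beta_map b ^^ p) x) = g ((beta_map b ^^ (p + q)) x)" for x
      unfolding G_def by (simp add: funpow_add add.commute[of p q])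
    have Ff2: "(\<integral>x. F x \<partial>lborel) = (\<integral>x. f x \<partial>lborel)"
      unfolding F_def by (rule btr_pow_integral[OF b1 uf])
    define Gn where "Gn = (\<lambda>x. g ((beta_map b ^^ (p + q)) x))"
    have Gn: "borel_fun Gn" "\<And>x. \<bar>Gn x\<bar> <= 1"
      using g by (auto simp: Gn_def intro: measurable_compose[OF beta_map_pow_measurable])
    have main: "\<bar>(\<integral>x. f x * Gn x \<partial>lborel) - (\<integral>x. f x \<partial>lborel) * m\<bar> <= \<rho> q + 2 * \<eta>"
      using d1 d3 d4 unfolding Ff Ff2 Gpq Gn_def by linarith
    have one: "\<bar>(\<integral>x. indicator {0..<1} x * Gn x \<partial>lborel) - m\<bar> <= \<rho> q"
    proof -
      have "(btr b ^^ p) (indicator {0..<1}) 0 <= 1 / b ^ p + b / (b - 1)"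
        using btr_pow_sup[OF b1 decf_indicator, of p] by simp
      also have "... <= b / (b - 1) + 1" using b1 by simp
      finally have "\<bar>(\<integral>x. (btr b ^^ p) (indicator {0..<1}) x * G x \<partial>lborel) - (\<integral>x. (btr b ^^ p) (indicator {0..<1}) x \<partial>lborel) * m\<bar> <= \<rho> q"
        using \<rho>[OF dI _ g, of q] unfolding G_def m_def by blast
      moreover have "(\<integral>x. (btr b ^^ p) (indicator {0..<1}) x \<partial>lborel) = 1"
        by (simp add: btr_pow_integral[OF b1 unit_bdd_indicator])
      moreover have "(\<integral>x. (btr b ^^ p) (indicator {0..<1}) x * G x \<partial>lborel) = (\<integral>x. indicator {0..<1} x * Gn x \<partial>lborel)"
        by (simp add: btr_pow_duality[OF b1 unit_bdd_indicator G] Gpq Gn_def)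
      ultimately show ?thesis by simp
    qed
    have u\<phi>: "unit_bdd (\<lambda>x. indicator {0..<1} x * \<phi> x)" using \<phi> by (intro unit_bdd_restrict) auto
    note ints = unit_bdd_integrable[OF uf] unit_bdd_integrable[OF unit_bdd_indicator]
      unit_bdd_integrable[OF unit_bdd_mult[OF uf Gn]] unit_bdd_integrable[OF unit_bdd_mult[OF unit_bdd_indicator Gn]]
    have e1: "(E01 x. \<phi> x * g ((beta_map b ^^ (p + q)) x)) =
       2 * (\<integral>x. f x * Gn x \<partial>lborel) - (\<integral>x. indicator {0..<1} x * Gn x \<partial>lborel)"
    proof -
      have "(E01 x. \<phi> x * g ((beta_map b ^^ (p + q)) x)) = (\<integral>x. 2 * (f x * Gn x) - indicator {0..<1} x * Gn x \<partial>lborel)"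
        using \<phi> g by (subst beta_integral_lam01) (auto intro!: Bochner_Integration.integral_cong simp: f_def Gn_def indicator_def algebra_simps)
      also have "... = 2 * (\<integral>x. f x * Gn x \<partial>lborel) - (\<integral>x. indicator {0..<1} x * Gn x \<partial>lborel)"
        using ints by (subst Bochner_Integration.integral_diff) auto
      finally show ?thesis .
    qed
    have e2: "(E01 x. \<phi> x) = 2 * (\<integral>x. f x \<partial>lborel) - 1"
    proof -
      have "(E01 x. \<phi> x) = (\<integral>x. indicator {0..<1} x * \<phi> x \<partial>lborel)"
        using \<phi> by (intro integral_lam01_Ico) auto
      also have "... = (\<integral>x. 2 * f x - indicator {0..<1} x \<partial>lborel)"
        by (intro Bochner_Integration.integral_cong) (auto simp: f_def indicator_def)
      also have "... = 2 * (\<integral>x. f x \<partial>lborel) - 1"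
        using ints by (subst Bochner_Integration.integral_diff) auto
      finally show ?thesis .
    qed
    have "\<bar>(2 * (\<integral>x. f x * Gn x \<partial>lborel) - (\<integral>x. indicator {0..<1} x * Gn x \<partial>lborel)) - (2 * (\<integral>x. f x \<partial>lborel) - 1) * m\<bar>
       <= 3 * \<rho> q + 4 * \<eta>"
      using main one by (simp add: left_diff_distrib)
    then show "\<bar>(E01 x. \<phi> x * g ((beta_map b ^^ (p + q)) x)) - (E01 x. \<phi> x) * (\<integral>x. g x \<partial>parry_measure b)\<bar>
          <= 3 * \<rho> q + 4 * (real (card S) / b ^ p)"
      unfolding e1 e2 by (simp add: m_def \<eta>_def)
  qed
qed

lemma equidist_beta: "equidist (ln b) (beta_map b) (parry_measure b)"
proof (rule equidistI)
  show "0 < ln b" using b1 by simp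
  fix h' assume h': "0 <= h'" "h' < ln b"
  from equidist_beta_bound obtain \<rho> where \<rho>: "\<rho> \<longlonglongrightarrow> 0"
    and bd: "\<forall>p q \<phi> S g. finite S --> step S \<phi> --> borel_fun \<phi> --> unit_bounded \<phi> -->
        borel_fun g --> unit_bounded g -->
        \<bar>(E01 x. \<phi> x * g ((beta_map b ^^ (p + q)) x)) - (E01 x. \<phi> x) * (\<integral>x. g x \<partial>parry_measure b)\<bar>
          <= 3 * \<rho> q + 4 * (real (card S) / b ^ p)" by blast
  have pow: "4 * (real N / b ^ p) <= 0 + 4 * real N * exp (- real p * h')" for N p
  proof -
    have "b ^ p = exp (real p * ln b)" using b1 by (simp add: exp_of_nat_mult)
    then have "1 / b ^ p = exp (- (real p * ln b))" by (simp add: exp_minus inverse_eq_divide)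
    also have "... <= exp (- real p * h')" using h' by (simp add: mult_left_mono)
    finally have "4 * real N * (1 / b ^ p) <= 4 * real N * exp (- real p * h')" by (intro mult_left_mono) auto
    then show ?thesis by simp
  qed
  show "\<exists>\<rho> \<sigma> K. \<rho> \<longlonglongrightarrow> 0 \<and> \<sigma> \<longlonglongrightarrow> 0 \<and>
      (\<forall>p q \<phi> S g. finite S --> step S \<phi> --> borel_fun \<phi> --> unit_bounded \<phi> -->
        borel_fun g --> unit_bounded g -->
        \<bar>(E01 x. \<phi> x * g ((beta_map b ^^ (p + q)) x)) - (E01 x. \<phi> x) * (\<integral>x. g x \<partial>parry_measure b)\<bar>
          <= \<rho> q + \<sigma> p + K * real (card S) * exp (- real p * h'))"
  proof (rule exI[of _ "\<lambda>q. 3 * \<rho> q"], rule exI[of _ "\<lambda>_. 0"], rule exI[of _ 4], intro conjI allI impI)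
    show "(\<lambda>q. 3 * \<rho> q) \<longlonglongrightarrow> 0" using tendsto_mult_right_zero[OF \<rho>] .
    fix p q \<phi> S and g :: "real => real"
    assume "finite S" "step S \<phi>" "borel_fun \<phi>" "unit_bounded \<phi>" "borel_fun g" "unit_bounded g"
    then have "\<bar>(E01 x. \<phi> x * g ((beta_map b ^^ (p + q)) x)) - (E01 x. \<phi> x) * (\<integral>x. g x \<partial>parry_measure b)\<bar>
          <= 3 * \<rho> q + 4 * (real (card S) / b ^ p)"
      using bd by blast
    then show "\<bar>(E01 x. \<phi> x * g ((beta_map b ^^ (p + q)) x)) - (E01 x. \<phi> x) * (\<integral>x. g x \<partial>parry_measure b)\<bar>
          <= 3 * \<rho> q + 0 + 4 * real (card S) * exp (- real p * h')"
      using pow[of "card S" p] by linarith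
  qed simp
qed

lemma beta_measure_eq_parry: "beta_measure b = parry_measure b"
  by (rule beta_measure_eq[OF equidist_beta _ nice_beta equiv_parry]) (use b1 in simp)

end

section \<open>The Gauss map\<close>

lemma gauss_map_measurable [measurable]: "borel_fun gauss_map"
  unfolding gauss_map_def[abs_def] frac_def by measurable

lemma gauss_map_pow_measurable [measurable]: "borel_fun (gauss_map ^^ n)"
  by (rule measurable_funpow) (rule gauss_map_measurable)

lemma gauss_map_unit: "0 <= gauss_map x" "gauss_map x < 1"
  by (auto simp: gauss_map_def frac_lt_1)

section \<open>Change of variables along the branches of the Gauss map\<close>

lemma nn_integral_inverse_shift:
  fixes F :: "real => ennreal"
  assumes F [measurable]: "borel_fun F" and k: "1 <= (k::nat)"
  shows "(\<integral>\<^sup>+x. F x * indicator {1 / (real k + 1)..1 / real k} x \<partial>lborel) =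
    (\<integral>\<^sup>+u. F (1 / (real k + u)) * ennreal (1 / (real k + u)\<^sup>2) * indicator {0..1} u \<partial>lborel)"
proof -
  \<comment> \<open>The inverse branch \<open>u \<mapsto> 1 / (k + u)\<close> is decreasing. The
    reflection \<open>v = 1 - u\<close> makes it increasing for the substitution and is undone
    afterwards by an affine change of variables.\<close>
  define g where "g = (\<lambda>v. 1 / (real k + 1 - v))"
  define g' where "g' = (\<lambda>v. 1 / (real k + 1 - v)\<^sup>2)"
  have "(\<integral>\<^sup>+x. F x * indicator {g 0..g 1} x \<partial>lborel) = (\<integral>\<^sup>+v. F (g v) * ennreal (g' v) * indicator {0..1} v \<partial>lborel)"
  proof (rule nn_integral_substitution_aux)
    show "(g has_real_derivative g' v) (at v)" if "v \<in> {0..1}" for v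
      unfolding g_def g'_def using that k
      by (auto intro!: derivative_eq_intros simp: power2_eq_square)
    show "continuous_on {0..1} g'"
      unfolding g'_def using k by (intro continuous_intros) auto
  qed (auto simp: g'_def)
  also have "... = ennreal \<bar>- 1\<bar> * (\<integral>\<^sup>+u. F (g (1 + - 1 * u)) * ennreal (g' (1 + - 1 * u)) * indicator {0..1} (1 + - 1 * u) \<partial>lborel)"
    by (rule nn_integral_real_affine) (auto simp: g_def g'_def)
  also have "... = (\<integral>\<^sup>+u. F (1 / (real k + u)) * ennreal (1 / (real k + u)\<^sup>2) * indicator {0..1} u \<partial>lborel)"
    by (simp add: g_def g'_def) (intro nn_integral_cong, auto simp: indicator_def)
  finally show ?thesis by (simp add: g_def)
qed

lemma nn_integral_open_unit:
  fixes F :: "real => ennreal"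
  shows "(\<integral>\<^sup>+x. F x * indicator {0..1} x \<partial>lborel) = (\<integral>\<^sup>+x. F x * indicator {0<..<1} x \<partial>lborel)"
proof (rule nn_integral_cong_AE)
  show "AE x in lborel. F x * indicator {0..1} x = F x * indicator {0<..<1} x"
    using AE_lborel_neq[of 0] AE_lborel_neq[of 1] by eventually_elim (auto simp: indicator_def)
qed

definition gbranch :: "nat => real set" where
  "gbranch k = {x \<in> {0<..<1}. \<lfloor>1 / x\<rfloor> = int k}"

lemma gbranch_measurable [measurable]: "gbranch k \<in> sets borel"
  unfolding gbranch_def by measurable

lemma gauss_map_branch: "x \<in> gbranch k ==> gauss_map x = 1 / x - real k"
  by (auto simp: gbranch_def gauss_map_def frac_def)

lemma nn_integral_gauss_branch:
  fixes W \<psi> :: "real => ennreal"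
  assumes [measurable]: "borel_fun W" "borel_fun \<psi>" and k: "1 <= k"
  shows "(\<integral>\<^sup>+x. W x * \<psi> (gauss_map x) * indicator (gbranch k) x \<partial>lborel) =
    (\<integral>\<^sup>+u. W (1 / (real k + u)) * \<psi> u * ennreal (1 / (real k + u)\<^sup>2) * indicator {0<..<1} u \<partial>lborel)"
proof -
  have "(\<integral>\<^sup>+x. W x * \<psi> (gauss_map x) * indicator (gbranch k) x \<partial>lborel) =
     (\<integral>\<^sup>+x. (W x * \<psi> (1 / x - real k)) * indicator {1 / (real k + 1)..1 / real k} x \<partial>lborel)"
  proof (rule nn_integral_cong_AE)
    show "AE x in lborel. W x * \<psi> (gauss_map x) * indicator (gbranch k) x =
      (W x * \<psi> (1 / x - real k)) * indicator {1 / (real k + 1)..1 / real k} x"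
      using AE_lborel_neq[of "1 / (real k + 1)"] AE_lborel_neq[of 1]
    proof eventually_elim
      case (elim x)
      have "x \<in> gbranch k \<longleftrightarrow> x \<in> {1 / (real k + 1)..1 / real k}"
      proof
        assume x: "x \<in> gbranch k"
        then have "0 < x" "real k <= 1 / x" "1 / x < real k + 1"
          by (auto simp: gbranch_def floor_eq_iff)
        then show "x \<in> {1 / (real k + 1)..1 / real k}" using k by (auto simp: field_simps)
      next
        assume x: "x \<in> {1 / (real k + 1)..1 / real k}"
        have "0 < 1 / (real k + 1)" by simp
        then have x0: "0 < x" using x by (meson atLeastAtMost_iff less_le_trans)
        have "1 / real k <= 1" using k by simp
        then have "x < 1" using x elim by auto
        moreover have "real k <= 1 / x" "1 / x < real k + 1"
          using x x0 k elim by (auto simp: field_simps)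
        ultimately show "x \<in> gbranch k" using x0 by (auto simp: gbranch_def floor_eq_iff)
      qed
      then show ?case using gauss_map_branch[of x k] by (auto simp: indicator_def)
    qed
  qed
  also have "... = (\<integral>\<^sup>+u. (W (1 / (real k + u)) * \<psi> (1 / (1 / (real k + u)) - real k)) * ennreal (1 / (real k + u)\<^sup>2) * indicator {0..1} u \<partial>lborel)"
    using k by (intro nn_integral_inverse_shift) auto
  also have "... = (\<integral>\<^sup>+u. (W (1 / (real k + u)) * \<psi> u * ennreal (1 / (real k + u)\<^sup>2)) * indicator {0..1} u \<partial>lborel)"
    by (intro nn_integral_cong) simp
  finally show ?thesis by (simp add: nn_integral_open_unit)
qed

lemma gbranch_UN: "(\<Union>k. gbranch (Suc k)) = {0<..<1}"
proof (intro set_eqI iffI)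
  fix x :: real assume x: "x \<in> {0<..<1}"
  then have "1 <= 1 / x" by auto
  then have "1 <= \<lfloor>1 / x\<rfloor>" by linarith
  then have "x \<in> gbranch (Suc (nat (\<lfloor>1 / x\<rfloor> - 1)))" using x by (simp add: gbranch_def)
  then show "x \<in> (\<Union>k. gbranch (Suc k))" by blast
qed (auto simp: gbranch_def)

lemma gbranch_disjoint: "disjoint_family (\<lambda>k. gbranch (Suc k))"
  by (auto simp: disjoint_family_on_def gbranch_def)

lemma nn_integral_gauss_sum:
  fixes W \<psi> :: "real => ennreal"
  assumes [measurable]: "borel_fun W" "borel_fun \<psi>"
  shows "(\<integral>\<^sup>+x. W x * \<psi> (gauss_map x) * indicator {0<..<1} x \<partial>lborel) =
    (\<integral>\<^sup>+u. (\<Sum>k. W (1 / (real (Suc k) + u)) * ennreal (1 / (real (Suc k) + u)\<^sup>2)) * \<psi> u * indicator {0<..<1} u \<partial>lborel)"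
proof -
  have "(\<integral>\<^sup>+x. W x * \<psi> (gauss_map x) * indicator {0<..<1} x \<partial>lborel) =
    (\<integral>\<^sup>+x. (\<Sum>k. W x * \<psi> (gauss_map x) * indicator (gbranch (Suc k)) x) \<partial>lborel)"
    unfolding ennreal_suminf_cmult suminf_indicator[OF gbranch_disjoint] gbranch_UN ..
  also have "... = (\<Sum>k. \<integral>\<^sup>+x. W x * \<psi> (gauss_map x) * indicator (gbranch (Suc k)) x \<partial>lborel)"
    by (intro nn_integral_suminf) measurable
  also have "... = (\<Sum>k. \<integral>\<^sup>+u. W (1 / (real (Suc k) + u)) * \<psi> u * ennreal (1 / (real (Suc k) + u)\<^sup>2) * indicator {0<..<1} u \<partial>lborel)"
    by (intro suminf_cong nn_integral_gauss_branch) auto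
  also have "... = (\<integral>\<^sup>+u. (\<Sum>k. W (1 / (real (Suc k) + u)) * \<psi> u * ennreal (1 / (real (Suc k) + u)\<^sup>2) * indicator {0<..<1} u) \<partial>lborel)"
    by (intro nn_integral_suminf[symmetric]) measurable
  also have "... = (\<integral>\<^sup>+u. (\<Sum>k. W (1 / (real (Suc k) + u)) * ennreal (1 / (real (Suc k) + u)\<^sup>2) * (\<psi> u * indicator {0<..<1} u)) \<partial>lborel)"
    by (simp only: mult_ac)
  finally show ?thesis unfolding ennreal_suminf_multc by (simp only: mult.assoc)
qed

section \<open>The normalised transfer operator of the Gauss map\<close>

definition gp :: "nat => real => real" where
  "gp k x = (x + 1) / ((x + real (Suc k)) * (x + real (Suc (Suc k))))"

text \<open>This transfer operator is taken with respect to the Gauss measure, not Lebesgue measure.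
  Its weights \<open>gp k x\<close> form a probability distribution in \<open>k\<close>
  (\<open>gp_sums\<close>), so constants are fixed and bounds are preserved; \<open>k\<close>
  belongs to the branch with digit \<open>Suc k\<close>.\<close>

definition gtr :: "(real => real) => real => real" where
  "gtr f x = (if 0 <= x \<and> x <= 1 then \<Sum>k. gp k x * f (1 / (x + real (Suc k))) else 0)"

definition gdens :: "real => real" where
  "gdens x = 1 / (ln 2 * (1 + x))"

lemma gp_nonneg: "0 <= x ==> 0 <= gp k x"
  by (simp add: gp_def)

lemma gp_diff: "0 <= x ==> gp k x = (x + 1) / (x + real (Suc k)) - (x + 1) / (x + real (Suc (Suc k)))"
  by (simp add: gp_def divide_simps) (simp add: algebra_simps)

lemma gp_tail_lim: "(\<lambda>k. (x + 1) / (x + real (Suc k))) \<longlonglongrightarrow> 0"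
  by real_asymp

lemma gp_sums:
  assumes "0 <= x" shows "(\<lambda>k. gp k x) sums 1"
proof -
  have "(\<lambda>k. (x + 1) / (x + real (Suc k)) - (x + 1) / (x + real (Suc (Suc k)))) sums ((x + 1) / (x + real (Suc 0)) - 0)"
    by (rule telescope_sums'[OF gp_tail_lim])
  then show ?thesis using assms by (simp add: gp_diff[OF assms])
qed

definition ubnd :: "real => (real => real) => bool" where
  "ubnd B f \<longleftrightarrow> f \<in> borel_measurable borel \<and> (\<forall>x. 0 <= f x \<and> f x <= B)"

lemma ubndD: "ubnd B f ==> borel_fun f" "ubnd B f ==> 0 <= f x" "ubnd B f ==> f x <= B" "ubnd B f ==> 0 <= B"
  by (auto simp: ubnd_def intro: order_trans)

lemma gtr_summable:
  assumes "ubnd B f" "0 <= x"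
  shows "summable (\<lambda>k. gp k x * f (1 / (x + real (Suc k))))"
proof (rule summable_comparison_test)
  show "summable (\<lambda>k. gp k x * B)"
    using gp_sums[OF assms(2)] by (intro summable_mult2) (simp add: sums_iff)
  show "\<exists>N. \<forall>n\<ge>N. norm (gp n x * f (1 / (x + real (Suc n)))) <= gp n x * B"
    using ubndD[OF assms(1)] gp_nonneg[OF assms(2)] by (intro exI[of _ 0]) (auto simp: abs_mult intro!: mult_left_mono)
qed

lemma gtr_sums:
  assumes "ubnd B f" "0 <= x" "x <= 1"
  shows "(\<lambda>k. gp k x * f (1 / (x + real (Suc k)))) sums gtr f x"
  using summable_sums[OF gtr_summable[OF assms(1,2)]] assms by (simp add: gtr_def)

lemma gtr_ubnd:
  assumes f: "ubnd B f" shows "ubnd B (gtr f)"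
  unfolding ubnd_def
proof (intro conjI allI)
  have [measurable]: "borel_fun f" by (rule ubndD(1)[OF f])
  show "gtr f \<in> borel_measurable borel"
    unfolding gtr_def[abs_def] gp_def by measurable
  fix x
  show "0 <= gtr f x"
    unfolding gtr_def using ubndD[OF f] gp_nonneg gtr_summable[OF f] by (auto intro!: suminf_nonneg)
  show "gtr f x <= B"
  proof (cases "0 <= x \<and> x <= 1")
    case True
    have "gtr f x <= 1 * B"
    proof (rule sums_le)
      show "(\<lambda>k. gp k x * f (1 / (x + real (Suc k)))) sums gtr f x" using True by (intro gtr_sums[OF f]) auto
      show "(\<lambda>k. gp k x * B) sums (1 * B)" using True by (intro sums_mult2 gp_sums) auto
      show "gp k x * f (1 / (x + real (Suc k))) <= gp k x * B" for k
        using True gp_nonneg[of x k] ubndD(3)[OF f] by (intro mult_left_mono) auto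
    qed
    then show ?thesis by simp
  next
    case False
    then show ?thesis using ubndD(4)[OF f] by (auto simp: gtr_def)
  qed
qed

lemma gtr_pow_ubnd: "ubnd B f ==> ubnd B ((gtr ^^ n) f)"
  by (induction n) (auto intro: gtr_ubnd)

lemma gtr_lincomb:
  assumes "ubnd B f" "ubnd C g" "0 <= x" "x <= 1"
  shows "gtr (\<lambda>x. c * f x + d * g x) x = c * gtr f x + d * gtr g x"
proof -
  have "(\<lambda>k. c * (gp k x * f (1 / (x + real (Suc k)))) + d * (gp k x * g (1 / (x + real (Suc k))))) sums (c * gtr f x + d * gtr g x)"
    by (intro sums_add sums_mult gtr_sums[OF assms(1)] gtr_sums[OF assms(2)] assms)
  then show ?thesis using assms by (simp add: gtr_def sums_iff algebra_simps)
qed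

text \<open>The weights \<open>gp k x\<close> give \<open>k \<ge> j\<close> the total mass \<open>(x + 1) / (x + j + 1)\<close>, which increases with \<open>x\<close>.\<close>
lemma gtr_mono:
  assumes f: "ubnd B f" and inc: "\<And>x y. 0 <= x ==> x <= y ==> y <= 1 ==> f x <= f y"
    and xy: "0 <= x" "x <= y" "y <= 1"
  shows "gtr f y <= gtr f x"
proof -
  define a where "a = (\<lambda>k. f (1 / (x + real (Suc k))))"
  define q where "q = (\<lambda>x k. (x + 1) / (x + real (Suc k)))"
  define D where "D = (\<lambda>k. q y k - q x k)"
  have a_dec: "a (Suc k) <= a k" for k
    unfolding a_def using xy by (intro inc) (auto simp: field_simps)
  have a_nn: "0 <= a k" for k unfolding a_def by (rule ubndD(2)[OF f])
  have D_nn: "0 <= D k" for k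
  proof -
    have "(x + 1) * (y + real (Suc k)) <= (y + 1) * (x + real (Suc k))"
      using xy mult_right_mono[of x y "real k"] by (simp add: algebra_simps)
    then show ?thesis using xy by (simp add: D_def q_def divide_simps)
  qed
  have D0: "D 0 = 0" using xy by (simp add: D_def q_def)
  have part: "(\<Sum>k<N. (D k - D (Suc k)) * a k) <= - D N * a N" for N
  proof (induction N)
    case (Suc N)
    have "D (Suc N) * a (Suc N) <= D (Suc N) * a N" by (rule mult_left_mono[OF a_dec D_nn])
    then show ?case using Suc by (simp add: algebra_simps)
  qed (simp add: D0)
  have gpq: "gp k z = q z k - q z (Suc k)" if "0 <= z" for k z
    using gp_diff[OF that, of k] by (simp add: q_def)
  have s1: "summable (\<lambda>k. gp k y * a k)"
  proof (rule summable_comparison_test)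
    show "summable (\<lambda>k. gp k y * B)"
      using gp_sums[of y] xy by (intro summable_mult2) (simp add: sums_iff)
    show "\<exists>N. \<forall>n\<ge>N. norm (gp n y * a n) <= gp n y * B"
      using ubndD[OF f] gp_nonneg[of y] xy a_nn by (intro exI[of _ 0]) (auto simp: abs_mult a_def intro!: mult_left_mono)
  qed
  have sx: "(\<lambda>k. gp k x * a k) sums gtr f x"
    using gtr_sums[OF f, of x] xy by (simp add: a_def)
  have "gtr f y <= (\<Sum>k. gp k y * a k)"
  proof (rule sums_le[OF _ gtr_sums[OF f] summable_sums[OF s1]])
    show "gp k y * f (1 / (y + real (Suc k))) <= gp k y * a k" for k
      unfolding a_def using xy gp_nonneg[of y] by (intro mult_left_mono inc) (auto simp: field_simps)
  qed (use xy in auto)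
  also have "(\<Sum>k. gp k y * a k) <= gtr f x"
  proof -
    have "(\<lambda>k. gp k y * a k - gp k x * a k) sums ((\<Sum>k. gp k y * a k) - gtr f x)"
      by (intro sums_diff summable_sums s1 sx)
    then have "(\<lambda>N. \<Sum>k<N. gp k y * a k - gp k x * a k) \<longlonglongrightarrow> ((\<Sum>k. gp k y * a k) - gtr f x)"
      by (simp add: sums_def)
    moreover have "(\<Sum>k<N. gp k y * a k - gp k x * a k) <= 0" for N
    proof -
      have "(\<Sum>k<N. gp k y * a k - gp k x * a k) = (\<Sum>k<N. (D k - D (Suc k)) * a k)"
        using xy by (intro sum.cong) (auto simp: gpq D_def algebra_simps)
      also have "... <= - D N * a N" by (rule part)
      also have "... <= 0" using D_nn[of N] a_nn[of N] by simp
      finally show ?thesis .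
    qed
    ultimately have "(\<Sum>k. gp k y * a k) - gtr f x <= 0"
      by (intro LIMSEQ_le_const2) auto
    then show ?thesis by simp
  qed
  finally show ?thesis .
qed

text \<open>Since \<open>gp k 1 = 2 * gp (k + 1) 0\<close> and both terms evaluate \<open>f\<close>
  at \<open>1 / (k + 2)\<close>, the two end values satisfy
  \<open>gtr f 1 = 2 * gtr f 0 - f 1\<close>. The difference is therefore
  \<open>f 1 - gtr f 0\<close>, and \<open>gtr f 0\<close> is at least the mean of
  \<open>f 0\<close> and \<open>f 1\<close> because the first weight at 0 is 1/2.\<close>

lemma gtr_osc:
  assumes f: "ubnd B f" and inc: "\<And>x y. 0 <= x ==> x <= y ==> y <= 1 ==> f x <= f y"
  shows "gtr f 0 - gtr f 1 <= (f 1 - f 0) / 2"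
proof -
  define a where "a = (\<lambda>k. gp k 0 * f (1 / real (Suc k)))"
  have "a sums (gtr f 0 - a 0 + a 0)" using gtr_sums[OF f, of 0] by (simp only: a_def) simp
  then have "(\<lambda>k. a (Suc k)) sums (gtr f 0 - a 0)" by (simp only: sums_Suc_iff)
  moreover have "a 0 = f 1 / 2" by (simp add: a_def gp_def)
  ultimately have s0': "(\<lambda>k. a (Suc k)) sums (gtr f 0 - f 1 / 2)" by simp
  have eq: "gp k 1 * f (1 / (1 + real (Suc k))) = 2 * a (Suc k)" for k
  proof -
    have "gp k 1 = 2 * gp (Suc k) 0" by (simp add: gp_def)
    moreover have "1 + real (Suc k) = real (Suc (Suc k))" by simp
    ultimately show ?thesis unfolding a_def by (simp only: mult.assoc)
  qed
  have s1: "(\<lambda>k. 2 * a (Suc k)) sums gtr f 1"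
    unfolding eq[symmetric] by (rule gtr_sums[OF f]) auto
  from sums_unique2[OF s1 sums_mult[OF s0', of 2]] have "gtr f 1 = 2 * (gtr f 0 - f 1 / 2)" .
  moreover have "f 0 / 2 <= gtr f 0 - f 1 / 2"
  proof -
    have "(\<lambda>k. gp k 0) sums 1" by (rule gp_sums) simp
    moreover have "1 = 1 / 2 + gp 0 0" by (simp add: gp_def)
    ultimately have "(\<lambda>k. gp k 0) sums (1 / 2 + gp 0 0)" by (simp only:)
    then have "(\<lambda>k. gp (Suc k) 0) sums (1 / 2)" by (rule sums_Suc_iff[of "\<lambda>k. gp k 0", THEN iffD2])
    from sums_mult2[OF this, of "f 0"] have *: "(\<lambda>k. gp (Suc k) 0 * f 0) sums (1 / 2 * f 0)" .
    have "gp (Suc k) 0 * f 0 <= gp (Suc k) 0 * f (1 / real (Suc (Suc k)))" for k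
    proof (rule mult_left_mono)
      show "f 0 <= f (1 / real (Suc (Suc k)))" by (rule inc) auto
    qed (simp add: gp_nonneg)
    then have "gp (Suc k) 0 * f 0 <= a (Suc k)" for k by (simp only: a_def)
    from sums_le[OF this * s0'] show ?thesis by simp
  qed
  ultimately show ?thesis by simp
qed

definition monob :: "real => (real => real) => bool" where
  "monob d f \<longleftrightarrow> ((\<forall>x y. 0 <= x --> x <= y --> y <= 1 --> f x <= f y) \<or> (\<forall>x y. 0 <= x --> x <= y --> y <= 1 --> f y <= f x))
     \<and> \<bar>f 1 - f 0\<bar> <= d"

lemma gtr_monob:
  assumes f: "ubnd B f" "monob d f" shows "monob (d / 2) (gtr f)"
proof -
  consider "\<And>x y. 0 <= x ==> x <= y ==> y <= 1 ==> f x <= f y" | "\<And>x y. 0 <= x ==> x <= y ==> y <= 1 ==> f y <= f x"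
    using f(2) unfolding monob_def by blast
  then show ?thesis
  proof cases
    case 1
    have "gtr f 1 <= gtr f 0" by (rule gtr_mono[OF f(1) 1]) auto
    then have "\<bar>gtr f 1 - gtr f 0\<bar> <= d / 2"
      using gtr_osc[OF f(1) 1] f(2) by (simp add: monob_def)
    then show ?thesis using gtr_mono[OF f(1) 1] unfolding monob_def by blast
  next
    case 2
    have one: "ubnd 1 (\<lambda>_. 1)" by (simp add: ubnd_def)
    \<comment> \<open>The decreasing case is reduced to the increasing one by \<open>B - f\<close>,
      which is again nonnegative; since \<open>gtr\<close> fixes constants, the image is
      \<open>B - gtr f\<close>.\<close>
    have g: "ubnd B (\<lambda>x. B * 1 + (-1) * f x)" using f(1) by (auto simp: ubnd_def)
    have inc: "\<And>x y. 0 <= x ==> x <= y ==> y <= 1 ==> B * 1 + (-1) * f x <= B * 1 + (-1) * f y" using 2 by simp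
    have one1: "gtr (\<lambda>_. 1) x = 1" if "0 <= x" "x <= 1" for x
      using gp_sums[of x] that by (simp add: gtr_def sums_iff)
    have eq: "gtr (\<lambda>x. B * 1 + (-1) * f x) x = B - gtr f x" if "0 <= x" "x <= 1" for x
      using gtr_lincomb[OF one f(1) that, of B "-1"] one1[OF that] by simp
    have m: "gtr f x <= gtr f y" if "0 <= x" "x <= y" "y <= 1" for x y
      using gtr_mono[OF g inc that] that eq[of x] eq[of y] by simp
    have "\<bar>gtr f 1 - gtr f 0\<bar> <= d / 2"
      using gtr_osc[OF g inc] f(2) m[of 0 1] eq[of 0] eq[of 1] by (simp add: monob_def)
    then show ?thesis using m unfolding monob_def by blast
  qed
qed

lemma gtr_pow_monob:
  assumes f: "ubnd B f" "monob d f" shows "monob (d / 2 ^ n) ((gtr ^^ n) f)"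
proof (induction n)
  case (Suc n)
  from gtr_monob[OF gtr_pow_ubnd[OF f(1)] Suc] show ?case by (simp add: mult.commute)
qed (use f in simp)

lemma monob_diff:
  assumes "monob d f" "0 <= x" "x <= 1" "0 <= y" "y <= 1" shows "\<bar>f x - f y\<bar> <= d"
proof -
  have "\<bar>f x - f y\<bar> <= \<bar>f 1 - f 0\<bar>"
  proof -
    consider "\<forall>x y. 0 <= x --> x <= y --> y <= 1 --> f x <= f y" | "\<forall>x y. 0 <= x --> x <= y --> y <= 1 --> f y <= f x"
      using assms(1) unfolding monob_def by blast
    then show ?thesis
    proof cases
      case 1
      then have "f 0 <= f x" "f x <= f 1" "f 0 <= f y" "f y <= f 1" using assms by auto
      then show ?thesis by linarith
    next
      case 2
      then have "f x <= f 0" "f 1 <= f x" "f y <= f 0" "f 1 <= f y" using assms by auto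
      then show ?thesis by linarith
    qed
  qed
  then show ?thesis using assms(1) by (simp add: monob_def)
qed

section \<open>The Gauss measure: duality, mixing, invariance\<close>

lemma gdens_pos: "0 <= x ==> 0 < gdens x"
  by (simp add: gdens_def)

lemma gdens_measurable [measurable]: "borel_fun gdens"
  unfolding gdens_def[abs_def] by measurable

lemma gauss_measure_gdens: "muG = density lam01 (\<lambda>x. ennreal (gdens x))"
  by (simp add: gauss_measure_def gdens_def)

lemma sets_gauss_measure [simp]: "sets muG = sets lam01"
  by (simp add: gauss_measure_def)

lemma space_gauss_measure [simp]: "space muG = {0..1}"
  by (simp add: gauss_measure_def)

lemma nn_integral_gauss_measure:
  assumes [measurable]: "borel_fun F"
  shows "(\<integral>\<^sup>+x. F x \<partial>muG) = (\<integral>\<^sup>+x. F x * ennreal (gdens x) * indicator {0<..<1} x \<partial>lborel)"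
proof -
  have "(\<integral>\<^sup>+x. F x \<partial>muG) = (\<integral>\<^sup>+x. ennreal (gdens x) * F x \<partial>lam01)"
    unfolding gauss_measure_gdens by (rule nn_integral_density) (auto simp: measurable_lam01_cong intro!: measurable_restrict_space1)
  also have "... = (\<integral>\<^sup>+x. (F x * ennreal (gdens x)) * indicator {0..1} x \<partial>lborel)"
    unfolding lam01_def by (subst nn_integral_restrict_space) (auto simp: mult_ac)
  finally show ?thesis by (simp add: nn_integral_open_unit)
qed

lemma nn_gauss_duality:
  assumes f: "ubnd B f" and \<psi> [measurable]: "borel_fun \<psi>"
  shows "(\<integral>\<^sup>+x. ennreal (f x) * \<psi> (gauss_map x) \<partial>muG) = (\<integral>\<^sup>+x. ennreal (gtr f x) * \<psi> x \<partial>muG)"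
proof -
  have [measurable]: "borel_fun f" "gtr f \<in> borel_measurable borel"
    using f gtr_ubnd[OF f] ubndD(1) by auto
  have "(\<integral>\<^sup>+x. ennreal (f x) * \<psi> (gauss_map x) \<partial>muG) =
    (\<integral>\<^sup>+x. (ennreal (f x) * ennreal (gdens x)) * \<psi> (gauss_map x) * indicator {0<..<1} x \<partial>lborel)"
    by (subst nn_integral_gauss_measure) (auto simp: mult_ac)
  also have "... = (\<integral>\<^sup>+u. (\<Sum>k. ennreal (f (1 / (real (Suc k) + u))) * ennreal (gdens (1 / (real (Suc k) + u))) * ennreal (1 / (real (Suc k) + u)\<^sup>2)) * \<psi> u * indicator {0<..<1} u \<partial>lborel)"
    by (rule nn_integral_gauss_sum) measurable
  also have "... = (\<integral>\<^sup>+u. ennreal (gtr f u) * \<psi> u * ennreal (gdens u) * indicator {0<..<1} u \<partial>lborel)"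
  proof (intro nn_integral_cong)
    fix u :: real
    show "(\<Sum>k. ennreal (f (1 / (real (Suc k) + u))) * ennreal (gdens (1 / (real (Suc k) + u))) * ennreal (1 / (real (Suc k) + u)\<^sup>2)) * \<psi> u * indicator {0<..<1} u
      = ennreal (gtr f u) * \<psi> u * ennreal (gdens u) * indicator {0<..<1} u"
    proof (cases "u \<in> {0<..<1}")
      case True
      then have u: "0 <= u" "u <= 1" "0 < u" by auto
      have tm: "ennreal (f (1 / (real (Suc k) + u))) * ennreal (gdens (1 / (real (Suc k) + u))) * ennreal (1 / (real (Suc k) + u)\<^sup>2)
        = ennreal (gp k u * f (1 / (u + real (Suc k))) * gdens u)" for k
      proof -
        define K where "K = real (Suc k)"
        have K: "K \<ge> 1" by (simp add: K_def)
        \<comment> \<open>The origin of the weights \<open>gp\<close>: Jacobian of the inverse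
          branch times Gauss density at its value, relative to the Gauss density at
          \<open>u\<close>.\<close>
        have e: "gdens (1 / (K + u)) * (1 / (K + u)\<^sup>2) = gp k u * gdens u"
          using u K unfolding gdens_def gp_def of_nat_Suc[of "Suc k"] K_def[symmetric]
          by (simp add: divide_simps power2_eq_square) (simp add: algebra_simps)
        have "ennreal (f (1 / (K + u))) * ennreal (gdens (1 / (K + u))) * ennreal (1 / (K + u)\<^sup>2)
           = ennreal (f (1 / (K + u)) * gdens (1 / (K + u)) * (1 / (K + u)\<^sup>2))"
          using ubndD(2)[OF f] gdens_pos[of "1 / (K + u)"] u K by (simp add: ennreal_mult'[symmetric] less_imp_le)
        also have "f (1 / (K + u)) * gdens (1 / (K + u)) * (1 / (K + u)\<^sup>2) = gp k u * f (1 / (u + K)) * gdens u"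
          unfolding mult.assoc e by (simp add: add.commute)
        finally show ?thesis by (simp add: K_def)
      qed
      have s: "(\<lambda>k. gp k u * f (1 / (u + real (Suc k))) * gdens u) sums (gtr f u * gdens u)"
        by (intro sums_mult2 gtr_sums[OF f]) (use u in auto)
      have "(\<Sum>k. ennreal (gp k u * f (1 / (u + real (Suc k))) * gdens u)) = ennreal (gtr f u * gdens u)"
        using s u ubndD(2)[OF f] gp_nonneg gdens_pos[of u]
        by (subst suminf_ennreal2) (auto simp: sums_iff less_imp_le intro!: mult_nonneg_nonneg)
      also have "... = ennreal (gtr f u) * ennreal (gdens u)"
        using ubndD(2)[OF gtr_ubnd[OF f]] by (simp add: ennreal_mult')
      finally show ?thesis unfolding tm by (simp add: mult_ac)
    qed simp
  qed
  also have "... = (\<integral>\<^sup>+x. ennreal (gtr f x) * \<psi> x \<partial>muG)"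
    by (subst nn_integral_gauss_measure) (auto simp: mult_ac)
  finally show ?thesis .
qed

lemma measurable_gaussI: "f \<in> borel_measurable borel ==> f \<in> borel_measurable muG"
  using measurable_lam01I by (simp cong: measurable_cong_sets)

lemma prob_space_gauss: "prob_space muG"
proof
  have "emeasure muG (space muG) = (\<integral>\<^sup>+x. 1 \<partial>muG)" by simp
  also have "... = (\<integral>\<^sup>+x. ennreal (gdens x) * indicator {0<..<1} x \<partial>lborel)"
    by (subst nn_integral_gauss_measure) auto
  also have "... = (\<integral>\<^sup>+x. ennreal (gdens x) * indicator {0..1} x \<partial>lborel)"
    by (rule nn_integral_open_unit[symmetric])
  also have "... = ennreal (ln (1 + 1) / ln 2 - ln (1 + 0) / ln 2)"
  proof (rule nn_integral_FTC_Icc)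
    show "((\<lambda>x. ln (1 + x) / ln 2) has_real_derivative gdens x) (at x)" if "x \<in> {0..1}" for x
    proof -
      have "((\<lambda>x. ln (1 + x) / ln 2) has_real_derivative (1 / (1 + x)) / ln 2) (at x)"
        using that by (auto intro!: derivative_eq_intros)
      then show ?thesis
        by (simp add: gdens_def mult.commute)
    qed
  qed (auto simp: less_imp_le[OF gdens_pos])
  finally show "emeasure muG (space muG) = 1" by simp
qed

interpretation gauss: prob_space muG by (rule prob_space_gauss)

lemma integrable_gauss_bounded:
  fixes f :: "real => real"
  assumes "borel_fun f" "\<And>x. \<bar>f x\<bar> <= B"
  shows "integrable muG f"
  by (rule gauss.integrable_const_bound[where B = B]) (use assms in \<open>auto intro: measurable_gaussI\<close>)

lemma gauss_duality:
  fixes \<phi> :: "real => real"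
  assumes f: "ubnd B f" and \<phi> [measurable]: "borel_fun \<phi>" and C: "\<And>x. \<bar>\<phi> x\<bar> <= C"
  shows "(\<integral>x. f x * \<phi> (gauss_map x) \<partial>muG) = (\<integral>x. gtr f x * \<phi> x \<partial>muG)"
proof -
  have [measurable]: "borel_fun f" "gtr f \<in> borel_measurable borel"
    using f gtr_ubnd[OF f] ubndD(1) by auto
  have B: "0 <= B" by (rule ubndD(4)[OF f])
  have nn: "(\<integral>x. f x * \<psi> (gauss_map x) \<partial>muG) = (\<integral>x. gtr f x * \<psi> x \<partial>muG)"
    if [measurable]: "borel_fun \<psi>" and nn: "\<And>x. 0 <= \<psi> x" for \<psi>
  proof -
    have "(\<integral>\<^sup>+x. ennreal (f x * \<psi> (gauss_map x)) \<partial>muG) = (\<integral>\<^sup>+x. ennreal (gtr f x * \<psi> x) \<partial>muG)"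
      using nn_gauss_duality[OF f, of "\<lambda>x. ennreal (\<psi> x)"] nn ubndD(2)[OF f] ubndD(2)[OF gtr_ubnd[OF f]]
      by (simp add: ennreal_mult')
    then show ?thesis
      using nn ubndD(2)[OF f] ubndD(2)[OF gtr_ubnd[OF f]]
      by (subst (1 2) integral_eq_nn_integral) (auto intro!: measurable_gaussI)
  qed
  \<comment> \<open>The nonnegative case is applied to \<open>\<phi> + D\<close>, and the constant
    \<open>D\<close> is removed by the case of the function 1.\<close>
  define D where "D = C + 1"
  have D: "0 < D" "\<bar>\<phi> x\<bar> <= D" for x using C[of 0] C[of x] by (auto simp: D_def)
  have bd: "integrable muG (\<lambda>x. g x * \<psi> x)"
    if "ubnd B g" "borel_fun \<psi>" "\<And>x. \<bar>\<psi> x\<bar> <= D" for g \<psi>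
  proof (rule integrable_gauss_bounded)
    show "\<bar>g x * \<psi> x\<bar> <= B * D" for x
      unfolding abs_mult using ubndD(2,3)[OF that(1), of x] that(3)[of x] B by (intro mult_mono) auto
  qed (use ubndD(1)[OF that(1)] that(2) in measurable)
  have i1: "integrable muG (\<lambda>x. f x * \<phi> (gauss_map x))" "integrable muG (\<lambda>x. gtr f x * \<phi> x)"
    using bd[OF f, of "\<lambda>x. \<phi> (gauss_map x)"] bd[OF gtr_ubnd[OF f], of \<phi>] D by auto
  have i2: "integrable muG f" "integrable muG (gtr f)"
    using ubndD[OF f] ubndD[OF gtr_ubnd[OF f]] by (auto intro!: integrable_gauss_bounded[of _ B])
  have "(\<integral>x. f x * (\<phi> (gauss_map x) + D) \<partial>muG) = (\<integral>x. gtr f x * (\<phi> x + D) \<partial>muG)"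
  proof (rule nn[of "\<lambda>x. \<phi> x + D"])
    show "0 <= \<phi> x + D" for x using D(2)[of x] by linarith
  qed measurable
  moreover have "(\<integral>x. f x \<partial>muG) = (\<integral>x. gtr f x \<partial>muG)"
    using nn[of "\<lambda>_. 1"] by simp
  ultimately show ?thesis
    using i1 i2 by (simp add: distrib_left)
qed

lemma gauss_pow_duality:
  fixes \<phi> :: "real => real"
  assumes f: "ubnd B f" and \<phi>: "borel_fun \<phi>" "\<And>x. \<bar>\<phi> x\<bar> <= C"
  shows "(\<integral>x. f x * \<phi> ((gauss_map ^^ n) x) \<partial>muG) = (\<integral>x. (gtr ^^ n) f x * \<phi> x \<partial>muG)"
  using \<phi>
proof (induction n arbitrary: \<phi>)
  case (Suc n)
  have "(\<integral>x. (gtr ^^ Suc n) f x * \<phi> x \<partial>muG) = (\<integral>x. (gtr ^^ n) f x * \<phi> (gauss_map x) \<partial>muG)"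
    using gauss_duality[OF gtr_pow_ubnd[OF f] Suc.prems] by simp
  also have "... = (\<integral>x. f x * \<phi> (gauss_map ((gauss_map ^^ n) x)) \<partial>muG)"
    using Suc.prems by (intro Suc.IH[symmetric]) (auto intro: measurable_compose[OF gauss_map_measurable])
  finally show ?case by simp
qed simp

text \<open>After \<open>n\<close> applications the oscillation is at most \<open>d / 2 ^ n\<close>,
  so the image of \<open>f\<close> differs from its mean, which the operator preserves, by no more
  than that at any point of \<open>[0, 1]\<close>.\<close>

lemma gauss_mixing_monob:
  fixes \<phi> :: "real => real"
  assumes f: "ubnd B f" "monob d f" and \<phi>: "borel_fun \<phi>" "\<And>x. \<bar>\<phi> x\<bar> <= C"
  shows "\<bar>(\<integral>x. f x * \<phi> ((gauss_map ^^ n) x) \<partial>muG) - (\<integral>x. f x \<partial>muG) * (\<integral>x. \<phi> x \<partial>muG)\<bar> <= d / 2 ^ n * C"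
proof -
  define F where "F = (gtr ^^ n) f"
  have F: "ubnd B F" unfolding F_def by (rule gtr_pow_ubnd[OF f(1)])
  have Fm: "monob (d / 2 ^ n) F" unfolding F_def by (rule gtr_pow_monob[OF f])
  have C0: "0 <= C" using \<phi>(2)[of 0] by linarith
  define m where "m = (\<integral>x. f x \<partial>muG)"
  have mF: "m = (\<integral>x. F x \<partial>muG)"
    using gauss_pow_duality[OF f(1), of "\<lambda>_. 1" 1 n] by (simp add: F_def m_def)
  have iF: "integrable muG F"
    using ubndD[OF F] by (intro integrable_gauss_bounded[of _ B]) auto
  have dev: "\<bar>F x - m\<bar> <= d / 2 ^ n" if "x \<in> {0..1}" for x
  proof -
    have "F x - m = (\<integral>y. F x - F y \<partial>muG)"
      using iF by (simp add: mF gauss.prob_space[simplified])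
    also have "\<bar>...\<bar> <= (\<integral>y. \<bar>F x - F y\<bar> \<partial>muG)" by (rule integral_abs_bound)
    also have "... <= (\<integral>y. d / 2 ^ n \<partial>muG)"
      using iF that monob_diff[OF Fm] by (intro integral_mono) auto
    finally show ?thesis by (simp add: gauss.prob_space[simplified])
  qed
  have i: "integrable muG \<phi>" "integrable muG (\<lambda>x. F x * \<phi> x)"
  proof -
    show "integrable muG \<phi>" by (rule integrable_gauss_bounded[OF \<phi>])
    show "integrable muG (\<lambda>x. F x * \<phi> x)"
    proof (rule integrable_gauss_bounded)
      show "\<bar>F x * \<phi> x\<bar> <= B * C" for x
        unfolding abs_mult using ubndD(2,3)[OF F, of x] ubndD(4)[OF F] \<phi>(2)[of x] by (intro mult_mono) auto
    qed (use ubndD(1)[OF F] \<phi>(1) in measurable)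
  qed
  have "(\<integral>x. f x * \<phi> ((gauss_map ^^ n) x) \<partial>muG) - m * (\<integral>x. \<phi> x \<partial>muG) = (\<integral>x. (F x - m) * \<phi> x \<partial>muG)"
    unfolding gauss_pow_duality[OF f(1) \<phi>] using i by (simp add: F_def[symmetric] left_diff_distrib)
  also have "\<bar>...\<bar> <= (\<integral>x. \<bar>(F x - m) * \<phi> x\<bar> \<partial>muG)" by (rule integral_abs_bound)
  also have "... <= (\<integral>x. d / 2 ^ n * C \<partial>muG)"
  proof (rule integral_mono)
    show "integrable muG (\<lambda>x. \<bar>(F x - m) * \<phi> x\<bar>)"
      using i by (intro integrable_abs) (auto simp: left_diff_distrib)
    show "\<bar>(F x - m) * \<phi> x\<bar> <= d / 2 ^ n * C" if "x \<in> space muG" for x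
      unfolding abs_mult using dev[of x] that \<phi>(2)[of x] by (intro mult_mono) (auto intro: order_trans[OF abs_ge_zero])
  qed simp
  finally show ?thesis by (simp add: m_def gauss.prob_space[simplified])
qed

lemma gauss_map_lam01: "gauss_map \<in> measurable lam01 lam01"
  by (rule measurable_lam01_lam01I) (use gauss_map_unit in \<open>auto intro: measurable_lam01I less_imp_le\<close>)

lemma invariant_gauss: "invariant_measure muG gauss_map"
  unfolding invariant_measure_def
proof
  show T: "gauss_map \<in> muG \<rightarrow>\<^sub>M muG"
    using gauss_map_lam01 by (simp cong: measurable_cong_sets)
  show "distr muG muG gauss_map = muG"
  proof (rule measure_eqI)
    fix A assume "A \<in> sets (distr muG muG gauss_map)"
    then have A: "A \<in> sets muG" "A \<in> sets borel" by (auto simp: sets_lam01_iff)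
    have "emeasure (distr muG muG gauss_map) A = (\<integral>\<^sup>+x. indicator A x \<partial>distr muG muG gauss_map)"
      using A by simp
    also have "... = (\<integral>\<^sup>+x. ennreal 1 * indicator A (gauss_map x) \<partial>muG)"
      using borel_measurable_indicator[OF A(1)] by (subst nn_integral_distr[OF T]) auto
    also have "... = (\<integral>\<^sup>+x. ennreal (gtr (\<lambda>_. 1) x) * indicator A x \<partial>muG)"
      using A by (intro nn_gauss_duality[of 1]) (auto simp: ubnd_def)
    also have "... = (\<integral>\<^sup>+x. indicator A x \<partial>muG)"
      using gp_sums by (intro nn_integral_cong) (auto simp: gtr_def sums_iff)
    finally show "emeasure (distr muG muG gauss_map) A = emeasure muG A"
      using A by simp
  qed simp
qed

lemma ln2_bounds: "1 / 2 < ln (2::real)" "ln (2::real) <= 1"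
proof -
  show "ln (2::real) <= 1" using ln_le_minus_one[of 2] by simp
  have "exp (1 / 2) ^ 2 = exp (1::real)" by (simp add: exp_of_nat_mult[symmetric])
  also have "... < 2 ^ 2" using exp_le by simp
  finally have "exp (1 / 2 :: real) < 2" by (rule power_less_imp_less_base) simp
  then show "1 / 2 < ln (2::real)" by (metis exp_less_cancel_iff exp_ln zero_less_numeral)
qed

lemma gdens_bounds: "0 <= x ==> x <= 1 ==> 1 <= 2 * gdens x" "0 <= x ==> gdens x <= 2"
proof -
  assume x: "0 <= x"
  have "1 / 2 * 1 <= ln 2 * (1 + x)" using ln2_bounds x by (intro mult_mono) auto
  then show "gdens x <= 2" by (simp add: gdens_def field_simps)
  assume "x <= 1"
  then have "ln 2 * (1 + x) <= 1 * 2" using ln2_bounds x by (intro mult_mono) auto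
  moreover have "0 < ln 2 * (1 + x)" using x by simp
  ultimately show "1 <= 2 * gdens x" by (simp add: gdens_def field_simps)
qed

lemma integral_gauss_lam01:
  fixes F :: "real => real"
  assumes "fun01 F"
  shows "(\<integral>x. F x \<partial>muG) = (E01 x. gdens x * F x)"
proof -
  have "AE x in lam01. 0 <= gdens x" by (rule AE_I2) (auto intro: less_imp_le gdens_pos)
  then show ?thesis
    unfolding gauss_measure_gdens using assms measurable_lam01I[OF gdens_measurable]
    by (subst integral_density) auto
qed

lemma nn_integral_gauss_lam01:
  assumes "fun01 F"
  shows "(\<integral>\<^sup>+x. F x \<partial>muG) = (\<integral>\<^sup>+x. ennreal (gdens x) * F x \<partial>lam01)"
  unfolding gauss_measure_gdens using assms measurable_lam01I[OF gdens_measurable]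
  by (intro nn_integral_density) auto

lemma nn_integral_lam01_le_gauss:
  assumes "fun01 F"
  shows "(\<integral>\<^sup>+x. F x \<partial>lam01) <= 2 * (\<integral>\<^sup>+x. F x \<partial>muG)"
proof -
  have "(\<integral>\<^sup>+x. F x \<partial>lam01) <= (\<integral>\<^sup>+x. 2 * (ennreal (gdens x) * F x) \<partial>lam01)"
  proof (rule nn_integral_mono)
    fix x assume "x \<in> space lam01"
    then have "ennreal 1 <= ennreal (2 * gdens x)" using gdens_bounds(1)[of x] by (intro ennreal_leI) auto
    then have "1 <= 2 * ennreal (gdens x)" by (simp add: ennreal_mult')
    then have "1 * F x <= 2 * ennreal (gdens x) * F x" by (rule mult_right_mono) simp
    then show "F x <= 2 * (ennreal (gdens x) * F x)" by (simp add: mult.assoc)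
  qed
  also have "... = 2 * (\<integral>\<^sup>+x. F x \<partial>muG)"
    unfolding nn_integral_gauss_lam01[OF assms]
    by (intro nn_integral_cmult borel_measurable_times_ennreal assms
        measurable_compose[OF measurable_lam01I[OF gdens_measurable] measurable_ennreal])
  finally show ?thesis .
qed

lemma integral_lam01_le_gauss:
  fixes F :: "real => real"
  assumes F: "fun01 F" "\<And>x. 0 <= F x" and i: "integrable muG F"
  shows "(E01 x. F x) <= 2 * (\<integral>x. F x \<partial>muG)"
proof -
  have "(\<integral>\<^sup>+x. ennreal (F x) \<partial>lam01) <= 2 * (\<integral>\<^sup>+x. ennreal (F x) \<partial>muG)"
    using F by (intro nn_integral_lam01_le_gauss) measurable
  also have "... = ennreal (2 * (\<integral>x. F x \<partial>muG))"
    using F i by (subst nn_integral_eq_integral) (auto simp: ennreal_mult')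
  finally have "(\<integral>\<^sup>+x. ennreal (F x) \<partial>lam01) <= ennreal (2 * (\<integral>x. F x \<partial>muG))" .
  moreover have "0 <= (\<integral>x. F x \<partial>muG)" using F by (intro integral_nonneg_AE) auto
  ultimately show ?thesis
    using F by (subst integral_eq_nn_integral) (auto simp: enn2real_leI)
qed

lemma nice_gauss: "nice gauss_map muG"
  unfolding nice_def
\<comment> \<open>On \<open>[0, 1]\<close> the Gauss density lies between 1/2 and 2. Passing from
  Lebesgue to Gauss measure, using invariance, and passing back costs 2 each time, hence 4. The
  indicator keeps the density bounded on the whole line.\<close>
proof (intro conjI exI[of _ "\<lambda>x. indicator {0..1} x * gdens x"] exI[of _ 4] allI impI)
  show "borel_fun (\<lambda>x. indicator {0..1} x * gdens x)" by measurable
  show "0 <= indicator {0..1} x * gdens x" "indicator {0..1} x * gdens x <= 4" for x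
    using gdens_bounds(2)[of x] gdens_pos[of x] by (auto simp: indicator_def)
  show "muG = density lam01 (\<lambda>x. ennreal (indicator {0..1} x * gdens x))"
    unfolding gauss_measure_gdens using measurable_lam01I[OF gdens_measurable]
    by (intro density_cong) (auto intro!: AE_I2 measurable_lam01I)
  fix n and u :: "real => real" assume u: "fun01 u" "\<forall>x. 0 <= u x \<and> u x <= 2"
  have ug: "u \<in> borel_measurable muG" using u(1) by (simp cong: measurable_cong_sets)
  have um: "fun01 (\<lambda>x. u ((gauss_map ^^ n) x))"
    by (rule measurable_compose[OF measurable_funpow[OF gauss_map_lam01] u(1)])
  have "(E01 x. u ((gauss_map ^^ n) x)) <= 2 * (\<integral>x. u ((gauss_map ^^ n) x) \<partial>muG)"
  proof (rule integral_lam01_le_gauss[OF um])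
    show "integrable muG (\<lambda>x. u ((gauss_map ^^ n) x))"
      by (rule gauss.integrable_const_bound[where B = 2]) (use u(2) um in \<open>auto cong: measurable_cong_sets\<close>)
  qed (use u in auto)
  also have "(\<integral>x. u ((gauss_map ^^ n) x) \<partial>muG) = (\<integral>x. u x \<partial>muG)"
    by (rule integral_pow_invariant[OF invariant_gauss ug])
  also have "... = (E01 x. gdens x * u x)" by (rule integral_gauss_lam01[OF u(1)])
  also have "... <= (E01 x. 2 * u x)"
  proof (rule integral_mono)
    have b: "0 <= gdens x * u x \<and> gdens x * u x <= 2 * u x" if "x \<in> {0..1}" for x
      using gdens_bounds(2)[of x] gdens_pos[of x] u(2)[rule_format, of x] that by (auto intro!: mult_right_mono)
    then show "gdens x * u x <= 2 * u x" if "x \<in> space lam01" for x using that by simp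
    show "integrable lam01 (\<lambda>x. gdens x * u x)"
    proof (rule integrable_lam01_bounded)
      show "\<bar>gdens x * u x\<bar> <= 4" if "x \<in> {0..1}" for x
        using b[OF that] u(2)[rule_format, of x] by (subst abs_of_nonneg) linarith+
    qed (use u(1) measurable_lam01I[OF gdens_measurable] in measurable)
    show "integrable lam01 (\<lambda>x. 2 * u x)"
      using u by (intro integrable_lam01_bounded[of _ 4]) auto
  qed
  finally show "(E01 x. u ((gauss_map ^^ n) x)) <= 4 * (E01 x. u x)" by simp
qed (auto intro: gauss_map_lam01 prob_space_gauss invariant_gauss)

section \<open>The Lyapunov exponent of the Gauss map\<close>

definition ltrunc :: "real => real => real" where
  "ltrunc K x = (if x <= exp (- K) then K else if x <= 1 then - ln x else 0)"

text \<open>The integral of \<open>- 2 * ln x\<close>, the logarithm of the absolute derivative,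
  under the Gauss measure; it is twice Levy's constant. The identification is made in
  \<open>integrable_ln_gauss\<close>.\<close>

definition lyap :: real where "lyap = pi\<^sup>2 / (6 * ln 2)"

lemma ltrunc_antimono:
  assumes "0 <= K" "x <= y" shows "ltrunc K y <= ltrunc K x"
proof (cases "y <= exp (- K)")
  case True
  then show ?thesis using assms by (simp add: ltrunc_def)
next
  case False
  then have "exp (- K) < y" by simp
  then have y: "0 < y" "exp (- K) < y" using less_trans[OF exp_gt_zero, of "- K" y] by auto
  then have "- ln y <= K" using ln_less_cancel_iff[of "exp (- K)" y] by simp
  moreover have "- ln y <= - ln x" if "exp (- K) < x"
  proof -
    have "0 < x" using that by (rule less_trans[OF exp_gt_zero])
    then show ?thesis using assms by simp
  qed
  moreover have "0 <= - ln x" if "exp (- K) < x" "x <= 1"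
    using that by (simp add: ln_le_zero_iff less_trans[OF exp_gt_zero])
  ultimately show ?thesis using assms y by (auto simp: ltrunc_def)
qed

lemma ubnd_ltrunc: assumes "0 <= K" shows "ubnd K (ltrunc K)"
  unfolding ubnd_def
proof (intro conjI allI)
  show "ltrunc K \<in> borel_measurable borel" unfolding ltrunc_def[abs_def] by measurable
  fix x
  have "ltrunc K (max x 1) = 0 \<or> ltrunc K (max x 1) = K" using assms by (auto simp: ltrunc_def max_def)
  then have "0 <= ltrunc K (max x 1)" using assms by auto
  also have "... <= ltrunc K x" using assms by (intro ltrunc_antimono) auto
  finally show "0 <= ltrunc K x" .
  have "ltrunc K x <= ltrunc K (min x 0)" using assms by (intro ltrunc_antimono) auto
  also have "... = K" using assms by (auto simp: ltrunc_def min_def intro: order_trans[OF _ exp_ge_zero])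
  finally show "ltrunc K x <= K" .
qed

text \<open>The point of the truncation: \<open>- ln\<close> is unbounded, but cut off at height
  \<open>K\<close> it belongs to the bounded monotone functions whose correlations decay.\<close>

lemma monob_ltrunc: assumes "0 <= K" shows "monob K (ltrunc K)"
  unfolding monob_def
proof (intro conjI disjI2 allI impI)
  show "\<bar>ltrunc K 1 - ltrunc K 0\<bar> <= K"
    using ubndD(2,3)[OF ubnd_ltrunc[OF assms], of 0] ubndD(2,3)[OF ubnd_ltrunc[OF assms], of 1] by linarith
qed (rule ltrunc_antimono[OF assms])

lemma integrable_pow_gauss:
  fixes f :: "real => real"
  assumes "integrable muG f" shows "integrable muG (\<lambda>x. f ((gauss_map ^^ n) x))"
  using assms
proof (induction n arbitrary: f)
  case (Suc n)
  have T: "gauss_map \<in> muG \<rightarrow>\<^sub>M muG" "distr muG muG gauss_map = muG"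
    using invariant_gauss by (auto simp: invariant_measure_def)
  have "integrable (distr muG muG gauss_map) f" using Suc.prems T by simp
  then have "integrable muG (\<lambda>x. f (gauss_map x))"
    by (rule integrable_distr[OF T(1)])
  from Suc.IH[OF this] show ?case by simp
qed simp

text \<open>The correlations of \<open>f\<close> decay exponentially, so the variance of its Birkhoff sums grows linearly.\<close>
lemma birkhoff_variance:
  fixes f :: "real => real"
  assumes K: "0 <= K" and f: "ubnd K f" "monob K f" and m: "m = (\<integral>x. f x \<partial>muG)"
  shows "(\<integral>x. (\<Sum>k<n. f ((gauss_map ^^ k) x) - m)\<^sup>2 \<partial>muG) <= 3 * K\<^sup>2 * real n"
proof (induction n)
  case (Suc n)
  define g where "g = (\<lambda>k x. f ((gauss_map ^^ k) x) - m)"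
  have fm [measurable]: "borel_fun f" by (rule ubndD(1)[OF f(1)])
  have intf: "integrable muG f"
    using ubndD[OF f(1)] by (intro integrable_gauss_bounded[of _ K]) auto
  have m01: "0 <= m" "m <= K"
  proof -
    show "0 <= m" unfolding m using ubndD(2)[OF f(1)] by (intro integral_nonneg_AE) auto
    have "m <= (\<integral>x. K \<partial>muG)" unfolding m using ubndD(3)[OF f(1)] intf by (intro integral_mono) auto
    then show "m <= K" by (simp add: gauss.prob_space[simplified])
  qed
  have gb: "\<bar>g k x\<bar> <= K" for k x
    using ubndD(2,3)[OF f(1), of "(gauss_map ^^ k) x"] m01 unfolding g_def by linarith
  have gm [measurable]: "g k \<in> borel_measurable borel" for k unfolding g_def by measurable
  have ii: "integrable muG (\<lambda>x. g i x * g j x)" for i j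
  proof (rule integrable_gauss_bounded)
    show "\<bar>g i x * g j x\<bar> <= K * K" for x unfolding abs_mult using gb K by (intro mult_mono) auto
  qed measurable
  \<comment> \<open>Invariance shifts the pair of times \<open>(k, n)\<close> to
    \<open>(0, n - k)\<close>; since \<open>f - m\<close> has mean 0, only the mixing error
    remains.\<close>
  have cov: "(\<integral>x. g k x * g n x \<partial>muG) <= K\<^sup>2 / 2 ^ (n - k)" if "k <= n" for k
  proof -
    have "g k x * g n x = (\<lambda>y. (f y - m) * (f ((gauss_map ^^ (n - k)) y) - m)) ((gauss_map ^^ k) x)" for x
    proof -
      have "(gauss_map ^^ n) x = (gauss_map ^^ (n - k)) ((gauss_map ^^ k) x)"
        using that by (metis comp_apply funpow_add le_add_diff_inverse2)
      then show ?thesis by (simp add: g_def)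
    qed
    then have "(\<integral>x. g k x * g n x \<partial>muG) = (\<integral>y. (f y - m) * (f ((gauss_map ^^ (n - k)) y) - m) \<partial>muG)"
      by (simp only:) (rule integral_pow_invariant[OF invariant_gauss], rule measurable_gaussI, measurable)
    also have "... = (\<integral>y. f y * (f ((gauss_map ^^ (n - k)) y) - m) - m * (f ((gauss_map ^^ (n - k)) y) - m) \<partial>muG)"
      by (simp add: left_diff_distrib)
    also have "... = (\<integral>y. f y * (f ((gauss_map ^^ (n - k)) y) - m) \<partial>muG) - m * (\<integral>y. f ((gauss_map ^^ (n - k)) y) - m \<partial>muG)"
    proof -
      have "integrable muG (\<lambda>y. f y * (f ((gauss_map ^^ (n - k)) y) - m))"
      proof (rule integrable_gauss_bounded)
        show "\<bar>f y * (f ((gauss_map ^^ (n - k)) y) - m)\<bar> <= K * K" for y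
          unfolding abs_mult using gb[of "n - k" y] K ubndD(2,3)[OF f(1), of y] by (intro mult_mono) (auto simp: g_def)
      qed measurable
      moreover have "integrable muG (\<lambda>y. m * (f ((gauss_map ^^ (n - k)) y) - m))"
        using integrable_pow_gauss[OF intf] by auto
      ultimately show ?thesis by simp
    qed
    also have "(\<integral>y. f ((gauss_map ^^ (n - k)) y) - m \<partial>muG) = 0"
      using integrable_pow_gauss[OF intf] integral_pow_invariant[OF invariant_gauss measurable_gaussI[OF fm]] m
      by (simp add: gauss.prob_space[simplified])
    also have "(\<integral>y. f y * (f ((gauss_map ^^ (n - k)) y) - m) \<partial>muG) - m * 0 <= K / 2 ^ (n - k) * K"
    proof -
      have "\<bar>(\<integral>y. f y * (\<lambda>y. f y - m) ((gauss_map ^^ (n - k)) y) \<partial>muG) - (\<integral>y. f y \<partial>muG) * (\<integral>y. f y - m \<partial>muG)\<bar> <= K / 2 ^ (n - k) * K"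
        by (rule gauss_mixing_monob[OF f]) (use gb[of 0] in \<open>auto simp: g_def\<close>)
      moreover have "(\<integral>y. f y - m \<partial>muG) = 0"
        using intf m by (simp add: gauss.prob_space[simplified])
      ultimately show ?thesis by simp
    qed
    finally show ?thesis by (simp add: power2_eq_square)
  qed
  have "(\<Sum>k<Suc n. g k x)\<^sup>2 = (\<Sum>k<n. g k x)\<^sup>2 + 2 * (\<Sum>k<n. g k x * g n x) + g n x * g n x" for x
    by (simp add: power2_eq_square algebra_simps sum_distrib_left sum_distrib_right)
  then have "(\<integral>x. (\<Sum>k<Suc n. g k x)\<^sup>2 \<partial>muG) = (\<integral>x. (\<Sum>k<n. g k x)\<^sup>2 + 2 * (\<Sum>k<n. g k x * g n x) + g n x * g n x \<partial>muG)"
    by simp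
  also have "... = (\<integral>x. (\<Sum>k<n. g k x)\<^sup>2 \<partial>muG) + 2 * (\<Sum>k<n. \<integral>x. g k x * g n x \<partial>muG) + (\<integral>x. g n x * g n x \<partial>muG)"
  proof -
    have "integrable muG (\<lambda>x. (\<Sum>k<n. g k x)\<^sup>2)"
    proof (rule integrable_gauss_bounded)
      have "\<bar>\<Sum>k<n. g k x\<bar> <= real n * K" for x
      proof -
        have "\<bar>\<Sum>k<n. g k x\<bar> <= (\<Sum>k<n. \<bar>g k x\<bar>)" by (rule sum_abs)
        also have "... <= (\<Sum>k<n. K)" by (intro sum_mono gb)
        finally show ?thesis by simp
      qed
      then show "\<bar>(\<Sum>k<n. g k x)\<^sup>2\<bar> <= (real n * K)\<^sup>2" for x
        using power_mono[of "\<bar>\<Sum>k<n. g k x\<bar>" "real n * K" 2] by simp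
    qed measurable
    then show ?thesis using ii by simp
  qed
  \<comment> \<open>The step from \<open>n\<close> to \<open>n + 1\<close> adds the variance, at
    most \<open>K^2\<close>, and twice a geometric sum of covariances, at most
    \<open>2 * K^2\<close>. This is the 3 in the statement.\<close>
  also have "... <= 3 * K\<^sup>2 * real n + 2 * (\<Sum>k<n. K\<^sup>2 / 2 ^ (n - k)) + K\<^sup>2"
  proof (intro add_mono mult_left_mono sum_mono)
    show "(\<integral>x. (\<Sum>k<n. g k x)\<^sup>2 \<partial>muG) <= 3 * K\<^sup>2 * real n" using Suc by (simp add: g_def)
    show "(\<integral>x. g n x * g n x \<partial>muG) <= K\<^sup>2" using cov[of n] by simp
  qed (use cov in auto)
  also have "(\<Sum>k<n. K\<^sup>2 / 2 ^ (n - k)) <= K\<^sup>2"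
  proof -
    have "(\<Sum>k<n. (1 / 2) ^ (n - k)) = 1 - (1 / 2 :: real) ^ n"
    proof (induction n)
      case (Suc n)
      have "(\<Sum>k<Suc n. (1 / 2 :: real) ^ (Suc n - k)) = (1 / 2) * (\<Sum>k<n. (1 / 2) ^ (n - k)) + 1 / 2"
        by (simp add: Suc_diff_le sum_distrib_left)
      then show ?case using Suc by simp
    qed simp
    then have "(\<Sum>k<n. (1 / 2 :: real) ^ (n - k)) <= 1" by simp
    then have "K\<^sup>2 * (\<Sum>k<n. (1 / 2) ^ (n - k)) <= K\<^sup>2" by (simp add: mult_left_le)
    then show ?thesis by (simp add: sum_distrib_left power_divide)
  qed
  finally show ?case by (simp add: g_def algebra_simps)
qed simp

text \<open>The antiderivative \<open>x ^ (n + 1) * (1 / (n + 1)^2 - ln x / (n + 1))\<close> tends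
  to 0 at 0, because \<open>x * ln x\<close> does; the integral is improper there, so a version of
  the fundamental theorem with one-sided limits is used.\<close>

lemma integral_ln_power:
  fixes n :: nat
  shows "integrable lborel (\<lambda>x::real. indicator {0<..<1} x * (- ln x * x ^ n) :: real)"
    "(\<integral>x. indicator {0<..<1} x * (- ln x * x ^ n) \<partial>lborel) = 1 / (real n + 1)\<^sup>2"
proof -
  define c where "c = real n + 1"
  have c: "0 < c" "real (Suc n) = c" by (auto simp: c_def)
  define F where "F = (\<lambda>x::real. x ^ Suc n * (1 / c\<^sup>2 - ln x / c))"
  have d: "(F has_real_derivative (- ln x * x ^ n)) (at x)" if "0 < x" for x
  proof -
    have "((\<lambda>x. 1 / c\<^sup>2 - ln x / c) has_real_derivative (- (1 / x / c))) (at x)"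
      using that c(1) by (auto intro!: derivative_eq_intros)
    from DERIV_mult[OF DERIV_pow[of "Suc n" x] this]
    have "(F has_real_derivative (real (Suc n) * x ^ (Suc n - Suc 0) * (1 / c\<^sup>2 - ln x / c) + - (1 / x / c) * x ^ Suc n)) (at x)"
      unfolding F_def .
    moreover have "real (Suc n) * x ^ (Suc n - Suc 0) * (1 / c\<^sup>2 - ln x / c) + - (1 / x / c) * x ^ Suc n = - ln x * x ^ n"
    proof -
      have "c * x ^ n * (1 / c\<^sup>2 - ln x / c) = x ^ n / c - x ^ n * ln x"
        using c(1) by (simp add: power2_eq_square right_diff_distrib)
      moreover have "1 / x / c * x ^ Suc n = x ^ n / c" using that by simp
      ultimately show ?thesis unfolding c(2) by simp
    qed
    ultimately show ?thesis by simp
  qed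
  have Feq: "F = (\<lambda>x. x ^ Suc n / c\<^sup>2 - x ^ n * (x * ln x) / c)"
    by (auto simp: F_def fun_eq_iff algebra_simps)
  have l0: "(F \<longlongrightarrow> 0) (at_right 0)"
  proof -
    have "((\<lambda>x::real. x * ln x) \<longlongrightarrow> 0) (at_right 0)" by real_asymp
    moreover have "((\<lambda>x::real. x ^ n) \<longlongrightarrow> 0 ^ n) (at_right 0)" "((\<lambda>x::real. x ^ Suc n) \<longlongrightarrow> 0 ^ Suc n) (at_right 0)"
      by (intro tendsto_intros)+
    ultimately have "(F \<longlongrightarrow> 0 ^ Suc n / c\<^sup>2 - 0 ^ n * 0 / c) (at_right 0)"
      unfolding Feq using c by (intro tendsto_intros) auto
    then show ?thesis by simp
  qed
  have l1: "(F \<longlongrightarrow> F 1) (at_left 1)"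
  proof -
    have "isCont F 1" using d[of 1] by (intro DERIV_isCont) auto
    then show ?thesis by (auto simp: continuous_at intro: tendsto_mono[OF at_le])
  qed
  have nn: "0 <= - ln x * x ^ n" if "0 < x" "x < 1" for x :: real
    using that by (intro mult_nonneg_nonneg) auto
  have prem: "ereal 0 < ereal 1" "\<And>x. ereal 0 < ereal x ==> ereal x < ereal 1 ==> (F has_real_derivative - ln x * x ^ n) (at x)"
    "\<And>x. ereal 0 < ereal x ==> ereal x < ereal 1 ==> isCont (\<lambda>x. - ln x * x ^ n) x"
    "AE x in lborel. ereal 0 < ereal x --> ereal x < ereal 1 --> 0 <= - ln x * x ^ n"
    "((F \<circ> real_of_ereal) \<longlongrightarrow> 0) (at_right (ereal 0))" "((F \<circ> real_of_ereal) \<longlongrightarrow> F 1) (at_left (ereal 1))"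
  proof -
    show "AE x in lborel. ereal 0 < ereal x --> ereal x < ereal 1 --> 0 <= - ln x * x ^ n"
      by (intro AE_I2 impI nn) auto
    show "((F \<circ> real_of_ereal) \<longlongrightarrow> 0) (at_right (ereal 0))" "((F \<circ> real_of_ereal) \<longlongrightarrow> F 1) (at_left (ereal 1))"
      using l0 l1 by (simp_all only: ereal_tendsto_simps)
  qed (use d in \<open>auto intro!: continuous_intros\<close>)
  have "set_integrable lborel (einterval (ereal 0) (ereal 1)) (\<lambda>x. - ln x * x ^ n)"
    by (rule interval_integral_FTC_nonneg(1)[OF prem])
  moreover have "(LBINT x=ereal 0..ereal 1. - ln x * x ^ n) = F 1 - 0"
    by (rule interval_integral_FTC_nonneg(2)[OF prem])
  moreover have "F 1 = 1 / (real n + 1)\<^sup>2" by (simp add: F_def c_def)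
  ultimately show "integrable lborel (\<lambda>x::real. indicator {0<..<1} x * (- ln x * x ^ n) :: real)"
    "(\<integral>x. indicator {0<..<1} x * (- ln x * x ^ n) \<partial>lborel) = 1 / (real n + 1)\<^sup>2"
    by (auto simp: set_integrable_def interval_lebesgue_integral_def set_lebesgue_integral_def)
qed

text \<open>The squares sum to \<open>pi^2 / 6\<close>; grouping them in pairs and subtracting twice
  the even part, which is a quarter of the total, leaves half of it.\<close>

lemma alternating_squares_sums:
  "(\<lambda>m. 1 / (2 * real m + 1)\<^sup>2 - 1 / (2 * real m + 2)\<^sup>2) sums (pi\<^sup>2 / 12)"
proof -
  have z: "(\<lambda>n. 1 / (real n + 1)\<^sup>2) sums (pi\<^sup>2 / 6)" using inverse_squares_sums by (simp add: add.commute)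
  have "(\<lambda>n. \<Sum>j = n * 2..<n * 2 + 2. 1 / (real j + 1)\<^sup>2) sums (pi\<^sup>2 / 6)"
    by (rule sums_group[OF z]) simp
  moreover have "(\<Sum>j = n * 2..<n * 2 + 2. 1 / (real j + 1)\<^sup>2) = 1 / (2 * real n + 1)\<^sup>2 + 1 / (2 * real n + 2)\<^sup>2" for n
  proof -
    have "{n * 2..<n * 2 + 2} = {n * 2, n * 2 + 1}" by auto
    then show ?thesis by (simp add: algebra_simps)
  qed
  ultimately have 1: "(\<lambda>n. 1 / (2 * real n + 1)\<^sup>2 + 1 / (2 * real n + 2)\<^sup>2) sums (pi\<^sup>2 / 6)" by simp
  have e: "2 * (1 / 4 * (1 / (real n + 1)\<^sup>2)) = 2 * (1 / (2 * real n + 2)\<^sup>2)" for n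
    by (simp add: power2_eq_square divide_simps) (simp add: algebra_simps)
  have 2: "(\<lambda>n. 2 * (1 / (2 * real n + 2)\<^sup>2)) sums (2 * (1 / 4 * (pi\<^sup>2 / 6)))"
    unfolding e[symmetric] by (intro sums_mult z)
  from sums_diff[OF 1 2] show ?thesis by simp
qed

text \<open>The alternating geometric series of \<open>1 / (1 + x)\<close>, with consecutive terms
  paired so that every summand is nonnegative and the sum may be interchanged with a nonnegative
  integral.\<close>

lemma geometric_ln_sums:
  assumes "0 < x" "x < (1::real)"
  shows "(\<lambda>m. - ln x * x ^ (2 * m) - (- ln x * x ^ (2 * m + 1))) sums (- ln x / (1 + x))"
proof -
  have "(\<lambda>m. (x\<^sup>2) ^ m) sums (1 / (1 - x\<^sup>2))"
    using assms by (intro geometric_sums) (auto simp: power_less_one_iff abs_square_less_1)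
  then have "(\<lambda>m. (- ln x * (1 - x)) * (x\<^sup>2) ^ m) sums ((- ln x * (1 - x)) * (1 / (1 - x\<^sup>2)))"
    by (rule sums_mult)
  moreover have "(- ln x * (1 - x)) * (1 / (1 - x\<^sup>2)) = - ln x / (1 + x)"
  proof -
    have "1 - x\<^sup>2 = (1 - x) * (1 + x)" by (simp add: power2_eq_square algebra_simps)
    then show ?thesis using assms by simp
  qed
  moreover have "(- ln x * (1 - x)) * (x\<^sup>2) ^ m = - ln x * x ^ (2 * m) - (- ln x * x ^ (2 * m + 1))" for m
    unfolding power_add power_mult[of x 2 m] power_one_right by (simp add: algebra_simps)
  ultimately show ?thesis by simp
qed

text \<open>Expanding the Gauss density in the paired geometric series turns the integral into the
  alternating sum of inverse squares, \<open>pi^2 / 12\<close>, divided by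
  \<open>ln 2\<close>.\<close>

lemma nn_integral_ln_gauss: "(\<integral>\<^sup>+x. ennreal (- ln x) \<partial>muG) = ennreal (lyap / 2)"
proof -
  define D where "D = (\<lambda>m x::real. - ln x * x ^ (2 * m) - (- ln x * x ^ (2 * m + 1)))"
  have D0: "0 <= D m x" if "0 < x" "x < 1" for m x
  proof -
    have "D m x = (- ln x) * (x ^ (2 * m) * (1 - x))" by (simp add: D_def algebra_simps)
    moreover have "0 <= - ln x" using that by simp
    moreover have "0 <= x ^ (2 * m) * (1 - x)" using that by simp
    ultimately show ?thesis by (simp only: mult_nonneg_nonneg)
  qed
  have Dm [measurable]: "D m \<in> borel_measurable borel" for m unfolding D_def by measurable
  have int: "(\<integral>\<^sup>+x. ennreal (D m x) * indicator {0<..<1} x \<partial>lborel) = ennreal (1 / (2 * real m + 1)\<^sup>2 - 1 / (2 * real m + 2)\<^sup>2)" for m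
  proof -
    have "(\<integral>\<^sup>+x. ennreal (D m x) * indicator {0<..<1} x \<partial>lborel) = (\<integral>\<^sup>+x. ennreal (indicator {0<..<1} x * (- ln x * x ^ (2 * m)) - indicator {0<..<1} x * (- ln x * x ^ (2 * m + 1))) \<partial>lborel)"
      by (intro nn_integral_cong) (auto simp: D_def indicator_def)
    also have "... = ennreal (\<integral>x. indicator {0<..<1} x * (- ln x * x ^ (2 * m)) - indicator {0<..<1} x * (- ln x * x ^ (2 * m + 1)) \<partial>lborel)"
    proof (rule nn_integral_eq_integral)
      show "AE x in (lborel :: real measure). (0 :: real) <= indicator {0<..<1} x * (- ln x * x ^ (2 * m)) - indicator {0<..<1} x * (- ln x * x ^ (2 * m + 1))"
      proof (rule AE_I2)
        fix x :: real
        show "(0 :: real) <= indicator {0<..<1} x * (- ln x * x ^ (2 * m)) - indicator {0<..<1} x * (- ln x * x ^ (2 * m + 1))"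
        proof (cases "x \<in> {0<..<1}")
          case True
          then show ?thesis using D0[of x m] by (simp add: D_def)
        qed simp
      qed
    qed (intro Bochner_Integration.integrable_diff integral_ln_power)
    also have "(\<integral>x. indicator {0<..<1} x * (- ln x * x ^ (2 * m)) - indicator {0<..<1} x * (- ln x * x ^ (2 * m + 1)) \<partial>lborel)
       = 1 / (real (2 * m) + 1)\<^sup>2 - 1 / (real (2 * m + 1) + 1)\<^sup>2"
      by (subst Bochner_Integration.integral_diff) (simp_all only: integral_ln_power)
    finally show ?thesis by (simp add: add.commute)
  qed
  have "(\<integral>\<^sup>+x. ennreal (- ln x) \<partial>muG) = (\<integral>\<^sup>+x. ennreal (- ln x) * ennreal (gdens x) * indicator {0<..<1} x \<partial>lborel)"
    by (rule nn_integral_gauss_measure) measurable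
  also have "... = (\<integral>\<^sup>+x. ennreal (1 / ln 2) * (\<Sum>m. ennreal (D m x) * indicator {0<..<1} x) \<partial>lborel)"
  proof (intro nn_integral_cong)
    fix x :: real
    show "ennreal (- ln x) * ennreal (gdens x) * indicator {0<..<1} x = ennreal (1 / ln 2) * (\<Sum>m. ennreal (D m x) * indicator {0<..<1} x)"
    proof (cases "x \<in> {0<..<1}")
      case True
      then have x: "0 < x" "x < 1" by auto
      have "(\<Sum>m. ennreal (D m x)) = ennreal (- ln x / (1 + x))"
        using geometric_ln_sums[OF x] D0[OF x] by (subst suminf_ennreal2) (auto simp: D_def sums_iff)
      moreover have "ennreal (- ln x) * ennreal (gdens x) = ennreal (1 / ln 2) * ennreal (- ln x / (1 + x))"
      proof -
        have "0 <= - ln x / (1 + x)" using x by (intro divide_nonneg_nonneg) auto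
        then show ?thesis
          using x gdens_pos[of x] by (subst (1 2) ennreal_mult[symmetric]) (auto simp: gdens_def)
      qed
      ultimately show ?thesis using True by simp
    qed simp
  qed
  also have "... = ennreal (1 / ln 2) * (\<Sum>m. \<integral>\<^sup>+x. ennreal (D m x) * indicator {0<..<1} x \<partial>lborel)"
    by (subst nn_integral_cmult, measurable, subst nn_integral_suminf, measurable)
  also have "... = ennreal (1 / ln 2) * ennreal (pi\<^sup>2 / 12)"
  proof -
    have "0 <= 1 / (2 * real m + 1)\<^sup>2 - 1 / (2 * real m + 2)\<^sup>2" for m
      by (auto intro!: divide_left_mono power_mono)
    then have "(\<Sum>m. ennreal (1 / (2 * real m + 1)\<^sup>2 - 1 / (2 * real m + 2)\<^sup>2)) = ennreal (pi\<^sup>2 / 12)"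
      by (subst suminf_ennreal2[OF _ sums_summable[OF alternating_squares_sums]])
         (simp_all only: sums_unique[OF alternating_squares_sums, symmetric])
    then show ?thesis by (simp only: int)
  qed
  also have "... = ennreal (lyap / 2)"
    by (subst ennreal_mult[symmetric]) (auto simp: lyap_def field_simps)
  finally show ?thesis .
qed

lemma lyap_pos: "0 < lyap"
  by (simp add: lyap_def)

lemma AE_gauss_01: "AE x in muG. 0 < x \<and> x < 1"
proof -
  have "AE x in lam01. 0 < x \<and> x < 1"
    using AE_lam01_neq[of 0] AE_lam01_neq[of 1] AE_space by eventually_elim auto
  then show ?thesis
    unfolding gauss_measure_gdens using measurable_lam01I[OF gdens_measurable]
    by (subst AE_density) (auto elim: eventually_mono)
qed

lemma integrable_ln_gauss: "integrable muG (\<lambda>x. - ln x)" "(\<integral>x. - ln x \<partial>muG) = lyap / 2"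
proof -
  have m: "(\<lambda>x. - ln x :: real) \<in> borel_measurable muG" by (rule measurable_gaussI) measurable
  have nn: "AE x in muG. 0 <= - ln x"
    using AE_gauss_01 by eventually_elim simp
  show "integrable muG (\<lambda>x. - ln x)"
    by (rule integrableI_nonneg[OF m nn]) (simp add: nn_integral_ln_gauss)
  show "(\<integral>x. - ln x \<partial>muG) = lyap / 2"
    unfolding integral_eq_nn_integral[OF m nn] nn_integral_ln_gauss using lyap_pos by simp
qed

lemma AE_gauss_orbit: "AE x in muG. \<forall>k. 0 < (gauss_map ^^ k) x \<and> (gauss_map ^^ k) x < 1"
proof (subst AE_all_countable, rule allI)
  fix k
  have "AE x in muG. 0 < (gauss_map ^^ k) x \<and> (gauss_map ^^ k) x < 1"
  proof (induction k)
    case (Suc k)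
    have T: "gauss_map \<in> muG \<rightarrow>\<^sub>M muG" "distr muG muG gauss_map = muG"
      using invariant_gauss by (auto simp: invariant_measure_def)
    have "AE x in distr muG muG gauss_map. 0 < (gauss_map ^^ k) x \<and> (gauss_map ^^ k) x < 1"
      by (subst T(2)) (rule Suc)
    then have "AE x in muG. 0 < (gauss_map ^^ k) (gauss_map x) \<and> (gauss_map ^^ k) (gauss_map x) < 1"
      by (rule AE_distrD[OF T(1)])
    then show ?case by (simp add: funpow_swap1)
  qed (use AE_gauss_01 in simp)
  then show "AE x in muG. 0 < (gauss_map ^^ k) x \<and> (gauss_map ^^ k) x < 1" .
qed

lemma ltrunc_le_ln: "0 <= K ==> 0 < x ==> x < 1 ==> ltrunc K x <= - ln x"
proof -
  assume *: "0 <= K" "0 < x" "x < 1"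
  have "K <= - ln x" if "x <= exp (- K)" using that * ln_le_cancel_iff[of x "exp (- K)"] by simp
  then show ?thesis using * by (auto simp: ltrunc_def)
qed

text \<open>The logarithm of the absolute derivative of the \<open>n\<close>-th iterate: by the
  chain rule, since one step has derivative \<open>- 1 / x^2\<close>.\<close>

definition lsum :: "nat => real => real" where
  "lsum n x = (\<Sum>k<n. - 2 * ln ((gauss_map ^^ k) x))"

lemma lsum_measurable [measurable]: "lsum n \<in> borel_measurable borel"
  unfolding lsum_def[abs_def] by measurable

lemma integrable_lsum: "integrable muG (lsum n)"
  unfolding lsum_def using integrable_pow_gauss[OF integrable_ln_gauss(1)]
  by (intro Bochner_Integration.integrable_sum) (auto dest: integrable_mult_right[of 2])

text \<open>The function \<open>- ln\<close> is split into a truncation and a nonnegative rest of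
  small integral. Birkhoff averages of the truncation have variance of order \<open>1 / n\<close>;
  those of the rest keep its small integral by invariance.\<close>

lemma lsum_L1:
  "(\<lambda>n. \<integral>x. \<bar>lsum n x / real n - lyap\<bar> \<partial>muG) \<longlonglongrightarrow> 0"
proof (rule tendstoI)
  fix e :: real assume e: "0 < e"
  have ltm: "ltrunc K \<in> borel_measurable borel" if "0 <= K" for K using ubndD(1)[OF ubnd_ltrunc[OF that]] .
  have "(\<lambda>K. \<integral>x. ltrunc (real K) x \<partial>muG) \<longlonglongrightarrow> (\<integral>x. - ln x \<partial>muG)"
  proof (rule integral_dominated_convergence[where w = "\<lambda>x. - ln x"])
    show "AE x in muG. (\<lambda>K. ltrunc (real K) x) \<longlonglongrightarrow> - ln x"
      using AE_gauss_01
    proof eventually_elim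
      case (elim x)
      have "\<forall>\<^sub>F K in sequentially. ltrunc (real K) x = - ln x"
      proof (rule eventually_sequentiallyI)
        fix K assume "nat \<lceil>- ln x\<rceil> + 1 <= K"
        then have "- ln x < real K" by linarith
        then have "exp (- real K) < exp (ln x)" by simp
        then show "ltrunc (real K) x = - ln x" using elim by (simp add: ltrunc_def)
      qed
      then show ?case by (rule tendsto_eventually)
    qed
    show "AE x in muG. norm (ltrunc (real K) x) <= - ln x" for K
      using AE_gauss_01
    proof eventually_elim
      case (elim x)
      then show ?case using ltrunc_le_ln[of "real K" x] ubndD(2)[OF ubnd_ltrunc[of "real K"], of x] by simp
    qed
  qed (use ltm integrable_ln_gauss in \<open>auto intro!: measurable_gaussI\<close>)
  then have "\<forall>\<^sub>F K in sequentially. (\<integral>x. - ln x \<partial>muG) - e / 8 < (\<integral>x. ltrunc (real K) x \<partial>muG)"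
    using e by (intro order_tendstoD(1)) auto
  then obtain K :: nat where K: "lyap / 2 - e / 8 < (\<integral>x. ltrunc (real K) x \<partial>muG)"
    unfolding integrable_ln_gauss(2) by (auto simp: eventually_sequentially)
  define f where "f = ltrunc (real K)"
  define m where "m = (\<integral>x. f x \<partial>muG)"
  have f: "ubnd (real K) f" "monob (real K) f" unfolding f_def by (auto intro: ubnd_ltrunc monob_ltrunc)
  have fm [measurable]: "borel_fun f" by (rule ubndD(1)[OF f(1)])
  have intf: "integrable muG f"
    using ubndD[OF f(1)] by (intro integrable_gauss_bounded[of _ "real K"]) auto
  define r where "r = (\<lambda>x. - ln x - f x)"
  have intr: "integrable muG r" unfolding r_def using integrable_ln_gauss intf by auto
  have rnn: "0 <= r x" if "0 < x" "x < 1" for x using ltrunc_le_ln[of "real K" x] that by (simp add: r_def f_def)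
  have rint: "(\<integral>x. r x \<partial>muG) = lyap / 2 - m"
    unfolding r_def using integrable_ln_gauss intf by (simp add: m_def)
  have rint0: "0 <= (\<integral>x. r x \<partial>muG)"
  proof (rule integral_nonneg_AE)
    show "AE x in muG. 0 <= r x" using AE_gauss_01 by eventually_elim (rule rnn; simp)
  qed
  have md: "\<bar>2 * m - lyap\<bar> < e / 4" using K rint rint0 by (simp add: m_def f_def)
  \<comment> \<open>The weight in \<open>2 * \<bar>A\<bar> <= A^2 / t + t\<close>, which passes from
    the variance bound to an L1 bound.\<close>
  define t where "t = e / 8"
  have t: "0 < t" using e by (simp add: t_def)
  define A where "A = (\<lambda>n x. (\<Sum>k<n. f ((gauss_map ^^ k) x) - m) / real n)"
  have main: "(\<integral>x. \<bar>lsum n x / real n - lyap\<bar> \<partial>muG) <= (3 * (real K)\<^sup>2 / real n) / t + t + e / 4 + e / 4" if n: "0 < n" for n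
  proof -
    have intA2: "integrable muG (\<lambda>x. (A n x)\<^sup>2)"
    proof (rule integrable_gauss_bounded)
      have m01: "\<bar>m\<bar> <= real K"
        unfolding m_def using integral_abs_bound[of muG f] integral_mono[OF integrable_abs[OF intf], of "\<lambda>_. real K"]
          ubndD(2,3)[OF f(1)] by (simp add: gauss.prob_space[simplified])
      have "\<bar>f y - m\<bar> <= 2 * real K" for y using ubndD(2,3)[OF f(1), of y] m01 by linarith
      then have "\<bar>\<Sum>k<n. f ((gauss_map ^^ k) x) - m\<bar> <= (\<Sum>k<n. 2 * real K)" for x
        by (intro order_trans[OF sum_abs] sum_mono) auto
      then have "\<bar>A n x\<bar> <= 2 * real K" for x
        using n by (simp add: A_def abs_divide field_simps)
      then show "\<bar>(A n x)\<^sup>2\<bar> <= (2 * real K)\<^sup>2" for x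
        using power_mono[of "\<bar>A n x\<bar>" "2 * real K" 2] by simp
    qed (simp add: A_def, measurable)
    have A2: "(\<integral>x. (A n x)\<^sup>2 \<partial>muG) <= 3 * (real K)\<^sup>2 / real n"
    proof -
      have "(\<integral>x. (A n x)\<^sup>2 \<partial>muG) = (\<integral>x. (\<Sum>k<n. f ((gauss_map ^^ k) x) - m)\<^sup>2 \<partial>muG) / (real n)\<^sup>2"
        by (simp add: A_def power_divide)
      also have "... <= (3 * (real K)\<^sup>2 * real n) / (real n)\<^sup>2"
        by (intro divide_right_mono birkhoff_variance[OF _ f m_def]) auto
      also have "... = 3 * (real K)\<^sup>2 / real n" using n by (simp add: power2_eq_square)
      finally show ?thesis .
    qed
    define R where "R = (\<lambda>x. (\<Sum>k<n. r ((gauss_map ^^ k) x)) / real n)"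
    have intR: "integrable muG R"
      unfolding R_def using integrable_pow_gauss[OF intr] by auto
    have Rint: "(\<integral>x. R x \<partial>muG) = lyap / 2 - m"
    proof -
      have "(\<integral>x. R x \<partial>muG) = (\<Sum>k<n. \<integral>x. r ((gauss_map ^^ k) x) \<partial>muG) / real n"
        unfolding R_def using integrable_pow_gauss[OF intr] by simp
      also have "... = (\<Sum>k<n. \<integral>x. r x \<partial>muG) / real n"
        by (simp add: integral_pow_invariant[OF invariant_gauss borel_measurable_integrable[OF intr]])
      finally show ?thesis using n rint by simp
    qed
    have split: "lsum n x / real n - lyap = 2 * A n x + 2 * R x + (2 * m - lyap)" for x
    proof -
      have "lsum n x = (\<Sum>k<n. 2 * (f ((gauss_map ^^ k) x) - m) + 2 * r ((gauss_map ^^ k) x) + 2 * m)"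
        unfolding lsum_def r_def by (intro sum.cong) auto
      also have "... = 2 * (\<Sum>k<n. f ((gauss_map ^^ k) x) - m) + 2 * (\<Sum>k<n. r ((gauss_map ^^ k) x)) + real n * (2 * m)"
        by (simp add: sum.distrib sum_distrib_left sum_subtractf right_diff_distrib)
      finally show ?thesis using n by (simp add: A_def R_def field_simps)
    qed
    have "(\<integral>x. \<bar>lsum n x / real n - lyap\<bar> \<partial>muG) <= (\<integral>x. (A n x)\<^sup>2 / t + t + 2 * R x + \<bar>2 * m - lyap\<bar> \<partial>muG)"
    proof (rule integral_mono_AE)
      show "integrable muG (\<lambda>x. \<bar>lsum n x / real n - lyap\<bar>)"
        using integrable_lsum[of n] by auto
      show "AE x in muG. \<bar>lsum n x / real n - lyap\<bar> <= (A n x)\<^sup>2 / t + t + 2 * R x + \<bar>2 * m - lyap\<bar>"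
        using AE_gauss_orbit
      proof eventually_elim
        case (elim x)
        have R0: "0 <= R x" unfolding R_def using elim rnn by (intro divide_nonneg_nonneg sum_nonneg) auto
        have "0 <= (\<bar>A n x\<bar> - t)\<^sup>2 / t" using t by simp
        then have "2 * \<bar>A n x\<bar> <= (A n x)\<^sup>2 / t + t"
          using t by (simp add: power2_eq_square field_simps)
        then show ?case unfolding split using R0 by linarith
      qed
    qed (use intA2 intR in auto)
    also have "... = (\<integral>x. (A n x)\<^sup>2 \<partial>muG) / t + t + 2 * (lyap / 2 - m) + \<bar>2 * m - lyap\<bar>"
      using intA2 intR Rint by (simp add: gauss.prob_space[simplified])
    also have "... <= (3 * (real K)\<^sup>2 / real n) / t + t + e / 4 + e / 4"
    proof (intro add_mono divide_right_mono)
      have "2 * (lyap / 2 - m) = lyap - 2 * m" by simp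
      also have "... <= \<bar>2 * m - lyap\<bar>" using abs_ge_minus_self[of "2 * m - lyap"] by simp
      finally show "2 * (lyap / 2 - m) <= e / 4" using md by linarith
    qed (use A2 t md in auto)
    finally show ?thesis .
  qed
  have "(\<lambda>n. (3 * (real K)\<^sup>2 / real n) / t) \<longlonglongrightarrow> 0"
    by (rule tendsto_divide_zero[OF lim_const_over_n])
  then have "\<forall>\<^sub>F n in sequentially. (3 * (real K)\<^sup>2 / real n) / t < t" using t by (intro order_tendstoD) auto
  moreover have "\<forall>\<^sub>F n in sequentially. 0 < n" by (rule eventually_gt_at_top)
  ultimately show "\<forall>\<^sub>F n in sequentially. dist (\<integral>x. \<bar>lsum n x / real n - lyap\<bar> \<partial>muG) 0 < e"
  proof eventually_elim
    case (elim n)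
    have "0 <= (\<integral>x. \<bar>lsum n x / real n - lyap\<bar> \<partial>muG)" by (intro integral_nonneg_AE) auto
    then show ?case using main[OF elim(2)] elim(1) e by (simp add: t_def)
  qed
qed

text \<open>Markov's inequality; the factor 2 compares Lebesgue with Gauss measure.\<close>

lemma lsum_in_measure:
  assumes "0 < d"
  shows "(\<lambda>n. measure lam01 {x \<in> {0..1}. d <= \<bar>lsum n x / real n - lyap\<bar>}) \<longlonglongrightarrow> 0"
proof (rule tendsto_sandwich[of "\<lambda>_. 0"])
  have "(\<lambda>n. (2 / d) * (\<integral>x. \<bar>lsum n x / real n - lyap\<bar> \<partial>muG)) \<longlonglongrightarrow> (2 / d) * 0"
    by (intro tendsto_intros lsum_L1)
  then show "(\<lambda>n. (2 / d) * (\<integral>x. \<bar>lsum n x / real n - lyap\<bar> \<partial>muG)) \<longlonglongrightarrow> 0" by simp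
  show "\<forall>\<^sub>F n in sequentially. measure lam01 {x \<in> {0..1}. d <= \<bar>lsum n x / real n - lyap\<bar>} <= (2 / d) * (\<integral>x. \<bar>lsum n x / real n - lyap\<bar> \<partial>muG)"
  proof (intro always_eventually allI)
    fix n
    define B where "B = {x \<in> {0..1}. d <= \<bar>lsum n x / real n - lyap\<bar>}"
    have "B \<in> sets borel" unfolding B_def by measurable
    then have B: "B \<in> sets lam01" by (auto simp: sets_lam01_iff B_def)
    have Bg: "integrable muG (indicator B :: real => real)"
      by (rule gauss.integrable_const_bound[where B = 1]) (use borel_measurable_indicator[of B muG] B in auto)
    have "measure lam01 B = (E01 x. indicator B x)" using B by (simp add: sets_lam01_iff Int_absorb2)
    also have "... <= 2 * (\<integral>x. indicator B x \<partial>muG)"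
      using B Bg by (intro integral_lam01_le_gauss) auto
    also have "(\<integral>x. indicator B x \<partial>muG) <= (\<integral>x. \<bar>lsum n x / real n - lyap\<bar> / d \<partial>muG)"
    proof (rule integral_mono)
      show "integrable muG (indicator B :: real => real)" by (rule Bg)
      show "integrable muG (\<lambda>x. \<bar>lsum n x / real n - lyap\<bar> / d)" using integrable_lsum[of n] by auto
      show "indicator B x <= \<bar>lsum n x / real n - lyap\<bar> / d" for x
        using assms by (auto simp: B_def indicator_def field_simps)
    qed
    finally show "measure lam01 {x \<in> {0..1}. d <= \<bar>lsum n x / real n - lyap\<bar>} <= (2 / d) * (\<integral>x. \<bar>lsum n x / real n - lyap\<bar> \<partial>muG)"
      by (simp add: B_def)
  qed
qed auto

section \<open>Cylinders of the continued fraction expansion and their distortion\<close>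

fun gcyl :: "nat list => real set" where
  "gcyl [] = {0<..<1}"
| "gcyl (a # w) = {x \<in> gbranch a. gauss_map x \<in> gcyl w}"

definition gwords :: "nat => nat list set" where
  "gwords p = {w. length w = p \<and> (\<forall>a\<in>set w. 1 <= a)}"

lemma gcyl_subset: "gcyl w \<subseteq> {0<..<1}"
  by (cases w) (auto simp: gbranch_def)

lemma gcyl_measurable [measurable]: "gcyl w \<in> sets borel"
proof (induction w)
  case (Cons a w)
  have "gcyl (a # w) = gbranch a \<inter> gauss_map -` gcyl w" by auto
  moreover have "gauss_map -` gcyl w \<in> sets borel"
    using measurable_sets[OF gauss_map_measurable Cons] by simp
  ultimately show ?case by simp
qed simp

lemma gcyl_lam01: "gcyl w \<in> sets lam01"
  using gcyl_subset[of w] by (force simp: sets_lam01_iff)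

lemma gauss_map_gbranch_antimono: "x \<in> gbranch a ==> y \<in> gbranch a ==> x <= y ==> gauss_map y <= gauss_map x"
  unfolding gauss_map_branch by (intro diff_right_mono divide_left_mono) (auto simp: gbranch_def)

lemma gbranch_convex: "x \<in> gbranch a ==> y \<in> gbranch a ==> x <= z ==> z <= y ==> z \<in> gbranch a"
proof -
  assume *: "x \<in> gbranch a" "y \<in> gbranch a" "x <= z" "z <= y"
  then have "0 < x" "0 < z" by (auto simp: gbranch_def)
  then have "1 / y <= 1 / z" "1 / z <= 1 / x" using * by (auto intro: divide_left_mono)
  then have "\<lfloor>1 / y\<rfloor> <= \<lfloor>1 / z\<rfloor>" "\<lfloor>1 / z\<rfloor> <= \<lfloor>1 / x\<rfloor>" by (auto intro: floor_mono)
  then show ?thesis using * \<open>0 < z\<close> by (auto simp: gbranch_def)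
qed

lemma gcyl_convex: "x \<in> gcyl w ==> y \<in> gcyl w ==> x <= z ==> z <= y ==> z \<in> gcyl w"
proof (induction w arbitrary: x y z)
  case (Cons a w)
  have z: "z \<in> gbranch a" using gbranch_convex[of x a y z] Cons.prems by auto
  have "gauss_map z \<in> gcyl w"
  proof (rule Cons.IH[of "gauss_map y" "gauss_map x"])
    show "gauss_map y <= gauss_map z" "gauss_map z <= gauss_map x"
      using Cons.prems z gauss_map_gbranch_antimono[of z a y] gauss_map_gbranch_antimono[of x a z] by simp_all
  qed (use Cons.prems in simp_all)
  then show ?case using z by simp
qed auto

text \<open>Every branch is decreasing, so the direction alternates with the length of the word.
  Only monotonicity itself is needed later, hence the disjunction.\<close>

lemma gcyl_monotone:
  "(\<forall>x\<in>gcyl w. \<forall>y\<in>gcyl w. x <= y --> (gauss_map ^^ length w) x <= (gauss_map ^^ length w) y) \<or>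
   (\<forall>x\<in>gcyl w. \<forall>y\<in>gcyl w. x <= y --> (gauss_map ^^ length w) y <= (gauss_map ^^ length w) x)"
proof (induction w)
  case (Cons a w)
  have *: "gauss_map y <= gauss_map x" if "x \<in> gcyl (a # w)" "y \<in> gcyl (a # w)" "x <= y" for x y
    by (rule gauss_map_gbranch_antimono[of _ a]) (use that in auto)
  show ?case
    using Cons
  proof
    assume h: "\<forall>x\<in>gcyl w. \<forall>y\<in>gcyl w. x <= y --> (gauss_map ^^ length w) x <= (gauss_map ^^ length w) y"
    show ?thesis
    proof (intro disjI2 ballI impI)
      fix x y assume "x \<in> gcyl (a # w)" "y \<in> gcyl (a # w)" "x <= y"
      with *[OF this] h show "(gauss_map ^^ length (a # w)) y <= (gauss_map ^^ length (a # w)) x"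
        by (simp add: funpow_swap1)
    qed
  next
    assume h: "\<forall>x\<in>gcyl w. \<forall>y\<in>gcyl w. x <= y --> (gauss_map ^^ length w) y <= (gauss_map ^^ length w) x"
    show ?thesis
    proof (intro disjI1 ballI impI)
      fix x y assume "x \<in> gcyl (a # w)" "y \<in> gcyl (a # w)" "x <= y"
      with *[OF this] h show "(gauss_map ^^ length (a # w)) x <= (gauss_map ^^ length (a # w)) y"
        by (simp add: funpow_swap1)
    qed
  qed
qed auto

lemma gcyl_disjoint: "length v = length w ==> x \<in> gcyl v ==> x \<in> gcyl w ==> v = w"
proof (induction v w arbitrary: x rule: list_induct2)
  case (Cons a v b w)
  have "a = b" using Cons.prems by (simp add: gbranch_def)
  moreover have "v = w" using Cons.prems by (intro Cons.IH[of "gauss_map x"]) simp_all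
  ultimately show ?case by simp
qed simp

text \<open>Cylinders omit points whose orbit meets 0, since all iterates up to the length of the
  word have to lie in the open interval; by \<open>AE_gauss_orbit\<close> the omitted points form a
  null set.\<close>

lemma gcyl_cover:
  assumes "\<And>k. 0 < (gauss_map ^^ k) x \<and> (gauss_map ^^ k) x < 1"
  shows "\<exists>w\<in>gwords p. x \<in> gcyl w"
  using assms
proof (induction p arbitrary: x)
  case 0
  then show ?case using 0[of 0] by (auto simp: gwords_def)
next
  case (Suc p)
  have "0 < (gauss_map ^^ k) (gauss_map x) \<and> (gauss_map ^^ k) (gauss_map x) < 1" for k
    using Suc.prems[of "Suc k"] by (simp add: funpow_swap1)
  from Suc.IH[OF this] obtain w where w: "w \<in> gwords p" "gauss_map x \<in> gcyl w" by blast
  have "x \<in> {0<..<1}" using Suc.prems[of 0] by simp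
  then obtain k where k: "x \<in> gbranch (Suc k)" using gbranch_UN by blast
  then have "Suc k # w \<in> gwords (Suc p)" "x \<in> gcyl (Suc k # w)" using w by (auto simp: gwords_def)
  then show ?case by blast
qed

lemma lsum_Suc: "lsum (Suc n) x = - 2 * ln x + lsum n (gauss_map x)"
  unfolding lsum_def by (subst sum.lessThan_Suc_shift) (simp add: funpow_swap1)

text \<open>The inverse branches are Moebius maps; the weights \<open>1 / (\<alpha> + \<gamma> x)\<^sup>2\<close> form a class that is
  closed under them.\<close>
lemma gcyl_weight:
  assumes "w \<in> gwords p" "0 < \<alpha>" "0 <= \<gamma>" "\<gamma> <= \<alpha>"
  shows "\<exists>\<alpha>' \<gamma>'. 0 < \<alpha>' \<and> 0 <= \<gamma>' \<and> \<gamma>' <= \<alpha>' \<and>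
    (\<forall>\<psi>\<in>borel_measurable borel. (\<integral>\<^sup>+x. ennreal (1 / (\<alpha> + \<gamma> * x)\<^sup>2) * \<psi> ((gauss_map ^^ p) x) * indicator (gcyl w) x \<partial>lborel) =
       (\<integral>\<^sup>+t. ennreal (1 / (\<alpha>' + \<gamma>' * t)\<^sup>2) * \<psi> t * indicator {0<..<1} t \<partial>lborel)) \<and>
    (\<forall>x\<in>gcyl w. exp (- lsum p x) / (\<alpha> + \<gamma> * x)\<^sup>2 = 1 / (\<alpha>' + \<gamma>' * (gauss_map ^^ p) x)\<^sup>2)"
  using assms
proof (induction w arbitrary: p \<alpha> \<gamma>)
  case Nil
  then show ?case by (intro exI[of _ \<alpha>] exI[of _ \<gamma>]) (auto simp: gwords_def lsum_def)
next
  case (Cons a w)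
  obtain q where p: "p = Suc q" and w: "w \<in> gwords q" and a: "1 <= a"
    using Cons.prems(1) by (auto simp: gwords_def)
  \<comment> \<open>Composition with the branch of digit \<open>a\<close> sends
    \<open>(\<alpha>, \<gamma>)\<close> to \<open>(\<alpha> * a + \<gamma>, \<alpha>)\<close>. This
    is the recursion of continued fraction denominators; started at \<open>(1, 0)\<close> it
    produces two consecutive ones. The order \<open>\<gamma> <= \<alpha>\<close> survives because
    digits are at least 1.\<close>
  define \<alpha>1 where "\<alpha>1 = \<alpha> * real a + \<gamma>"
  have a1: "1 <= real a" using a by simp
  have "\<alpha> * 1 <= \<alpha> * real a" using a1 Cons.prems by (intro mult_left_mono) auto
  then have al: "0 < \<alpha>1" "\<alpha> <= \<alpha>1" using Cons.prems(2,3) unfolding \<alpha>1_def by linarith+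
  have key: "1 / (\<alpha> + \<gamma> * (1 / (real a + u)))\<^sup>2 * (1 / (real a + u)\<^sup>2) = 1 / (\<alpha>1 + \<alpha> * u)\<^sup>2" if "0 <= u" for u
  proof -
    have "(\<alpha> + \<gamma> * (1 / (real a + u))) * (real a + u) = \<alpha>1 + \<alpha> * u"
      using that a1 by (simp add: \<alpha>1_def field_simps)
    then show ?thesis by (simp add: power_mult_distrib[symmetric])
  qed
  from Cons.IH[OF w al(1) less_imp_le[OF Cons.prems(2)] al(2)] obtain \<alpha>' \<gamma>' where
    IH0: "0 < \<alpha>'" "0 <= \<gamma>'" "\<gamma>' <= \<alpha>'"
    "\<forall>\<psi>\<in>borel_measurable borel. (\<integral>\<^sup>+x. ennreal (1 / (\<alpha>1 + \<alpha> * x)\<^sup>2) * \<psi> ((gauss_map ^^ q) x) * indicator (gcyl w) x \<partial>lborel) =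
       (\<integral>\<^sup>+t. ennreal (1 / (\<alpha>' + \<gamma>' * t)\<^sup>2) * \<psi> t * indicator {0<..<1} t \<partial>lborel)"
    "\<forall>x\<in>gcyl w. exp (- lsum q x) / (\<alpha>1 + \<alpha> * x)\<^sup>2 = 1 / (\<alpha>' + \<gamma>' * (gauss_map ^^ q) x)\<^sup>2"
    by blast
  note IH = IH0(1-3) bspec[OF IH0(4)] bspec[OF IH0(5)]
  show ?case
  proof (rule exI[of _ \<alpha>'], rule exI[of _ \<gamma>'], intro conjI ballI IH0(1-3))
    fix \<psi> :: "real => ennreal" assume [measurable]: "borel_fun \<psi>"
    have "(\<integral>\<^sup>+x. ennreal (1 / (\<alpha> + \<gamma> * x)\<^sup>2) * \<psi> ((gauss_map ^^ p) x) * indicator (gcyl (a # w)) x \<partial>lborel) =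
       (\<integral>\<^sup>+x. ennreal (1 / (\<alpha> + \<gamma> * x)\<^sup>2) * (\<psi> ((gauss_map ^^ q) (gauss_map x)) * indicator (gcyl w) (gauss_map x)) * indicator (gbranch a) x \<partial>lborel)"
      by (intro nn_integral_cong) (auto simp: p funpow_swap1 indicator_def)
    also have "... = (\<integral>\<^sup>+u. ennreal (1 / (\<alpha> + \<gamma> * (1 / (real a + u)))\<^sup>2) * (\<psi> ((gauss_map ^^ q) u) * indicator (gcyl w) u) * ennreal (1 / (real a + u)\<^sup>2) * indicator {0<..<1} u \<partial>lborel)"
      by (rule nn_integral_gauss_branch[of "\<lambda>x. ennreal (1 / (\<alpha> + \<gamma> * x)\<^sup>2)" "\<lambda>u. \<psi> ((gauss_map ^^ q) u) * indicator (gcyl w) u", OF _ _ a]) measurable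
    also have "... = (\<integral>\<^sup>+x. ennreal (1 / (\<alpha>1 + \<alpha> * x)\<^sup>2) * \<psi> ((gauss_map ^^ q) x) * indicator (gcyl w) x \<partial>lborel)"
    proof (intro nn_integral_cong)
      fix u :: real
      show "ennreal (1 / (\<alpha> + \<gamma> * (1 / (real a + u)))\<^sup>2) * (\<psi> ((gauss_map ^^ q) u) * indicator (gcyl w) u) * ennreal (1 / (real a + u)\<^sup>2) * indicator {0<..<1} u
        = ennreal (1 / (\<alpha>1 + \<alpha> * u)\<^sup>2) * \<psi> ((gauss_map ^^ q) u) * indicator (gcyl w) u"
      proof (cases "u \<in> gcyl w")
        case True
        then have u: "u \<in> {0<..<1}" using gcyl_subset by blast
        have "ennreal (1 / (\<alpha> + \<gamma> * (1 / (real a + u)))\<^sup>2) * ennreal (1 / (real a + u)\<^sup>2) = ennreal (1 / (\<alpha>1 + \<alpha> * u)\<^sup>2)"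
          using key[of u] u by (subst ennreal_mult[symmetric]) auto
        note e = this
        have "ennreal (1 / (\<alpha> + \<gamma> * (1 / (real a + u)))\<^sup>2) * (\<psi> ((gauss_map ^^ q) u) * indicator (gcyl w) u) * ennreal (1 / (real a + u)\<^sup>2) * indicator {0<..<1} u
          = (ennreal (1 / (\<alpha> + \<gamma> * (1 / (real a + u)))\<^sup>2) * ennreal (1 / (real a + u)\<^sup>2)) * \<psi> ((gauss_map ^^ q) u) * indicator (gcyl w) u"
          using u by (simp only: indicator_simps mult_1_right mult_1_left mult_ac)
        then show ?thesis unfolding e .
      qed simp
    qed
    also have "... = (\<integral>\<^sup>+t. ennreal (1 / (\<alpha>' + \<gamma>' * t)\<^sup>2) * \<psi> t * indicator {0<..<1} t \<partial>lborel)"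
      by (rule IH) measurable
    finally show "(\<integral>\<^sup>+x. ennreal (1 / (\<alpha> + \<gamma> * x)\<^sup>2) * \<psi> ((gauss_map ^^ p) x) * indicator (gcyl (a # w)) x \<partial>lborel) =
       (\<integral>\<^sup>+t. ennreal (1 / (\<alpha>' + \<gamma>' * t)\<^sup>2) * \<psi> t * indicator {0<..<1} t \<partial>lborel)" .
  next
    fix x assume x: "x \<in> gcyl (a # w)"
    define u where "u = gauss_map x"
    have u: "u \<in> gcyl w" "0 < u" using x gcyl_subset[of w] by (auto simp: u_def)
    have x0: "0 < x" using x by (auto simp: gbranch_def)
    have "real a + u = 1 / x" using x gauss_map_branch[of x a] by (simp add: u_def)
    then have xu: "x = 1 / (real a + u)" by simp
    have "exp (- lsum p x) = x\<^sup>2 * exp (- lsum q u)"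
    proof -
      have "exp (2 * ln x) = x\<^sup>2" using x0 by (simp add: exp_of_nat_mult[of 2, simplified])
      moreover have "- lsum p x = 2 * ln x + (- lsum q u)" by (simp add: p lsum_Suc u_def)
      ultimately show ?thesis by (simp only: exp_add)
    qed
    then have "exp (- lsum p x) / (\<alpha> + \<gamma> * x)\<^sup>2 = exp (- lsum q u) * (1 / (\<alpha> + \<gamma> * (1 / (real a + u)))\<^sup>2 * (1 / (real a + u)\<^sup>2))"
      by (simp add: xu power_divide)
    also have "... = exp (- lsum q u) / (\<alpha>1 + \<alpha> * u)\<^sup>2"
      using key[of u] u by simp
    also have "... = 1 / (\<alpha>' + \<gamma>' * (gauss_map ^^ q) u)\<^sup>2"
      by (rule IH(5)[OF u(1)])
    finally show "exp (- lsum p x) / (\<alpha> + \<gamma> * x)\<^sup>2 = 1 / (\<alpha>' + \<gamma>' * (gauss_map ^^ p) x)\<^sup>2"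
      by (simp add: p u_def funpow_swap1)
  qed
qed

lemma lsum_pow_unit: "0 <= (gauss_map ^^ n) x \<and> (gauss_map ^^ n) x <= 1" if "x \<in> {0<..<1}"
  using that gauss_map_unit by (cases n) (auto intro: less_imp_le)

text \<open>Bounded distortion: the image of Lebesgue measure on a cylinder has the density
  \<open>1 / (\<alpha> + \<gamma> * t)^2\<close>, which varies by a factor of at most 4 since
  \<open>\<gamma> <= \<alpha>\<close>. The same expression gives \<open>exp (- lsum p x)\<close>, so
  length and derivative are comparable.\<close>

lemma gcyl_law:
  assumes w: "w \<in> gwords p"
  obtains \<alpha> \<gamma> where "0 < \<alpha>" "0 <= \<gamma>" "\<gamma> <= \<alpha>"
    "\<forall>\<psi>. borel_fun \<psi> --> (\<forall>x. \<bar>\<psi> x\<bar> <= (1::real)) --> (\<integral>x. indicator (gcyl w) x * \<psi> ((gauss_map ^^ p) x) \<partial>lborel) =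
       (\<integral>t. indicator {0<..<1} t * (\<psi> t / (\<alpha> + \<gamma> * t)\<^sup>2) \<partial>lborel)"
    "\<forall>x\<in>gcyl w. exp (- lsum p x) <= 1 / \<alpha>\<^sup>2 \<and> 1 / (4 * \<alpha>\<^sup>2) <= exp (- lsum p x)"
    "measure lam01 (gcyl w) <= 1 / \<alpha>\<^sup>2" "1 / (4 * \<alpha>\<^sup>2) <= measure lam01 (gcyl w)"
proof -
  from gcyl_weight[OF w zero_less_one order_refl zero_le_one] obtain \<alpha> \<gamma> where ag: "0 < \<alpha>" "0 <= \<gamma>" "\<gamma> <= \<alpha>" and
    nn0: "\<forall>\<psi>\<in>borel_measurable borel. (\<integral>\<^sup>+x. ennreal (1 / (1 + 0 * x)\<^sup>2) * \<psi> ((gauss_map ^^ p) x) * indicator (gcyl w) x \<partial>lborel) =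
       (\<integral>\<^sup>+t. ennreal (1 / (\<alpha> + \<gamma> * t)\<^sup>2) * \<psi> t * indicator {0<..<1} t \<partial>lborel)" and
    e0: "\<forall>x\<in>gcyl w. exp (- lsum p x) / (1 + 0 * x)\<^sup>2 = 1 / (\<alpha> + \<gamma> * (gauss_map ^^ p) x)\<^sup>2"
    by blast
  have nn: "(\<integral>\<^sup>+x. \<psi> ((gauss_map ^^ p) x) * indicator (gcyl w) x \<partial>lborel) =
       (\<integral>\<^sup>+t. ennreal (1 / (\<alpha> + \<gamma> * t)\<^sup>2) * \<psi> t * indicator {0<..<1} t \<partial>lborel)" if "borel_fun \<psi>" for \<psi>
    using bspec[OF nn0 that] by simp
  have e: "exp (- lsum p x) = 1 / (\<alpha> + \<gamma> * (gauss_map ^^ p) x)\<^sup>2" if "x \<in> gcyl w" for x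
    using bspec[OF e0 that] by simp
  have bnd: "1 / (\<alpha> + \<gamma> * t)\<^sup>2 <= 1 / \<alpha>\<^sup>2" "1 / (4 * \<alpha>\<^sup>2) <= 1 / (\<alpha> + \<gamma> * t)\<^sup>2" if "0 <= t" "t <= 1" for t
  proof -
    have g: "0 <= \<gamma> * t" "\<gamma> * t <= \<alpha>" using that ag mult_mono[of \<gamma> \<alpha> t 1] by auto
    show "1 / (\<alpha> + \<gamma> * t)\<^sup>2 <= 1 / \<alpha>\<^sup>2"
      using ag g by (intro divide_left_mono power_mono mult_pos_pos) auto
    have "(\<alpha> + \<gamma> * t)\<^sup>2 <= (2 * \<alpha>)\<^sup>2" using ag g by (intro power_mono) auto
    then show "1 / (4 * \<alpha>\<^sup>2) <= 1 / (\<alpha> + \<gamma> * t)\<^sup>2"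
      using ag g by (intro divide_left_mono mult_pos_pos) (auto simp: power_mult_distrib)
  qed
  have km: "borel_fun (\<lambda>t. 1 / (\<alpha> + \<gamma> * t)\<^sup>2)" by measurable
  have realint: "(\<integral>x. indicator (gcyl w) x * \<psi> ((gauss_map ^^ p) x) \<partial>lborel) =
       (\<integral>t. indicator {0<..<1} t * (\<psi> t / (\<alpha> + \<gamma> * t)\<^sup>2) \<partial>lborel)"
    if [measurable]: "borel_fun \<psi>" and nneg: "\<And>x. 0 <= \<psi> x" for \<psi> :: "real => real"
  proof -
    have "(\<integral>x. indicator (gcyl w) x * \<psi> ((gauss_map ^^ p) x) \<partial>lborel) = enn2real (\<integral>\<^sup>+x. ennreal (indicator (gcyl w) x * \<psi> ((gauss_map ^^ p) x)) \<partial>lborel)"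
    proof (rule integral_eq_nn_integral)
      show "(\<lambda>x. indicator (gcyl w) x * \<psi> ((gauss_map ^^ p) x)) \<in> borel_measurable lborel" by measurable
    qed (use nneg in auto)
    also have "(\<integral>\<^sup>+x. ennreal (indicator (gcyl w) x * \<psi> ((gauss_map ^^ p) x)) \<partial>lborel) = (\<integral>\<^sup>+x. ennreal (\<psi> ((gauss_map ^^ p) x)) * indicator (gcyl w) x \<partial>lborel)"
      by (intro nn_integral_cong) (auto simp: indicator_def)
    also have "... = (\<integral>\<^sup>+t. ennreal (1 / (\<alpha> + \<gamma> * t)\<^sup>2) * ennreal (\<psi> t) * indicator {0<..<1} t \<partial>lborel)"
      by (rule nn[of "\<lambda>x. ennreal (\<psi> x)"]) measurable
    also have "... = (\<integral>\<^sup>+t. ennreal (indicator {0<..<1} t * (\<psi> t / (\<alpha> + \<gamma> * t)\<^sup>2)) \<partial>lborel)"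
      using nneg by (intro nn_integral_cong) (auto simp: indicator_def ennreal_mult[symmetric])
    also have "enn2real ... = (\<integral>t. indicator {0<..<1} t * (\<psi> t / (\<alpha> + \<gamma> * t)\<^sup>2) \<partial>lborel)"
    proof (rule integral_eq_nn_integral[symmetric])
      show "(\<lambda>t. indicator {0<..<1} t * (\<psi> t / (\<alpha> + \<gamma> * t)\<^sup>2)) \<in> borel_measurable lborel" by measurable
    qed (use nneg in auto)
    finally show ?thesis .
  qed
  have one: "measure lam01 (gcyl w) = (\<integral>t. indicator {0<..<1} t * (1 / (\<alpha> + \<gamma> * t)\<^sup>2) \<partial>lborel)"
  proof -
    have "measure lam01 (gcyl w) = (E01 x. indicator (gcyl w) x)"
      using gcyl_lam01[of w] by (simp add: sets_lam01_iff Int_absorb2)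
    also have "... = (\<integral>x. indicator (gcyl w) x * 1 \<partial>lborel)"
      unfolding integral_lam01 using gcyl_subset[of w] by (intro Bochner_Integration.integral_cong) (auto simp: indicator_def)
    also have "... = (\<integral>t. indicator {0<..<1} t * (1 / (\<alpha> + \<gamma> * t)\<^sup>2) \<partial>lborel)"
      using realint[of "\<lambda>_. 1"] by simp
    finally show ?thesis .
  qed
  have ibd: "integrable lborel (\<lambda>t. indicator {0<..<1} t * (\<psi> t / (\<alpha> + \<gamma> * t)\<^sup>2))"
    if [measurable]: "borel_fun \<psi>" and b: "\<And>x. \<bar>\<psi> x\<bar> <= B" for \<psi> :: "real => real" and B
  proof (rule Bochner_Integration.integrable_bound)
    show "integrable lborel (\<lambda>t::real. indicator {0<..<1} t * (B / \<alpha>\<^sup>2))"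
      by (intro integrable_mult_left integrable_real_indicator) auto
    show "AE t in lborel. norm (indicator {0<..<1} t * (\<psi> t / (\<alpha> + \<gamma> * t)\<^sup>2)) <= norm (indicator {0<..<1} t * (B / \<alpha>\<^sup>2))"
    proof (rule AE_I2)
      fix t :: real
      have B: "0 <= B" using b[of 0] by linarith
      show "norm (indicator {0<..<1} t * (\<psi> t / (\<alpha> + \<gamma> * t)\<^sup>2)) <= norm (indicator {0<..<1} t * (B / \<alpha>\<^sup>2))"
      proof (cases "t \<in> {0<..<1}")
        case True
        have "\<bar>\<psi> t\<bar> * (1 / (\<alpha> + \<gamma> * t)\<^sup>2) <= B * (1 / \<alpha>\<^sup>2)"
          using b[of t] bnd(1)[of t] True B by (intro mult_mono) auto
        then show ?thesis using True B by (simp add: abs_mult abs_divide)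
      qed simp
    qed
  qed measurable
  show thesis
  proof (rule that[OF ag])
    show "\<forall>x\<in>gcyl w. exp (- lsum p x) <= 1 / \<alpha>\<^sup>2 \<and> 1 / (4 * \<alpha>\<^sup>2) <= exp (- lsum p x)"
    proof
      fix x assume x: "x \<in> gcyl w"
      then have "x \<in> {0<..<1}" using gcyl_subset by blast
      then show "exp (- lsum p x) <= 1 / \<alpha>\<^sup>2 \<and> 1 / (4 * \<alpha>\<^sup>2) <= exp (- lsum p x)"
        unfolding e[OF x] using bnd lsum_pow_unit[of x p] by blast
    qed
    have ind: "(\<integral>t. indicator {0<..<1::real} t * c \<partial>lborel) = c" for c :: real by simp
    have icon: "integrable lborel (\<lambda>t. indicator {0<..<1::real} t * c)" for c :: real
      by (intro integrable_mult_left integrable_real_indicator) auto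
    have "(\<integral>t. indicator {0<..<1} t * (1 / (\<alpha> + \<gamma> * t)\<^sup>2) \<partial>lborel) <= (\<integral>t. indicator {0<..<1::real} t * (1 / \<alpha>\<^sup>2) \<partial>lborel)"
      using ibd[of "\<lambda>_. 1" 1] bnd(1) by (intro integral_mono icon) (auto simp: indicator_def)
    then show "measure lam01 (gcyl w) <= 1 / \<alpha>\<^sup>2" unfolding one ind .
    have "(\<integral>t. indicator {0<..<1::real} t * (1 / (4 * \<alpha>\<^sup>2)) \<partial>lborel) <= (\<integral>t. indicator {0<..<1} t * (1 / (\<alpha> + \<gamma> * t)\<^sup>2) \<partial>lborel)"
      using ibd[of "\<lambda>_. 1" 1] bnd(2) by (intro integral_mono icon) (auto simp: indicator_def)
    then show "1 / (4 * \<alpha>\<^sup>2) <= measure lam01 (gcyl w)" unfolding one ind .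
    show "\<forall>\<psi>. borel_fun \<psi> --> (\<forall>x. \<bar>\<psi> x\<bar> <= (1::real)) --> (\<integral>x. indicator (gcyl w) x * \<psi> ((gauss_map ^^ p) x) \<partial>lborel) =
       (\<integral>t. indicator {0<..<1} t * (\<psi> t / (\<alpha> + \<gamma> * t)\<^sup>2) \<partial>lborel)"
    proof (intro allI impI)
      fix \<psi> :: "real => real" assume [measurable]: "borel_fun \<psi>" and b: "unit_bounded \<psi>"
      have "(\<integral>x. indicator (gcyl w) x * (\<psi> ((gauss_map ^^ p) x) + 1) \<partial>lborel) =
         (\<integral>t. indicator {0<..<1} t * ((\<psi> t + 1) / (\<alpha> + \<gamma> * t)\<^sup>2) \<partial>lborel)"
      proof (rule realint[of "\<lambda>x. \<psi> x + 1"])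
        show "0 <= \<psi> x + 1" for x using b[rule_format, of x] by linarith
      qed measurable
      moreover have "(\<integral>x. indicator (gcyl w) x * 1 \<partial>lborel) = (\<integral>t. indicator {0<..<1} t * (1 / (\<alpha> + \<gamma> * t)\<^sup>2) \<partial>lborel)"
        using realint[of "\<lambda>_. 1"] by simp
      moreover have "integrable lborel (\<lambda>x. indicator (gcyl w) x * \<psi> ((gauss_map ^^ p) x))"
      proof (rule Bochner_Integration.integrable_bound)
        show "integrable lborel (\<lambda>t. indicator {0<..<1::real} t * (1::real))" by (rule icon)
        show "AE x in lborel. norm (indicator (gcyl w) x * \<psi> ((gauss_map ^^ p) x)) <= norm (indicator {0<..<1} x * (1::real))"
          using gcyl_subset[of w] b by (intro AE_I2) (auto simp: indicator_def)
      qed measurable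
      moreover have "integrable lborel (\<lambda>x. indicator (gcyl w) x * (1::real))"
      proof (rule Bochner_Integration.integrable_bound)
        show "integrable lborel (\<lambda>t. indicator {0<..<1::real} t * (1::real))" by (rule icon)
        show "AE x in lborel. norm (indicator (gcyl w) x * (1::real)) <= norm (indicator {0<..<1} x * (1::real))"
          using gcyl_subset[of w] by (intro AE_I2) (auto simp: indicator_def)
      qed measurable
      moreover have "integrable lborel (\<lambda>t. indicator {0<..<1} t * (\<psi> t / (\<alpha> + \<gamma> * t)\<^sup>2))"
        using ibd[of \<psi> 1] b by simp
      moreover have "integrable lborel (\<lambda>t. indicator {0<..<1} t * (1 / (\<alpha> + \<gamma> * t)\<^sup>2))"
        using ibd[of "\<lambda>_. 1" 1] by simp
      ultimately show "(\<integral>x. indicator (gcyl w) x * \<psi> ((gauss_map ^^ p) x) \<partial>lborel) =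
         (\<integral>t. indicator {0<..<1} t * (\<psi> t / (\<alpha> + \<gamma> * t)\<^sup>2) \<partial>lborel)"
        by (simp add: distrib_left add_divide_distrib)
    qed
  qed
qed

text \<open>Relative to the Gauss measure the image density is
  \<open>c * (1 + t) / (1 + s * t)^2\<close>, which need not be monotone. It is split into
  \<open>h1\<close>, decreasing, and \<open>h2\<close>, increasing; each mixes with error
  \<open>2 ^ (- q)\<close>. The 8 is 2 for the two parts times 4 for the distortion in
  \<open>c <= 4 * measure lam01 (gcyl w)\<close>.\<close>

lemma gauss_branch_mixing:
  assumes w: "w \<in> gwords p" and g: "borel_fun g" "unit_bounded g"
  shows "\<bar>(\<integral>x. indicator (gcyl w) x * g ((gauss_map ^^ (p + q)) x) \<partial>lborel) - measure lam01 (gcyl w) * (\<integral>x. g x \<partial>muG)\<bar>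
     <= 8 / 2 ^ q * measure lam01 (gcyl w)"
proof -
  obtain \<alpha> \<gamma> where ag: "0 < \<alpha>" "0 <= \<gamma>" "\<gamma> <= \<alpha>" and
    law: "\<forall>\<psi>. borel_fun \<psi> --> (\<forall>x. \<bar>\<psi> x\<bar> <= (1::real)) --> (\<integral>x. indicator (gcyl w) x * \<psi> ((gauss_map ^^ p) x) \<partial>lborel) =
       (\<integral>t. indicator {0<..<1} t * (\<psi> t / (\<alpha> + \<gamma> * t)\<^sup>2) \<partial>lborel)" and
    lower: "1 / (4 * \<alpha>\<^sup>2) <= measure lam01 (gcyl w)"
    by (rule gcyl_law[OF w]) (rule that)
  \<comment> \<open>Clamping the argument to \<open>[0, 1]\<close> makes the bounds of
    \<open>h1\<close> and \<open>h2\<close> hold on the whole line, as \<open>ubnd\<close>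
    demands.\<close>
  define cl where "cl = (\<lambda>t::real. max 0 (min 1 t))"
  define s where "s = \<gamma> / \<alpha>"
  have s: "0 <= s" "s <= 1" using ag by (auto simp: s_def)
  define h1 where "h1 = (\<lambda>t. 1 / (1 + s * cl t)\<^sup>2)"
  define h2 where "h2 = (\<lambda>t. cl t / (1 + s * cl t)\<^sup>2)"
  have cl: "0 <= cl t" "cl t <= 1" for t by (auto simp: cl_def)
  have cl_id: "cl t = t" if "0 <= t" "t <= 1" for t using that by (auto simp: cl_def)
  have clm [measurable]: "borel_fun cl" unfolding cl_def by measurable
  have den: "1 <= (1 + s * cl t)\<^sup>2" for t using s cl[of t] by (intro one_le_power) auto
  have h1m [measurable]: "borel_fun h1" unfolding h1_def by measurable
  have h2m [measurable]: "borel_fun h2" unfolding h2_def by measurable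
  have inv_le: "1 / X <= 1" if "1 <= X" for X :: real using that by simp
  have h1b: "0 <= h1 t" "h1 t <= 1" for t
    using inv_le[OF den[of t]] unfolding h1_def by simp_all
  have h2e: "h2 t = cl t * h1 t" for t by (simp add: h1_def h2_def)
  have h2b: "0 <= h2 t" "h2 t <= 1" for t
    using h1b[of t] cl[of t] mult_mono[of "cl t" 1 "h1 t" 1] by (auto simp: h2e)
  have u1: "ubnd 1 h1" "ubnd 1 h2" using h1b h2b by (auto simp: ubnd_def)
  have m1: "monob 1 h1"
    unfolding monob_def
  proof (intro conjI disjI2 allI impI)
    show "h1 y <= h1 x" if "0 <= x" "x <= y" "y <= 1" for x y
    proof -
      have "0 < 1 + s * x" "0 < 1 + s * y" using that s by (auto intro!: add_pos_nonneg)
      moreover have "s * x <= s * y" using that s by (intro mult_left_mono) auto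
      ultimately have "1 / (1 + s * y)\<^sup>2 <= 1 / (1 + s * x)\<^sup>2"
        by (intro divide_left_mono power_mono mult_pos_pos zero_less_power) auto
      then show ?thesis using that by (simp add: h1_def cl_id)
    qed
    show "\<bar>h1 1 - h1 0\<bar> <= 1" using h1b[of 0] h1b[of 1] by linarith
  qed
  have m2: "monob 1 h2"
    unfolding monob_def
  proof (intro conjI disjI1 allI impI)
    fix x y :: real assume xy: "0 <= x" "x <= y" "y <= 1"
    have "s * s * (x * y) <= 1" using s xy by (intro mult_le_one mult_nonneg_nonneg) auto
    then have "0 <= (y - x) * (1 - s * s * (x * y))" using xy by (intro mult_nonneg_nonneg) auto
    then have "x * (1 + s * y)\<^sup>2 <= y * (1 + s * x)\<^sup>2" by (simp add: power2_eq_square algebra_simps)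
    moreover have "0 < (1 + s * x)\<^sup>2" "0 < (1 + s * y)\<^sup>2"
      using xy s by (auto intro!: zero_less_power add_pos_nonneg simp del: zero_less_power_eq_numeral zero_less_power2)
    ultimately show "h2 x <= h2 y" using xy by (simp add: h2_def cl_id pos_divide_le_eq pos_le_divide_eq mult.commute)
  next
    show "\<bar>h2 1 - h2 0\<bar> <= 1" using h2b[of 0] h2b[of 1] by linarith
  qed
  \<comment> \<open>The factor \<open>ln 2\<close> cancels the one in the Gauss density; the other
    factor \<open>1 + t\<close> is what \<open>h1 + h2\<close> supplies.\<close>
  define c where "c = ln 2 / \<alpha>\<^sup>2"
  have c: "0 <= c" "c <= 1 / \<alpha>\<^sup>2" using ln2_bounds ag by (auto simp: c_def divide_right_mono)
  have conv: "(\<integral>t. indicator {0<..<1} t * (\<psi> t / (\<alpha> + \<gamma> * t)\<^sup>2) \<partial>lborel) = c * ((\<integral>t. h1 t * \<psi> t \<partial>muG) + (\<integral>t. h2 t * \<psi> t \<partial>muG))"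
    if [measurable]: "borel_fun \<psi>" and b: "\<And>x. \<bar>\<psi> x\<bar> <= 1" for \<psi> :: "real => real"
  proof -
    have i: "integrable muG (\<lambda>t. h1 t * \<psi> t)" "integrable muG (\<lambda>t. h2 t * \<psi> t)"
      using h1b h2b b by (auto intro!: integrable_gauss_bounded[of _ 1] mult_le_one simp: abs_mult)
    have "c * ((\<integral>t. h1 t * \<psi> t \<partial>muG) + (\<integral>t. h2 t * \<psi> t \<partial>muG)) = (\<integral>t. c * (h1 t * \<psi> t + h2 t * \<psi> t) \<partial>muG)"
      using i by simp
    also have "... = (E01 t. gdens t * (c * (h1 t * \<psi> t + h2 t * \<psi> t)))"
      by (rule integral_gauss_lam01) (rule measurable_lam01I, measurable)
    also have "... = (\<integral>t. indicator {0..1} t * (gdens t * (c * (h1 t * \<psi> t + h2 t * \<psi> t))) \<partial>lborel)"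
      by (rule integral_lam01)
    also have "... = (\<integral>t. indicator {0<..<1} t * (\<psi> t / (\<alpha> + \<gamma> * t)\<^sup>2) \<partial>lborel)"
    proof (rule integral_cong_AE)
      show "AE t in lborel. indicator {0..1} t * (gdens t * (c * (h1 t * \<psi> t + h2 t * \<psi> t))) = indicator {0<..<1} t * (\<psi> t / (\<alpha> + \<gamma> * t)\<^sup>2)"
        using AE_lborel_neq[of 0] AE_lborel_neq[of 1]
      proof eventually_elim
        case (elim t)
        show ?case
        proof (cases "t \<in> {0<..<1}")
          case True
          then have t: "0 <= t" "t <= 1" by auto
          have l2: "ln (2::real) \<noteq> 0" using ln2_bounds by auto
          have "\<alpha> + \<gamma> * t = \<alpha> * (1 + s * t)" using ag by (simp add: s_def field_simps)
          then have k: "(\<alpha> + \<gamma> * t)\<^sup>2 = \<alpha>\<^sup>2 * (1 + s * t)\<^sup>2" by (simp add: power_mult_distrib)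
          have "gdens t * (c * (h1 t * \<psi> t + h2 t * \<psi> t)) = gdens t * (ln 2 * (1 + t)) * (\<psi> t / (\<alpha>\<^sup>2 * (1 + s * t)\<^sup>2))"
            unfolding c_def h1_def h2_def cl_id[OF t] by (simp add: divide_inverse algebra_simps)
          also have "gdens t * (ln 2 * (1 + t)) = 1" using t l2 by (simp add: gdens_def)
          finally show ?thesis using True by (simp add: k)
        qed (use elim in \<open>auto simp: indicator_def\<close>)
      qed
    qed measurable
    finally show ?thesis ..
  qed
  define G where "G = (\<lambda>x. g ((gauss_map ^^ q) x))"
  have G: "borel_fun G" "\<And>x. \<bar>G x\<bar> <= 1"
    using g by (auto simp: G_def intro: measurable_compose[OF gauss_map_pow_measurable])
  define m where "m = (\<integral>x. g x \<partial>muG)"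
  have m_one: "measure lam01 (gcyl w) = c * ((\<integral>t. h1 t \<partial>muG) + (\<integral>t. h2 t \<partial>muG))"
  proof -
    have "measure lam01 (gcyl w) = (E01 x. indicator (gcyl w) x)"
      using gcyl_lam01[of w] by (simp add: sets_lam01_iff Int_absorb2)
    also have "... = (\<integral>x. indicator (gcyl w) x * 1 \<partial>lborel)"
      unfolding integral_lam01 using gcyl_subset[of w] by (intro Bochner_Integration.integral_cong) (auto simp: indicator_def)
    also have "... = (\<integral>t. indicator {0<..<1} t * (1 / (\<alpha> + \<gamma> * t)\<^sup>2) \<partial>lborel)"
      using law[rule_format, of "\<lambda>_. 1"] by simp
    also have "... = c * ((\<integral>t. h1 t \<partial>muG) + (\<integral>t. h2 t \<partial>muG))"
      using conv[of "\<lambda>_. 1"] by simp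
    finally show ?thesis .
  qed
  have "(\<integral>x. indicator (gcyl w) x * g ((gauss_map ^^ (p + q)) x) \<partial>lborel) = (\<integral>x. indicator (gcyl w) x * G ((gauss_map ^^ p) x) \<partial>lborel)"
    by (simp add: G_def funpow_add add.commute[of p q])
  also have "... = c * ((\<integral>t. h1 t * G t \<partial>muG) + (\<integral>t. h2 t * G t \<partial>muG))"
    using law[rule_format, of G] conv[of G] G by simp
  finally have eq: "(\<integral>x. indicator (gcyl w) x * g ((gauss_map ^^ (p + q)) x) \<partial>lborel) - measure lam01 (gcyl w) * m =
     c * (((\<integral>t. h1 t * G t \<partial>muG) - (\<integral>t. h1 t \<partial>muG) * m) + ((\<integral>t. h2 t * G t \<partial>muG) - (\<integral>t. h2 t \<partial>muG) * m))"
    by (simp add: m_one algebra_simps)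
  have "\<bar>(\<integral>t. h1 t * G t \<partial>muG) - (\<integral>t. h1 t \<partial>muG) * m\<bar> <= 1 / 2 ^ q * 1"
    unfolding G_def m_def by (rule gauss_mixing_monob[OF u1(1) m1]) (use g in auto)
  moreover have "\<bar>(\<integral>t. h2 t * G t \<partial>muG) - (\<integral>t. h2 t \<partial>muG) * m\<bar> <= 1 / 2 ^ q * 1"
    unfolding G_def m_def by (rule gauss_mixing_monob[OF u1(2) m2]) (use g in auto)
  ultimately have "\<bar>((\<integral>t. h1 t * G t \<partial>muG) - (\<integral>t. h1 t \<partial>muG) * m) + ((\<integral>t. h2 t * G t \<partial>muG) - (\<integral>t. h2 t \<partial>muG) * m)\<bar> <= 2 / 2 ^ q"
    by linarith
  from mult_left_mono[OF this c(1)]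
  have "\<bar>(\<integral>x. indicator (gcyl w) x * g ((gauss_map ^^ (p + q)) x) \<partial>lborel) - measure lam01 (gcyl w) * m\<bar> <= c * (2 / 2 ^ q)"
    unfolding eq abs_mult abs_of_nonneg[OF c(1)] .
  also have "... <= (4 * measure lam01 (gcyl w)) * (2 / 2 ^ q)"
  proof (rule mult_right_mono)
    have "1 / \<alpha>\<^sup>2 <= 4 * measure lam01 (gcyl w)" using lower by simp
    then show "c <= 4 * measure lam01 (gcyl w)" using c by linarith
  qed simp
  finally show ?thesis by (simp add: m_def)
qed

section \<open>Equidistribution and speed of the Gauss map\<close>

definition lbad :: "nat => real => real set" where
  "lbad p d = {x \<in> {0..1}. d <= \<bar>lsum p x / real p - lyap\<bar>}"

lemma lbad_measurable: "lbad p d \<in> sets lam01"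
proof -
  have "lbad p d \<in> sets borel" unfolding lbad_def by measurable
  then show ?thesis by (auto simp: sets_lam01_iff lbad_def)
qed

lemma gcyl_measure:
  assumes w: "w \<in> gwords p" and x: "x \<in> gcyl w"
  shows "measure lam01 (gcyl w) <= 4 * exp (- lsum p x)" "exp (- lsum p x) <= 4 * measure lam01 (gcyl w)"
proof -
  obtain \<alpha> :: real where e: "\<forall>x\<in>gcyl w. exp (- lsum p x) <= 1 / \<alpha>\<^sup>2 \<and> 1 / (4 * \<alpha>\<^sup>2) <= exp (- lsum p x)"
    and m: "measure lam01 (gcyl w) <= 1 / \<alpha>\<^sup>2" "1 / (4 * \<alpha>\<^sup>2) <= measure lam01 (gcyl w)"
    by (rule gcyl_law[OF w]) (rule that)
  have e1: "exp (- lsum p x) <= 1 / \<alpha>\<^sup>2" "1 / (4 * \<alpha>\<^sup>2) <= exp (- lsum p x)" using e x by auto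
  have "1 / \<alpha>\<^sup>2 = 4 * (1 / (4 * \<alpha>\<^sup>2))" by simp
  then show "measure lam01 (gcyl w) <= 4 * exp (- lsum p x)" "exp (- lsum p x) <= 4 * measure lam01 (gcyl w)"
    using e1 m by linarith+
qed

text \<open>By bounded distortion a single point with a typical derivative determines the length of
  the whole cylinder up to the factor 4.\<close>

lemma gcyl_measure_good:
  assumes w: "w \<in> gwords p" and x: "x \<in> gcyl w" "x \<notin> lbad p d" and p: "0 < p"
  shows "measure lam01 (gcyl w) <= 4 * exp (- real p * (lyap - d))" "exp (- real p * (lyap + d)) <= 4 * measure lam01 (gcyl w)"
proof -
  have "x \<in> {0..1}" using x(1) gcyl_subset[of w] by auto
  then have "\<bar>lsum p x / real p - lyap\<bar> < d" using x(2) by (auto simp: lbad_def)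
  then have "real p * \<bar>lsum p x / real p - lyap\<bar> < real p * d" using p by simp
  moreover have "real p * \<bar>lsum p x / real p - lyap\<bar> = \<bar>lsum p x - real p * lyap\<bar>"
  proof -
    have "real p * (lsum p x / real p - lyap) = lsum p x - real p * lyap" using p by (simp add: right_diff_distrib)
    moreover have "real p * \<bar>lsum p x / real p - lyap\<bar> = \<bar>real p * (lsum p x / real p - lyap)\<bar>" by (simp add: abs_mult)
    ultimately show ?thesis by (simp only:)
  qed
  ultimately have "\<bar>lsum p x - real p * lyap\<bar> < real p * d" by simp
  then have "- lsum p x <= - real p * (lyap - d)" "- real p * (lyap + d) <= - lsum p x"
    by (auto simp: algebra_simps)
  then have "exp (- lsum p x) <= exp (- real p * (lyap - d))" "exp (- real p * (lyap + d)) <= exp (- lsum p x)"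
    by auto
  then show "measure lam01 (gcyl w) <= 4 * exp (- real p * (lyap - d))" "exp (- real p * (lyap + d)) <= 4 * measure lam01 (gcyl w)"
    using gcyl_measure[OF w x(1)] by linarith+
qed

lemma AE_lam01_orbit: "AE x in lam01. \<forall>k. 0 < (gauss_map ^^ k) x \<and> (gauss_map ^^ k) x < 1"
proof -
  have "AE x in lam01. 0 < ennreal (gdens x) --> (\<forall>k. 0 < (gauss_map ^^ k) x \<and> (gauss_map ^^ k) x < 1)"
    using AE_gauss_orbit measurable_lam01I[OF gdens_measurable] unfolding gauss_measure_gdens
    by (subst (asm) AE_density) auto
  with AE_space show ?thesis
    by eventually_elim (auto simp: gdens_pos)
qed

text \<open>The integral is summed over the countably many cylinders. Those without \<open>Q\<close>
  contribute at most \<open>c\<close> times their length, the others lie in \<open>E\<close> and are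
  estimated by the bound of \<open>F\<close>.\<close>

lemma gcyl_sum_bound:
  fixes F :: "real => real" and p :: nat
  assumes F: "fun01 F" "\<And>x. \<bar>F x\<bar> <= B" and c: "0 <= c"
    and hit: "\<And>w. w \<in> gwords p ==> \<not> Q w ==> \<bar>\<integral>x. indicator (gcyl w) x * F x \<partial>lam01\<bar> <= c * measure lam01 (gcyl w)"
    and E: "E \<in> sets lam01" "\<And>w. w \<in> gwords p ==> Q w ==> gcyl w \<subseteq> E"
  shows "\<bar>\<integral>x. F x \<partial>lam01\<bar> <= c + B * measure lam01 E"
proof -
  have B: "0 <= B" using F(2)[of 0] by linarith
  \<comment> \<open>Words are enumerated through \<open>from_nat\<close>; the condition on
    \<open>to_nat\<close> keeps one index per word, so that the sets are disjoint.\<close>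
  define A where "A = (\<lambda>i::nat. if from_nat i \<in> gwords p \<and> to_nat (from_nat i :: nat list) = i then gcyl (from_nat i) else {})"
  have A: "A i \<in> sets lam01" for i unfolding A_def using gcyl_lam01 by auto
  have disj: "A i \<inter> A j = {}" if "i \<noteq> j" for i j
  proof (rule ccontr)
    assume "A i \<inter> A j \<noteq> {}"
    then obtain x where x: "x \<in> A i" "x \<in> A j" by blast
    then have *: "from_nat i \<in> gwords p" "to_nat (from_nat i :: nat list) = i" "x \<in> gcyl (from_nat i)"
      "from_nat j \<in> gwords p" "to_nat (from_nat j :: nat list) = j" "x \<in> gcyl (from_nat j)"
      by (auto simp: A_def split: if_splits)
    then have "(from_nat i :: nat list) = from_nat j"
      by (intro gcyl_disjoint[of _ _ x]) (auto simp: gwords_def)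
    then show False using * that by metis
  qed
  have int: "integrable lam01 F" using F by (intro integrable_lam01_bounded[of _ B]) auto
  have UA: "(\<Union>i. A i) \<in> sets lam01" using A by auto
  have full: "AE x in lam01. x \<in> (\<Union>i. A i)"
    using AE_lam01_orbit
  proof eventually_elim
    case (elim x)
    then obtain w where w: "w \<in> gwords p" "x \<in> gcyl w" using gcyl_cover[of x p] by blast
    then have "x \<in> A (to_nat w)" by (simp add: A_def)
    then show ?case by blast
  qed
  have si: "set_integrable lam01 (\<Union>i. A i) F"
    unfolding set_integrable_def using UA int by (intro integrable_mult_indicator) auto
  have "(E01 x. F x) = (LINT x:(\<Union>i. A i)|lam01. F x)"
    unfolding set_lebesgue_integral_def
  proof (rule integral_cong_AE)
    show "AE x in lam01. F x = indicator (\<Union>i. A i) x *\<^sub>R F x" using full by eventually_elim simp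
  qed (use F UA in auto)
  also have "... = (\<Sum>i. LINT x:A i|lam01. F x)"
    by (rule lebesgue_integral_countable_add[OF A disj si])
  finally have tot: "(E01 x. F x) = (\<Sum>i. LINT x:A i|lam01. F x)" .
  have s1: "(\<lambda>i. measure lam01 (A i)) sums measure lam01 (\<Union>i. A i)"
    using A disj by (intro lam01.finite_measure_UNION) (auto simp: disjoint_family_on_def)
  have s2: "(\<lambda>i. measure lam01 (A i \<inter> E)) sums measure lam01 (\<Union>i. A i \<inter> E)"
    using A disj E(1) by (intro lam01.finite_measure_UNION) (auto simp: disjoint_family_on_def)
  have term_le: "\<bar>LINT x:A i|lam01. F x\<bar> <= c * measure lam01 (A i) + B * measure lam01 (A i \<inter> E)" for i
  proof (cases "from_nat i \<in> gwords p \<and> to_nat (from_nat i :: nat list) = i")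
    case False
    then have "A i = {}" by (auto simp: A_def)
    then show ?thesis by (simp add: set_lebesgue_integral_def)
  next
    case True
    then have Ai: "A i = gcyl (from_nat i)" by (simp add: A_def)
    have e: "(LINT x:A i|lam01. F x) = (E01 x. indicator (A i) x * F x)"
      by (simp add: set_lebesgue_integral_def)
    show ?thesis
    proof (cases "Q (from_nat i)")
      case False
      then show ?thesis using hit[of "from_nat i"] True B e Ai by (simp add: add_increasing2)
    next
      case Q: True
      then have "A i \<inter> E = A i" using E(2)[of "from_nat i"] True Ai by blast
      moreover have "\<bar>\<integral>x. indicator (A i) x * F x \<partial>lam01\<bar> <= B * measure lam01 (A i)"
      proof -
        have "\<bar>\<integral>x. indicator (A i) x * F x \<partial>lam01\<bar> <= (E01 x. \<bar>indicator (A i) x * F x\<bar>)"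
          by (rule integral_abs_bound)
        also have "... <= (E01 x. B * indicator (A i) x)"
        proof (rule integral_mono)
          show "integrable lam01 (\<lambda>x. \<bar>indicator (A i) x * F x\<bar>)"
            using integrable_mult_indicator[OF A int, of i] by (intro integrable_abs) simp
          show "integrable lam01 (\<lambda>x. B * indicator (A i) x)"
            using A[of i] by (intro integrable_mult_right integrable_real_indicator) (auto simp: lam01.emeasure_eq_measure)
          show "\<bar>indicator (A i) x * F x\<bar> <= B * indicator (A i) x" for x
            using F(2)[of x] by (auto simp: indicator_def)
        qed
        also have "... = B * measure lam01 (A i)"
          using A[of i] by (simp add: sets_lam01_iff Int_absorb2)
        finally show ?thesis .
      qed
      ultimately show ?thesis unfolding e using c by (simp add: add_increasing)
    qed
  qed
  have s3: "(\<lambda>i. c * measure lam01 (A i) + B * measure lam01 (A i \<inter> E)) sums (c * measure lam01 (\<Union>i. A i) + B * measure lam01 (\<Union>i. A i \<inter> E))"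
    by (intro sums_add sums_mult s1 s2)
  have "\<bar>\<Sum>i. LINT x:A i|lam01. F x\<bar> <= (\<Sum>i. c * measure lam01 (A i) + B * measure lam01 (A i \<inter> E))"
  proof -
    have sm: "summable (\<lambda>i. \<bar>LINT x:A i|lam01. F x\<bar>)"
      by (rule summable_comparison_test[OF _ sums_summable[OF s3]]) (use term_le in auto)
    have "\<bar>\<Sum>i. LINT x:A i|lam01. F x\<bar> <= (\<Sum>i. \<bar>LINT x:A i|lam01. F x\<bar>)" by (rule summable_rabs[OF sm])
    also have "... <= (\<Sum>i. c * measure lam01 (A i) + B * measure lam01 (A i \<inter> E))"
      by (rule suminf_le[OF term_le sm sums_summable[OF s3]])
    finally show ?thesis .
  qed
  also have "... = c * measure lam01 (\<Union>i. A i) + B * measure lam01 (\<Union>i. A i \<inter> E)"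
    using s3 by (simp add: sums_iff)
  also have "... <= c * 1 + B * measure lam01 E"
    using B c E(1) by (intro add_mono mult_left_mono lam01.prob_le_1 lam01.finite_measure_mono) auto
  finally show ?thesis unfolding tot by simp
qed

lemma gcyl_step_const:
  assumes "step S \<phi>" "gcyl w \<inter> S = {}" "x \<in> gcyl w" "y \<in> gcyl w"
  shows "\<phi> x = \<phi> y"
proof -
  have *: "\<phi> x = \<phi> y" if "x <= y" "x \<in> gcyl w" "y \<in> gcyl w" for x y
  proof (rule stepD[OF assms(1)])
    have "{x..y} \<subseteq> gcyl w"
    proof
      fix z assume "z \<in> {x..y}"
      then show "z \<in> gcyl w" using gcyl_convex[OF that(2,3), of z] by simp
    qed
    then show "{x..y} \<inter> S = {}" using assms(2) by blast
  qed (use that gcyl_subset[of w] in auto)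
  show ?thesis
  proof (cases "x <= y")
    case True
    then show ?thesis by (rule *[OF _ assms(3,4)])
  next
    case False
    then show ?thesis using *[OF _ assms(4,3)] by simp
  qed
qed

text \<open>A cylinder that contains a jump either lies entirely in the bad set or has a typical
  point and hence length at most \<open>4 * exp (- p * (lyap - d))\<close>. Cylinders of equal rank
  are disjoint, so each jump meets at most one of the second kind.\<close>

lemma gcyl_hit_measure:
  assumes S: "finite S" and p: "0 < p"
  obtains E where "E \<in> sets lam01" "\<forall>w\<in>gwords p. gcyl w \<inter> S \<noteq> {} --> gcyl w \<subseteq> E"
    "measure lam01 E <= measure lam01 (lbad p d) + real (card S) * (4 * exp (- real p * (lyap - d)))"
proof -
  define D where "D = (\<lambda>s. \<Union>{gcyl w | w. w \<in> gwords p \<and> s \<in> gcyl w \<and> \<not> gcyl w \<subseteq> lbad p d})"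
  have D: "D s \<in> sets lam01 \<and> measure lam01 (D s) <= 4 * exp (- real p * (lyap - d))" for s
  proof (cases "\<exists>w. w \<in> gwords p \<and> s \<in> gcyl w \<and> \<not> gcyl w \<subseteq> lbad p d")
    case True
    then obtain w where w: "w \<in> gwords p" "s \<in> gcyl w" "\<not> gcyl w \<subseteq> lbad p d" by blast
    have "v = w" if "v \<in> gwords p" "s \<in> gcyl v" for v
      using that w gcyl_disjoint[of v w s] by (auto simp: gwords_def)
    then have "{gcyl w | w. w \<in> gwords p \<and> s \<in> gcyl w \<and> \<not> gcyl w \<subseteq> lbad p d} = {gcyl w}" using w by blast
    then have "D s = gcyl w" by (simp add: D_def)
    moreover obtain x where x: "x \<in> gcyl w" "x \<notin> lbad p d" using w by blast
    ultimately show ?thesis using gcyl_measure_good(1)[OF w(1) x p] gcyl_lam01[of w] by simp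
  next
    case False
    then have "D s = {}" by (auto simp: D_def)
    then show ?thesis by simp
  qed
  define E where "E = lbad p d \<union> (\<Union>s\<in>S. D s)"
  show thesis
  proof (rule that[of E])
    show "E \<in> sets lam01" unfolding E_def using S D lbad_measurable by auto
    have "gcyl w \<subseteq> E" if hw: "w \<in> gwords p" "gcyl w \<inter> S \<noteq> {}" for w
    proof (cases "gcyl w \<subseteq> lbad p d")
      case True
      then show ?thesis by (auto simp: E_def)
    next
      case False
      obtain s where "s \<in> gcyl w" "s \<in> S" using hw by blast
      then have "gcyl w \<subseteq> D s" using False hw by (auto simp: D_def)
      then show ?thesis using \<open>s \<in> S\<close> by (auto simp: E_def)
    qed
    then show "\<forall>w\<in>gwords p. gcyl w \<inter> S \<noteq> {} --> gcyl w \<subseteq> E" by blast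
    have "measure lam01 E <= measure lam01 (lbad p d) + measure lam01 (\<Union>s\<in>S. D s)"
      unfolding E_def using S D lbad_measurable by (intro measure_Un_le) auto
    also have "measure lam01 (\<Union>s\<in>S. D s) <= (\<Sum>s\<in>S. measure lam01 (D s))"
      using S D by (intro measure_UNION_le) auto
    also have "... <= (\<Sum>s\<in>S. 4 * exp (- real p * (lyap - d)))" using D by (intro sum_mono) auto
    finally show "measure lam01 E <= measure lam01 (lbad p d) + real (card S) * (4 * exp (- real p * (lyap - d)))"
      by simp
  qed
qed

text \<open>On a cylinder without a jump \<open>\<phi>\<close> is constant and
  \<open>gauss_branch_mixing\<close> applies; the cylinders with a jump are lost, but have small
  total measure. Subtracting the mean \<open>m\<close> inside makes the comparison local to each
  cylinder, with a factor bounded by 2.\<close>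

lemma equidist_gauss_bound:
  assumes p: "0 < p" and S: "finite S" "step S \<phi>" and \<phi>: "borel_fun \<phi>" "unit_bounded \<phi>"
    and g: "borel_fun g" "unit_bounded g"
  shows "\<bar>(E01 x. \<phi> x * g ((gauss_map ^^ (p + q)) x)) - (E01 x. \<phi> x) * (\<integral>x. g x \<partial>muG)\<bar>
    <= 8 / 2 ^ q + 2 * measure lam01 (lbad p d) + 8 * real (card S) * exp (- real p * (lyap - d))"
proof -
  define m where "m = (\<integral>x. g x \<partial>muG)"
  have m1: "\<bar>m\<bar> <= 1"
    unfolding m_def using g measurable_gaussI[OF g(1)] by (intro abs_integral_le_1 prob_space_gauss) auto
  define F where "F = (\<lambda>x. \<phi> x * (g ((gauss_map ^^ (p + q)) x) - m))"
  have gm [measurable]: "borel_fun (\<lambda>x. g ((gauss_map ^^ (p + q)) x))"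
    by (rule measurable_compose[OF gauss_map_pow_measurable g(1)])
  have Zb: "\<bar>g y - m\<bar> <= 2" for y using g(2)[rule_format, of y] m1 by linarith
  have Fb: "\<bar>F x\<bar> <= 2" for x
    using mult_mono[OF \<phi>(2)[rule_format, of x] Zb] by (simp add: F_def abs_mult)
  have Fm: "fun01 F"
    unfolding F_def by (intro measurable_lam01I borel_measurable_times borel_measurable_diff gm \<phi>(1) borel_measurable_const)
  obtain E where E: "E \<in> sets lam01" "\<forall>w\<in>gwords p. gcyl w \<inter> S \<noteq> {} --> gcyl w \<subseteq> E"
    "measure lam01 E <= measure lam01 (lbad p d) + real (card S) * (4 * exp (- real p * (lyap - d)))"
    by (rule gcyl_hit_measure[OF S(1) p, of d])
  have "\<bar>\<integral>x. F x \<partial>lam01\<bar> <= 8 / 2 ^ q + 2 * measure lam01 E"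
  proof (rule gcyl_sum_bound[OF Fm Fb, where Q = "\<lambda>w. gcyl w \<inter> S \<noteq> {}"])
    fix w assume w: "w \<in> gwords p" "\<not> gcyl w \<inter> S \<noteq> {}"
    have "\<exists>c. (\<forall>x\<in>gcyl w. \<phi> x = c) \<and> \<bar>c\<bar> <= 1"
    proof (cases "gcyl w = {}")
      case True
      then show ?thesis by (intro exI[of _ 0]) auto
    next
      case False
      then obtain y where y: "y \<in> gcyl w" by blast
      show ?thesis
      proof (intro exI[of _ "\<phi> y"] conjI ballI)
        show "\<phi> x = \<phi> y" if "x \<in> gcyl w" for x
          by (rule gcyl_step_const[OF S(2) _ that y]) (use w(2) in simp)
      qed (use \<phi>(2) in simp)
    qed
    then obtain c where c0: "\<forall>x\<in>gcyl w. \<phi> x = c" "\<bar>c\<bar> <= 1" by blast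
    note c = bspec[OF c0(1)] c0(2)
    have i1: "integrable lam01 (\<lambda>x. indicator (gcyl w) x * g ((gauss_map ^^ (p + q)) x))"
    proof (rule integrable_lam01_bounded[of _ 1])
      show "\<bar>indicator (gcyl w) x * g ((gauss_map ^^ (p + q)) x)\<bar> <= 1" for x using g(2) by (auto simp: indicator_def)
      show "fun01 (\<lambda>x. indicator (gcyl w) x * g ((gauss_map ^^ (p + q)) x))"
        by (rule measurable_lam01I) measurable
    qed
    have i2: "integrable lam01 (\<lambda>x. indicator (gcyl w) x * m)"
      using gcyl_lam01[of w] by (intro integrable_mult_left integrable_real_indicator) (auto simp: lam01.emeasure_eq_measure)
    have "(E01 x. indicator (gcyl w) x * F x) = (E01 x. c * (indicator (gcyl w) x * g ((gauss_map ^^ (p + q)) x) - indicator (gcyl w) x * m))"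
      by (intro Bochner_Integration.integral_cong) (auto simp: F_def indicator_def c algebra_simps)
    also have "... = c * ((E01 x. indicator (gcyl w) x * g ((gauss_map ^^ (p + q)) x)) - (E01 x. indicator (gcyl w) x * m))"
      using i1 i2 by simp
    also have "(E01 x. indicator (gcyl w) x * m) = measure lam01 (gcyl w) * m"
      using gcyl_lam01[of w] by (simp add: sets_lam01_iff Int_absorb2)
    also have "(E01 x. indicator (gcyl w) x * g ((gauss_map ^^ (p + q)) x)) = (\<integral>x. indicator (gcyl w) x * g ((gauss_map ^^ (p + q)) x) \<partial>lborel)"
      unfolding integral_lam01 using gcyl_subset[of w] by (intro Bochner_Integration.integral_cong) (auto simp: indicator_def)
    finally have "\<bar>\<integral>x. indicator (gcyl w) x * F x \<partial>lam01\<bar> =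
        \<bar>c\<bar> * \<bar>(\<integral>x. indicator (gcyl w) x * g ((gauss_map ^^ (p + q)) x) \<partial>lborel) - measure lam01 (gcyl w) * m\<bar>"
      by (simp add: abs_mult)
    also have "... <= 1 * \<bar>(\<integral>x. indicator (gcyl w) x * g ((gauss_map ^^ (p + q)) x) \<partial>lborel) - measure lam01 (gcyl w) * m\<bar>"
      using c(2) by (intro mult_right_mono) auto
    also have "... <= 8 / 2 ^ q * measure lam01 (gcyl w)"
      using gauss_branch_mixing[OF w(1) g, of q] by (simp add: m_def)
    finally show "\<bar>\<integral>x. indicator (gcyl w) x * F x \<partial>lam01\<bar> <= 8 / 2 ^ q * measure lam01 (gcyl w)" .
  qed (use E in auto)
  moreover have "(E01 x. F x) = (E01 x. \<phi> x * g ((gauss_map ^^ (p + q)) x)) - (E01 x. \<phi> x) * m"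
  proof -
    have "integrable lam01 \<phi>" using \<phi> by (intro integrable_lam01_bounded[of _ 1] measurable_lam01I) auto
    moreover have "integrable lam01 (\<lambda>x. \<phi> x * g ((gauss_map ^^ (p + q)) x))"
    proof (rule integrable_lam01_bounded[of _ 1])
      show "\<bar>\<phi> x * g ((gauss_map ^^ (p + q)) x)\<bar> <= 1" for x
        using \<phi>(2) g(2) by (auto simp: abs_mult intro: mult_le_one)
      show "fun01 (\<lambda>x. \<phi> x * g ((gauss_map ^^ (p + q)) x))"
        by (intro measurable_lam01I borel_measurable_times gm \<phi>(1))
    qed
    ultimately show ?thesis by (simp add: F_def right_diff_distrib)
  qed
  ultimately show ?thesis using E(3) by (simp add: m_def)
qed

lemma equidist_gauss: "equidist lyap gauss_map muG"
proof (rule equidistI[OF lyap_pos])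
  fix h' assume h': "0 <= h'" "h' < lyap"
  define d where "d = lyap - h'"
  have d: "0 < d" using h' by (simp add: d_def)
  have bad: "(\<lambda>p. measure lam01 (lbad p d)) \<longlonglongrightarrow> 0" unfolding lbad_def by (rule lsum_in_measure[OF d])
  show "\<exists>\<rho> \<sigma> K. \<rho> \<longlonglongrightarrow> 0 \<and> \<sigma> \<longlonglongrightarrow> 0 \<and>
      (\<forall>p q \<phi> S g. finite S --> step S \<phi> --> borel_fun \<phi> --> unit_bounded \<phi> -->
        borel_fun g --> unit_bounded g -->
        \<bar>(E01 x. \<phi> x * g ((gauss_map ^^ (p + q)) x)) - (E01 x. \<phi> x) * (\<integral>x. g x \<partial>muG)\<bar>
          <= \<rho> q + \<sigma> p + K * real (card S) * exp (- real p * h'))"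
  \<comment> \<open>The cylinder estimate needs \<open>p > 0\<close>, where
    \<open>lsum p x / p\<close> makes sense. For \<open>p = 0\<close> the trivial bound 2 is put
    into \<open>\<sigma>\<close>, which does not affect its limit.\<close>
  proof (rule exI[of _ "\<lambda>q. 8 / 2 ^ q"], rule exI[of _ "\<lambda>p. (if p = 0 then 2 else 0) + 2 * measure lam01 (lbad p d)"], rule exI[of _ 8], intro conjI allI impI)
    have "(\<lambda>q. 8 * (1 / 2) ^ q :: real) \<longlonglongrightarrow> 8 * 0" by (intro tendsto_intros LIMSEQ_power_zero) auto
    then show "(\<lambda>q. 8 / 2 ^ q :: real) \<longlonglongrightarrow> 0" by (simp add: power_divide)
    have "(\<lambda>p. (if p = 0 then 2 else 0) + 2 * measure lam01 (lbad p d)) \<longlonglongrightarrow> 0 + 2 * 0"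
    proof (intro tendsto_intros bad)
      have "\<forall>\<^sub>F p in sequentially. (if p = (0::nat) then 2 else 0) = (0::real)"
        using eventually_gt_at_top[of "0::nat"] by eventually_elim auto
      then show "(\<lambda>p. if p = (0::nat) then 2 else (0::real)) \<longlonglongrightarrow> 0" by (rule tendsto_eventually)
    qed
    then show "(\<lambda>p. (if p = 0 then 2 else 0) + 2 * measure lam01 (lbad p d)) \<longlonglongrightarrow> 0" by simp
    fix p q \<phi> S and g :: "real => real"
    assume *: "finite S" "step S \<phi>" "borel_fun \<phi>" "unit_bounded \<phi>" "borel_fun g" "unit_bounded g"
    show "\<bar>(E01 x. \<phi> x * g ((gauss_map ^^ (p + q)) x)) - (E01 x. \<phi> x) * (\<integral>x. g x \<partial>muG)\<bar>
          <= 8 / 2 ^ q + ((if p = 0 then 2 else 0) + 2 * measure lam01 (lbad p d)) + 8 * real (card S) * exp (- real p * h')"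
    proof (cases "p = 0")
      case False
      then show ?thesis using equidist_gauss_bound[OF _ *, of p q d] by (simp add: d_def)
    next
      case True
      have "\<bar>\<integral>x. \<phi> x * g ((gauss_map ^^ (p + q)) x) \<partial>lam01\<bar> <= 1"
      proof (rule abs_integral_le_1[OF lam01.prob_space_axioms])
        show "\<forall>x. \<bar>\<phi> x * g ((gauss_map ^^ (p + q)) x)\<bar> <= 1" using * by (auto simp: abs_mult intro: mult_le_one)
        show "fun01 (\<lambda>x. \<phi> x * g ((gauss_map ^^ (p + q)) x))"
          using *(3) measurable_compose[OF gauss_map_pow_measurable *(5)] by (intro measurable_lam01I) measurable
      qed
      moreover have "\<bar>(E01 x. \<phi> x) * (\<integral>x. g x \<partial>muG)\<bar> <= 1"
        unfolding abs_mult using * by (intro mult_le_one abs_integral_le_1 lam01.prob_space_axioms prob_space_gauss)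
          (auto intro: measurable_lam01I measurable_gaussI)
      moreover have "0 <= 8 / 2 ^ q + 2 * measure lam01 (lbad p d) + 8 * real (card S) * exp (- real p * h')" by simp
      ultimately show ?thesis unfolding if_P[OF True] by linarith
    qed
  qed
qed

text \<open>Membership in an interval can change between \<open>x\<close> and \<open>y\<close> only
  at one of its end points. Infimum and supremum thus serve as jump points irrespective of which
  ends belong to the set.\<close>

lemma convex_boundary_hit:
  fixes A :: "real set"
  assumes conv: "\<And>x y z. x \<in> A ==> y \<in> A ==> x <= z ==> z <= y ==> z \<in> A" and bdd: "A \<subseteq> {0<..<1}"
    and xy: "x <= y" "{x..y} \<inter> {Inf A, Sup A} = {}"
  shows "x \<in> A \<longleftrightarrow> y \<in> A"
proof
  have bA: "bdd_above A" "bdd_below A" using bdd by (auto intro!: bdd_aboveI[of _ 1] bdd_belowI[of _ 0])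
  assume x: "x \<in> A"
  show "y \<in> A"
  proof (rule ccontr)
    assume y: "y \<notin> A"
    have "x <= Sup A" using x bA by (intro cSup_upper)
    moreover have "Sup A <= y"
    proof (rule cSup_least)
      fix c assume "c \<in> A"
      then show "c <= y" using conv[OF x _ xy(1), of c] y by (meson linear)
    qed (use x in auto)
    ultimately show False using xy(2) by auto
  qed
next
  have bA: "bdd_above A" "bdd_below A" using bdd by (auto intro!: bdd_aboveI[of _ 1] bdd_belowI[of _ 0])
  assume y: "y \<in> A"
  show "x \<in> A"
  proof (rule ccontr)
    assume x: "x \<notin> A"
    have "Inf A <= y" using y bA by (intro cInf_lower)
    moreover have "x <= Inf A"
    proof (rule cInf_greatest)
      fix c assume "c \<in> A"
      then show "x <= c" using conv[OF _ y _ xy(1), of c] x by (meson linear)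
    qed (use y in auto)
    ultimately show False using xy(2) by auto
  qed
qed

lemma one_over_quarter_inverse: "1 / (inverse E / 4) = 4 * (E :: real)"
  by (cases "E = 0") (simp_all add: field_simps)

text \<open>Cylinders not contained in the bad set have length at least about
  \<open>exp (- n * lyap)\<close>, so there are at most about \<open>exp (n * lyap)\<close> of them.
  The composition is kept on these and replaced by 0 elsewhere, that is, on the bad set up to a null
  set.\<close>

lemma slow_gauss: "slow lyap gauss_map"
  unfolding slow_def
proof (intro allI impI)
  fix g :: "real => real" and S and d e :: real
  assume g: "finite S" "step S g" "borel_fun g" "unit_bounded g" and de: "0 < d" "0 < e"
  \<comment> \<open>One half of \<open>d\<close> is spent on the deviation of the exponent, the
    other on the constant \<open>4 * (2 + 4 * card S)\<close>.\<close>
  define d2 where "d2 = d / 2"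
  have d2: "0 < d2" using de by (simp add: d2_def)
  have bad: "(\<lambda>p. measure lam01 (lbad p d2)) \<longlonglongrightarrow> 0" unfolding lbad_def by (rule lsum_in_measure[OF d2])
  have "\<forall>\<^sub>F n in sequentially. measure lam01 (lbad n d2) < e" using de by (intro order_tendstoD(2)[OF bad]) auto
  moreover have "\<forall>\<^sub>F n in sequentially. real (4 * (2 + 4 * card S)) <= exp (real n * d2)"
  proof -
    have "filterlim (\<lambda>n. exp (real n * d2)) at_top sequentially"
      using d2 by (intro filterlim_compose[OF exp_at_top] filterlim_at_top_mult_tendsto_pos[OF tendsto_const] filterlim_real_sequentially) auto
    then show ?thesis unfolding filterlim_at_top by blast
  qed
  moreover have "\<forall>\<^sub>F n in sequentially. 0 < n" by (rule eventually_gt_at_top)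
  ultimately show "\<forall>\<^sub>F n in sequentially. \<exists>\<phi> S'. finite S' \<and> step S' \<phi> \<and> borel_fun \<phi> \<and> unit_bounded \<phi> \<and>
        real (card S') <= exp (real n * (lyap + d)) \<and> (E01 x. \<bar>\<phi> x - g ((gauss_map ^^ n) x)\<bar>) <= e"
  proof eventually_elim
    case (elim n)
    define W where "W = {w \<in> gwords n. \<not> gcyl w \<subseteq> lbad n d2}"
    define b where "b = exp (- real n * (lyap + d2)) / 4"
    have b: "0 < b" by (simp add: b_def)
    have big: "b <= measure lam01 (gcyl w)" if wW: "w \<in> W" for w
    proof -
      obtain x where x: "x \<in> gcyl w" "x \<notin> lbad n d2" using wW by (auto simp: W_def)
      have "w \<in> gwords n" using wW by (simp add: W_def)
      from gcyl_measure_good(2)[OF this x elim(3)] show ?thesis by (simp add: b_def)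
    qed
    have card_le: "real (card V) <= 1 / b" if "V \<subseteq> W" "finite V" for V
    proof -
      have "real (card V) * b = (\<Sum>w\<in>V. b)" by simp
      also have "... <= (\<Sum>w\<in>V. measure lam01 (gcyl w))" using big that by (intro sum_mono) auto
      also have "... = measure lam01 (\<Union>w\<in>V. gcyl w)"
      proof (rule lam01.finite_measure_finite_Union[symmetric, OF that(2)])
        show "disjoint_family_on gcyl V"
          unfolding disjoint_family_on_def
        proof (intro ballI impI)
          fix v w assume vw: "v \<in> V" "w \<in> V" "v \<noteq> w"
          then have "length v = length w" using that(1) by (auto simp: W_def gwords_def)
          then show "gcyl v \<inter> gcyl w = {}" using gcyl_disjoint[of v w] vw(3) by blast
        qed
      qed (use gcyl_lam01 in auto)
      also have "... <= 1" by (rule lam01.prob_le_1)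
      finally show ?thesis using b by (simp add: field_simps)
    qed
    have finW: "finite W"
    proof (rule ccontr)
      assume "infinite W"
      then obtain V where V: "V \<subseteq> W" "finite V" "card V = nat \<lceil>1 / b\<rceil> + 1"
        using infinite_arbitrarily_large by blast
      have "1 / b < real (card V)" unfolding V(3) by linarith
      then show False using card_le[OF V(1,2)] by linarith
    qed
    \<comment> \<open>On a cylinder the iterate is monotone, so these one-sided level sets are
      intervals. Agreement of \<open>x\<close> and \<open>y\<close> on both sides of every
      \<open>s\<close> means that the iterate neither crosses nor leaves \<open>s\<close>. Each
      cylinder yields \<open>1 + 2 * card S\<close> intervals with two end points, hence the factor
      \<open>2 + 4 * card S\<close>.\<close>
    define C1 where "C1 = (\<lambda>w s. {x \<in> gcyl w. (gauss_map ^^ n) x <= s})"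
    define C2 where "C2 = (\<lambda>w s. {x \<in> gcyl w. s <= (gauss_map ^^ n) x})"
    define fam where "fam = gcyl ` W \<union> (\<lambda>(w, s). C1 w s) ` (W \<times> S) \<union> (\<lambda>(w, s). C2 w s) ` (W \<times> S)"
    define S' where "S' = Inf ` fam \<union> Sup ` fam"
    have fin: "finite fam" unfolding fam_def by (intro finite_UnI finite_imageI finite_cartesian_product finW g(1))
    have cf: "card fam <= card W + card W * card S + card W * card S"
    proof -
      have "card fam <= card (gcyl ` W \<union> (\<lambda>(w, s). C1 w s) ` (W \<times> S)) + card ((\<lambda>(w, s). C2 w s) ` (W \<times> S))"
        unfolding fam_def by (rule card_Un_le)
      also have "... <= card (gcyl ` W) + card ((\<lambda>(w, s). C1 w s) ` (W \<times> S)) + card ((\<lambda>(w, s). C2 w s) ` (W \<times> S))"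
        by (intro add_right_mono card_Un_le)
      also have "... <= card W + card (W \<times> S) + card (W \<times> S)"
        by (intro add_mono card_image_le finite_cartesian_product finW g(1))
      finally show ?thesis by (simp add: card_cartesian_product)
    qed
    have "card S' <= card (Inf ` fam) + card (Sup ` fam)" unfolding S'_def by (rule card_Un_le)
    also have "... <= card fam + card fam" by (intro add_mono card_image_le fin)
    also have "... <= 2 * (card W + card W * card S + card W * card S)"
      using add_mono[OF cf cf] by (simp only: mult_2)
    also have "... = card W * (2 + 4 * card S)"
    proof -
      have "2 * (a + a * c + a * c) = a * (2 + 4 * c)" for a c :: nat by (simp add: algebra_simps)
      then show ?thesis .
    qed
    finally have "real (card S') <= real (card W * (2 + 4 * card S))" by (simp only: of_nat_le_iff)
    also have "... = real (card W) * real (2 + 4 * card S)" by (rule of_nat_mult)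
    also have "... <= (1 / b) * real (2 + 4 * card S)" by (rule mult_right_mono[OF card_le[OF subset_refl finW]]) simp
    also have "... = exp (real n * (lyap + d2)) * real (4 * (2 + 4 * card S))"
    proof -
      define E where "E = exp (real n * (lyap + d2))"
      have b': "b = inverse E / 4" by (simp add: b_def E_def exp_minus)
      have A: "1 / b = 4 * E" unfolding b' by (rule one_over_quarter_inverse)
      have B: "real (4 * c) = 4 * real c" for c by simp
      show ?thesis unfolding E_def[symmetric] A B by (rule trans[OF mult.assoc mult.left_commute])
    qed
    also have "... <= exp (real n * (lyap + d2)) * exp (real n * d2)"
      by (rule mult_left_mono[OF elim(2)]) simp
    also have "... = exp (real n * (lyap + d))"
    proof -
      have "real n * (lyap + d2) + real n * d2 = real n * (lyap + d)" by (simp add: d2_def field_simps)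
      then show ?thesis by (simp only: exp_add[symmetric])
    qed
    finally have cardS: "real (card S') <= exp (real n * (lyap + d))" .
    define U where "U = (\<Union>w\<in>W. gcyl w)"
    have U: "U \<in> sets borel" unfolding U_def by (intro sets.finite_UN finW gcyl_measurable)
    define \<phi> where "\<phi> = (\<lambda>x. indicator U x * g ((gauss_map ^^ n) x))"
    have gm: "borel_fun (\<lambda>x. g ((gauss_map ^^ n) x))"
      by (rule measurable_compose[OF gauss_map_pow_measurable g(3)])
    have \<phi>m: "borel_fun \<phi>"
      unfolding \<phi>_def using U by (intro borel_measurable_times borel_measurable_indicator gm U)
    have conv: "z \<in> A" if A: "A \<in> fam" and xyz: "x \<in> A" "y \<in> A" "x <= z" "z <= y" for A x y z
    proof -
      have mon: "z \<in> gcyl w \<and> min ((gauss_map ^^ n) x) ((gauss_map ^^ n) y) <= (gauss_map ^^ n) z \<and>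
          (gauss_map ^^ n) z <= max ((gauss_map ^^ n) x) ((gauss_map ^^ n) y)"
        if w: "w \<in> W" "x \<in> gcyl w" "y \<in> gcyl w" for w
      proof -
        have zc: "z \<in> gcyl w" by (rule gcyl_convex[OF w(2,3) xyz(3,4)])
        have len: "length w = n" using w by (simp add: W_def gwords_def)
        from gcyl_monotone[of w]
        have "((gauss_map ^^ n) x <= (gauss_map ^^ n) z \<and> (gauss_map ^^ n) z <= (gauss_map ^^ n) y) \<or>
          ((gauss_map ^^ n) z <= (gauss_map ^^ n) x \<and> (gauss_map ^^ n) y <= (gauss_map ^^ n) z)"
          unfolding len using w(2,3) zc xyz(3,4) by blast
        then show ?thesis using zc by linarith
      qed
      from A consider w where "w \<in> W" "A = gcyl w" | w s where "w \<in> W" "A = C1 w s" | w s where "w \<in> W" "A = C2 w s"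
        unfolding fam_def by (elim UnE imageE SigmaE) auto
      then show ?thesis
      proof cases
        case (1 w)
        then show ?thesis using mon[of w] xyz by blast
      next
        case (2 w s)
        then have xy: "x \<in> gcyl w" "y \<in> gcyl w" "(gauss_map ^^ n) x <= s" "(gauss_map ^^ n) y <= s" using xyz by (auto simp: C1_def)
        then have "z \<in> gcyl w" "(gauss_map ^^ n) z <= s" using mon[OF 2(1) xy(1,2)] by linarith+
        then show ?thesis using 2(2) by (simp add: C1_def)
      next
        case (3 w s)
        then have xy: "x \<in> gcyl w" "y \<in> gcyl w" "s <= (gauss_map ^^ n) x" "s <= (gauss_map ^^ n) y" using xyz by (auto simp: C2_def)
        then have "z \<in> gcyl w" "s <= (gauss_map ^^ n) z" using mon[OF 3(1) xy(1,2)] by linarith+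
        then show ?thesis using 3(2) by (simp add: C2_def)
      qed
    qed
    have sub: "A \<subseteq> {0<..<1}" if "A \<in> fam" for A
    proof -
      from that obtain w where "A \<subseteq> gcyl w" unfolding fam_def C1_def C2_def by (elim UnE imageE SigmaE) auto
      then show ?thesis using gcyl_subset[of w] by (rule subset_trans)
    qed
    have same: "x \<in> A \<longleftrightarrow> y \<in> A" if A: "A \<in> fam" and xy: "x <= y" "{x..y} \<inter> S' = {}" for A x y
    proof (rule convex_boundary_hit[OF _ sub[OF A] xy(1)])
      show "c \<in> A" if "a \<in> A" "b \<in> A" "a <= c" "c <= b" for a b c by (rule conv[OF A that])
      have "Inf A \<in> S'" "Sup A \<in> S'" using A by (auto simp: S'_def)
      then show "{x..y} \<inter> {Inf A, Sup A} = {}" using xy(2) by blast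
    qed
    have "step S' \<phi>"
      unfolding step_def
    proof (intro allI impI)
      fix x y :: real assume xy: "0 <= x" "x <= y" "y < 1" "{x..y} \<inter> S' = {}"
      have sm: "x \<in> A \<longleftrightarrow> y \<in> A" if "A \<in> fam" for A using same[OF that xy(2,4)] .
      show "\<phi> x = \<phi> y"
      proof (cases "x \<in> U")
        case False
        have "y \<notin> U"
        proof
          assume "y \<in> U"
          then obtain w where "w \<in> W" "y \<in> gcyl w" by (auto simp: U_def)
          moreover have "gcyl w \<in> fam" using \<open>w \<in> W\<close> by (auto simp: fam_def)
          ultimately have "x \<in> U" using sm by (auto simp: U_def)
          then show False using False by simp
        qed
        then show ?thesis using False by (simp add: \<phi>_def)
      next
        case True
        then obtain w where w: "w \<in> W" "x \<in> gcyl w" by (auto simp: U_def)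
        have wf: "gcyl w \<in> fam" "\<And>s. s \<in> S ==> C1 w s \<in> fam" "\<And>s. s \<in> S ==> C2 w s \<in> fam"
          using w(1) by (auto simp: fam_def)
        have y: "y \<in> gcyl w" using sm[OF wf(1)] w by blast
        then have yU: "y \<in> U" using w(1) by (auto simp: U_def)
        define u where "u = (gauss_map ^^ n) x"
        define v where "v = (gauss_map ^^ n) y"
        have x01: "x \<in> {0<..<1}" "y \<in> {0<..<1}" using w(2) y gcyl_subset by blast+
        have u01: "0 <= u" "u < 1" "0 <= v" "v < 1"
          unfolding u_def v_def using x01 gauss_map_unit by (cases n; auto)+
        have "g u = g v"
        proof (rule ccontr)
          assume ne: "g u \<noteq> g v"
          have C: "x \<in> C1 w s \<longleftrightarrow> y \<in> C1 w s" "x \<in> C2 w s \<longleftrightarrow> y \<in> C2 w s" if "s \<in> S" for s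
            using sm[OF wf(2)[OF that]] sm[OF wf(3)[OF that]] by blast+
          have C': "u <= s \<longleftrightarrow> v <= s" "s <= u \<longleftrightarrow> s <= v" if "s \<in> S" for s
            using C[OF that] w(2) y by (auto simp: C1_def C2_def u_def v_def)
          consider "u <= v" | "v <= u" by linarith
          then show False
          proof cases
            case 1
            then have "{u..v} \<inter> S \<noteq> {}" using stepD[OF g(2) u01(1) 1 u01(4)] ne by blast
            then obtain s where "s \<in> S" "u <= s" "s <= v" by auto
            then have "u = v" using C'[of s] by linarith
            then show False using ne by simp
          next
            case 2
            then have "{v..u} \<inter> S \<noteq> {}" using stepD[OF g(2) u01(3) 2 u01(2)] ne by metis
            then obtain s where "s \<in> S" "v <= s" "s <= u" by auto
            then have "u = v" using C'[of s] by linarith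
            then show False using ne by simp
          qed
        qed
        then show ?thesis using True yU by (simp add: \<phi>_def u_def v_def)
      qed
    qed
    moreover have "(E01 x. \<bar>\<phi> x - g ((gauss_map ^^ n) x)\<bar>) <= e"
    proof -
      have "(E01 x. \<bar>\<phi> x - g ((gauss_map ^^ n) x)\<bar>) <= (E01 x. indicator (lbad n d2) x)"
      proof (rule integral_mono_AE)
        show "integrable lam01 (\<lambda>x. \<bar>\<phi> x - g ((gauss_map ^^ n) x)\<bar>)"
        proof (rule integrable_lam01_bounded[of _ 1])
          show "\<bar>\<bar>\<phi> x - g ((gauss_map ^^ n) x)\<bar>\<bar> <= 1" for x using g(4) by (auto simp: \<phi>_def indicator_def)
          show "fun01 (\<lambda>x. \<bar>\<phi> x - g ((gauss_map ^^ n) x)\<bar>)"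
            by (intro measurable_lam01I borel_measurable_abs borel_measurable_diff \<phi>m gm)
        qed
        show "integrable lam01 (indicator (lbad n d2) :: real => real)"
          using lbad_measurable by (intro integrable_real_indicator) (auto simp: lam01.emeasure_eq_measure)
        show "AE x in lam01. \<bar>\<phi> x - g ((gauss_map ^^ n) x)\<bar> <= indicator (lbad n d2) x"
          using AE_lam01_orbit
        proof eventually_elim
          case (elim x)
          then obtain w where w: "w \<in> gwords n" "x \<in> gcyl w" using gcyl_cover[of x n] by blast
          show ?case
          proof (cases "w \<in> W")
            case True
            then have "x \<in> U" using w by (auto simp: U_def)
            then show ?thesis by (simp add: \<phi>_def)
          next
            case False
            then have "x \<in> lbad n d2" using w by (auto simp: W_def)
            then show ?thesis using g(4) by (auto simp: \<phi>_def indicator_def)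
          qed
        qed
      qed
      also have "... = measure lam01 (lbad n d2)" using lbad_measurable[of n d2] by (simp add: sets_lam01_iff Int_absorb2)
      finally show ?thesis using elim(1) by linarith
    qed
    moreover have "finite S'" unfolding S'_def using fin by auto
    moreover have "unit_bounded \<phi>" using g(4) by (auto simp: \<phi>_def indicator_def)
    ultimately show ?case using cardS \<phi>m by blast
  qed
qed

section \<open>The mean ergodic theorem\<close>

lemma lam01_prob: "measure lam01 {0..1} = 1"
  using lam01.prob_space by simp

lemma funpow_comp: "(T ^^ d) ((T ^^ k) x) = (T ^^ (k + d)) x"
  by (metis add.commute comp_apply funpow_add)

text \<open>Shifting a window by one place exchanges only its two boundary terms, each of modulus at
  most 1.\<close>

lemma shift_sum_bound:
  fixes u :: "nat => real"
  assumes "\<And>k. \<bar>u k\<bar> <= 1"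
  shows "\<bar>(\<Sum>k\<in>{M..<N}. u (k + d)) - (\<Sum>k\<in>{M..<N}. u k)\<bar> <= 2 * real d"
proof (induction d)
  case (Suc d)
  have "\<bar>(\<Sum>k\<in>{M..<N}. u (Suc (k + d))) - (\<Sum>k\<in>{M..<N}. u (k + d))\<bar> <= 2"
  proof (cases "M <= N")
    case True
    have "(\<Sum>k\<in>{M..<N}. u (Suc (k + d)) - u (k + d)) = u (N + d) - u (M + d)"
      using sum_Suc_diff'[OF True, of "\<lambda>k. u (k + d)"] by simp
    then show ?thesis
      using assms[of "N + d"] assms[of "M + d"] by (simp add: sum_subtractf)
  qed simp
  then show ?case using Suc by simp
qed simp

lemma square_mean_le:
  fixes u :: "'i => real"
  assumes "finite I" "I \<noteq> {}"
  shows "((\<Sum>i\<in>I. u i) / real (card I))\<^sup>2 <= (\<Sum>i\<in>I. (u i)\<^sup>2) / real (card I)"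
proof -
  define c where "c = real (card I)"
  have c: "0 < c" using assms by (simp add: c_def card_gt_0_iff)
  define m where "m = (\<Sum>i\<in>I. u i) / c"
  have "0 <= (\<Sum>i\<in>I. (u i - m)\<^sup>2)" by (intro sum_nonneg) auto
  also have "... = (\<Sum>i\<in>I. (u i)\<^sup>2 - 2 * m * u i + m\<^sup>2)"
    by (rule sum.cong) (simp_all add: power2_eq_square algebra_simps)
  also have "... = (\<Sum>i\<in>I. (u i)\<^sup>2) - 2 * m * (\<Sum>i\<in>I. u i) + c * m\<^sup>2"
    by (simp only: sum.distrib sum_subtractf sum_distrib_left[symmetric] sum_constant c_def)
  also have "(\<Sum>i\<in>I. u i) = c * m" using c by (simp add: m_def)
  also have "(\<Sum>i\<in>I. (u i)\<^sup>2) - 2 * m * (c * m) + c * m\<^sup>2 = (\<Sum>i\<in>I. (u i)\<^sup>2) - c * m\<^sup>2"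
    by (simp add: power2_eq_square algebra_simps)
  finally have "c * m\<^sup>2 <= (\<Sum>i\<in>I. (u i)\<^sup>2)" by simp
  then show ?thesis using c by (simp add: m_def c_def[symmetric] field_simps)
qed

context
  fixes T :: "real => real" and f :: "real => real"
  assumes T: "invariant_measure lam01 T" and f: "fun01 f" "\<And>x. \<bar>f x\<bar> <= 1"
begin

definition avg :: "nat => real => real" where
  "avg D x = (\<Sum>d\<in>{0..<D}. f ((T ^^ d) x)) / real D"

lemma T_meas: "(T ^^ d) \<in> measurable lam01 lam01"
  using T by (intro measurable_funpow) (simp add: invariant_measure_def)

lemma f_pow_meas [measurable]: "fun01 (\<lambda>x. f ((T ^^ d) x))"
  by (rule measurable_compose[OF T_meas f(1)])

lemma avg_meas [measurable]: "avg D \<in> borel_measurable lam01"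
  unfolding avg_def by measurable

lemma avg_le_1: "\<bar>avg D x\<bar> <= 1"
proof -
  have "\<bar>\<Sum>d\<in>{0..<D}. f ((T ^^ d) x)\<bar> <= (\<Sum>d\<in>{0..<D}. 1)"
    by (intro order_trans[OF sum_abs] sum_mono f)
  then show ?thesis by (cases "D = 0") (auto simp: avg_def field_simps)
qed

lemma avg_bounded_int:
  assumes "fun01 g" "\<And>x. \<bar>g x\<bar> <= (B::real)" shows "integrable lam01 g"
  using assms by (intro integrable_lam01_bounded[of _ B])

text \<open>If averaging \<open>G\<close> along orbits reproduces \<open>avg N\<close> up to
  \<open>C / N\<close>, then by convexity of the square and invariance the norm of
  \<open>avg N\<close> is asymptotically at most that of \<open>G\<close>. It is applied to
  \<open>G = avg D\<close> and to midpoints of two averages.\<close>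

lemma avg_compare:
  assumes G: "fun01 G" "\<And>x. \<bar>G x\<bar> <= 1"
    and C: "\<And>N x. 0 < N ==> \<bar>(\<Sum>k\<in>{0..<N}. G ((T ^^ k) x)) / real N - avg N x\<bar> <= C / real N" and N: "0 < N"
  shows "(E01 x. (avg N x)\<^sup>2) <= (E01 x. (G x)\<^sup>2) + 2 * C / real N"
proof -
  define B where "B = (\<lambda>x. (\<Sum>k\<in>{0..<N}. G ((T ^^ k) x)) / real N)"
  have Gm [measurable]: "fun01 (\<lambda>x. G ((T ^^ d) x))" for d
    by (rule measurable_compose[OF T_meas G(1)])
  have B1: "\<bar>B x\<bar> <= 1" for x
  proof -
    have "\<bar>\<Sum>d\<in>{0..<N}. G ((T ^^ d) x)\<bar> <= (\<Sum>d\<in>{0..<N}. 1)"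
      by (intro order_trans[OF sum_abs] sum_mono G)
    then show ?thesis using N by (simp add: B_def field_simps)
  qed
  have sq: "\<bar>y\<bar> <= 1 ==> \<bar>y\<^sup>2\<bar> <= 1" for y :: real by (simp add: abs_square_le_1)
  have i: "integrable lam01 (\<lambda>x. (G ((T ^^ k) x))\<^sup>2)" for k
    by (rule avg_bounded_int[of _ 1]) (measurable, use sq G in blast)
  have "(E01 x. (avg N x)\<^sup>2) <= (E01 x. (\<Sum>k\<in>{0..<N}. (G ((T ^^ k) x))\<^sup>2) / real N + 2 * C / real N)"
  proof (rule integral_mono)
    show "integrable lam01 (\<lambda>x. (avg N x)\<^sup>2)"
      by (rule avg_bounded_int[of _ 1]) (measurable, use sq avg_le_1 in blast)
    show "integrable lam01 (\<lambda>x. (\<Sum>k\<in>{0..<N}. (G ((T ^^ k) x))\<^sup>2) / real N + 2 * C / real N)"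
      using i by auto
    fix x
    have "(avg N x)\<^sup>2 = (B x)\<^sup>2 + (avg N x - B x) * (avg N x + B x)" by (simp add: power2_eq_square algebra_simps)
    also have "(avg N x - B x) * (avg N x + B x) <= \<bar>avg N x - B x\<bar> * \<bar>avg N x + B x\<bar>"
      by (simp add: abs_mult[symmetric])
    also have "... <= C / real N * 2"
    proof (rule mult_mono)
      show "\<bar>avg N x - B x\<bar> <= C / real N"
        using C[OF N, of x] unfolding B_def by (subst abs_minus_commute)
      then show "0 <= C / real N" by (rule order_trans[OF abs_ge_zero])
      show "\<bar>avg N x + B x\<bar> <= 2" using avg_le_1[of N x] B1[of x] by linarith
    qed simp
    also have "(B x)\<^sup>2 <= (\<Sum>k\<in>{0..<N}. (G ((T ^^ k) x))\<^sup>2) / real N"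
      using square_mean_le[of "{0..<N}" "\<lambda>k. G ((T ^^ k) x)"] N by (simp add: B_def)
    finally show "(avg N x)\<^sup>2 <= (\<Sum>k\<in>{0..<N}. (G ((T ^^ k) x))\<^sup>2) / real N + 2 * C / real N" by (simp add: mult.commute)
  qed
  also have "... = (\<Sum>k\<in>{0..<N}. E01 x. (G ((T ^^ k) x))\<^sup>2) / real N + 2 * C / real N"
    using i by (simp add: lam01_prob)
  also have "(\<Sum>k\<in>{0..<N}. E01 x. (G ((T ^^ k) x))\<^sup>2) = (\<Sum>k\<in>{0..<N}. E01 x. (G x)\<^sup>2)"
    using integral_pow_invariant[OF T, of "\<lambda>x. (G x)\<^sup>2"] G(1) by (intro sum.cong) auto
  finally show ?thesis using N by simp
qed

text \<open>After interchanging the sums, the double average is a mean of \<open>D\<close> shifted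
  copies of the long average, each shifted by fewer than \<open>D\<close> places.\<close>

lemma avg_of_avg:
  assumes D: "0 < D" and N: "0 < N"
  shows "\<bar>(\<Sum>k\<in>{0..<N}. avg D ((T ^^ k) x)) / real N - avg N x\<bar> <= 2 * real D / real N"
proof -
  define u where "u = (\<lambda>k. f ((T ^^ k) x))"
  have u1: "\<bar>u k\<bar> <= 1" for k by (simp add: u_def f)
  have "(\<Sum>k\<in>{0..<N}. avg D ((T ^^ k) x)) = (\<Sum>k\<in>{0..<N}. (\<Sum>d\<in>{0..<D}. u (k + d)) / real D)"
    unfolding avg_def u_def by (simp add: funpow_comp)
  also have "... = (\<Sum>d\<in>{0..<D}. \<Sum>k\<in>{0..<N}. u (k + d)) / real D"
    by (subst sum.swap) (simp add: sum_divide_distrib)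
  finally have e: "(\<Sum>k\<in>{0..<N}. avg D ((T ^^ k) x)) - (\<Sum>k\<in>{0..<N}. u k) = (\<Sum>d\<in>{0..<D}. (\<Sum>k\<in>{0..<N}. u (k + d)) - (\<Sum>k\<in>{0..<N}. u k)) / real D"
    using D by (simp add: sum_subtractf field_simps)
  have "\<bar>\<Sum>d\<in>{0..<D}. (\<Sum>k\<in>{0..<N}. u (k + d)) - (\<Sum>k\<in>{0..<N}. u k)\<bar> <= (\<Sum>d\<in>{0..<D}. 2 * real D)"
  proof (intro order_trans[OF sum_abs] sum_mono)
    fix d assume "d \<in> {0..<D}"
    then show "\<bar>(\<Sum>k\<in>{0..<N}. u (k + d)) - (\<Sum>k\<in>{0..<N}. u k)\<bar> <= 2 * real D"
      using shift_sum_bound[of u d 0 N] u1 by (intro order_trans[OF shift_sum_bound[of u d 0 N]]) auto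
  qed
  then have "\<bar>(\<Sum>k\<in>{0..<N}. avg D ((T ^^ k) x)) - (\<Sum>k\<in>{0..<N}. u k)\<bar> <= 2 * real D"
    unfolding e using D by (simp add: abs_divide field_simps)
  then have "\<bar>(\<Sum>k\<in>{0..<N}. avg D ((T ^^ k) x)) - (\<Sum>k\<in>{0..<N}. u k)\<bar> / real N <= 2 * real D / real N"
    by (intro divide_right_mono) auto
  then show ?thesis
    using N by (simp add: avg_def u_def diff_divide_distrib[symmetric])
qed

text \<open>The minimal-norm proof of von Neumann's theorem: the squared norms of the averages
  converge to their infimum, midpoints of averages cannot fall below it either, and the
  parallelogram law then makes the averages a Cauchy sequence.\<close>

definition ainf :: real where "ainf = (INF D\<in>{1..}. E01 x. (avg D x)\<^sup>2)"

lemma avg_norm_ge: "1 <= D ==> ainf <= (E01 x. (avg D x)\<^sup>2)"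
  unfolding ainf_def by (rule cINF_lower) (auto intro!: bdd_belowI[of _ 0] integral_nonneg_AE)

lemma avg_norm_lim: "(\<lambda>D. E01 x. (avg D x)\<^sup>2) \<longlonglongrightarrow> ainf"
proof (rule order_tendstoI)
  fix a assume "a < ainf"
  then show "\<forall>\<^sub>F D in sequentially. a < (E01 x. (avg D x)\<^sup>2)"
    by (intro eventually_sequentiallyI[of 1] less_le_trans[OF _ avg_norm_ge])
next
  fix a assume a: "ainf < a"
  then obtain D where D: "1 <= D" "(E01 x. (avg D x)\<^sup>2) < a"
    unfolding ainf_def by (subst (asm) cINF_less_iff) (auto intro!: bdd_belowI[of _ 0] integral_nonneg_AE)
  have "(\<lambda>N. 2 * (2 * real D) / real N) \<longlonglongrightarrow> 0" by (rule lim_const_over_n)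
  then have "\<forall>\<^sub>F N in sequentially. 2 * (2 * real D) / real N < a - (E01 x. (avg D x)\<^sup>2)"
    using D by (intro order_tendstoD) auto
  then show "\<forall>\<^sub>F N in sequentially. (E01 x. (avg N x)\<^sup>2) < a"
    using eventually_gt_at_top[of 0]
  proof eventually_elim
    case (elim N)
    have "(E01 x. (avg N x)\<^sup>2) <= (E01 x. (avg D x)\<^sup>2) + 2 * (2 * real D) / real N"
      by (rule avg_compare[OF avg_meas avg_le_1 _ elim(2)]) (use avg_of_avg D in auto)
    then show ?case using elim by linarith
  qed
qed

lemma abs_midpoint_diff_le:
  fixes X :: real
  assumes "X = (p + q) / 2" "\<bar>p - A\<bar> <= P" "\<bar>q - A\<bar> <= Q" "E = (P + Q) / 2"
  shows "\<bar>X - A\<bar> <= E"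
  using assms unfolding abs_le_iff by (simp add: field_simps)

text \<open>Averaging the midpoint over a long orbit segment gives \<open>avg N\<close> up to
  \<open>(m + l) / N\<close>, so its squared norm is at least that of \<open>avg N\<close> minus a
  quantity tending to 0.\<close>

lemma avg_mid_ge:
  assumes "1 <= m" "1 <= l" shows "ainf <= (E01 x. ((avg m x + avg l x) / 2)\<^sup>2)"
proof (rule LIMSEQ_le_const2)
  define G where "G = (\<lambda>x. (avg m x + avg l x) / 2)"
  show "(\<lambda>N. ainf - 2 * (real m + real l) / real N) \<longlonglongrightarrow> ainf"
    using tendsto_diff[OF tendsto_const[of ainf] lim_const_over_n[of "2 * (real m + real l)"]] by simp
  show "\<exists>N0. \<forall>N\<ge>N0. ainf - 2 * (real m + real l) / real N <= (E01 x. ((avg m x + avg l x) / 2)\<^sup>2)"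
  proof (intro exI[of _ 1] allI impI)
    fix N :: nat assume N: "1 <= N"
    have "(E01 x. (avg N x)\<^sup>2) <= (E01 x. (G x)\<^sup>2) + 2 * (real m + real l) / real N"
    proof (rule avg_compare)
      show "fun01 G" unfolding G_def by measurable
      show "\<bar>G x\<bar> <= 1" for x using avg_le_1[of m x] avg_le_1[of l x] by (simp add: G_def)
      fix N :: nat and x assume N: "0 < N"
      define p where "p = (\<Sum>k\<in>{0..<N}. avg m ((T ^^ k) x)) / real N"
      define q where "q = (\<Sum>k\<in>{0..<N}. avg l ((T ^^ k) x)) / real N"
      have "(\<Sum>k\<in>{0..<N}. G ((T ^^ k) x)) = ((\<Sum>k\<in>{0..<N}. avg m ((T ^^ k) x)) + (\<Sum>k\<in>{0..<N}. avg l ((T ^^ k) x))) / 2"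
        unfolding G_def by (simp only: sum_divide_distrib[symmetric] sum.distrib)
      then have "(\<Sum>k\<in>{0..<N}. G ((T ^^ k) x)) / real N = (p + q) / 2"
        by (simp add: p_def q_def add_divide_distrib mult.commute)
      moreover have "\<bar>p - avg N x\<bar> <= 2 * real m / real N" "\<bar>q - avg N x\<bar> <= 2 * real l / real N"
        unfolding p_def q_def using assms N by (intro avg_of_avg; simp)+
      moreover have "(real m + real l) / real N = (2 * real m / real N + 2 * real l / real N) / 2"
        by (simp add: add_divide_distrib)
      ultimately show "\<bar>(\<Sum>k\<in>{0..<N}. G ((T ^^ k) x)) / real N - avg N x\<bar> <= (real m + real l) / real N"
        by (rule abs_midpoint_diff_le)
    qed (use N in simp)
    then show "ainf - 2 * (real m + real l) / real N <= (E01 x. ((avg m x + avg l x) / 2)\<^sup>2)"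
      using avg_norm_ge[OF N] by (simp add: G_def)
  qed
qed

text \<open>The parallelogram law: two squared norms below \<open>ainf + e / 4\<close> and a
  midpoint not below \<open>ainf\<close> leave at most \<open>e\<close> for the difference.\<close>

lemma avg_cauchy:
  assumes "0 < e"
  shows "\<exists>K. \<forall>m\<ge>K. \<forall>l\<ge>K. (E01 x. (avg m x - avg l x)\<^sup>2) <= e"
proof -
  have "\<forall>\<^sub>F D in sequentially. (E01 x. (avg D x)\<^sup>2) < ainf + e / 4"
    using assms by (intro order_tendstoD(2)[OF avg_norm_lim]) auto
  then obtain K0 where K0: "\<And>D. K0 <= D ==> (E01 x. (avg D x)\<^sup>2) < ainf + e / 4"
    by (auto simp: eventually_sequentially)
  have sq: "\<bar>y\<bar> <= 1 ==> \<bar>y\<^sup>2\<bar> <= 1" for y :: real by (simp add: abs_square_le_1)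
  have i: "integrable lam01 (\<lambda>x. (avg m x)\<^sup>2)" for m
    by (rule avg_bounded_int[of _ 1]) (measurable, use sq avg_le_1 in blast)
  have j: "integrable lam01 (\<lambda>x. ((avg m x + avg l x) / 2)\<^sup>2)" for m l
  proof (rule avg_bounded_int[of _ 1])
    show "\<bar>((avg m x + avg l x) / 2)\<^sup>2\<bar> <= 1" for x
      using avg_le_1[of m x] avg_le_1[of l x] by (intro sq) (auto simp: abs_le_iff)
  qed measurable
  show ?thesis
  proof (intro exI[of _ "max 1 K0"] allI impI)
    fix m l assume ml: "max 1 K0 <= m" "max 1 K0 <= l"
    have "(E01 x. (avg m x - avg l x)\<^sup>2) = (E01 x. 2 * (avg m x)\<^sup>2 + 2 * (avg l x)\<^sup>2 - 4 * ((avg m x + avg l x) / 2)\<^sup>2)"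
      by (intro Bochner_Integration.integral_cong) (auto simp: power2_eq_square field_simps)
    also have "... = 2 * (E01 x. (avg m x)\<^sup>2) + 2 * (E01 x. (avg l x)\<^sup>2) - 4 * (E01 x. ((avg m x + avg l x) / 2)\<^sup>2)"
      using i[of m] i[of l] j[of m l] by simp
    also have "... <= e" using K0[of m] K0[of l] avg_mid_ge[of m l] ml by simp
    finally show "(E01 x. (avg m x - avg l x)\<^sup>2) <= e" .
  qed
qed

lemma avg_T:
  assumes "0 < D" shows "\<bar>avg D (T x) - avg D x\<bar> <= 2 / real D"
proof -
  define u where "u = (\<lambda>k. f ((T ^^ k) x))"
  have "\<bar>(\<Sum>k\<in>{0..<D}. u (k + 1)) - (\<Sum>k\<in>{0..<D}. u k)\<bar> <= 2 * real 1"
    by (rule shift_sum_bound) (simp add: u_def f)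
  moreover have "avg D (T x) = (\<Sum>k\<in>{0..<D}. u (k + 1)) / real D"
    by (simp add: avg_def u_def funpow_swap1)
  moreover have "avg D x = (\<Sum>k\<in>{0..<D}. u k) / real D" by (simp add: avg_def u_def)
  ultimately show ?thesis
    using assms by (simp add: diff_divide_distrib[symmetric] abs_divide divide_right_mono)
qed

lemma integral_avg: "0 < D ==> (E01 x. avg D x) = (E01 x. f x)"
proof -
  assume D: "0 < D"
  have "integrable lam01 (\<lambda>x. f ((T ^^ d) x))" for d
    by (rule avg_bounded_int[of _ 1]) (use f in auto)
  then have "(E01 x. avg D x) = (\<Sum>d\<in>{0..<D}. E01 x. f ((T ^^ d) x)) / real D"
    unfolding avg_def by simp
  then show ?thesis using D integral_pow_invariant[OF T f(1)] by simp
qed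

text \<open>Along a fast subsequence the averages converge almost everywhere. The limit is
  invariant, hence constant by ergodicity, and the constant is the mean of \<open>f\<close>. Only
  the limit of the squared norms is used later, and it exists already along the full
  sequence.\<close>

theorem mean_ergodic:
  assumes erg: "ergodic_wrt lam01 T"
  shows "(\<lambda>D. E01 x. (avg D x)\<^sup>2) \<longlonglongrightarrow> (E01 x. f x)\<^sup>2"
proof -
  have "\<exists>K. \<forall>m\<ge>K. \<forall>l\<ge>K. (E01 x. (avg m x - avg l x)\<^sup>2) <= (1 / 4) ^ j" for j :: nat
    by (rule avg_cauchy) simp
  then obtain K where K: "\<And>j m l. K j <= m ==> K j <= l ==> (E01 x. (avg m x - avg l x)\<^sup>2) <= (1 / 4) ^ j" by metis
  \<comment> \<open>The sum makes both \<open>N j\<close> and \<open>N (Suc j)\<close> at least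
    \<open>K j\<close>, and the summand \<open>Suc j\<close> forces \<open>N\<close> to
    infinity.\<close>
  define N where "N = (\<lambda>j. Suc j + (\<Sum>i\<le>j. K i))"
  have NK: "K j <= N j" "K j <= N (Suc j)" "j < N j" for j
  proof -
    have "K j <= (\<Sum>i\<le>j. K i)" by (rule member_le_sum) auto
    then show "K j <= N j" "K j <= N (Suc j)" "j < N j" by (auto simp: N_def)
  qed
  define G where "G = (\<lambda>j x. avg (N j) x)"
  have Gm [measurable]: "G j \<in> borel_measurable lam01" for j unfolding G_def by measurable
  have G1: "\<bar>G j x\<bar> <= 1" for j x unfolding G_def by (rule avg_le_1)
  have sq: "\<bar>y\<bar> <= 2 ==> \<bar>y\<^sup>2\<bar> <= 4" for y :: real
    using power_mono[of "\<bar>y\<bar>" 2 2] by simp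
  have step: "(E01 x. \<bar>G (Suc j) x - G j x\<bar>) <= (1 / 2) ^ j" for j
  proof -
    define t :: real where "t = (1 / 2) ^ j"
    have t: "0 < t" by (simp add: t_def)
    have iq: "integrable lam01 (\<lambda>x. (G (Suc j) x - G j x)\<^sup>2)"
    proof (rule avg_bounded_int[of _ 4])
      show "\<bar>(G (Suc j) x - G j x)\<^sup>2\<bar> <= 4" for x using G1[of j x] G1[of "Suc j" x] by (intro sq) linarith
    qed measurable
    \<comment> \<open>From L2 to L1 by \<open>y <= y^2 / (2 * t) + t / 2\<close> with
      \<open>t = 2 ^ (- j)\<close>, the square root of the L2 bound; the result is summable.\<close>
    have "(E01 x. \<bar>G (Suc j) x - G j x\<bar>) <= (E01 x. (1 / (2 * t)) * (G (Suc j) x - G j x)\<^sup>2 + t / 2)"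
    proof (rule integral_mono)
      show "integrable lam01 (\<lambda>x. \<bar>G (Suc j) x - G j x\<bar>)"
        by (intro integrable_abs Bochner_Integration.integrable_diff avg_bounded_int[OF Gm G1])
      show "integrable lam01 (\<lambda>x. (1 / (2 * t)) * (G (Suc j) x - G j x)\<^sup>2 + t / 2)" using iq by auto
      fix x
      define y where "y = \<bar>G (Suc j) x - G j x\<bar>"
      have "0 <= (y - t)\<^sup>2" by simp
      then have "2 * t * y <= y\<^sup>2 + t * t" by (simp add: power2_eq_square algebra_simps)
      then have "y <= (y\<^sup>2 + t * t) / (2 * t)" using t by (simp add: pos_le_divide_eq mult_ac)
      also have "... = (1 / (2 * t)) * y\<^sup>2 + t / 2" using t by (simp add: add_divide_distrib)
      finally show "\<bar>G (Suc j) x - G j x\<bar> <= (1 / (2 * t)) * (G (Suc j) x - G j x)\<^sup>2 + t / 2" by (simp add: y_def)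
    qed
    also have "... = (1 / (2 * t)) * (E01 x. (G (Suc j) x - G j x)\<^sup>2) + t / 2"
      using iq by (simp add: lam01_prob)
    also have "... <= (1 / (2 * t)) * (1 / 4) ^ j + t / 2"
      using K[OF NK(2) NK(1), of j] t unfolding G_def by (intro add_right_mono mult_left_mono) auto
    also have "(1 / 4 :: real) ^ j = t * t" unfolding t_def power_mult_distrib[symmetric] by simp
    also have "(1 / (2 * t)) * (t * t) + t / 2 = t" using t by simp
    finally show ?thesis by (simp add: t_def)
  qed
  have "(\<integral>\<^sup>+x. (\<Sum>j. ennreal \<bar>G (Suc j) x - G j x\<bar>) \<partial>lam01) = (\<Sum>j. \<integral>\<^sup>+x. ennreal \<bar>G (Suc j) x - G j x\<bar> \<partial>lam01)"
    by (rule nn_integral_suminf) measurable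
  also have "... <= (\<Sum>j. ennreal ((1 / 2) ^ j))"
  proof (intro suminf_le allI)
    fix j
    have "integrable lam01 (\<lambda>x. \<bar>G (Suc j) x - G j x\<bar>)"
      by (intro integrable_abs Bochner_Integration.integrable_diff avg_bounded_int[OF Gm G1])
    then have "(\<integral>\<^sup>+x. ennreal \<bar>G (Suc j) x - G j x\<bar> \<partial>lam01) = ennreal (E01 x. \<bar>G (Suc j) x - G j x\<bar>)"
      by (intro nn_integral_eq_integral) auto
    then show "(\<integral>\<^sup>+x. ennreal \<bar>G (Suc j) x - G j x\<bar> \<partial>lam01) <= ennreal ((1 / 2) ^ j)"
      using step[of j] by (simp add: ennreal_leI)
  qed auto
  also have "... = ennreal (\<Sum>j. (1 / 2) ^ j)"
    by (rule suminf_ennreal2) (auto intro: summable_geometric)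
  also have "... < \<infinity>" by simp
  finally have "(\<integral>\<^sup>+x. (\<Sum>j. ennreal \<bar>G (Suc j) x - G j x\<bar>) \<partial>lam01) \<noteq> \<infinity>" by simp
  then have "AE x in lam01. (\<Sum>j. ennreal \<bar>G (Suc j) x - G j x\<bar>) \<noteq> \<infinity>"
    by (intro nn_integral_PInf_AE) measurable
  then have conv: "AE x in lam01. convergent (\<lambda>j. G j x)"
  proof eventually_elim
    case (elim x)
    have "summable (\<lambda>j. \<bar>G (Suc j) x - G j x\<bar>)"
      by (rule summable_suminf_not_top) (use elim in auto)
    then have "summable (\<lambda>j. G (Suc j) x - G j x)" by (rule summable_rabs_cancel)
    then have "convergent (\<lambda>n. \<Sum>j<n. G (Suc j) x - G j x)" by (simp only: summable_iff_convergent)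
    then have "convergent (\<lambda>n. (\<Sum>j<n. G (Suc j) x - G j x) + G 0 x)"
      by (intro convergent_add convergent_const)
    also have "(\<lambda>n. (\<Sum>j<n. G (Suc j) x - G j x) + G 0 x) = (\<lambda>n. G n x)"
      by (rule ext) (simp add: sum_lessThan_telescope[of "\<lambda>j. G j x"])
    finally show ?case .
  qed
  define g where "g = (\<lambda>x. lim (\<lambda>j. G j x))"
  have gm: "fun01 g" unfolding g_def by (rule borel_measurable_lim_metric) measurable
  \<comment> \<open>Invariance has to hold at every point, since \<open>ergodic_wrt\<close> speaks
    only of sets equal to their preimage. It does so even where the averages diverge: the sequences
    at \<open>x\<close> and at \<open>T x\<close> have the same limits, if any, and
    \<open>lim\<close> depends on nothing else.\<close>
  have inv: "g (T x) = g x" for x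
  proof -
    have 0: "(\<lambda>j. G j (T x) - G j x) \<longlonglongrightarrow> 0"
    proof (rule Lim_null_comparison)
      show "\<forall>\<^sub>F j in sequentially. norm (G j (T x) - G j x) <= 2 * inverse (real (Suc j))"
      proof (intro always_eventually allI)
        fix j
        have "real (Suc j) <= real (N j)" using NK(3)[of j] by simp
        then have "2 / real (N j) <= 2 / real (Suc j)" by (intro divide_left_mono) auto
        moreover have "\<bar>avg (N j) (T x) - avg (N j) x\<bar> <= 2 / real (N j)"
          using NK(3)[of j] by (intro avg_T) simp
        ultimately have "\<bar>avg (N j) (T x) - avg (N j) x\<bar> <= 2 / real (Suc j)" by linarith
        then show "norm (G j (T x) - G j x) <= 2 * inverse (real (Suc j))"
          unfolding G_def real_norm_def divide_inverse .
      qed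
      show "(\<lambda>j. 2 * inverse (real (Suc j))) \<longlonglongrightarrow> 0"
        using tendsto_mult_right_zero[OF LIMSEQ_inverse_real_of_nat] .
    qed
    have "(\<lambda>j. G j (T x)) \<longlonglongrightarrow> L \<longleftrightarrow> (\<lambda>j. G j x) \<longlonglongrightarrow> L" for L
      using Lim_transform[OF _ 0, of L] Lim_transform2[OF _ 0, of L] by (rule iffI[rotated])
    then show ?thesis by (simp add: g_def lim_def)
  qed
  have lim: "AE x in lam01. (\<lambda>j. G j x) \<longlonglongrightarrow> g x"
    using conv by eventually_elim (simp add: g_def convergent_LIMSEQ_iff)
  have gb: "AE x in lam01. \<bar>g x\<bar> <= 1"
    using lim
  proof eventually_elim
    case (elim x)
    show ?case by (rule LIMSEQ_le_const2[OF tendsto_rabs[OF elim]]) (use G1 in auto)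
  qed
  have ig: "integrable lam01 g"
    by (rule lam01.integrable_const_bound[where B = 1]) (use gb gm in auto)
  define c where "c = (E01 x. g x)"
  \<comment> \<open>Cutting at the mean \<open>c\<close> suffices: if \<open>A\<close> has measure 0
    or 1, then \<open>g - c\<close> has a constant sign almost everywhere, and its integral is
    0.\<close>
  define A where "A = {x \<in> {0..1}. g x <= c}"
  have meas: "A \<in> sets lam01"
    using gm[unfolded borel_measurable_iff_le, rule_format, of c] by (simp add: A_def)
  have "T -` A \<inter> space lam01 = A"
  proof (rule set_eqI)
    fix x
    have "x \<in> {0..1} ==> T x \<in> {0..1}" using measurable_space[OF T_meas[of 1], of x] by simp
    then show "x \<in> T -` A \<inter> space lam01 \<longleftrightarrow> x \<in> A" by (auto simp only: inv A_def space_lam01 vimage_eq Int_iff mem_Collect_eq)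
  qed
  then have "measure lam01 A = 0 \<or> measure lam01 A = 1"
    using erg meas unfolding ergodic_wrt_def by blast
  then have gc: "AE x in lam01. g x = c"
  proof
    assume "measure lam01 A = 0"
    then have "A \<in> null_sets lam01"
      using meas by (simp add: null_sets_def lam01.emeasure_eq_measure)
    then have "AE x in lam01. x \<notin> A" by (rule AE_not_in)
    then have nn: "AE x in lam01. 0 <= g x - c"
      using AE_space by eventually_elim (auto simp: A_def)
    have "(E01 x. g x - c) = 0" using ig by (simp add: c_def lam01_prob)
    then have "AE x in lam01. g x - c = 0"
      using integral_nonneg_eq_0_iff_AE[OF _ nn] ig by auto
    then show ?thesis by eventually_elim simp
  next
    assume "measure lam01 A = 1"
    then have "AE x in lam01. x \<in> A"
      using meas by (intro lam01.AE_prob_1)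
    then have nn: "AE x in lam01. 0 <= c - g x"
      by eventually_elim (auto simp: A_def)
    have "(E01 x. c - g x) = 0" using ig by (simp add: c_def lam01_prob)
    then have "AE x in lam01. c - g x = 0"
      using integral_nonneg_eq_0_iff_AE[OF _ nn] ig by auto
    then show ?thesis by eventually_elim simp
  qed
  have limc: "AE x in lam01. (\<lambda>j. G j x) \<longlonglongrightarrow> c"
    using lim gc by eventually_elim simp
  have "(\<lambda>j. E01 x. G j x) \<longlonglongrightarrow> (E01 x. c)"
    by (rule integral_dominated_convergence[where w = "\<lambda>_. 1"]) (use limc G1 in auto)
  moreover have "(E01 x. G j x) = (E01 x. f x)" for j
    unfolding G_def using NK(3)[of j] by (intro integral_avg) auto
  ultimately have cf: "c = (E01 x. f x)"
    by (simp add: LIMSEQ_const_iff lam01_prob)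
  have "(\<lambda>j. E01 x. (G j x)\<^sup>2) \<longlonglongrightarrow> (E01 x. c\<^sup>2)"
  proof (rule integral_dominated_convergence[where w = "\<lambda>_. 1"])
    show "AE x in lam01. (\<lambda>j. (G j x)\<^sup>2) \<longlonglongrightarrow> c\<^sup>2" using limc by eventually_elim (intro tendsto_intros)
  qed (use G1 in \<open>auto simp: abs_square_le_1\<close>)
  moreover have "(\<lambda>j. E01 x. (G j x)\<^sup>2) \<longlonglongrightarrow> ainf"
    unfolding G_def
  proof (rule filterlim_compose[OF avg_norm_lim])
    show "filterlim N sequentially sequentially"
      unfolding filterlim_at_top eventually_sequentially
    proof (intro allI)
      fix Z
      show "\<exists>M. \<forall>n\<ge>M. Z <= N n"
      proof (intro exI[of _ Z] allI impI)
        fix n assume "Z <= n"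
        then show "Z <= N n" using NK(3)[of n] by linarith
      qed
    qed
  qed
  ultimately have "ainf = c\<^sup>2" by (simp add: LIMSEQ_unique lam01_prob)
  then show ?thesis using avg_norm_lim cf by simp
qed

end

section \<open>Interval exchange transformations\<close>

context
  fixes n :: nat and a :: "nat => real" and \<pi> :: "nat => nat"
  assumes a_pos: "\<forall>i\<in>{1..n}. a i > 0" and a_sum: "(\<Sum>i\<in>{1..n}. a i) = 1"
    and perm: "\<pi> permutes {1..n}"
begin

definition iet_left :: "nat => real" where
  "iet_left i = (\<Sum>j\<in>{1..<i}. a j)"

definition iet_dest :: "nat => real" where
  "iet_dest i = (\<Sum>j\<in>{j\<in>{1..n}. \<pi> j < \<pi> i}. a j)"

lemma iet_interval_eq: "1 <= i ==> iet_interval a i = {iet_left i ..< iet_left i + a i}"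
proof -
  assume "1 <= i"
  then have "{1..i} = insert i {1..<i}" by auto
  then have "(\<Sum>j\<in>{1..i}. a j) = iet_left i + a i" by (simp add: iet_left_def)
  then show ?thesis by (simp only: iet_interval_def iet_left_def)
qed

lemma iet_left_step: "i \<in> {1..n} ==> j \<in> {1..n} ==> i < j ==> iet_left i + a i <= iet_left j"
proof -
  assume ij: "i \<in> {1..n}" "j \<in> {1..n}" "i < j"
  have "iet_left i + a i = (\<Sum>k\<in>insert i {1..<i}. a k)" by (simp add: iet_left_def)
  also have "... <= iet_left j" unfolding iet_left_def
    using ij a_pos by (intro sum_mono2) (auto intro: less_imp_le)
  finally show ?thesis .
qed

lemma iet_left_bounds: "i \<in> {1..n} ==> 0 <= iet_left i" "i \<in> {1..n} ==> iet_left i + a i <= 1"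
proof -
  assume i: "i \<in> {1..n}"
  show "0 <= iet_left i" unfolding iet_left_def using i a_pos by (intro sum_nonneg) (auto intro: less_imp_le)
  have "iet_left i + a i = (\<Sum>k\<in>insert i {1..<i}. a k)" by (simp add: iet_left_def)
  also have "... <= (\<Sum>k\<in>{1..n}. a k)"
    using i a_pos by (intro sum_mono2) (auto intro: less_imp_le)
  finally show "iet_left i + a i <= 1" unfolding a_sum .
qed

lemma iet_dest_step: "i \<in> {1..n} ==> j \<in> {1..n} ==> \<pi> i < \<pi> j ==> iet_dest i + a i <= iet_dest j"
proof -
  assume ij: "i \<in> {1..n}" "j \<in> {1..n}" "\<pi> i < \<pi> j"
  have "iet_dest i + a i = (\<Sum>k\<in>insert i {k\<in>{1..n}. \<pi> k < \<pi> i}. a k)" by (simp add: iet_dest_def)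
  also have "... <= iet_dest j" unfolding iet_dest_def
    using ij a_pos by (intro sum_mono2) (auto intro: less_imp_le)
  finally show ?thesis .
qed

lemma iet_dest_bounds: "i \<in> {1..n} ==> 0 <= iet_dest i" "i \<in> {1..n} ==> iet_dest i + a i <= 1"
proof -
  assume i: "i \<in> {1..n}"
  show "0 <= iet_dest i" unfolding iet_dest_def using a_pos by (intro sum_nonneg) (auto intro: less_imp_le)
  have "iet_dest i + a i = (\<Sum>k\<in>insert i {k\<in>{1..n}. \<pi> k < \<pi> i}. a k)" by (simp add: iet_dest_def)
  also have "... <= (\<Sum>k\<in>{1..n}. a k)"
    using i a_pos by (intro sum_mono2) (auto intro: less_imp_le)
  finally show "iet_dest i + a i <= 1" unfolding a_sum .
qed

definition iet_src :: "nat => real set" where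
  "iet_src i = {iet_left i ..< iet_left i + a i}"

definition iet_tgt :: "nat => real set" where
  "iet_tgt i = {iet_dest i ..< iet_dest i + a i}"

lemma iet_src_unique: "i \<in> {1..n} ==> j \<in> {1..n} ==> x \<in> iet_src i ==> x \<in> iet_src j ==> i = j"
  using iet_left_step[of i j] iet_left_step[of j i] by (cases i j rule: linorder_cases) (auto simp: iet_src_def)

lemma iet_tgt_unique: "i \<in> {1..n} ==> j \<in> {1..n} ==> x \<in> iet_tgt i ==> x \<in> iet_tgt j ==> i = j"
  using iet_dest_step[of i j] iet_dest_step[of j i] injD[OF permutes_inj[OF perm], of i j]
  by (cases "\<pi> i" "\<pi> j" rule: linorder_cases) (auto simp: iet_tgt_def)

lemma iet_src_subset: "i \<in> {1..n} ==> iet_src i \<subseteq> {0..<1}"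
  using iet_left_bounds[of i] by (auto simp: iet_src_def)

lemma iet_tgt_subset: "i \<in> {1..n} ==> iet_tgt i \<subseteq> {0..<1}"
  using iet_dest_bounds[of i] by (auto simp: iet_tgt_def)

lemma iet_src_cover:
  assumes "0 <= x" "x < 1" shows "\<exists>i\<in>{1..n}. x \<in> iet_src i"
proof -
  define i where "i = (LEAST i. x < (\<Sum>j\<in>{1..i}. a j))"
  have n: "x < (\<Sum>j\<in>{1..n}. a j)" using assms a_sum by simp
  have i: "x < (\<Sum>j\<in>{1..i}. a j)" unfolding i_def by (rule LeastI[of _ n]) (rule n)
  have "i <= n" unfolding i_def by (rule Least_le) (rule n)
  have "i \<noteq> 0" using i assms by (cases i) auto
  then obtain k where k: "i = Suc k" by (cases i) auto
  have "\<not> x < (\<Sum>j\<in>{1..k}. a j)" using not_less_Least[of k "\<lambda>i. x < (\<Sum>j\<in>{1..i}. a j)"] k by (simp add: i_def)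
  then have "x \<in> iet_src i"
    using i k by (simp add: iet_src_def iet_left_def atLeastLessThanSuc_atLeastAtMost)
  moreover have "i \<in> {1..n}" using \<open>i <= n\<close> k by simp
  ultimately show ?thesis by blast
qed

lemma iet_eq: "i \<in> {1..n} ==> x \<in> iet_src i ==> iet n a \<pi> x = x - iet_left i + iet_dest i"
proof -
  assume i: "i \<in> {1..n}" "x \<in> iet_src i"
  have eq: "j \<in> {1..n} ==> iet_interval a j = iet_src j" for j by (simp add: iet_interval_eq iet_src_def)
  have "(THE j. j \<in> {1..n} \<and> x \<in> iet_interval a j) = i"
  proof (rule the_equality)
    show "i \<in> {1..n} \<and> x \<in> iet_interval a i" using i eq by blast
    show "j = i" if "j \<in> {1..n} \<and> x \<in> iet_interval a j" for j
      using that i eq iet_src_unique by blast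
  qed
  moreover have "\<exists>i\<in>{1..n}. x \<in> iet_interval a i" using i eq by blast
  ultimately show ?thesis by (simp add: iet_def Let_def iet_left_def iet_dest_def)
qed

lemma iet_outside: "x \<notin> {0..<1} ==> iet n a \<pi> x = x"
proof -
  assume x: "x \<notin> {0..<1}"
  have "\<not> (\<exists>i\<in>{1..n}. x \<in> iet_interval a i)"
  proof
    assume "\<exists>i\<in>{1..n}. x \<in> iet_interval a i"
    then obtain i where i: "i \<in> {1..n}" "x \<in> iet_interval a i" by blast
    then have "x \<in> iet_src i" by (simp add: iet_interval_eq iet_src_def)
    then show False using iet_src_subset[OF i(1)] x by blast
  qed
  then show ?thesis unfolding iet_def by (rule if_not_P)
qed

lemma iet_in_tgt: "i \<in> {1..n} ==> x \<in> iet_src i ==> iet n a \<pi> x \<in> iet_tgt i"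
  using iet_eq[of i x] by (simp add: iet_src_def iet_tgt_def)

lemma iet_maps: "0 <= x ==> x < 1 ==> iet n a \<pi> x \<in> {0..<1}"
proof -
  assume "0 <= x" "x < 1"
  then obtain i where i: "i \<in> {1..n}" "x \<in> iet_src i" using iet_src_cover[of x] by blast
  show ?thesis using iet_in_tgt[OF i] iet_tgt_subset[OF i(1)] by blast
qed

lemma iet_inj: "inj_on (iet n a \<pi>) {0..<1}"
proof (rule inj_onI)
  fix x y assume xy: "x \<in> {0..<1}" "y \<in> {0..<1}" "iet n a \<pi> x = iet n a \<pi> y"
  obtain i where i: "i \<in> {1..n}" "x \<in> iet_src i" using iet_src_cover[of x] xy(1) unfolding atLeastLessThan_iff by blast
  obtain j where j: "j \<in> {1..n}" "y \<in> iet_src j" using iet_src_cover[of y] xy(2) unfolding atLeastLessThan_iff by blast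
  have "i = j" by (rule iet_tgt_unique[OF i(1) j(1) iet_in_tgt[OF i, unfolded xy(3)] iet_in_tgt[OF j]])
  then have "x - iet_left j + iet_dest j = y - iet_left j + iet_dest j"
    using iet_eq[OF i] iet_eq[OF j] xy(3) by metis
  then show "x = y" by linarith
qed

text \<open>Exhibits the map as the identity plus a finite sum of multiples of indicators, from
  which Borel measurability is immediate.\<close>

lemma iet_sum_form: "iet n a \<pi> x = x + (\<Sum>i\<in>{1..n}. indicator (iet_src i) x * (iet_dest i - iet_left i))"
proof (cases "x \<in> {0..<1}")
  case True
  then obtain i where i: "i \<in> {1..n}" "x \<in> iet_src i" using iet_src_cover[of x] unfolding atLeastLessThan_iff by blast
  have "(\<Sum>j\<in>{1..n}. indicator (iet_src j) x * (iet_dest j - iet_left j)) = (\<Sum>j\<in>{i}. indicator (iet_src j) x * (iet_dest j - iet_left j))"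
  proof (rule sum.mono_neutral_right)
    show "\<forall>j\<in>{1..n} - {i}. indicator (iet_src j) x * (iet_dest j - iet_left j) = 0"
    proof
      fix j assume j: "j \<in> {1..n} - {i}"
      then have "x \<notin> iet_src j" using i iet_src_unique[of j i x] by blast
      then show "indicator (iet_src j) x * (iet_dest j - iet_left j) = 0" by simp
    qed
  qed (use i in auto)
  then show ?thesis using iet_eq[OF i] i by simp
next
  case False
  then have "indicator (iet_src j) x * (iet_dest j - iet_left j) = 0" if "j \<in> {1..n}" for j
  proof -
    have "x \<notin> iet_src j" using iet_src_subset[OF that] False by blast
    then show ?thesis by simp
  qed
  then have "(\<Sum>i\<in>{1..n}. indicator (iet_src i) x * (iet_dest i - iet_left i)) = 0" by (intro sum.neutral) blast
  then show ?thesis using iet_outside[OF False] by simp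
qed

lemma iet_borel [measurable]: "iet n a \<pi> \<in> borel_measurable borel"
proof -
  have "iet n a \<pi> = (\<lambda>x. x + (\<Sum>i\<in>{1..n}. indicator (iet_src i) x * (iet_dest i - iet_left i)))"
    by (rule ext) (rule iet_sum_form)
  moreover have "... \<in> borel_measurable borel" unfolding iet_src_def by measurable
  ultimately show ?thesis by simp
qed

lemma iet_unit: "x \<in> {0..1} ==> iet n a \<pi> x \<in> {0..1}"
proof (cases "x = 1")
  case True
  then show ?thesis using iet_outside[of x] by simp
next
  case False
  assume "x \<in> {0..1}"
  then show ?thesis using iet_maps[of x] False by auto
qed

lemma iet_lam01: "iet n a \<pi> \<in> measurable lam01 lam01"
  by (rule measurable_lam01_lam01I) (use iet_borel iet_unit in \<open>auto intro: measurable_lam01I\<close>)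

lemma measure_lborel_shift:
  fixes t :: real assumes "B \<in> sets borel" shows "measure lborel {x. x + t \<in> B} = measure lborel B"
proof -
  have "measure lborel B = measure (distr lborel borel ((+) t)) B" by (simp only: lborel_distr_plus)
  also have "... = measure lborel ((+) t -` B \<inter> space lborel)" using assms by (intro measure_distr) auto
  also have "(+) t -` B \<inter> space lborel = {x. x + t \<in> B}" by (auto simp: add.commute)
  finally show ?thesis by simp
qed

lemma measure_lam01_subset: "X \<in> sets borel ==> X \<subseteq> {0..1} ==> measure lam01 X = measure lborel X"
  unfolding lam01_def by (intro measure_restrict_space) auto

text \<open>On each source interval the map is a translation onto a target interval, and the targets
  are disjoint; the remaining point 1 is null. The reverse inequality needs no covering by the
  targets: it follows by taking complements.\<close>

lemma iet_vimage_le: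
  assumes A: "A \<in> sets lam01"
  shows "measure lam01 (iet n a \<pi> -` A \<inter> {0..1}) <= measure lam01 A"
proof -
  have AB: "A \<in> sets borel" "A \<subseteq> {0..1}" using A by (auto simp: sets_lam01_iff)
  define X where "X = (\<lambda>i. {x \<in> iet_src i. iet n a \<pi> x \<in> A})"
  have Xb: "X i \<in> sets borel" for i
  proof -
    have "X i = iet_src i \<inter> (iet n a \<pi> -` A \<inter> space borel)" by (auto simp: X_def)
    then show ?thesis using measurable_sets[OF iet_borel AB(1)] by (auto simp: iet_src_def)
  qed
  have Xl: "X i \<in> sets lam01" "X i \<subseteq> {0..1}" if "i \<in> {1..n}" for i
  proof -
    show "X i \<subseteq> {0..1}" using iet_src_subset[OF that] unfolding X_def by force
    then show "X i \<in> sets lam01" using Xb[of i] by (simp add: sets_lam01_iff)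
  qed
  have m: "measure lam01 (X i) = measure lam01 (A \<inter> iet_tgt i)" if i: "i \<in> {1..n}" for i
  proof -
    have "X i = {x. x + (iet_dest i - iet_left i) \<in> A \<inter> iet_tgt i}"
    proof (rule set_eqI)
      fix x
      have "x \<in> iet_src i \<longleftrightarrow> x + (iet_dest i - iet_left i) \<in> iet_tgt i" by (auto simp: iet_src_def iet_tgt_def)
      moreover have "iet n a \<pi> x = x + (iet_dest i - iet_left i)" if "x \<in> iet_src i"
        using iet_eq[OF i that] by simp
      ultimately show "x \<in> X i \<longleftrightarrow> x \<in> {x. x + (iet_dest i - iet_left i) \<in> A \<inter> iet_tgt i}"
        unfolding X_def mem_Collect_eq Int_iff by metis
    qed
    then have "measure lborel (X i) = measure lborel (A \<inter> iet_tgt i)"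
      using AB by (simp only:) (rule measure_lborel_shift, auto simp: iet_tgt_def)
    moreover have "measure lam01 (A \<inter> iet_tgt i) = measure lborel (A \<inter> iet_tgt i)"
      by (rule measure_lam01_subset) (use AB in \<open>auto simp: iet_tgt_def\<close>)
    ultimately show ?thesis
      using measure_lam01_subset[OF Xb Xl(2)[OF i]] by simp
  qed
  have "measure lam01 (iet n a \<pi> -` A \<inter> {0..1}) <= measure lam01 ((\<Union>i\<in>{1..n}. X i) \<union> {1})"
  proof (rule lam01.finite_measure_mono)
    show "iet n a \<pi> -` A \<inter> {0..1} \<subseteq> (\<Union>i\<in>{1..n}. X i) \<union> {1}"
    proof
      fix x assume x: "x \<in> iet n a \<pi> -` A \<inter> {0..1}"
      show "x \<in> (\<Union>i\<in>{1..n}. X i) \<union> {1}"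
      proof (cases "x = 1")
        case False
        then have "0 <= x" "x < 1" using x by auto
        then obtain i where "i \<in> {1..n}" "x \<in> iet_src i" using iet_src_cover by blast
        then show ?thesis using x by (auto simp: X_def)
      qed simp
    qed
    show "(\<Union>i\<in>{1..n}. X i) \<union> {1} \<in> sets lam01"
      by (intro sets.Un sets.finite_UN Xl) (auto simp: sets_lam01_iff)
  qed
  also have "... <= measure lam01 (\<Union>i\<in>{1..n}. X i) + measure lam01 {1}"
    by (intro measure_Un_le sets.finite_UN Xl) (auto simp: sets_lam01_iff)
  also have "measure lam01 {1} = 0" using measure_lam01_subset[of "{1}"] by simp
  also have "measure lam01 (\<Union>i\<in>{1..n}. X i) <= (\<Sum>i\<in>{1..n}. measure lam01 (X i))"
    by (intro measure_UNION_le Xl) auto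
  also have "... = (\<Sum>i\<in>{1..n}. measure lam01 (A \<inter> iet_tgt i))" using m by (intro sum.cong) auto
  also have "... = measure lam01 (\<Union>i\<in>{1..n}. A \<inter> iet_tgt i)"
  proof (rule lam01.finite_measure_finite_Union[symmetric])
    show "disjoint_family_on (\<lambda>i. A \<inter> iet_tgt i) {1..n}"
      unfolding disjoint_family_on_def using iet_tgt_unique by blast
    show "(\<lambda>i. A \<inter> iet_tgt i) ` {1..n} \<subseteq> sets lam01"
      using AB by (auto simp: sets_lam01_iff iet_tgt_def)
  qed simp
  also have "... <= measure lam01 A" by (rule lam01.finite_measure_mono) (use A in auto)
  finally show ?thesis by simp
qed

lemma iet_invariant: "invariant_measure lam01 (iet n a \<pi>)"
  unfolding invariant_measure_def
proof (intro conjI iet_lam01 measure_eqI)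
  fix A assume "A \<in> sets (distr lam01 lam01 (iet n a \<pi>))"
  then have A: "A \<in> sets lam01" by simp
  have V: "iet n a \<pi> -` A \<inter> {0..1} \<in> sets lam01" using measurable_sets[OF iet_lam01 A] by simp
  \<comment> \<open>Applying the inequality to the complement of \<open>A\<close> turns it into
    equality, since both measures have total mass 1.\<close>
  have "iet n a \<pi> -` (space lam01 - A) \<inter> {0..1} = space lam01 - iet n a \<pi> -` A \<inter> {0..1}"
    using iet_unit by (auto simp del: atLeastAtMost_iff)
  then have "lam01.prob (space lam01 - iet n a \<pi> -` A \<inter> {0..1}) <= lam01.prob (space lam01 - A)"
    using iet_vimage_le[OF sets.compl_sets[OF A]] by simp
  then have "lam01.prob A <= lam01.prob (iet n a \<pi> -` A \<inter> {0..1})"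
    using lam01.prob_compl[OF A] lam01.prob_compl[OF V] by linarith
  then have "lam01.prob A = lam01.prob (iet n a \<pi> -` A \<inter> {0..1})" using iet_vimage_le[OF A] by linarith
  then show "emeasure (distr lam01 lam01 (iet n a \<pi>)) A = emeasure lam01 A"
    using A by (simp add: emeasure_distr[OF iet_lam01] lam01.emeasure_eq_measure)
qed simp

text \<open>Within one source interval the map is an increasing translation, so new jumps arise only
  at left end points of source intervals and at preimages of old jumps.\<close>

lemma iet_step:
  assumes "step S g"
  shows "step (iet_left ` {1..n} \<union> (iet n a \<pi> -` S \<inter> {0..<1})) (\<lambda>x. g (iet n a \<pi> x))"
  unfolding step_def
proof (intro allI impI)
  fix x y :: real assume xy: "0 <= x" "x <= y" "y < 1"
    and d: "{x..y} \<inter> (iet_left ` {1..n} \<union> (iet n a \<pi> -` S \<inter> {0..<1})) = {}"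
  obtain i where i: "i \<in> {1..n}" "x \<in> iet_src i" using iet_src_cover[OF xy(1) le_less_trans[OF xy(2,3)]] by blast
  obtain j where j: "j \<in> {1..n}" "y \<in> iet_src j" using iet_src_cover[OF order_trans[OF xy(1,2)] xy(3)] by blast
  have "i = j"
  proof (cases i j rule: linorder_cases)
    case less
    then have "iet_left j \<in> {x..y}" using iet_left_step[OF i(1) j(1)] i(2) j(2) by (auto simp: iet_src_def)
    then show ?thesis using d j(1) by blast
  next
    case greater
    then show ?thesis using iet_left_step[OF j(1) i(1)] i(2) j(2) xy by (auto simp: iet_src_def)
  qed
  then have j: "y \<in> iet_src i" using j by simp
  note ex = iet_eq[OF i] and ey = iet_eq[OF i(1) j]
  have "{iet n a \<pi> x..iet n a \<pi> y} \<inter> S = {}"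
  proof (rule ccontr)
    assume "{iet n a \<pi> x..iet n a \<pi> y} \<inter> S \<noteq> {}"
    then obtain s where s: "s \<in> S" "iet n a \<pi> x <= s" "s <= iet n a \<pi> y" by auto
    define z where "z = s - iet_dest i + iet_left i"
    have z: "x <= z" "z <= y" using s ex ey by (auto simp: z_def)
    then have "z \<in> iet_src i" using i(2) j by (auto simp: iet_src_def)
    then have "iet n a \<pi> z = s" using iet_eq[OF i(1)] by (simp add: z_def)
    then have "z \<in> {x..y} \<inter> (iet n a \<pi> -` S \<inter> {0..<1})" using z xy s by auto
    then show False using d by blast
  qed
  then show "g (iet n a \<pi> x) = g (iet n a \<pi> y)"
    using iet_maps[of x] iet_maps[of y] xy ex ey by (intro stepD[OF assms]) auto
qed

text \<open>The map is injective on \<open>[0, 1)\<close>, so taking preimages does not multiply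
  jumps; each iteration adds at most \<open>n\<close>. Linear growth is what speed 0 rests
  on.\<close>

lemma iet_pow_step:
  assumes S: "finite S" "step S g"
  shows "\<exists>S'. finite S' \<and> step S' (\<lambda>x. g ((iet n a \<pi> ^^ m) x)) \<and> card S' <= m * n + card S"
proof (induction m)
  case 0
  show ?case using S by (intro exI[of _ S]) simp
next
  case (Suc m)
  then obtain S' where S': "finite S'" "step S' (\<lambda>x. g ((iet n a \<pi> ^^ m) x))" "card S' <= m * n + card S" by blast
  define S2 where "S2 = iet_left ` {1..n} \<union> (iet n a \<pi> -` S' \<inter> {0..<1})"
  have "card S2 <= card (iet_left ` {1..n}) + card (iet n a \<pi> -` S' \<inter> {0..<1})"
    unfolding S2_def by (rule card_Un_le)
  also have "... <= card {1..n} + card S'"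
    by (intro add_mono card_image_le card_vimage_inj_on_le[OF iet_inj S'(1)]) simp
  also have "... <= Suc m * n + card S" using S'(3) by simp
  finally have "card S2 <= Suc m * n + card S" .
  moreover have "finite S2" unfolding S2_def
    by (intro finite_UnI finite_imageI finite_vimage_IntI[OF S'(1) iet_inj]) simp
  moreover have "step S2 (\<lambda>x. g ((iet n a \<pi> ^^ Suc m) x))"
    using iet_step[OF S'(2)] unfolding S2_def funpow_Suc_right o_def .
  ultimately show ?case by blast
qed

lemma slow_iet: "slow 0 (iet n a \<pi>)"
  unfolding slow_def
proof (intro allI impI)
  fix g :: "real => real" and S and d e :: real
  assume g: "finite S" "step S g" "borel_fun g" "unit_bounded g" and de: "0 < d" "0 < e"
  have "\<forall>\<^sub>F m in sequentially. real m * real n + real (card S) <= exp (real m * d)"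
    using de(1) by real_asymp
  then show "\<forall>\<^sub>F m in sequentially. \<exists>\<phi> S'. finite S' \<and> step S' \<phi> \<and> borel_fun \<phi> \<and> unit_bounded \<phi> \<and>
        real (card S') <= exp (real m * (0 + d)) \<and> (E01 x. \<bar>\<phi> x - g ((iet n a \<pi> ^^ m) x)\<bar>) <= e"
  proof eventually_elim
    case (elim m)
    obtain S' where S': "finite S'" "step S' (\<lambda>x. g ((iet n a \<pi> ^^ m) x))" "card S' <= m * n + card S"
      using iet_pow_step[OF g(1,2), of m] by blast
    have "real (card S') <= real (m * n + card S)" using S'(3) by (simp only: of_nat_le_iff)
    also have "... <= exp (real m * (0 + d))" using elim by simp
    finally have c: "real (card S') <= exp (real m * (0 + d))" .
    have "borel_fun (\<lambda>x. g ((iet n a \<pi> ^^ m) x))"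
      by (rule measurable_compose[OF measurable_funpow[OF iet_borel] g(3)])
    then show ?case
      by (intro exI[of _ "\<lambda>x. g ((iet n a \<pi> ^^ m) x)"], intro exI[of _ S'])
         (use S' c g(4) de in simp)
  qed
qed

lemma nice_iet: "nice (iet n a \<pi>) lam01"
  unfolding nice_def
proof (intro conjI iet_lam01 iet_invariant lam01.prob_space_axioms exI[of _ "\<lambda>_. 1 :: real"] exI[of _ "1 :: real"] allI impI)
  show "lam01 = density lam01 (\<lambda>x. ennreal 1)" by (simp add: density_1)
  fix m and u :: "real => real" assume "fun01 u"
  then show "(E01 x. u ((iet n a \<pi> ^^ m) x)) <= 1 * (E01 x. u x)"
    by (simp add: integral_pow_invariant[OF iet_invariant])
qed auto

end

section \<open>Products of maps with distinct speeds\<close>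

lemma niceE:
  assumes "nice T \<mu>"
  obtains \<rho> C where "borel_fun \<rho>" "\<forall>x. 0 <= \<rho> x \<and> \<rho> x <= C" "\<mu> = density lam01 (\<lambda>x. ennreal (\<rho> x))"
    "\<forall>n u. fun01 u --> (\<forall>x. 0 <= u x \<and> u x <= 2) --> (E01 x. u ((T ^^ n) x)) <= C * (E01 x. u x)"
  using assms unfolding nice_def by blast

lemma nice_measurable_comp:
  assumes "nice T \<mu>" "fun01 f"
  shows "fun01 (\<lambda>x. f ((T ^^ n) x))"
  by (rule measurable_compose[OF niceD(2)[OF assms(1)] assms(2)])

text \<open>One approximant works for all \<open>n\<close> and for the mean under
  \<open>\<mu>\<close>, because the constant \<open>C\<close> of \<open>nice\<close> controls both
  the pullbacks and the density. The accuracy \<open>e / (C + 1)\<close> avoids a division by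
  0.\<close>

lemma nice_step_approx:
  fixes f :: "real => real"
  assumes nice: "nice T \<mu>" and f: "fun01 f" "unit_bounded f" and e: "0 < e"
  shows "\<exists>S s. finite S \<and> step S s \<and> borel_fun s \<and> (unit_bounded s) \<and>
    (\<forall>n. (E01 x. \<bar>f ((T ^^ n) x) - s ((T ^^ n) x)\<bar>) <= e) \<and> \<bar>(\<integral>x. f x \<partial>\<mu>) - (\<integral>x. s x \<partial>\<mu>)\<bar> <= e"
proof -
  obtain \<rho> C where \<rho>: "borel_fun \<rho>" "\<forall>x. 0 <= \<rho> x \<and> \<rho> x <= C" "\<mu> = density lam01 (\<lambda>x. ennreal (\<rho> x))"
    and C: "\<forall>n u. fun01 u --> (\<forall>x. 0 <= u x \<and> u x <= 2) --> (E01 x. u ((T ^^ n) x)) <= C * (E01 x. u x)"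
    by (rule niceE[OF nice])
  have C0: "0 <= C" using \<rho>(2)[rule_format, of 0] by linarith
  have e1: "0 < e / (C + 1)" using e C0 by simp
  obtain S s where s: "finite S" "step S s" "borel_fun s" "unit_bounded s"
    "(E01 x. \<bar>f x - s x\<bar>) < e / (C + 1)"
    by (rule step_approx_bounded[OF f(1) f(2)[rule_format] e1])
  have sm: "fun01 s" by (rule measurable_lam01I[OF s(3)])
  have um: "fun01 (\<lambda>x. \<bar>f x - s x\<bar>)" using f(1) sm by measurable
  have u2: "\<bar>f x - s x\<bar> <= 2" for x using f(2)[rule_format, of x] s(4)[rule_format, of x] by linarith
  have Ce: "C * (E01 x. \<bar>f x - s x\<bar>) <= e"
  proof -
    have "C * (E01 x. \<bar>f x - s x\<bar>) <= C * (e / (C + 1))" using s(5) C0 by (intro mult_left_mono) auto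
    also have "... <= e" using C0 e by (simp add: field_simps)
    finally show ?thesis .
  qed
  have 1: "(E01 x. \<bar>f ((T ^^ n) x) - s ((T ^^ n) x)\<bar>) <= e" for n
  proof -
    have "(E01 x. \<bar>f ((T ^^ n) x) - s ((T ^^ n) x)\<bar>) <= C * (E01 x. \<bar>f x - s x\<bar>)"
      using C[rule_format, OF um, of n] u2 by simp
    then show ?thesis using Ce by linarith
  qed
  have rm: "fun01 \<rho>" by (rule measurable_lam01I[OF \<rho>(1)])
  have im: "(\<integral>x. g x \<partial>\<mu>) = (E01 x. \<rho> x * g x)" if "fun01 g" for g :: "real => real"
    unfolding \<rho>(3) using that \<rho> rm by (subst integral_density) auto
  have bd: "integrable lam01 (\<lambda>x. \<rho> x * g x)" if "fun01 g" "unit_bounded g" for g :: "real => real"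
  proof (rule integrable_lam01_bounded)
    show "fun01 (\<lambda>x. \<rho> x * g x)" using that(1) rm by measurable
    show "\<bar>\<rho> x * g x\<bar> <= C * 1" for x unfolding abs_mult using \<rho>(2) that(2) C0 by (intro mult_mono) auto
  qed
  have "(\<integral>x. f x \<partial>\<mu>) - (\<integral>x. s x \<partial>\<mu>) = (E01 x. \<rho> x * f x - \<rho> x * s x)"
    unfolding im[OF f(1)] im[OF sm] by (rule Bochner_Integration.integral_diff[symmetric, OF bd[OF f] bd[OF sm s(4)]])
  also have "\<bar>...\<bar> <= (E01 x. \<bar>\<rho> x * f x - \<rho> x * s x\<bar>)" by (rule integral_abs_bound)
  also have "... <= (E01 x. C * \<bar>f x - s x\<bar>)"
  proof (rule integral_mono)
    show "integrable lam01 (\<lambda>x. \<bar>\<rho> x * f x - \<rho> x * s x\<bar>)"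
      by (intro integrable_abs Bochner_Integration.integrable_diff bd f sm s(4))
    show "integrable lam01 (\<lambda>x. C * \<bar>f x - s x\<bar>)"
    proof (rule integrable_lam01_bounded)
      show "fun01 (\<lambda>x. C * \<bar>f x - s x\<bar>)" using um by measurable
      show "\<bar>C * \<bar>f x - s x\<bar>\<bar> <= C * 2" for x using C0 u2[of x] by (simp add: abs_mult mult_left_mono)
    qed
    show "\<bar>\<rho> x * f x - \<rho> x * s x\<bar> <= C * \<bar>f x - s x\<bar>" for x
      using \<rho>(2) by (simp add: right_diff_distrib[symmetric] abs_mult mult_right_mono)
  qed
  also have "... = C * (E01 x. \<bar>f x - s x\<bar>)" by simp
  also note Ce
  finally have 2: "\<bar>(\<integral>x. f x \<partial>\<mu>) - (\<integral>x. s x \<partial>\<mu>)\<bar> <= e" .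
  show ?thesis by (rule exI[of _ S], rule exI[of _ s]) (use s 1 2 in blast)
qed

lemma abs_prod_le_1:
  fixes z :: "'i => real" assumes "\<And>i. i \<in> I ==> \<bar>z i\<bar> <= 1" shows "\<bar>\<Prod>i\<in>I. z i\<bar> <= 1"
  unfolding abs_prod using assms by (intro prod_le_1) auto

lemma abs_prod_diff:
  fixes z w :: "'i => real"
  assumes "\<And>i. i \<in> I ==> \<bar>z i\<bar> <= 1" "\<And>i. i \<in> I ==> \<bar>w i\<bar> <= 1"
  shows "\<bar>(\<Prod>i\<in>I. z i) - (\<Prod>i\<in>I. w i)\<bar> <= (\<Sum>i\<in>I. \<bar>z i - w i\<bar>)"
  using norm_prod_diff[of I z w] assms by simp

text \<open>The product of two step functions jumps only in the union of their jump sets. Each new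
  factor uses \<open>d / 2\<close> and \<open>e / 2\<close>; the resulting factor 2 in the count is
  absorbed by \<open>exp (n * d / 2)\<close>.\<close>

lemma product_slow:
  fixes T :: "nat => real => real" and g :: "nat => real => real"
  assumes K: "finite K" and nice: "\<And>i. i \<in> K ==> nice (T i) (\<mu> i)" and slow: "\<And>i. i \<in> K ==> slow (h i) (T i)"
    and h: "\<And>i. i \<in> K ==> h i <= H"
    and g: "\<And>i. i \<in> K ==> \<exists>S. finite S \<and> step S (g i)" "\<And>i. g i \<in> borel_measurable borel" "\<And>i x. \<bar>g i x\<bar> <= 1"
    and de: "0 < d" "0 < e"
  shows "\<forall>\<^sub>F n in sequentially. \<exists>\<phi> S'. finite S' \<and> step S' \<phi> \<and> borel_fun \<phi> \<and> unit_bounded \<phi> \<and>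
        real (card S') <= exp (real n * (H + d)) \<and> (E01 x. \<bar>\<phi> x - (\<Prod>i\<in>K. g i ((T i ^^ n) x))\<bar>) <= e"
  using K nice slow h g(1) de
proof (induction K arbitrary: d e rule: finite_induct)
  case empty
  have "finite {} \<and> step {} (\<lambda>x. 1 :: real) \<and> borel_fun (\<lambda>x. 1 :: real) \<and> (\<forall>x::real. \<bar>1::real\<bar> <= 1) \<and>
        real (card {}) <= exp (real n * (H + d)) \<and> (E01 x. \<bar>1 - (\<Prod>i\<in>{}. g i ((T i ^^ n) x))\<bar>) <= e" for n
    using empty by (simp add: step_const)
  then show ?case by (intro always_eventually allI) blast
next
  case (insert j K)
  have 1: "\<forall>\<^sub>F n in sequentially. \<exists>\<phi> S'. finite S' \<and> step S' \<phi> \<and> borel_fun \<phi> \<and> unit_bounded \<phi> \<and>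
        real (card S') <= exp (real n * (H + d / 2)) \<and> (E01 x. \<bar>\<phi> x - (\<Prod>i\<in>K. g i ((T i ^^ n) x))\<bar>) <= e / 2"
    by (rule insert.IH) (use insert.prems in auto)
  obtain S where S: "finite S" "step S (g j)" using insert.prems(4)[of j] by blast
  have "slow (h j) (T j)" using insert.prems(2) by simp
  moreover have "0 < d / 2" "0 < e / 2" using insert.prems by auto
  moreover have "\<forall>x. \<bar>g j x\<bar> <= 1" using g(3) by blast
  ultimately have 2: "\<forall>\<^sub>F n in sequentially. \<exists>\<phi> S'. finite S' \<and> step S' \<phi> \<and> borel_fun \<phi> \<and> unit_bounded \<phi> \<and>
        real (card S') <= exp (real n * (h j + d / 2)) \<and> (E01 x. \<bar>\<phi> x - g j ((T j ^^ n) x)\<bar>) <= e / 2"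
    using S g(2)[of j] unfolding slow_def by blast
  have 3: "\<forall>\<^sub>F n in sequentially. 2 <= exp (real n * (d / 2))"
    using insert.prems(5) by real_asymp
  from 1 2 3 show ?case
  proof eventually_elim
    case (elim n)
    from elim(1) obtain \<phi>1 S1 where p1: "finite S1" "step S1 \<phi>1" "borel_fun \<phi>1" "unit_bounded \<phi>1"
      "real (card S1) <= exp (real n * (H + d / 2))" "(E01 x. \<bar>\<phi>1 x - (\<Prod>i\<in>K. g i ((T i ^^ n) x))\<bar>) <= e / 2" by blast
    from elim(2) obtain \<phi>2 S2 where p2: "finite S2" "step S2 \<phi>2" "borel_fun \<phi>2" "unit_bounded \<phi>2"
      "real (card S2) <= exp (real n * (h j + d / 2))" "(E01 x. \<bar>\<phi>2 x - g j ((T j ^^ n) x)\<bar>) <= e / 2" by blast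
    have c: "real (card (S1 \<union> S2)) <= exp (real n * (H + d))"
    proof -
      have "real (card (S1 \<union> S2)) <= real (card S1 + card S2)" by (simp only: of_nat_le_iff card_Un_le)
      also have "... = real (card S1) + real (card S2)" by simp
      also have "... <= exp (real n * (H + d / 2)) + exp (real n * (H + d / 2))"
      proof (rule add_mono[OF p1(5) order_trans[OF p2(5)]])
        have "h j <= H" using insert.prems(3) by simp
        then have "real n * (h j + d / 2) <= real n * (H + d / 2)" by (intro mult_left_mono) auto
        then show "exp (real n * (h j + d / 2)) <= exp (real n * (H + d / 2))" by simp
      qed
      also have "... = exp (real n * (H + d / 2)) * 2" by simp
      also have "... <= exp (real n * (H + d / 2)) * exp (real n * (d / 2))"
        by (rule mult_left_mono[OF elim(3)]) simp
      also have "... = exp (real n * (H + d))"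
        unfolding exp_add[symmetric] distrib_left[symmetric] by (simp add: field_simps)
      finally show ?thesis .
    qed
    have Pm: "fun01 (\<lambda>x. g i ((T i ^^ n) x))" if "i \<in> insert j K" for i
      by (rule nice_measurable_comp[OF insert.prems(1)[OF that] measurable_lam01I[OF g(2)]])
    then have PKm: "fun01 (\<lambda>x. \<Prod>i\<in>K. g i ((T i ^^ n) x))"
      by (intro borel_measurable_prod) auto
    have P1: "\<bar>\<Prod>i\<in>K. g i ((T i ^^ n) x)\<bar> <= 1" for x by (rule abs_prod_le_1) (rule g(3))
    have i1: "integrable lam01 (\<lambda>x. \<bar>\<phi>1 x - (\<Prod>i\<in>K. g i ((T i ^^ n) x))\<bar>)"
      by (intro integrable_abs Bochner_Integration.integrable_diff integrable_lam01_bounded[of _ 1] PKm P1 measurable_lam01I p1(3) p1(4)[rule_format])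
    have i2: "integrable lam01 (\<lambda>x. \<bar>\<phi>2 x - g j ((T j ^^ n) x)\<bar>)"
      by (intro integrable_abs Bochner_Integration.integrable_diff integrable_lam01_bounded[of _ 1] Pm g(3) measurable_lam01I p2(3) p2(4)[rule_format]) simp
    have i3: "integrable lam01 (\<lambda>x. \<bar>\<phi>1 x * \<phi>2 x - (\<Prod>i\<in>insert j K. g i ((T i ^^ n) x))\<bar>)"
    proof (intro integrable_abs Bochner_Integration.integrable_diff)
      show "integrable lam01 (\<lambda>x. \<phi>1 x * \<phi>2 x)"
      proof (rule integrable_lam01_bounded)
        show "fun01 (\<lambda>x. \<phi>1 x * \<phi>2 x)" using p1(3) p2(3) by (intro measurable_lam01I) measurable
        show "\<bar>\<phi>1 x * \<phi>2 x\<bar> <= 1 * 1" for x unfolding abs_mult using p1(4) p2(4) by (intro mult_mono) auto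
      qed
      show "integrable lam01 (\<lambda>x. \<Prod>i\<in>insert j K. g i ((T i ^^ n) x))"
        by (rule integrable_lam01_bounded[of _ 1]) (intro borel_measurable_prod Pm abs_prod_le_1 g(3), assumption?)+
    qed
    have "(E01 x. \<bar>\<phi>1 x * \<phi>2 x - (\<Prod>i\<in>insert j K. g i ((T i ^^ n) x))\<bar>) \<le>
      (E01 x. \<bar>\<phi>1 x - (\<Prod>i\<in>K. g i ((T i ^^ n) x))\<bar> + \<bar>\<phi>2 x - g j ((T j ^^ n) x)\<bar>)"
    proof (rule integral_mono[OF i3 Bochner_Integration.integrable_add[OF i1 i2]])
      fix x
      define P where "P = (\<Prod>i\<in>K. g i ((T i ^^ n) x))"
      define Q where "Q = g j ((T j ^^ n) x)"
      have "(\<Prod>i\<in>insert j K. g i ((T i ^^ n) x)) = P * Q" using insert.hyps by (simp add: P_def Q_def mult.commute)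
      then have "\<phi>1 x * \<phi>2 x - (\<Prod>i\<in>insert j K. g i ((T i ^^ n) x)) = (\<phi>1 x - P) * \<phi>2 x + P * (\<phi>2 x - Q)"
        by (simp add: algebra_simps)
      also have "\<bar>...\<bar> <= \<bar>\<phi>1 x - P\<bar> * \<bar>\<phi>2 x\<bar> + \<bar>P\<bar> * \<bar>\<phi>2 x - Q\<bar>"
        unfolding abs_mult[symmetric] by (rule abs_triangle_ineq)
      also have "... <= \<bar>\<phi>1 x - P\<bar> * 1 + 1 * \<bar>\<phi>2 x - Q\<bar>"
        using p2(4) P1[of x] by (intro add_mono mult_left_mono mult_right_mono) (auto simp: P_def)
      finally show "\<bar>\<phi>1 x * \<phi>2 x - (\<Prod>i\<in>insert j K. g i ((T i ^^ n) x))\<bar> <= \<bar>\<phi>1 x - (\<Prod>i\<in>K. g i ((T i ^^ n) x))\<bar> + \<bar>\<phi>2 x - g j ((T j ^^ n) x)\<bar>"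
        by (simp add: P_def Q_def)
    qed
    also have "... <= e" using p1(6) p2(6) by (simp add: Bochner_Integration.integral_add[OF i1 i2])
    finally have i: "(E01 x. \<bar>\<phi>1 x * \<phi>2 x - (\<Prod>i\<in>insert j K. g i ((T i ^^ n) x))\<bar>) <= e" .
    have "\<forall>x. \<bar>\<phi>1 x * \<phi>2 x\<bar> <= 1" 
    proof
      fix x
      have "\<bar>\<phi>1 x\<bar> * \<bar>\<phi>2 x\<bar> <= 1 * 1" using p1(4) p2(4) by (intro mult_mono) auto
      then show "\<bar>\<phi>1 x * \<phi>2 x\<bar> <= 1" by (simp add: abs_mult)
    qed
    moreover have "borel_fun (\<lambda>x. \<phi>1 x * \<phi>2 x)" using p1(3) p2(3) by measurable
    moreover have "step (S1 \<union> S2) (\<lambda>x. \<phi>1 x * \<phi>2 x)" by (rule step_combine[OF p1(2) p2(2)])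
    moreover have "finite (S1 \<union> S2)" using p1 p2 by simp
    ultimately show ?case
      by (intro exI[of _ "\<lambda>x. \<phi>1 x * \<phi>2 x"], intro exI[of _ "S1 \<union> S2"]) (use c i in simp)
  qed
qed

text \<open>Index 0 is reserved for the interval exchange, with speed 0: it is \<open>slow\<close>
  but not assumed \<open>equidist\<close>, and its ergodicity replaces mixing. The indices in
  \<open>I\<close> carry the maps of positive, pairwise different speeds.\<close>

locale distinct_speeds =
  fixes I :: "nat set" and T :: "nat => real => real" and \<mu> :: "nat => real measure" and h :: "nat => real"
  assumes finI: "finite I" and zeroI: "0 \<notin> I" and h0: "h 0 = 0" and hpos: "\<And>i. i \<in> I ==> 0 < h i"
    and hinj: "inj_on h I" and nice: "\<And>i. i \<in> insert 0 I ==> nice (T i) (\<mu> i)"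
    and slow: "\<And>i. i \<in> insert 0 I ==> slow (h i) (T i)" and equidist: "\<And>i. i \<in> I ==> equidist (h i) (T i) (\<mu> i)"
    and mu0: "\<mu> 0 = lam01" and ergodic0: "ergodic_wrt lam01 (T 0)"
begin

lemma comp_measurable:
  "i \<in> insert 0 I ==> f \<in> borel_measurable lam01 ==> fun01 (\<lambda>x. f ((T i ^^ n) x))"
  by (rule nice_measurable_comp[OF nice])

lemma abs_integral_mu_le:
  "i \<in> insert 0 I ==> f \<in> borel_measurable lam01 ==> (\<And>x. \<bar>f x\<bar> <= (1::real)) ==> \<bar>\<integral>x. f x \<partial>\<mu> i\<bar> <= 1"
  using niceD(3)[OF nice, of i] niceD(5)[OF nice, of i] by (intro abs_integral_le_1) (auto cong: measurable_cong_sets)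

text \<open>The factor \<open>j\<close> is strictly faster than all of \<open>K\<close>. The product
  over \<open>K\<close> is replaced by a step function with fewer than \<open>exp (n * h')\<close>
  jumps for some \<open>h' < h j\<close>, and equidistribution of \<open>T j\<close> splits the
  integral.\<close>

lemma product_limit_step_add:
  fixes g :: "nat => real => real"
  assumes K: "finite K" "K \<subseteq> I" and j: "j \<in> I" "j \<notin> K" "\<And>i. i \<in> K ==> h i <= h j"
    and g: "\<And>i. \<exists>S. finite S \<and> step S (g i)" "\<And>i. g i \<in> borel_measurable borel" "\<And>i x. \<bar>g i x\<bar> <= 1"
    and IH: "(\<lambda>n. E01 x. (\<Prod>i\<in>insert 0 K. g i ((T i ^^ n) x))) \<longlonglongrightarrow> c"
  shows "(\<lambda>n. E01 x. (\<Prod>i\<in>insert 0 (insert j K). g i ((T i ^^ n) x))) \<longlonglongrightarrow> (\<integral>x. g j x \<partial>\<mu> j) * c"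
proof (rule tendstoI)
  fix e :: real assume e: "0 < e"
  define P where "P = (\<lambda>n x. \<Prod>i\<in>insert 0 K. g i ((T i ^^ n) x))"
  define m where "m = (\<integral>x. g j x \<partial>\<mu> j)"
  have j0: "j \<in> insert 0 I" using j by simp
  have m1: "\<bar>m\<bar> <= 1" unfolding m_def by (rule abs_integral_mu_le[OF j0 measurable_lam01I[OF g(2)] g(3)])
  have sub: "i \<in> insert 0 I" if "i \<in> insert 0 K" for i using that K by auto
  have Pm: "P n \<in> borel_measurable lam01" for n
    unfolding P_def by (intro borel_measurable_prod comp_measurable measurable_lam01I g(2) sub)
  have P1: "\<bar>P n x\<bar> <= 1" for n x unfolding P_def by (rule abs_prod_le_1) (rule g(3))
  define H where "H = Max (insert 0 (h ` K))"
  have H: "h i <= H" if "i \<in> insert 0 K" for i using that K(1) h0 by (auto simp: H_def)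
  have "H \<in> insert 0 (h ` K)" unfolding H_def using K(1) by (intro Max_in) auto
  then have Hj: "H < h j"
  proof
    assume "H \<in> h ` K"
    then obtain i where i: "i \<in> K" "H = h i" by auto
    have "h i \<noteq> h j" using inj_onD[OF hinj, of i j] i(1) K(2) j(1,2) by blast
    then show ?thesis using j(3)[OF i(1)] i(2) by simp
  qed (use hpos[OF j(1)] in simp)
  \<comment> \<open>The rate \<open>H + d\<close> lies midway between the largest slower speed and
    \<open>h j\<close>; it bounds the jumps from above and is still admissible for
    equidistribution.\<close>
  define d where "d = (h j - H) / 2"
  have d: "0 < d" "H + d < h j" using Hj by (auto simp: d_def field_simps)
  have e5: "0 < e / 5" using e by simp
  have fK: "finite (insert 0 K)" using K by simp
  have ev1: "\<forall>\<^sub>F n in sequentially. \<exists>\<phi> S'. finite S' \<and> step S' \<phi> \<and> borel_fun \<phi> \<and> unit_bounded \<phi> \<and>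
        real (card S') <= exp (real n * (H + d)) \<and> (E01 x. \<bar>\<phi> x - P n x\<bar>) <= e / 5"
    unfolding P_def by (rule product_slow[OF fK nice slow H g(1) g(2) g(3) d(1) e5]) (rule sub, assumption)+
  have ev2: "\<forall>\<^sub>F n in sequentially. \<forall>\<phi> S g. finite S --> step S \<phi> --> borel_fun \<phi> --> unit_bounded \<phi> -->
        real (card S) <= exp (real n * (H + d)) --> borel_fun g --> unit_bounded g -->
        \<bar>(E01 x. \<phi> x * g ((T j ^^ n) x)) - (E01 x. \<phi> x) * (\<integral>x. g x \<partial>\<mu> j)\<bar> <= e / 5"
    using equidist[OF j(1)] d(2) e5 unfolding equidist_def by blast
  have ev3: "\<forall>\<^sub>F n in sequentially. dist (E01 x. P n x) c < e / 5"
    using tendstoD[OF IH e5] by (simp add: P_def)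
  from ev1 ev2 ev3
  show "\<forall>\<^sub>F n in sequentially. dist (E01 x. (\<Prod>i\<in>insert 0 (insert j K). g i ((T i ^^ n) x))) ((\<integral>x. g j x \<partial>\<mu> j) * c) < e"
  proof eventually_elim
    case (elim n)
    obtain \<phi> S where p: "finite S" "step S \<phi>" "borel_fun \<phi>" "unit_bounded \<phi>"
      "real (card S) <= exp (real n * (H + d))" "(E01 x. \<bar>\<phi> x - P n x\<bar>) <= e / 5" using elim(1) by blast
    define G where "G = (\<lambda>x. g j ((T j ^^ n) x))"
    have Gm: "fun01 G" unfolding G_def by (rule comp_measurable[OF j0 measurable_lam01I[OF g(2)]])
    have G1: "\<bar>G x\<bar> <= 1" for x unfolding G_def by (rule g(3))
    have pm: "fun01 \<phi>" by (rule measurable_lam01I[OF p(3)])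
    have p1: "\<bar>\<phi> x\<bar> <= 1" for x using p(4) by blast
    have prodeq: "(\<Prod>i\<in>insert 0 (insert j K). g i ((T i ^^ n) x)) = P n x * G x" for x
    proof -
      have "insert 0 (insert j K) = insert j (insert 0 K)" by auto
      moreover have "j \<notin> insert 0 K" using j(1,2) zeroI by blast
      ultimately show ?thesis using K(1) by (simp add: P_def G_def mult_ac)
    qed
    have bd: "integrable lam01 (\<lambda>x. u x * G x)" if "fun01 u" "\<And>x. \<bar>u x\<bar> <= 1" for u
    proof (rule integrable_lam01_bounded)
      show "fun01 (\<lambda>x. u x * G x)" using that(1) Gm by measurable
      show "\<bar>u x * G x\<bar> <= 1 * 1" for x unfolding abs_mult using that(2) G1 by (intro mult_mono) auto
    qed
    have ip: "integrable lam01 \<phi>" "integrable lam01 (P n)"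
      by (rule integrable_lam01_bounded[OF pm p1], rule integrable_lam01_bounded[OF Pm P1])
    have iabs: "integrable lam01 (\<lambda>x. \<bar>\<phi> x - P n x\<bar>)" using ip by (intro integrable_abs Bochner_Integration.integrable_diff)
    have 1: "\<bar>(E01 x. \<phi> x * G x) - (E01 x. P n x * G x)\<bar> <= e / 5"
    proof -
      have "(E01 x. \<phi> x * G x) - (E01 x. P n x * G x) = (E01 x. \<phi> x * G x - P n x * G x)"
        by (rule Bochner_Integration.integral_diff[symmetric, OF bd[OF pm p1] bd[OF Pm P1]])
      also have "\<bar>...\<bar> <= (E01 x. \<bar>\<phi> x * G x - P n x * G x\<bar>)" by (rule integral_abs_bound)
      also have "... <= (E01 x. \<bar>\<phi> x - P n x\<bar>)"
      proof (rule integral_mono[OF _ iabs])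
        show "integrable lam01 (\<lambda>x. \<bar>\<phi> x * G x - P n x * G x\<bar>)"
          by (intro integrable_abs Bochner_Integration.integrable_diff bd pm p1 Pm P1)
        show "\<bar>\<phi> x * G x - P n x * G x\<bar> <= \<bar>\<phi> x - P n x\<bar>" for x
          using G1[of x] by (simp add: left_diff_distrib[symmetric] abs_mult mult_left_le)
      qed
      finally show ?thesis using p(6) by linarith
    qed
    have 2: "\<bar>(E01 x. \<phi> x * G x) - (E01 x. \<phi> x) * m\<bar> <= e / 5"
    proof -
      have "\<forall>x. \<bar>g j x\<bar> <= 1" using g(3) by blast
      then show ?thesis using elim(2) p(1-5) g(2)[of j] unfolding G_def m_def by blast
    qed
    have 3: "\<bar>(E01 x. \<phi> x) - (E01 x. P n x)\<bar> <= e / 5"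
    proof -
      have "(E01 x. \<phi> x) - (E01 x. P n x) = (E01 x. \<phi> x - P n x)"
        by (rule Bochner_Integration.integral_diff[symmetric, OF ip])
      also have "\<bar>...\<bar> <= (E01 x. \<bar>\<phi> x - P n x\<bar>)" by (rule integral_abs_bound)
      finally show ?thesis using p(6) by linarith
    qed
    have "\<bar>(E01 x. \<phi> x) - c\<bar> <= 2 * e / 5" using 3 elim(3) unfolding dist_real_def by linarith
    then have "\<bar>(E01 x. \<phi> x) - c\<bar> * \<bar>m\<bar> <= 2 * e / 5 * 1" using m1 e by (intro mult_mono) auto
    then have "\<bar>(E01 x. \<phi> x) * m - m * c\<bar> <= 2 * e / 5"
      by (simp add: abs_mult[symmetric] algebra_simps)
    then have "\<bar>(E01 x. P n x * G x) - m * c\<bar> < e" using 1 2 e by linarith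
    then show ?case unfolding prodeq dist_real_def m_def .
  qed
qed

text \<open>The induction inserts the indices in the order of their speeds, so the new one is always
  the fastest. It starts with the interval exchange alone, where invariance of Lebesgue measure
  makes the sequence constant.\<close>

lemma product_limit_step:
  fixes g :: "nat => real => real"
  assumes g: "\<And>i. \<exists>S. finite S \<and> step S (g i)" "\<And>i. g i \<in> borel_measurable borel" "\<And>i x. \<bar>g i x\<bar> <= 1"
  shows "(\<lambda>n. E01 x. (\<Prod>i\<in>insert 0 I. g i ((T i ^^ n) x))) \<longlonglongrightarrow> (\<Prod>i\<in>insert 0 I. \<integral>x. g i x \<partial>\<mu> i)"
proof -
  have "K \<subseteq> I --> (\<lambda>n. E01 x. (\<Prod>i\<in>insert 0 K. g i ((T i ^^ n) x))) \<longlonglongrightarrow> (\<Prod>i\<in>insert 0 K. \<integral>x. g i x \<partial>\<mu> i)"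
    if "finite K" for K
    using that
  proof (induction K rule: finite_ranking_induct[where f = h])
    case empty
    have "invariant_measure lam01 (T 0)" using niceD(4)[OF nice, of 0] mu0 by simp
    then have "(E01 x. g 0 ((T 0 ^^ n) x)) = (\<integral>x. g 0 x \<partial>\<mu> 0)" for n
      unfolding mu0 by (rule integral_pow_invariant) (rule measurable_lam01I[OF g(2)])
    then show ?case by simp
  next
    case (insert j K)
    show ?case
    proof (cases "j \<in> K")
      case True
      then show ?thesis using insert.IH by (simp add: insert_absorb)
    next
      case False
      show ?thesis
      proof
        assume sub: "insert j K \<subseteq> I"
        have "(\<lambda>n. E01 x. (\<Prod>i\<in>insert 0 (insert j K). g i ((T i ^^ n) x)))
           \<longlonglongrightarrow> (\<integral>x. g j x \<partial>\<mu> j) * (\<Prod>i\<in>insert 0 K. \<integral>x. g i x \<partial>\<mu> i)"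
          by (rule product_limit_step_add) (use insert sub False g in auto)
        also have "(\<integral>x. g j x \<partial>\<mu> j) * (\<Prod>i\<in>insert 0 K. \<integral>x. g i x \<partial>\<mu> i) = (\<Prod>i\<in>insert j (insert 0 K). \<integral>x. g i x \<partial>\<mu> i)"
        proof (rule prod.insert[symmetric])
          show "finite (insert 0 K)" using insert.hyps by simp
          show "j \<notin> insert 0 K" using False zeroI sub by blast
        qed
        also have "insert j (insert 0 K) = insert 0 (insert j K)" by auto
        finally show "(\<lambda>n. E01 x. (\<Prod>i\<in>insert 0 (insert j K). g i ((T i ^^ n) x)))
           \<longlonglongrightarrow> (\<Prod>i\<in>insert 0 (insert j K). \<integral>x. g i x \<partial>\<mu> i)" .
      qed
    qed
  qed
  then show ?thesis using finI by blast
qed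

text \<open>Both the integral and the product of means change by at most the sum of the single
  approximation errors, since all factors are bounded by 1; with error \<open>t\<close> for each of
  the factors in \<open>J\<close> this is \<open>e / 3\<close>.\<close>

theorem product_limit:
  fixes f :: "nat => real => real"
  assumes f: "\<And>i. i \<in> insert 0 I ==> f i \<in> borel_measurable lam01" "\<And>i x. \<bar>f i x\<bar> <= 1"
  shows "(\<lambda>n. E01 x. (\<Prod>i\<in>insert 0 I. f i ((T i ^^ n) x))) \<longlonglongrightarrow> (\<Prod>i\<in>insert 0 I. \<integral>x. f i x \<partial>\<mu> i)"
proof (rule tendstoI)
  fix e :: real assume e: "0 < e"
  define J where "J = insert 0 I"
  have J: "finite J" "0 \<in> J" using finI by (auto simp: J_def)
  define t where "t = e / (3 * real (card J))"
  have cJ: "0 < real (card J)" using J by (auto simp: card_gt_0_iff)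
  have t: "0 < t" "real (card J) * t = e / 3" using e cJ by (auto simp: t_def)
  have "\<forall>i. \<exists>s. (\<exists>S. finite S \<and> step S s) \<and> borel_fun s \<and> (unit_bounded s) \<and>
     (i \<in> J --> (\<forall>n. (E01 x. \<bar>f i ((T i ^^ n) x) - s ((T i ^^ n) x)\<bar>) <= t) \<and> \<bar>(\<integral>x. f i x \<partial>\<mu> i) - (\<integral>x. s x \<partial>\<mu> i)\<bar> <= t)"
  proof
    fix i
    show "\<exists>s. (\<exists>S. finite S \<and> step S s) \<and> borel_fun s \<and> (unit_bounded s) \<and>
     (i \<in> J --> (\<forall>n. (E01 x. \<bar>f i ((T i ^^ n) x) - s ((T i ^^ n) x)\<bar>) <= t) \<and> \<bar>(\<integral>x. f i x \<partial>\<mu> i) - (\<integral>x. s x \<partial>\<mu> i)\<bar> <= t)"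
    proof (cases "i \<in> J")
      case True
      then have i: "i \<in> insert 0 I" by (simp add: J_def)
      have "\<forall>x. \<bar>f i x\<bar> <= 1" using f(2) by blast
      from nice_step_approx[OF nice[OF i] f(1)[OF i] this t(1)] show ?thesis by blast
    next
      case False
      have "finite {} \<and> step {} (\<lambda>x. 0)" by (simp add: step_const)
      then show ?thesis using False by (intro exI[of _ "\<lambda>x. 0"]) auto
    qed
  qed
  from choice[OF this] obtain s where *: "\<forall>i. (\<exists>S. finite S \<and> step S (s i)) \<and> s i \<in> borel_measurable borel \<and> (\<forall>x. \<bar>s i x\<bar> <= 1) \<and>
     (i \<in> J --> (\<forall>n. (E01 x. \<bar>f i ((T i ^^ n) x) - s i ((T i ^^ n) x)\<bar>) <= t) \<and> \<bar>(\<integral>x. f i x \<partial>\<mu> i) - (\<integral>x. s i x \<partial>\<mu> i)\<bar> <= t)"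
    by (rule exE)
  have s: "\<exists>S. finite S \<and> step S (s i)" "s i \<in> borel_measurable borel" "\<bar>s i x\<bar> <= 1"
    "i \<in> J ==> (E01 x. \<bar>f i ((T i ^^ n) x) - s i ((T i ^^ n) x)\<bar>) <= t"
    "i \<in> J ==> \<bar>(\<integral>x. f i x \<partial>\<mu> i) - (\<integral>x. s i x \<partial>\<mu> i)\<bar> <= t" for i x n
    using *[rule_format, of i] by simp_all
  have e3: "0 < e / 3" using e by simp
  have fm: "fun01 (\<lambda>x. f i ((T i ^^ n) x))" if "i \<in> J" for i n
    using comp_measurable[OF that[unfolded J_def] f(1)[OF that[unfolded J_def]]] .
  have sm: "fun01 (\<lambda>x. s i ((T i ^^ n) x))" if "i \<in> J" for i n
    using comp_measurable[OF that[unfolded J_def] measurable_lam01I[OF s(2)]] .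
  have "\<forall>\<^sub>F n in sequentially. dist (E01 x. (\<Prod>i\<in>J. s i ((T i ^^ n) x))) (\<Prod>i\<in>J. \<integral>x. s i x \<partial>\<mu> i) < e / 3"
    using tendstoD[OF product_limit_step[OF s(1-3)] e3] unfolding J_def .
  then show "\<forall>\<^sub>F n in sequentially. dist (E01 x. (\<Prod>i\<in>insert 0 I. f i ((T i ^^ n) x))) (\<Prod>i\<in>insert 0 I. \<integral>x. f i x \<partial>\<mu> i) < e"
    unfolding J_def[symmetric]
  proof eventually_elim
    case (elim n)
    have ip: "integrable lam01 (\<lambda>x. \<Prod>i\<in>J. u i ((T i ^^ n) x))"
      if "\<And>i. i \<in> J ==> fun01 (\<lambda>x. u i ((T i ^^ n) x))" "\<And>i x. \<bar>u i x\<bar> <= 1" for u :: "nat => real => real"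
      by (rule integrable_lam01_bounded[of _ 1]) (intro borel_measurable_prod abs_prod_le_1 that, assumption?)+
    have id: "integrable lam01 (\<lambda>x. \<bar>f i ((T i ^^ n) x) - s i ((T i ^^ n) x)\<bar>)" if "i \<in> J" for i
      by (intro integrable_abs Bochner_Integration.integrable_diff integrable_lam01_bounded[of _ 1] fm sm that f(2) s(3))
    note ipf = ip[of f, OF fm f(2)] and ips = ip[of s, OF sm s(3)]
    have "(E01 x. (\<Prod>i\<in>J. f i ((T i ^^ n) x))) - (E01 x. (\<Prod>i\<in>J. s i ((T i ^^ n) x))) =
      (E01 x. (\<Prod>i\<in>J. f i ((T i ^^ n) x)) - (\<Prod>i\<in>J. s i ((T i ^^ n) x)))"
      by (rule Bochner_Integration.integral_diff[symmetric, OF ipf ips])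
    also have "\<bar>...\<bar> <= (E01 x. \<bar>(\<Prod>i\<in>J. f i ((T i ^^ n) x)) - (\<Prod>i\<in>J. s i ((T i ^^ n) x))\<bar>)" by (rule integral_abs_bound)
    also have "... <= (E01 x. (\<Sum>i\<in>J. \<bar>f i ((T i ^^ n) x) - s i ((T i ^^ n) x)\<bar>))"
    proof (rule integral_mono)
      show "integrable lam01 (\<lambda>x. \<bar>(\<Prod>i\<in>J. f i ((T i ^^ n) x)) - (\<Prod>i\<in>J. s i ((T i ^^ n) x))\<bar>)"
        by (intro integrable_abs Bochner_Integration.integrable_diff ipf ips)
      show "integrable lam01 (\<lambda>x. \<Sum>i\<in>J. \<bar>f i ((T i ^^ n) x) - s i ((T i ^^ n) x)\<bar>)"
        by (intro Bochner_Integration.integrable_sum id)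
      show "\<bar>(\<Prod>i\<in>J. f i ((T i ^^ n) x)) - (\<Prod>i\<in>J. s i ((T i ^^ n) x))\<bar> <= (\<Sum>i\<in>J. \<bar>f i ((T i ^^ n) x) - s i ((T i ^^ n) x)\<bar>)" for x
        by (rule abs_prod_diff) (rule f(2), rule s(3))
    qed
    also have "... = (\<Sum>i\<in>J. E01 x. \<bar>f i ((T i ^^ n) x) - s i ((T i ^^ n) x)\<bar>)"
      by (intro Bochner_Integration.integral_sum id)
    also have "... <= (\<Sum>i\<in>J. t)" by (intro sum_mono s(4))
    also have "... = e / 3" using t(2) by simp
    finally have 1: "\<bar>(E01 x. (\<Prod>i\<in>J. f i ((T i ^^ n) x))) - (E01 x. (\<Prod>i\<in>J. s i ((T i ^^ n) x)))\<bar> <= e / 3" .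
    have "\<bar>(\<Prod>i\<in>J. \<integral>x. f i x \<partial>\<mu> i) - (\<Prod>i\<in>J. \<integral>x. s i x \<partial>\<mu> i)\<bar> <= (\<Sum>i\<in>J. \<bar>(\<integral>x. f i x \<partial>\<mu> i) - (\<integral>x. s i x \<partial>\<mu> i)\<bar>)"
    proof (rule abs_prod_diff)
      fix i assume "i \<in> J"
      then have i: "i \<in> insert 0 I" by (simp add: J_def)
      show "\<bar>\<integral>x. f i x \<partial>\<mu> i\<bar> <= 1" by (rule abs_integral_mu_le[OF i f(1)[OF i] f(2)])
      show "\<bar>\<integral>x. s i x \<partial>\<mu> i\<bar> <= 1" by (rule abs_integral_mu_le[OF i measurable_lam01I[OF s(2)] s(3)])
    qed
    also have "... <= (\<Sum>i\<in>J. t)" by (intro sum_mono s(5))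
    also have "... = e / 3" using t(2) by simp
    finally have 2: "\<bar>(\<Prod>i\<in>J. \<integral>x. f i x \<partial>\<mu> i) - (\<Prod>i\<in>J. \<integral>x. s i x \<partial>\<mu> i)\<bar> <= e / 3" .
    show ?case using elim 1 2 unfolding dist_real_def by linarith
  qed
qed

end

section \<open>Correlations and the van der Corput argument\<close>

lemma sum_indicator_card: "finite A ==> (\<Sum>e\<in>A. indicator S e :: real) = real (card (A \<inter> S))"
  by (simp add: indicator_def sum.If_cases)

text \<open>With truncated subtraction \<open>(d - e) + (e - d)\<close> is the distance of
  \<open>d\<close> and \<open>e\<close>. For each \<open>d\<close> at most \<open>2 * K\<close>
  indices are closer than \<open>K\<close>, and they weigh \<open>O(1 / D)\<close> in the mean; at
  larger distances \<open>z\<close> is small.\<close>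

lemma double_mean_zero:
  fixes z :: "nat => real"
  assumes z: "z \<longlonglongrightarrow> 0" and B: "\<And>m. \<bar>z m\<bar> <= B"
  shows "(\<lambda>D. (\<Sum>d\<in>{0..<D}. \<Sum>e\<in>{0..<D}. \<bar>z ((d - e) + (e - d))\<bar>) / (real D)\<^sup>2) \<longlonglongrightarrow> 0"
proof (rule tendstoI)
  fix \<epsilon> :: real assume e: "0 < \<epsilon>"
  have B0: "0 <= B" using B[of 0] by linarith
  have "0 < \<epsilon> / 2" using e by simp
  from tendstoD[OF z this] obtain K where K: "\<And>m. K <= m ==> \<bar>z m\<bar> < \<epsilon> / 2"
    by (auto simp: eventually_sequentially dist_real_def)
  have "(\<lambda>D. (B * (2 * real K)) / real D) \<longlonglongrightarrow> 0" by (rule lim_const_over_n)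
  then have "\<forall>\<^sub>F D in sequentially. (B * (2 * real K)) / real D < \<epsilon> / 2" using e by (intro order_tendstoD) auto
  then show "\<forall>\<^sub>F D in sequentially. dist ((\<Sum>d\<in>{0..<D}. \<Sum>e\<in>{0..<D}. \<bar>z ((d - e) + (e - d))\<bar>) / (real D)\<^sup>2) 0 < \<epsilon>"
    using eventually_gt_at_top[of 0]
  proof eventually_elim
    case (elim D)
    have inner: "(\<Sum>e\<in>{0..<D}. \<bar>z ((d - e) + (e - d))\<bar>) <= real D * (\<epsilon> / 2) + B * (2 * real K)" for d
    proof -
      have "(\<Sum>e\<in>{0..<D}. \<bar>z ((d - e) + (e - d))\<bar>) <= (\<Sum>e\<in>{0..<D}. \<epsilon> / 2 + B * indicator {d - K..<d + K} e)"
      proof (rule sum_mono)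
        fix e'
        show "\<bar>z ((d - e') + (e' - d))\<bar> <= \<epsilon> / 2 + B * indicator {d - K..<d + K} e'"
        proof (cases "e' \<in> {d - K..<d + K}")
          case True
          then show ?thesis using B[of "(d - e') + (e' - d)"] e by simp
        next
          case False
          then have "K <= (d - e') + (e' - d)" by auto
          from K[OF this] show ?thesis using False by simp
        qed
      qed
      also have "... = real D * (\<epsilon> / 2) + B * (\<Sum>e\<in>{0..<D}. indicator {d - K..<d + K} e)"
        by (simp only: sum.distrib sum_distrib_left sum_constant card_atLeastLessThan diff_zero)
      also have "(\<Sum>e\<in>{0..<D}. indicator {d - K..<d + K} e :: real) = real (card ({0..<D} \<inter> {d - K..<d + K}))"
        by (rule sum_indicator_card) simp
      also have "real (card ({0..<D} \<inter> {d - K..<d + K})) <= real (card {d - K..<d + K})"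
        by (simp only: of_nat_le_iff) (intro card_mono; simp)
      also have "... <= 2 * real K" by simp
      finally show ?thesis using B0 by (simp add: mult_left_mono)
    qed
    have "(\<Sum>d\<in>{0..<D}. \<Sum>e\<in>{0..<D}. \<bar>z ((d - e) + (e - d))\<bar>) <= (\<Sum>d\<in>{0..<D}. real D * (\<epsilon> / 2) + B * (2 * real K))"
      by (rule sum_mono) (rule inner)
    also have "... = (real D)\<^sup>2 * (\<epsilon> / 2) + real D * (B * (2 * real K))" by (simp add: power2_eq_square algebra_simps)
    finally have "(\<Sum>d\<in>{0..<D}. \<Sum>e\<in>{0..<D}. \<bar>z ((d - e) + (e - d))\<bar>) / (real D)\<^sup>2
       <= ((real D)\<^sup>2 * (\<epsilon> / 2) + real D * (B * (2 * real K))) / (real D)\<^sup>2" by (rule divide_right_mono) simp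
    also have "... = \<epsilon> / 2 + (B * (2 * real K)) / real D"
      using elim(2) by (simp add: add_divide_distrib power2_eq_square)
    also have "... < \<epsilon>" using elim(1) by linarith
    finally have "(\<Sum>d\<in>{0..<D}. \<Sum>e\<in>{0..<D}. \<bar>z ((d - e) + (e - d))\<bar>) / (real D)\<^sup>2 < \<epsilon>" .
    moreover have "0 <= (\<Sum>d\<in>{0..<D}. \<Sum>e\<in>{0..<D}. \<bar>z ((d - e) + (e - d))\<bar>) / (real D)\<^sup>2"
      by (intro divide_nonneg_nonneg sum_nonneg) auto
    ultimately show ?case by (simp add: dist_real_def)
  qed
qed

text \<open>Mixing is stated for Lebesgue integrals with a weight, so the weight is taken to be the
  density of \<open>\<mu>\<close> times \<open>f\<close>.\<close>

lemma nice_autocorrelation: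
  fixes f :: "real => real"
  assumes eq: "equidist h T \<mu>" and h: "0 < h" and nice: "nice T \<mu>"
    and f: "borel_fun f" "unit_bounded f"
  shows "(\<lambda>m. \<integral>x. f x * f ((T ^^ m) x) \<partial>\<mu>) \<longlonglongrightarrow> (\<integral>x. f x \<partial>\<mu>)\<^sup>2"
proof -
  obtain \<rho> C where \<rho>: "borel_fun \<rho>" "\<forall>x. 0 <= \<rho> x \<and> \<rho> x <= C" "\<mu> = density lam01 (\<lambda>x. ennreal (\<rho> x))"
    by (rule niceE[OF nice])
  have rm: "fun01 \<rho>" and fm: "fun01 f"
    by (rule measurable_lam01I, fact)+
  have im: "(\<integral>x. g x \<partial>\<mu>) = (E01 x. \<rho> x * g x)" if "fun01 g" for g :: "real => real"
    unfolding \<rho>(3) using that \<rho> rm by (subst integral_density) auto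
  have int: "integrable lam01 (\<lambda>x. \<rho> x * f x)"
  proof (rule integrable_lam01_bounded)
    show "fun01 (\<lambda>x. \<rho> x * f x)" using fm rm by measurable
    have C0: "0 <= C" using \<rho>(2)[rule_format, of 0] by linarith
    show "\<bar>\<rho> x * f x\<bar> <= C * 1" for x unfolding abs_mult using \<rho>(2) f(2) C0 by (intro mult_mono) auto
  qed
  have "(\<lambda>m. E01 x. (\<rho> x * f x) * f ((T ^^ m) x)) \<longlonglongrightarrow> (E01 x. \<rho> x * f x) * (\<integral>x. f x \<partial>\<mu>)"
    by (rule equidist_mixing[OF eq h nice int f])
  moreover have "(E01 x. (\<rho> x * f x) * f ((T ^^ m) x)) = (\<integral>x. f x * f ((T ^^ m) x) \<partial>\<mu>)" for m
    unfolding mult.assoc by (rule im[symmetric]) (intro borel_measurable_times fm nice_measurable_comp[OF nice])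
  ultimately show ?thesis unfolding im[OF fm, symmetric] power2_eq_square by simp
qed

context distinct_speeds
begin

definition prodobs :: "(nat => real => real) => nat => real => real" where
  "prodobs f n x = (\<Prod>i\<in>insert 0 I. f i ((T i ^^ n) x))"

definition corr :: "(nat => real => real) => nat => nat => nat => real" where
  "corr f i d e = (\<integral>x. f i ((T i ^^ d) x) * f i ((T i ^^ e) x) \<partial>\<mu> i)"

text \<open>A short average of \<open>D\<close> consecutive products. For fixed \<open>D\<close> its
  mean square deviation has a limit as \<open>n\<close> grows, because only finitely many pairs of
  times \<open>n + d\<close>, \<open>n + e\<close> occur.\<close>

definition window :: "(nat => real => real) => nat => nat => real => real" where
  "window f D n x = (\<Sum>d\<in>{0..<D}. prodobs f (n + d) x) / real D"

context
  fixes f :: "nat => real => real"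
  assumes f: "\<And>i. f i \<in> borel_measurable borel" "\<And>i x. \<bar>f i x\<bar> <= 1"
begin

lemma f_comp_measurable: "i \<in> insert 0 I ==> fun01 (\<lambda>x. f i ((T i ^^ n) x))"
  by (intro comp_measurable measurable_lam01I f)

lemma prodobs_measurable: "prodobs f n \<in> borel_measurable lam01"
  unfolding prodobs_def by (intro borel_measurable_prod f_comp_measurable)

lemma prodobs_le_1: "\<bar>prodobs f n x\<bar> <= 1"
  unfolding prodobs_def by (rule abs_prod_le_1) (rule f(2))

lemma corr_limit:
  "(\<lambda>n. E01 x. prodobs f (n + d) x * prodobs f (n + e) x) \<longlonglongrightarrow> (\<Prod>i\<in>insert 0 I. corr f i d e)"
proof -
  define f' where "f' = (\<lambda>i x. f i ((T i ^^ d) x) * f i ((T i ^^ e) x))"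
  have "(\<lambda>n. E01 x. (\<Prod>i\<in>insert 0 I. f' i ((T i ^^ n) x))) \<longlonglongrightarrow> (\<Prod>i\<in>insert 0 I. \<integral>x. f' i x \<partial>\<mu> i)"
  proof (rule product_limit)
    show "f' i \<in> borel_measurable lam01" if "i \<in> insert 0 I" for i
      unfolding f'_def by (intro borel_measurable_times f_comp_measurable that)
    show "\<bar>f' i x\<bar> <= 1" for i x
    proof -
      have "\<bar>f i ((T i ^^ d) x)\<bar> * \<bar>f i ((T i ^^ e) x)\<bar> <= 1 * 1" using f(2) by (intro mult_mono) auto
      then show ?thesis by (simp add: f'_def abs_mult)
    qed
  qed
  moreover have "(\<Prod>i\<in>insert 0 I. f' i ((T i ^^ n) x)) = prodobs f (n + d) x * prodobs f (n + e) x" for n x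
    unfolding f'_def prodobs_def funpow_comp by (rule prod.distrib)
  ultimately show ?thesis unfolding corr_def f'_def by simp
qed

lemma prodobs_limit: "(\<lambda>n. E01 x. prodobs f n x) \<longlonglongrightarrow> (\<Prod>i\<in>insert 0 I. \<integral>x. f i x \<partial>\<mu> i)"
  unfolding prodobs_def by (rule product_limit) (intro measurable_lam01I f)+

lemma window_measurable: "window f D n \<in> borel_measurable lam01"
  unfolding window_def by (intro borel_measurable_divide borel_measurable_sum prodobs_measurable borel_measurable_const)

lemma window_le_1: "\<bar>window f D n x\<bar> <= 1"
proof -
  have "\<bar>\<Sum>d\<in>{0..<D}. prodobs f (n + d) x\<bar> <= (\<Sum>d\<in>{0..<D}. 1)"
    by (intro order_trans[OF sum_abs] sum_mono prodobs_le_1)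
  then show ?thesis by (cases "D = 0") (auto simp: window_def field_simps)
qed

lemma window_limit:
  assumes D: "0 < D" and c: "c = (\<Prod>i\<in>insert 0 I. \<integral>x. f i x \<partial>\<mu> i)"
  shows "(\<lambda>n. E01 x. (window f D n x - c)\<^sup>2) \<longlonglongrightarrow>
    (\<Sum>d\<in>{0..<D}. \<Sum>e\<in>{0..<D}. \<Prod>i\<in>insert 0 I. corr f i d e) / (real D)\<^sup>2 - c\<^sup>2"
proof -
  define P where "P = prodobs f"
  have i1: "integrable lam01 (P n)" for n
    unfolding P_def by (rule integrable_lam01_bounded[OF prodobs_measurable prodobs_le_1])
  have i2: "integrable lam01 (\<lambda>x. P n x * P m x)" for n m
  proof (rule integrable_lam01_bounded)
    show "fun01 (\<lambda>x. P n x * P m x)" unfolding P_def by (intro borel_measurable_times prodobs_measurable)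
    show "\<bar>P n x * P m x\<bar> <= 1 * 1" for x unfolding abs_mult P_def by (intro mult_mono prodobs_le_1) auto
  qed
  have eq: "(E01 x. (window f D n x - c)\<^sup>2) =
     (\<Sum>d\<in>{0..<D}. \<Sum>e\<in>{0..<D}. E01 x. P (n + d) x * P (n + e) x) / (real D)\<^sup>2
       - 2 * c * ((\<Sum>d\<in>{0..<D}. E01 x. P (n + d) x) / real D) + c\<^sup>2" for n
  proof -
    have "(window f D n x - c)\<^sup>2 = (\<Sum>d\<in>{0..<D}. \<Sum>e\<in>{0..<D}. P (n + d) x * P (n + e) x) / (real D)\<^sup>2
       - 2 * c * ((\<Sum>d\<in>{0..<D}. P (n + d) x) / real D) + c\<^sup>2" for x
    proof -
      define s where "s = (\<Sum>d\<in>{0..<D}. P (n + d) x)"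
      have ss: "(\<Sum>d\<in>{0..<D}. \<Sum>e\<in>{0..<D}. P (n + d) x * P (n + e) x) = s\<^sup>2"
        unfolding s_def power2_eq_square by (rule sum_product[symmetric])
      have w: "window f D n x = s / real D" by (simp add: window_def P_def s_def)
      show ?thesis unfolding ss w s_def[symmetric] by (simp add: power2_diff power_divide)
    qed
    then have "(E01 x. (window f D n x - c)\<^sup>2) = (E01 x. (\<Sum>d\<in>{0..<D}. \<Sum>e\<in>{0..<D}. P (n + d) x * P (n + e) x) / (real D)\<^sup>2
       - 2 * c * ((\<Sum>d\<in>{0..<D}. P (n + d) x) / real D) + c\<^sup>2)" by simp
    also have "... = (E01 x. (\<Sum>d\<in>{0..<D}. \<Sum>e\<in>{0..<D}. P (n + d) x * P (n + e) x) / (real D)\<^sup>2)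
       - (E01 x. 2 * c * ((\<Sum>d\<in>{0..<D}. P (n + d) x) / real D)) + c\<^sup>2"
      using i1 i2 by (simp add: lam01_prob)
    also have "... = (\<Sum>d\<in>{0..<D}. \<Sum>e\<in>{0..<D}. E01 x. P (n + d) x * P (n + e) x) / (real D)\<^sup>2
       - 2 * c * ((\<Sum>d\<in>{0..<D}. E01 x. P (n + d) x) / real D) + c\<^sup>2"
      using i1 i2 by simp
    finally show ?thesis .
  qed
  have lim1: "(\<lambda>n. E01 x. P (n + d) x) \<longlonglongrightarrow> c" for d
    unfolding P_def c by (rule LIMSEQ_ignore_initial_segment[OF prodobs_limit])
  have "(\<lambda>n. (\<Sum>d\<in>{0..<D}. \<Sum>e\<in>{0..<D}. E01 x. P (n + d) x * P (n + e) x) / (real D)\<^sup>2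
       - 2 * c * ((\<Sum>d\<in>{0..<D}. E01 x. P (n + d) x) / real D) + c\<^sup>2) \<longlonglongrightarrow>
    (\<Sum>d\<in>{0..<D}. \<Sum>e\<in>{0..<D}. \<Prod>i\<in>insert 0 I. corr f i d e) / (real D)\<^sup>2 - 2 * c * ((\<Sum>d\<in>{0..<D}. c) / real D) + c\<^sup>2"
    by (intro tendsto_intros lim1 corr_limit[folded P_def]) (use D in simp_all)
  also have "2 * c * ((\<Sum>d\<in>{0..<D}. c) / real D) = 2 * c\<^sup>2" using D by (simp add: power2_eq_square)
  finally show ?thesis unfolding eq by simp
qed

text \<open>By invariance of the measure a correlation depends only on the distance of the two
  times.\<close>

lemma corr_shift:
  assumes i: "i \<in> insert 0 I"
  shows "corr f i d e = (\<integral>x. f i x * f i ((T i ^^ ((d - e) + (e - d))) x) \<partial>\<mu> i)"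
proof -
  have *: "corr f i d (d + m) = (\<integral>x. f i x * f i ((T i ^^ m) x) \<partial>\<mu> i)" for d m
  proof -
    define G where "G = (\<lambda>y. f i y * f i ((T i ^^ m) y))"
    have "fun01 G"
      unfolding G_def by (intro borel_measurable_times f_comp_measurable i measurable_lam01I f)
    then have "G \<in> borel_measurable (\<mu> i)" using niceD(5)[OF nice[OF i]] by (simp cong: measurable_cong_sets)
    then have "(\<integral>x. G ((T i ^^ d) x) \<partial>\<mu> i) = (\<integral>x. G x \<partial>\<mu> i)"
      by (rule integral_pow_invariant[OF niceD(4)[OF nice[OF i]]])
    then show ?thesis unfolding G_def corr_def funpow_comp .
  qed
  show ?thesis
  proof (cases "d <= e")
    case True
    then show ?thesis using *[of d "e - d"] by simp
  next
    case False
    have "corr f i d e = corr f i e d" unfolding corr_def by (simp only: mult.commute)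
    then show ?thesis using *[of e "d - e"] False by simp
  qed
qed

lemma corr_le_1:
  assumes i: "i \<in> insert 0 I" shows "\<bar>corr f i d e\<bar> <= 1"
  unfolding corr_def
proof (rule abs_integral_mu_le[OF i])
  show "fun01 (\<lambda>x. f i ((T i ^^ d) x) * f i ((T i ^^ e) x))"
    by (intro borel_measurable_times f_comp_measurable i)
  show "\<bar>f i ((T i ^^ d) x) * f i ((T i ^^ e) x)\<bar> <= 1" for x
  proof -
    have "\<bar>f i ((T i ^^ d) x)\<bar> * \<bar>f i ((T i ^^ e) x)\<bar> <= 1 * 1" using f(2) by (intro mult_mono) auto
    then show ?thesis by (simp add: abs_mult)
  qed
qed

text \<open>The factors in \<open>I\<close> are mixing, so their product \<open>q\<close> converges
  to \<open>Q\<close> as the distance grows; the double mean ignores the difference. What is left is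
  \<open>Q\<close> times the double mean of the correlations of \<open>T 0\<close>, which is the
  squared norm of its ergodic average. Here the mean ergodic theorem stands in for mixing.\<close>

lemma corr_mean_limit:
  assumes c: "c = (\<Prod>i\<in>insert 0 I. \<integral>x. f i x \<partial>\<mu> i)"
  shows "(\<lambda>D. (\<Sum>d\<in>{0..<D}. \<Sum>e\<in>{0..<D}. \<Prod>i\<in>insert 0 I. corr f i d e) / (real D)\<^sup>2) \<longlonglongrightarrow> c\<^sup>2"
proof -
  define q where "q = (\<lambda>m. \<Prod>i\<in>I. \<integral>x. f i x * f i ((T i ^^ m) x) \<partial>\<mu> i)"
  define Q where "Q = (\<Prod>i\<in>I. (\<integral>x. f i x \<partial>\<mu> i)\<^sup>2)"
  have q: "q \<longlonglongrightarrow> Q" unfolding q_def Q_def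
  proof (rule tendsto_prod)
    fix i assume i: "i \<in> I"
    show "(\<lambda>m. \<integral>x. f i x * f i ((T i ^^ m) x) \<partial>\<mu> i) \<longlonglongrightarrow> (\<integral>x. f i x \<partial>\<mu> i)\<^sup>2"
      using i f by (intro nice_autocorrelation[OF equidist[OF i] hpos[OF i] nice]) auto
  qed
  have qcorr: "(\<Prod>i\<in>I. corr f i d e) = q ((d - e) + (e - d))" for d e
    unfolding q_def by (intro prod.cong corr_shift) auto
  have q1: "\<bar>q m\<bar> <= 1" for m
  proof -
    have "q m = (\<Prod>i\<in>I. corr f i 0 m)" using qcorr[of 0 m] by simp
    then show ?thesis using corr_le_1 by (auto intro!: abs_prod_le_1)
  qed
  have Q1: "\<bar>Q\<bar> <= 1" by (rule LIMSEQ_le_const2[OF tendsto_rabs[OF q]]) (use q1 in auto)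
  have cQ: "c\<^sup>2 = Q * (E01 x. f 0 x)\<^sup>2"
    unfolding c Q_def using finI zeroI mu0 by (simp add: power_mult_distrib prod_power_distrib mult.commute)
  have f0: "f 0 \<in> borel_measurable lam01" by (rule measurable_lam01I[OF f(1)])
  have inv0: "invariant_measure lam01 (T 0)" using niceD(4)[OF nice, of 0] mu0 by simp
  have avg: "(\<lambda>D. Q * (E01 x. (avg (T 0) (f 0) D x)\<^sup>2)) \<longlonglongrightarrow> c\<^sup>2"
    unfolding cQ by (intro tendsto_intros mean_ergodic[OF inv0 f0 f(2) ergodic0])
  have avg_eq: "(E01 x. (avg (T 0) (f 0) D x)\<^sup>2) = (\<Sum>d\<in>{0..<D}. \<Sum>e\<in>{0..<D}. corr f 0 d e) / (real D)\<^sup>2" for D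
  proof -
    have "(avg (T 0) (f 0) D x)\<^sup>2 = (\<Sum>d\<in>{0..<D}. \<Sum>e\<in>{0..<D}. f 0 ((T 0 ^^ d) x) * f 0 ((T 0 ^^ e) x)) / (real D)\<^sup>2" for x
      unfolding avg_def[OF inv0 f0 f(2)] power_divide by (simp only: power2_eq_square sum_product)
    moreover have "integrable lam01 (\<lambda>x. f 0 ((T 0 ^^ d) x) * f 0 ((T 0 ^^ e) x))" for d e
    proof (rule integrable_lam01_bounded)
      show "fun01 (\<lambda>x. f 0 ((T 0 ^^ d) x) * f 0 ((T 0 ^^ e) x))"
        by (intro borel_measurable_times f_comp_measurable) auto
      show "\<bar>f 0 ((T 0 ^^ d) x) * f 0 ((T 0 ^^ e) x)\<bar> <= 1 * 1" for x
        unfolding abs_mult using f(2) by (intro mult_mono) auto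
    qed
    ultimately show ?thesis by (simp add: corr_def mu0)
  qed
  define z where "z = (\<lambda>m. q m - Q)"
  have z: "z \<longlonglongrightarrow> 0" unfolding z_def using tendsto_diff[OF q tendsto_const[of Q]] by simp
  have z2: "\<bar>z m\<bar> <= 2" for m using q1[of m] Q1 unfolding z_def by linarith
  have split: "(\<Prod>i\<in>insert 0 I. corr f i d e) = Q * corr f 0 d e + corr f 0 d e * z ((d - e) + (e - d))" for d e
    using finI zeroI by (simp add: qcorr z_def algebra_simps)
  have "(\<lambda>D. Q * (E01 x. (avg (T 0) (f 0) D x)\<^sup>2) +
     (\<Sum>d\<in>{0..<D}. \<Sum>e\<in>{0..<D}. corr f 0 d e * z ((d - e) + (e - d))) / (real D)\<^sup>2) \<longlonglongrightarrow> c\<^sup>2 + 0"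
  proof (intro tendsto_add avg)
    show "(\<lambda>D. (\<Sum>d\<in>{0..<D}. \<Sum>e\<in>{0..<D}. corr f 0 d e * z ((d - e) + (e - d))) / (real D)\<^sup>2) \<longlonglongrightarrow> 0"
    proof (rule Lim_null_comparison[OF _ double_mean_zero[OF z z2]], intro always_eventually allI)
      fix D
      have "\<bar>\<Sum>d\<in>{0..<D}. \<Sum>e\<in>{0..<D}. corr f 0 d e * z ((d - e) + (e - d))\<bar> <= (\<Sum>d\<in>{0..<D}. \<Sum>e\<in>{0..<D}. \<bar>z ((d - e) + (e - d))\<bar>)"
      proof (intro order_trans[OF sum_abs] sum_mono)
        fix d e
        have "\<bar>corr f 0 d e\<bar> * \<bar>z ((d - e) + (e - d))\<bar> <= 1 * \<bar>z ((d - e) + (e - d))\<bar>"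
          by (intro mult_right_mono corr_le_1) auto
        then show "\<bar>corr f 0 d e * z ((d - e) + (e - d))\<bar> <= \<bar>z ((d - e) + (e - d))\<bar>" by (simp add: abs_mult)
      qed
      then show "norm ((\<Sum>d\<in>{0..<D}. \<Sum>e\<in>{0..<D}. corr f 0 d e * z ((d - e) + (e - d))) / (real D)\<^sup>2)
         <= (\<Sum>d\<in>{0..<D}. \<Sum>e\<in>{0..<D}. \<bar>z ((d - e) + (e - d))\<bar>) / (real D)\<^sup>2"
        unfolding real_norm_def abs_divide by (simp add: divide_right_mono)
    qed
  qed
  moreover have "Q * (E01 x. (avg (T 0) (f 0) D x)\<^sup>2) +
     (\<Sum>d\<in>{0..<D}. \<Sum>e\<in>{0..<D}. corr f 0 d e * z ((d - e) + (e - d))) / (real D)\<^sup>2 =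
     (\<Sum>d\<in>{0..<D}. \<Sum>e\<in>{0..<D}. \<Prod>i\<in>insert 0 I. corr f i d e) / (real D)\<^sup>2" for D
    unfolding avg_eq split by (simp only: sum.distrib sum_distrib_left[symmetric] add_divide_distrib times_divide_eq_right)
  ultimately show ?thesis by simp
qed

text \<open>\<open>D\<close> is chosen so that windows starting late deviate little from
  \<open>c\<close>. The long average differs from the mean of the windows by at most
  \<open>2 * D / (N - M)\<close>, and convexity bounds the latter. At most \<open>n0\<close> windows
  start too early, wherever \<open>M\<close> lies; this makes the estimate uniform in
  \<open>M\<close>.\<close>

theorem l2_limit:
  assumes c: "c = (\<Prod>i\<in>insert 0 I. \<integral>x. f i x \<partial>\<mu> i)" and \<epsilon>: "0 < \<epsilon>"
  shows "\<exists>L. \<forall>M N. M < N \<and> L <= N - M -->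
    (E01 x. ((\<Sum>m\<in>{M..<N}. prodobs f m x) / real (N - M) - c)\<^sup>2) < \<epsilon>"
proof -
  have c1: "\<bar>c\<bar> <= 1"
    unfolding c by (intro abs_prod_le_1 abs_integral_mu_le measurable_lam01I f) 
  have e8: "0 < \<epsilon> / 8" using \<epsilon> by simp
  have "\<forall>\<^sub>F D in sequentially. (\<Sum>d\<in>{0..<D}. \<Sum>e\<in>{0..<D}. \<Prod>i\<in>insert 0 I. corr f i d e) / (real D)\<^sup>2 < c\<^sup>2 + \<epsilon> / 8"
    using e8 by (intro order_tendstoD(2)[OF corr_mean_limit[OF c]]) simp
  then have "\<forall>\<^sub>F D in sequentially. 0 < D \<and> (\<Sum>d\<in>{0..<D}. \<Sum>e\<in>{0..<D}. \<Prod>i\<in>insert 0 I. corr f i d e) / (real D)\<^sup>2 < c\<^sup>2 + \<epsilon> / 8"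
    using eventually_gt_at_top[of 0] by eventually_elim simp
  then obtain D where D: "0 < D" "(\<Sum>d\<in>{0..<D}. \<Sum>e\<in>{0..<D}. \<Prod>i\<in>insert 0 I. corr f i d e) / (real D)\<^sup>2 < c\<^sup>2 + \<epsilon> / 8"
    unfolding eventually_sequentially by blast
  define w where "w = (\<lambda>m. E01 x. (window f D m x - c)\<^sup>2)"
  have "(\<Sum>d\<in>{0..<D}. \<Sum>e\<in>{0..<D}. \<Prod>i\<in>insert 0 I. corr f i d e) / (real D)\<^sup>2 - c\<^sup>2 < \<epsilon> / 8"
    using D(2) by linarith
  then have "\<forall>\<^sub>F m in sequentially. w m < \<epsilon> / 8"
    unfolding w_def by (rule order_tendstoD(2)[OF window_limit[OF D(1) c]])
  then obtain n0 where n0: "\<And>m. n0 <= m ==> w m < \<epsilon> / 8" unfolding eventually_sequentially by blast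
  have sq4: "y\<^sup>2 <= 4" if "\<bar>y\<bar> <= 2" for y :: real using power_mono[OF that, of 2] by simp
  have wc4: "(window f D m x - c)\<^sup>2 <= 4" for m x
    using window_le_1[of D m x] c1 by (intro sq4) linarith
  have wi: "integrable lam01 (\<lambda>x. (window f D m x - c)\<^sup>2)" for m
  proof (rule integrable_lam01_bounded)
    show "fun01 (\<lambda>x. (window f D m x - c)\<^sup>2)"
      by (intro borel_measurable_power borel_measurable_diff window_measurable borel_measurable_const)
    show "\<bar>(window f D m x - c)\<^sup>2\<bar> <= 4" for x using wc4[of m x] by simp
  qed
  have w4: "w m <= 4" for m
  proof -
    have "w m <= (E01 x. 4)" unfolding w_def by (intro integral_mono wi wc4) simp
    then show ?thesis by (simp add: lam01_prob)
  qed
  \<comment> \<open>Chosen to make \<open>8 * (D + n0) / (N - M) <= \<epsilon> / 2\<close>;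
    \<open>D\<close> accounts for the passage to windows and \<open>n0\<close> for the early
    windows, each of which costs at most 4. The added 1 ensures that \<open>L\<close> is
    positive.\<close>
  define L where "L = nat \<lceil>16 * (real D + real n0) / \<epsilon>\<rceil> + 1"
  show ?thesis
  proof (intro exI[of _ L] allI impI)
    fix M N assume MN: "M < N \<and> L <= N - M"
    define R where "R = real (N - M)"
    have R: "0 < R" using MN by (simp add: R_def)
    have "16 * (real D + real n0) / \<epsilon> <= real L" unfolding L_def by linarith
    also have "... <= R" unfolding R_def of_nat_le_iff using MN by simp
    finally have RL: "8 * (real D + real n0) / R <= \<epsilon> / 2" using R \<epsilon> by (simp add: field_simps)
    have cR: "real (card {M..<N}) = R" by (simp add: R_def)
    define A where "A = (\<lambda>x. (\<Sum>m\<in>{M..<N}. prodobs f m x) / R)"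
    define B where "B = (\<lambda>x. (\<Sum>m\<in>{M..<N}. window f D m x) / R)"
    have mean1: "\<bar>(\<Sum>m\<in>{M..<N}. u m) / R\<bar> <= 1" if "\<And>m. \<bar>u m\<bar> <= 1" for u :: "nat => real"
    proof -
      have "\<bar>\<Sum>m\<in>{M..<N}. u m\<bar> <= (\<Sum>m\<in>{M..<N}. 1)" by (intro order_trans[OF sum_abs] sum_mono that)
      also have "... = R" by (simp add: R_def)
      finally show ?thesis using R by (simp add: abs_divide)
    qed
    have A1: "\<bar>A x\<bar> <= 1" and B1: "\<bar>B x\<bar> <= 1" for x
      unfolding A_def B_def by (intro mean1 prodobs_le_1 window_le_1)+
    have AB: "\<bar>B x - A x\<bar> <= 2 * real D / R" for x
    proof -
      define u where "u = (\<lambda>k. prodobs f k x)"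
      have "(\<Sum>m\<in>{M..<N}. window f D m x) = (\<Sum>d\<in>{0..<D}. \<Sum>m\<in>{M..<N}. u (m + d)) / real D"
        unfolding window_def u_def sum_divide_distrib[symmetric] by (subst sum.swap) (rule refl)
      then have e: "(\<Sum>m\<in>{M..<N}. window f D m x) - (\<Sum>m\<in>{M..<N}. u m) = (\<Sum>d\<in>{0..<D}. (\<Sum>m\<in>{M..<N}. u (m + d)) - (\<Sum>m\<in>{M..<N}. u m)) / real D"
        using D(1) by (simp add: sum_subtractf field_simps)
      have "\<bar>\<Sum>d\<in>{0..<D}. (\<Sum>m\<in>{M..<N}. u (m + d)) - (\<Sum>m\<in>{M..<N}. u m)\<bar> <= (\<Sum>d\<in>{0..<D}. 2 * real D)"
      proof (intro order_trans[OF sum_abs] sum_mono)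
        fix d assume d: "d \<in> {0..<D}"
        have "\<bar>(\<Sum>m\<in>{M..<N}. u (m + d)) - (\<Sum>m\<in>{M..<N}. u m)\<bar> <= 2 * real d"
          by (rule shift_sum_bound) (simp add: u_def prodobs_le_1)
        then show "\<bar>(\<Sum>m\<in>{M..<N}. u (m + d)) - (\<Sum>m\<in>{M..<N}. u m)\<bar> <= 2 * real D" using d by simp
      qed
      then have "\<bar>(\<Sum>m\<in>{M..<N}. window f D m x) - (\<Sum>m\<in>{M..<N}. u m)\<bar> <= 2 * real D"
        unfolding e using D(1) by (simp add: abs_divide field_simps)
      then have "\<bar>(\<Sum>m\<in>{M..<N}. window f D m x) - (\<Sum>m\<in>{M..<N}. u m)\<bar> / R <= 2 * real D / R"
        using R by (intro divide_right_mono) auto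
      then show ?thesis using R by (simp add: A_def B_def u_def diff_divide_distrib[symmetric])
    qed
    \<comment> \<open>From \<open>(A - c)^2 <= 2 * (A - B)^2 + 2 * (B - c)^2\<close>, where one of
      the two factors \<open>\<bar>B - A\<bar>\<close> is bounded by 2 only, so that the error is
      linear in \<open>1 / R\<close>.\<close>
    have pw: "(A x - c)\<^sup>2 <= 8 * real D / R + 2 * ((\<Sum>m\<in>{M..<N}. (window f D m x - c)\<^sup>2) / R)" for x
    proof -
      have "B x - c = (\<Sum>m\<in>{M..<N}. window f D m x - c) / R"
        using R by (simp add: B_def sum_subtractf diff_divide_distrib cR[symmetric])
      then have "(B x - c)\<^sup>2 <= (\<Sum>m\<in>{M..<N}. (window f D m x - c)\<^sup>2) / R"
        using square_mean_le[of "{M..<N}" "\<lambda>m. window f D m x - c"] MN unfolding cR by simp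
      moreover have "(A x - B x)\<^sup>2 <= 4 * real D / R"
      proof -
        have "(A x - B x)\<^sup>2 = \<bar>B x - A x\<bar> * \<bar>B x - A x\<bar>"
          by (simp add: power2_eq_square abs_mult[symmetric]) (simp add: algebra_simps)
        also have "... <= 2 * (2 * real D / R)"
          using AB[of x] A1[of x] B1[of x] by (intro mult_mono) auto
        finally show ?thesis by simp
      qed
      moreover have "(A x - c)\<^sup>2 <= 2 * (A x - B x)\<^sup>2 + 2 * (B x - c)\<^sup>2"
      proof -
        have "0 <= ((A x - B x) - (B x - c))\<^sup>2" by simp
        then show ?thesis by (simp add: power2_eq_square algebra_simps)
      qed
      ultimately show ?thesis by simp
    qed
    have "(E01 x. (A x - c)\<^sup>2) <= (E01 x. 8 * real D / R + 2 * ((\<Sum>m\<in>{M..<N}. (window f D m x - c)\<^sup>2) / R))"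
    proof (rule integral_mono[OF _ _ pw])
      show "integrable lam01 (\<lambda>x. (A x - c)\<^sup>2)"
      proof (rule integrable_lam01_bounded)
        show "fun01 (\<lambda>x. (A x - c)\<^sup>2)" unfolding A_def
          by (intro borel_measurable_power borel_measurable_diff borel_measurable_divide borel_measurable_sum prodobs_measurable borel_measurable_const)
        show "\<bar>(A x - c)\<^sup>2\<bar> <= 4" for x
        proof -
          have "\<bar>A x - c\<bar> <= 2" using A1[of x] c1 by linarith
          from sq4[OF this] show ?thesis by simp
        qed
      qed
      show "integrable lam01 (\<lambda>x. 8 * real D / R + 2 * ((\<Sum>m\<in>{M..<N}. (window f D m x - c)\<^sup>2) / R))"
        using wi by simp
    qed
    also have "... = 8 * real D / R + 2 * ((\<Sum>m\<in>{M..<N}. w m) / R)"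
      using wi by (simp add: w_def lam01_prob)
    also have "(\<Sum>m\<in>{M..<N}. w m) <= (\<Sum>m\<in>{M..<N}. \<epsilon> / 8 + 4 * indicator {..<n0} m)"
    proof (rule sum_mono)
      fix m
      show "w m <= \<epsilon> / 8 + 4 * indicator {..<n0} m"
        using n0[of m] w4[of m] \<epsilon> by (cases "m < n0") auto
    qed
    also have "... = R * (\<epsilon> / 8) + 4 * real (card ({M..<N} \<inter> {..<n0}))"
    proof -
      have "(\<Sum>m\<in>{M..<N}. indicator {..<n0} m :: real) = real (card ({M..<N} \<inter> {..<n0}))"
        by (rule sum_indicator_card) simp
      then show ?thesis by (simp only: sum.distrib sum_distrib_left[symmetric] sum_constant cR)
    qed
    also have "real (card ({M..<N} \<inter> {..<n0})) <= real (card {..<n0})"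
      by (simp only: of_nat_le_iff) (intro card_mono; simp)
    finally have "(E01 x. (A x - c)\<^sup>2) <= 8 * real D / R + 2 * ((R * (\<epsilon> / 8) + 4 * real n0) / R)"
      using R by (simp add: divide_right_mono)
    also have "... = 8 * (real D + real n0) / R + \<epsilon> / 4"
      using R by (simp add: field_simps)
    also have "... < \<epsilon>" using RL \<epsilon> by linarith
    finally show "(E01 x. ((\<Sum>m\<in>{M..<N}. prodobs f m x) / real (N - M) - c)\<^sup>2) < \<epsilon>"
      unfolding A_def R_def .
  qed
qed

end
end

section \<open>Essentially bounded functions and equivalent measures\<close>

lemma nice_AE_orbit:
  assumes nice: "nice T \<mu>" and P: "AE x in lam01. P x"
  shows "AE x in lam01. \<forall>m. P ((T ^^ m) x)"
  unfolding AE_all_countable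
proof
  fix m
  obtain \<rho> C where C: "\<forall>n (u :: real => real). fun01 u --> (\<forall>x. 0 <= u x \<and> u x <= 2) --> (E01 x. u ((T ^^ n) x)) <= C * (E01 x. u x)"
    by (rule niceE[OF nice])
  obtain N where N: "{x \<in> space lam01. \<not> P x} \<subseteq> N" "emeasure lam01 N = 0" "N \<in> sets lam01"
    using AE_E[OF P] by metis
  define V where "V = (T ^^ m) -` N \<inter> space lam01"
  have V: "V \<in> sets lam01" unfolding V_def by (rule measurable_sets[OF niceD(2)[OF nice] N(3)])
  have "\<forall>x. (0 :: real) <= indicator N x \<and> indicator N x <= (2 :: real)" by (simp add: indicator_def)
  \<comment> \<open>The pullback bound of \<open>nice\<close>, applied to the indicator of a null
    set, shows that its preimage under every iterate is null.\<close>
  then have "(E01 x. indicator N ((T ^^ m) x)) <= C * (E01 x. indicator N x)"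
    using C borel_measurable_indicator[OF N(3)] by blast
  moreover have "(E01 x. indicator N x) = measure lam01 N"
    using N(3) by (simp add: sets_lam01_iff Int_absorb2)
  moreover have "measure lam01 N = 0" using N(2) by (simp add: measure_def)
  moreover have "(E01 x. indicator N ((T ^^ m) x)) = (E01 x. (indicator V x :: real))"
    by (rule Bochner_Integration.integral_cong) (auto simp: V_def indicator_def)
  moreover have "(E01 x. indicator V x) = measure lam01 V"
    using V by (simp add: sets_lam01_iff Int_absorb2)
  ultimately have "measure lam01 V <= 0" by simp
  then have "measure lam01 V = 0" using measure_nonneg[of lam01 V] by linarith
  then have "V \<in> null_sets lam01" using V by (simp add: null_sets_def lam01.emeasure_eq_measure)
  from AE_not_in[OF this] show "AE x in lam01. P ((T ^^ m) x)"
    using AE_space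
  proof eventually_elim
    case (elim x)
    have "(T ^^ m) x \<in> space lam01" using measurable_space[OF niceD(2)[OF nice] elim(2)] .
    then show ?case using elim N(1) unfolding V_def by blast
  qed
qed

lemma nice_integral_cong:
  fixes f g :: "real => real"
  assumes nice: "nice T \<mu>" and fg: "fun01 f" "fun01 g" "AE x in lam01. f x = g x"
  shows "(\<integral>x. f x \<partial>\<mu>) = (\<integral>x. g x \<partial>\<mu>)"
proof (rule integral_cong_AE)
  have s: "sets \<mu> = sets lam01" by (rule niceD(5)[OF nice])
  show "f \<in> borel_measurable \<mu>" "g \<in> borel_measurable \<mu>" using fg s by (simp_all cong: measurable_cong_sets)
  obtain \<rho> where \<rho>: "borel_fun \<rho>" "\<mu> = density lam01 (\<lambda>x. ennreal (\<rho> x))"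
    by (rule niceE[OF nice])
  have "fun01 (\<lambda>x. ennreal (\<rho> x))"
    using measurable_lam01I[OF \<rho>(1)] by measurable
  then show "AE x in \<mu>. f x = g x" unfolding \<rho>(2) using fg(3) by (subst AE_density) auto
qed

text \<open>The density \<open>w\<close> of \<open>\<nu>\<close> is merely integrable, so smallness
  in Lebesgue L1 alone would not suffice. With the bound \<open>B\<close> on \<open>X\<close> the
  part where \<open>w <= K\<close> costs \<open>K\<close> times the integral of \<open>X\<close>,
  and the tail of \<open>w\<close> costs \<open>B\<close> times a small number. The resulting
  \<open>\<delta>\<close> is independent of \<open>X\<close>, hence of \<open>M\<close> and
  \<open>N\<close>.\<close>

lemma equiv_measure_uniform_small:
  assumes \<nu>: "prob_space \<nu>" "equiv_measure \<nu> lam01" and \<epsilon>: "0 < \<epsilon>" and B: "0 <= B"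
  shows "\<exists>\<delta>>0. \<forall>X. fun01 X --> (\<forall>x. 0 <= X x \<and> X x <= B) --> (E01 x. X x) < \<delta> -->
    (\<integral>\<^sup>+x. ennreal (X x) \<partial>\<nu>) < ennreal \<epsilon>"
proof -
  interpret nu: prob_space \<nu> by fact
  have sets: "sets \<nu> = sets lam01" and ac: "absolutely_continuous lam01 \<nu>"
    using \<nu>(2) by (auto simp: equiv_measure_def absolutely_continuous_def null_sets_def)
  obtain w where w: "fun01 w" "AE x in lam01. RN_deriv lam01 \<nu> x = ennreal (w x)" "\<And>x. 0 <= w x"
    using lam01.real_RN_deriv[OF nu.finite_measure_axioms ac sets] by metis
  have \<nu>w: "\<nu> = density lam01 (\<lambda>x. ennreal (w x))"
    using lam01.density_RN_deriv[OF ac sets] w(1,2) by (subst (asm) density_cong[of _ _ "\<lambda>x. ennreal (w x)"]) auto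
  have "(\<integral>\<^sup>+ x. ennreal (w x) \<partial>lam01) = 1"
  proof -
    have "1 = emeasure (density lam01 (\<lambda>x. ennreal (w x))) (space lam01)"
      using nu.emeasure_space_1 unfolding \<nu>w by simp
    also have "... = (\<integral>\<^sup>+ x. ennreal (w x) * indicator (space lam01) x \<partial>lam01)"
      using w(1) by (intro emeasure_density sets.top) auto
    also have "... = (\<integral>\<^sup>+ x. ennreal (w x) \<partial>lam01)"
      by (intro nn_integral_cong) (simp add: indicator_def)
    finally show ?thesis by simp
  qed
  then have iw: "integrable lam01 w" using w by (intro integrableI_nonneg) auto
  define t where "t = (\<lambda>K::nat. \<lambda>x. if real K < w x then w x else 0)"
  have tm: "t K \<in> borel_measurable lam01" for K unfolding t_def using w(1) by measurable
  have it: "integrable lam01 (t K)" for K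
    by (rule Bochner_Integration.integrable_bound[OF iw tm]) (auto simp: t_def)
  have "(\<lambda>K. E01 x. t K x) \<longlonglongrightarrow> (E01 x. 0)"
  proof (rule integral_dominated_convergence[where w = w])
    show "AE x in lam01. (\<lambda>K. t K x) \<longlonglongrightarrow> 0"
    proof (rule AE_I2)
      fix x
      have "\<forall>\<^sub>F K in sequentially. t K x = 0"
        using eventually_ge_at_top[of "nat \<lceil>w x\<rceil>"] proof eventually_elim
          case (elim K)
          then have "w x <= real K" by linarith
          then show ?case by (simp add: t_def)
        qed
      then show "(\<lambda>K. t K x) \<longlonglongrightarrow> 0" by (rule tendsto_eventually)
    qed
    show "AE x in lam01. norm (t K x) <= w x" for K using w(3) by (intro AE_I2) (auto simp: t_def)
  qed (use iw tm in auto)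
  then have "(\<lambda>K. B * (E01 x. t K x)) \<longlonglongrightarrow> B * 0" by (intro tendsto_intros) simp
  then have "\<forall>\<^sub>F K in sequentially. B * (E01 x. t K x) < \<epsilon> / 2" using \<epsilon> by (intro order_tendstoD) auto
  then obtain K where K: "B * (E01 x. t K x) < \<epsilon> / 2" by (auto simp: eventually_sequentially)
  define \<delta> where "\<delta> = \<epsilon> / (2 * (real K + 1))"
  show ?thesis
  proof (intro exI[of _ \<delta>] conjI allI impI)
    show "0 < \<delta>" using \<epsilon> by (simp add: \<delta>_def)
    fix X :: "real => real" assume X: "fun01 X" "\<forall>x. 0 <= X x \<and> X x <= B" "(E01 x. X x) < \<delta>"
    have iX: "integrable lam01 X" using X by (intro integrable_lam01_bounded[of _ B]) auto
    have le: "w x * X x <= real K * X x + B * t K x" for x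
    proof (cases "real K < w x")
      case True
      have "w x * X x <= w x * B" using X(2) w(3) by (intro mult_left_mono) auto
      moreover have "B * t K x = w x * B" using True by (simp add: t_def)
      moreover have "0 <= real K * X x" using X(2) by simp
      ultimately show ?thesis by linarith
    next
      case False
      then show ?thesis using X(2) by (simp add: t_def mult_right_mono)
    qed
    have wXm: "fun01 (\<lambda>x. w x * X x)" using w(1) X(1) by measurable
    have iwX: "integrable lam01 (\<lambda>x. w x * X x)"
    proof (rule Bochner_Integration.integrable_bound[OF _ wXm])
      show "integrable lam01 (\<lambda>x. B * w x)" using iw by simp
      show "AE x in lam01. norm (w x * X x) <= norm (B * w x)"
      proof (rule AE_I2)
        fix x
        have "X x * w x <= B * w x" using X(2) w(3) by (intro mult_right_mono) auto
        then show "norm (w x * X x) <= norm (B * w x)" using X(2) w(3)[of x] B by (simp add: abs_mult mult.commute)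
      qed
    qed
    have "(E01 x. w x * X x) <= (E01 x. real K * X x + B * t K x)"
      using iX it by (intro integral_mono iwX le) auto
    also have "... = real K * (E01 x. X x) + B * (E01 x. t K x)" using iX it by simp
    also have "real K * (E01 x. X x) <= real K * \<delta>" using X(3) by (intro mult_left_mono) auto
    also have "real K * \<delta> <= \<epsilon> / 2" using \<epsilon> by (simp add: \<delta>_def field_simps)
    finally have fin: "(E01 x. w x * X x) < \<epsilon>" using K by linarith
    have "(\<integral>\<^sup>+x. ennreal (X x) \<partial>\<nu>) = (\<integral>\<^sup>+x. ennreal (w x) * ennreal (X x) \<partial>lam01)"
      unfolding \<nu>w by (intro nn_integral_density measurable_compose[OF _ measurable_ennreal] w(1) X(1))
    also have "... = (\<integral>\<^sup>+x. ennreal (w x * X x) \<partial>lam01)"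
      using X(2) w(3) by (simp add: ennreal_mult)
    also have "... = ennreal (E01 x. w x * X x)"
      using X(2) w(3) by (intro nn_integral_eq_integral iwX) auto
    also have "... < ennreal \<epsilon>" by (rule ennreal_lessI[OF \<epsilon> fin])
    finally show "(\<integral>\<^sup>+x. ennreal (X x) \<partial>\<nu>) < ennreal \<epsilon>" .
  qed
qed

context distinct_speeds
begin

theorem l2_limit_Linfty:
  fixes \<nu> :: "real measure"
  assumes f: "\<And>i. i \<in> insert 0 I ==> f i \<in> Linfty" and \<nu>: "prob_space \<nu>" "equiv_measure \<nu> lam01" and \<epsilon>: "0 < \<epsilon>"
  shows "\<exists>L. \<forall>M N. M < N \<and> L <= N - M -->
    (\<integral>\<^sup>+x. ennreal (((\<Sum>m\<in>{M..<N}. prodobs f m x) / real (N - M) - (\<Prod>i\<in>insert 0 I. \<integral>x. f i x \<partial>\<mu> i))\<^sup>2) \<partial>\<nu>) < ennreal \<epsilon>"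
proof -
  define J where "J = insert 0 I"
  have fJ: "finite J" using finI by (simp add: J_def)
  have "\<forall>i. \<exists>C. i \<in> J --> (AE x in lam01. \<bar>f i x\<bar> <= C)"
    using f unfolding J_def Linfty_def by blast
  from choice[OF this] obtain C where C: "\<forall>i. i \<in> J --> (AE x in lam01. \<bar>f i x\<bar> <= C i)" by (rule exE)
  \<comment> \<open>One common bound for all functions; the added 1 makes it positive, so that
    division by it is safe.\<close>
  define B where "B = 1 + (\<Sum>i\<in>J. \<bar>C i\<bar>)"
  have "0 <= (\<Sum>i\<in>J. \<bar>C i\<bar>)" by (rule sum_nonneg) simp
  then have B: "0 < B" unfolding B_def by linarith
  have CB: "C i <= B" if "i \<in> J" for i
  proof -
    have "\<bar>C i\<bar> <= (\<Sum>i\<in>J. \<bar>C i\<bar>)" using fJ that by (intro member_le_sum) auto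
    then show ?thesis by (simp add: B_def)
  qed
  have fm: "f i \<in> borel_measurable lam01" if "i \<in> J" for i using f that by (simp add: J_def Linfty_def)
  \<comment> \<open>\<open>f i\<close> is bounded only almost everywhere and measurable only on
    \<open>[0, 1]\<close>. Cutting off outside the interval and clipping gives a Borel function on
    the line bounded everywhere, equal to \<open>f i / B\<close> almost everywhere.\<close>
  define g where "g = (\<lambda>i x. if i \<in> J then max (-1) (min 1 (indicator {0..1} x * f i x / B)) else 0)"
  have g1: "\<bar>g i x\<bar> <= 1" for i x by (auto simp: g_def abs_le_iff min_def max_def)
  have gm: "g i \<in> borel_measurable borel" for i
  proof (cases "i \<in> J")
    case True
    have "borel_fun (\<lambda>x. max (-1) (min 1 (indicator {0..1} x * f i x / B)))"
      by (intro borel_measurable_max borel_measurable_min borel_measurable_divide measurable_lam01_extend fm True borel_measurable_const)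
    then show ?thesis using True by (simp add: g_def)
  qed (simp add: g_def)
  have fg: "AE x in lam01. f i x = B * g i x" if "i \<in> J" for i
  proof -
    have "AE x in lam01. \<bar>f i x\<bar> <= C i" using C that by blast
    then show ?thesis using AE_space
    proof eventually_elim
      case (elim x)
      have "\<bar>f i x\<bar> <= B" using elim(1) CB[OF that] by linarith
      then have "\<bar>f i x / B\<bar> <= 1" using B by simp
      then have "max (-1) (min 1 (f i x / B)) = f i x / B" unfolding abs_le_iff by linarith
      moreover have "g i x = max (-1) (min 1 (f i x / B))" using elim(2) that by (simp add: g_def)
      ultimately have "g i x = f i x / B" by simp
      then show ?case using B by simp
    qed
  qed
  define b where "b = B ^ card J"
  have b: "0 < b" using B by (simp add: b_def)
  have int: "(\<Prod>i\<in>J. \<integral>x. f i x \<partial>\<mu> i) = b * (\<Prod>i\<in>J. \<integral>x. g i x \<partial>\<mu> i)"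
  proof -
    have "(\<integral>x. f i x \<partial>\<mu> i) = B * (\<integral>x. g i x \<partial>\<mu> i)" if i: "i \<in> J" for i
    proof -
      have "(\<integral>x. f i x \<partial>\<mu> i) = (\<integral>x. B * g i x \<partial>\<mu> i)"
        by (rule nice_integral_cong[OF nice[OF i[unfolded J_def]] fm[OF i] _ fg[OF i]])
           (intro borel_measurable_times borel_measurable_const measurable_lam01I gm)
      then show ?thesis by simp
    qed
    then have "(\<Prod>i\<in>J. \<integral>x. f i x \<partial>\<mu> i) = (\<Prod>i\<in>J. B * (\<integral>x. g i x \<partial>\<mu> i))" by (intro prod.cong) auto
    then show ?thesis by (simp add: prod.distrib b_def)
  qed
  \<comment> \<open>Changing \<open>f i\<close> on a null set must not matter along the whole orbit,
    which is where \<open>nice_AE_orbit\<close> enters.\<close>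
  have "AE x in lam01. \<forall>i\<in>J. \<forall>m. f i ((T i ^^ m) x) = B * g i ((T i ^^ m) x)"
    using nice_AE_orbit[OF nice fg] fJ by (intro AE_finite_allI) (auto simp: J_def)
  then have orb: "AE x in lam01. \<forall>m. prodobs f m x = b * prodobs g m x"
  proof eventually_elim
    case (elim x)
    show ?case
    proof
      fix m
      have "prodobs f m x = (\<Prod>i\<in>J. B * g i ((T i ^^ m) x))"
        unfolding prodobs_def J_def[symmetric] using elim by (intro prod.cong) auto
      then show "prodobs f m x = b * prodobs g m x"
        by (simp add: prodobs_def J_def[symmetric] prod.distrib b_def)
    qed
  qed
  have orb\<nu>: "AE x in \<nu>. \<forall>m. prodobs f m x = b * prodobs g m x"
  proof (rule absolutely_continuous_AE[OF _ _ orb])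
    show "sets \<nu> = sets lam01" "absolutely_continuous lam01 \<nu>"
      using \<nu>(2) by (auto simp: equiv_measure_def absolutely_continuous_def null_sets_def)
  qed
  define c where "c = (\<Prod>i\<in>J. \<integral>x. g i x \<partial>\<mu> i)"
  have c1: "\<bar>c\<bar> <= 1"
    unfolding c_def J_def by (intro abs_prod_le_1 abs_integral_mu_le measurable_lam01I gm g1)
  have "0 <= 4 * b\<^sup>2" by simp
  from equiv_measure_uniform_small[OF \<nu> \<epsilon> this]
  obtain \<delta> where \<delta>: "0 < \<delta>" and small: "\<forall>X. fun01 X --> (\<forall>x. 0 <= X x \<and> X x <= 4 * b\<^sup>2) -->
    (E01 x. X x) < \<delta> --> (\<integral>\<^sup>+x. ennreal (X x) \<partial>\<nu>) < ennreal \<epsilon>" by blast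
  have \<delta>b: "0 < \<delta> / b\<^sup>2" using \<delta> b by simp
  obtain L where L: "\<forall>M N. M < N \<and> L <= N - M -->
    (E01 x. ((\<Sum>m\<in>{M..<N}. prodobs g m x) / real (N - M) - c)\<^sup>2) < \<delta> / b\<^sup>2"
    using l2_limit[OF gm g1 c_def[unfolded J_def] \<delta>b] by blast
  show ?thesis
  proof (intro exI[of _ L] allI impI)
    fix M N assume MN: "M < N \<and> L <= N - M"
    define A where "A = (\<lambda>x. (\<Sum>m\<in>{M..<N}. prodobs g m x) / real (N - M))"
    define X where "X = (\<lambda>x. b\<^sup>2 * (A x - c)\<^sup>2)"
    have A1: "\<bar>A x\<bar> <= 1" for x
    proof -
      have "\<bar>\<Sum>m\<in>{M..<N}. prodobs g m x\<bar> <= (\<Sum>m\<in>{M..<N}. 1)"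
        by (intro order_trans[OF sum_abs] sum_mono prodobs_le_1 gm g1)
      then show ?thesis using MN by (simp add: A_def abs_divide)
    qed
    have X1: "0 <= X x \<and> X x <= 4 * b\<^sup>2" for x
    proof -
      have "\<bar>A x - c\<bar> <= 2" using A1[of x] c1 by linarith
      from power_mono[OF this, of 2] have "(A x - c)\<^sup>2 <= 4" by simp
      then have "b\<^sup>2 * (A x - c)\<^sup>2 <= b\<^sup>2 * 4" by (rule mult_left_mono) simp
      then show ?thesis by (simp add: X_def mult.commute)
    qed
    have Xm: "fun01 X" unfolding X_def A_def
      by (intro borel_measurable_times borel_measurable_power borel_measurable_diff borel_measurable_divide
          borel_measurable_sum prodobs_measurable borel_measurable_const gm g1)
    have "(E01 x. X x) = b\<^sup>2 * (E01 x. (A x - c)\<^sup>2)" by (simp add: X_def)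
    also have "... < b\<^sup>2 * (\<delta> / b\<^sup>2)"
      using L MN b unfolding A_def by (intro mult_strict_left_mono) auto
    also have "... = \<delta>" using b by simp
    finally have "(\<integral>\<^sup>+x. ennreal (X x) \<partial>\<nu>) < ennreal \<epsilon>" using small Xm X1 by blast
    moreover have "(\<integral>\<^sup>+x. ennreal (((\<Sum>m\<in>{M..<N}. prodobs f m x) / real (N - M) - (\<Prod>i\<in>insert 0 I. \<integral>x. f i x \<partial>\<mu> i))\<^sup>2) \<partial>\<nu>)
       = (\<integral>\<^sup>+x. ennreal (X x) \<partial>\<nu>)"
    proof (rule nn_integral_cong_AE, use orb\<nu> in eventually_elim)
      case (elim x)
      have "(\<Sum>m\<in>{M..<N}. prodobs f m x) = b * (\<Sum>m\<in>{M..<N}. prodobs g m x)"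
        unfolding sum_distrib_left using elim by (intro sum.cong) auto
      then have "(\<Sum>m\<in>{M..<N}. prodobs f m x) / real (N - M) - (\<Prod>i\<in>insert 0 I. \<integral>x. f i x \<partial>\<mu> i) = b * (A x - c)"
        unfolding J_def[symmetric] int c_def[symmetric] by (simp add: A_def right_diff_distrib)
      then show ?case by (simp add: X_def power_mult_distrib)
    qed
    ultimately show "(\<integral>\<^sup>+x. ennreal (((\<Sum>m\<in>{M..<N}. prodobs f m x) / real (N - M) - (\<Prod>i\<in>insert 0 I. \<integral>x. f i x \<partial>\<mu> i))\<^sup>2) \<partial>\<nu>) < ennreal \<epsilon>"
      by simp
  qed
qed

end

theorem theorem1p6:
  fixes n k :: nat and a :: "nat \<Rightarrow> real" and \<pi> :: "nat \<Rightarrow> nat"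
    and \<beta> :: "nat \<Rightarrow> real" and f :: "nat \<Rightarrow> real \<Rightarrow> real" and \<nu> :: "real measure"
  assumes n_pos: "n \<ge> 1"
    and a_pos: "\<forall>i\<in>{1..n}. a i > 0"
    and a_sum: "(\<Sum>i\<in>{1..n}. a i) = 1"
    and perm: "\<pi> permutes {1..n}"
    and erg: "ergodic_wrt lam01 (iet n a \<pi>)"
    and distinct_beta: "inj_on \<beta> {1..k}"
    and beta_gt: "\<forall>i\<in>{1..k}. \<beta> i > 1"
    and beta_log: "\<forall>i\<in>{1..k}. ln (\<beta> i) \<noteq> pi^2 / (6 * ln 2)"
    and f_Linf: "\<forall>i\<in>{0..k+1}. f i \<in> Linfty"
    and nu_prob: "prob_space \<nu>"
    and nu_equiv: "equiv_measure \<nu> lam01"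
  shows "\<forall>\<epsilon>>0. \<exists>L. \<forall>M N. M < N \<and> N - M \<ge> L \<longrightarrow>
     (\<integral>\<^sup>+ x. ennreal ((1 / real (N - M) *
        (\<Sum>m\<in>{M..<N}. f 0 ((iet n a \<pi> ^^ m) x) *
           (\<Prod>i\<in>{1..k}. f i ((beta_map (\<beta> i) ^^ m) x)) *
           f (k+1) ((gauss_map ^^ m) x))
        - (\<integral>x. f 0 x \<partial>lam01) * (\<Prod>i\<in>{1..k}. \<integral>x. f i x \<partial>beta_measure (\<beta> i))
          * (\<integral>x. f (k+1) x \<partial>gauss_measure)) ^ 2) \<partial>\<nu>) < ennreal \<epsilon>"
proof (intro allI impI)
  fix \<epsilon> :: real assume \<epsilon>: "0 < \<epsilon>"
  \<comment> \<open>Index 0 is the interval exchange, \<open>1\<close> to \<open>k\<close> are the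
    \<beta>-maps and \<open>k + 1\<close> is the Gauss map, matching the numbering of the functions
    \<open>f\<close>.\<close>
  define T where "T = (\<lambda>i. if i = 0 then iet n a \<pi> else if i <= k then beta_map (\<beta> i) else gauss_map)"
  define \<mu> where "\<mu> = (\<lambda>i. if i = 0 then lam01 else if i <= k then beta_measure (\<beta> i) else gauss_measure)"
  define h where "h = (\<lambda>i. if i = 0 then 0 else if i <= k then ln (\<beta> i) else lyap)"
  define I where "I = {1..k+1}"
  have T: "T 0 = iet n a \<pi>" "T (k + 1) = gauss_map" "\<And>i. i \<in> {1..k} ==> T i = beta_map (\<beta> i)" by (auto simp: T_def)
  have \<mu>: "\<mu> 0 = lam01" "\<mu> (k + 1) = gauss_measure" "\<And>i. i \<in> {1..k} ==> \<mu> i = beta_measure (\<beta> i)" by (auto simp: \<mu>_def)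
  have h: "h 0 = 0" "h (k + 1) = lyap" "\<And>i. i \<in> {1..k} ==> h i = ln (\<beta> i)" by (auto simp: h_def)
  have b1: "1 < \<beta> i" if "i \<in> {1..k}" for i using beta_gt that by blast
  have I: "I = insert (k + 1) {1..k}" by (auto simp: I_def)
  interpret distinct_speeds I T \<mu> h
  proof
    show "finite I" "0 \<notin> I" "h 0 = 0" "\<mu> 0 = lam01" "ergodic_wrt lam01 (T 0)"
      using erg by (simp_all add: I_def h \<mu> T)
    have P: "nice (T i) (\<mu> i) \<and> slow (h i) (T i) \<and> equidist (h i) (T i) (\<mu> i) \<and> 0 < h i" if "i \<in> I" for i
    proof (cases "i = k + 1")
      case True
      then show ?thesis using nice_gauss slow_gauss equidist_gauss lyap_pos unfolding True T(2) \<mu>(2) h(2) by blast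
    next
      case False
      then have i: "i \<in> {1..k}" using that by (simp add: I)
      show ?thesis
        unfolding T(3)[OF i] \<mu>(3)[OF i] h(3)[OF i] beta_measure_eq_parry[OF b1[OF i]]
        using nice_beta[OF b1[OF i]] slow_beta[OF b1[OF i]] equidist_beta[OF b1[OF i]] b1[OF i] by simp
    qed
    show "0 < h i" "equidist (h i) (T i) (\<mu> i)" if "i \<in> I" for i using P[OF that] by blast+
    show "nice (T i) (\<mu> i)" if "i \<in> insert 0 I" for i
    proof (cases "i = 0")
      case True
      then show ?thesis using nice_iet[OF a_pos a_sum perm] unfolding True T(1) \<mu>(1) by blast
    next
      case False
      then have "i \<in> I" using that by blast
      from P[OF this] show ?thesis by blast
    qed
    show "slow (h i) (T i)" if "i \<in> insert 0 I" for i
    proof (cases "i = 0")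
      case True
      then show ?thesis using slow_iet[OF a_pos a_sum perm] unfolding True T(1) h(1) by blast
    next
      case False
      then have "i \<in> I" using that by blast
      from P[OF this] show ?thesis by blast
    qed
    \<comment> \<open>The only use of the condition on \<open>ln (\<beta> i)\<close>: no \<beta>-map
      has the speed of the Gauss map. Distinctness among the \<beta>-maps comes from injectivity of
      the logarithm.\<close>
    have ne: "h i \<noteq> h (k + 1)" if "i \<in> {1..k}" for i
      using beta_log that unfolding h(2) h(3)[OF that] lyap_def by blast
    have "inj_on h {1..k}"
    proof (rule inj_onI)
      fix i j assume ij: "i \<in> {1..k}" "j \<in> {1..k}" "h i = h j"
      then have "ln (\<beta> i) = ln (\<beta> j)" by (simp only: h(3))
      then have "\<beta> i = \<beta> j" using b1[OF ij(1)] b1[OF ij(2)] by (subst (asm) ln_inj_iff) auto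
      then show "i = j" using inj_onD[OF distinct_beta _ ij(1,2)] by simp
    qed
    moreover have "h (k + 1) \<notin> h ` ({1..k} - {k + 1})" 
    proof
      assume "h (k + 1) \<in> h ` ({1..k} - {k + 1})"
      then obtain i where "i \<in> {1..k}" "h (k + 1) = h i" by blast
      then show False using ne[of i] by simp
    qed
    ultimately show "inj_on h I" unfolding I inj_on_insert by blast
  qed
  have prod3: "(\<Prod>i\<in>insert 0 I. u i) = u 0 * (\<Prod>i\<in>{1..k}. u i) * u (k + 1)" for u :: "nat => real"
    unfolding I by (simp add: mult_ac)
  have c: "(\<Prod>i\<in>insert 0 I. \<integral>x. f i x \<partial>\<mu> i) =
     (E01 x. f 0 x) * (\<Prod>i\<in>{1..k}. \<integral>x. f i x \<partial>beta_measure (\<beta> i)) * (\<integral>x. f (k+1) x \<partial>gauss_measure)"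
    unfolding prod3 \<mu>(1,2) using prod.cong[OF refl, of "{1..k}" "\<lambda>i. \<integral>x. f i x \<partial>\<mu> i" "\<lambda>i. \<integral>x. f i x \<partial>beta_measure (\<beta> i)"] \<mu>(3) by simp
  have p: "prodobs f m x = f 0 ((iet n a \<pi> ^^ m) x) * (\<Prod>i\<in>{1..k}. f i ((beta_map (\<beta> i) ^^ m) x)) * f (k+1) ((gauss_map ^^ m) x)" for m x
    unfolding prodobs_def prod3 T(1,2)
    using prod.cong[OF refl, of "{1..k}" "\<lambda>i. f i ((T i ^^ m) x)" "\<lambda>i. f i ((beta_map (\<beta> i) ^^ m) x)"] T(3) by simp
  have "f i \<in> Linfty" if "i \<in> insert 0 I" for i using f_Linf that by (auto simp: I_def)
  from l2_limit_Linfty[where f = f, OF this nu_prob nu_equiv \<epsilon>]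
  show "\<exists>L. \<forall>M N. M < N \<and> N - M \<ge> L -->
     (\<integral>\<^sup>+ x. ennreal ((1 / real (N - M) *
        (\<Sum>m\<in>{M..<N}. f 0 ((iet n a \<pi> ^^ m) x) *
           (\<Prod>i\<in>{1..k}. f i ((beta_map (\<beta> i) ^^ m) x)) *
           f (k+1) ((gauss_map ^^ m) x))
        - (E01 x. f 0 x) * (\<Prod>i\<in>{1..k}. \<integral>x. f i x \<partial>beta_measure (\<beta> i))
          * (\<integral>x. f (k+1) x \<partial>gauss_measure)) ^ 2) \<partial>\<nu>) < ennreal \<epsilon>"
    unfolding p c times_divide_eq_left mult_1_left .
qed

end
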